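(* Let $(a,b)$ be an admissible pair of degree $d$ and length $t$ such that $a_1>d$. Set $a_0:=d$ and $$A:=\bigoplus_{i=0}^t\mathcal{O}_{\mathbb{P}^3}(-a_i),\qquad B:=\bigoplus_{j=1}^t\mathcal{O}_{\mathbb{P}^3}(-b_j).$$ Then $\det(a,b)$ is an irreducible variety of dimension $$\dim \det(a,b)=2+\hom(B,A)-\hom(A,A)-\hom(B,B)-\binom{d-1}{3}-g_C+(d-4)d_C,$$ where $d_C$ and $g_C$ are the degree and (arithmetic) genus of a curve $C\subset\mathbb{P}^3$ whose ideal sheaf $\mathcal{I}_C$ is given by a resolution $0\to B\to A\to\mathcal{I}_C\to 0$.
   Context: We work over $\mathbb{C}$. An admissible pair $(a,b)$ of length $t\ge 2$ consists of integer sequences $a=(a_1,\dots,a_t)$, $b=(b_1,\dots,b_t)$ with $a_1\le\dots\le a_t$, $b_1\le\dots\le b_t$, and $a_i<b_j$ for all $1\le i,j\le t$; its degree is $d:=\sum_{i=1}^t(b_i-a_i)$. A surface $X=\{F=0\}\subset\mathbb{P}^3$ is a determinantal surface of type $(a,b)$ if $F=\det(S)$ for some $t\times t$ matrix $S=(m_{ij})$ where $m_{ij}\in\mathbb{C}[x,y,z,w]$ is homogeneous of degree $b_j-a_i$. The set $\det(a,b)$ is the Zariski closure in $|\mathcal{O}_{\mathbb{P}^3}(d)|$ of the set of all surfaces $\{\det(S)=0\}$ with $S$ of this form and $\det(S)\not\equiv0$. For sheaves $E,G$ on $\mathbb{P}^3$, $\hom(E,G):=h^0(\mathbb{P}^3,\mathcal{H}om_{\mathcal{O}_{\mathbb{P}^3}}(E,G))$.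 The numbers $d_C,g_C$ depend only on $a_0,\dots,a_t,b_1,\dots,b_t$: $$d_C=\tfrac12\Big(\sum_{j=1}^tb_j^2-\sum_{i=0}^ta_i^2\Big),\qquad g_C=1+\tfrac16\Big(\sum_{j=1}^tb_j^3-\sum_{i=0}^ta_i^3\Big)-2d_C.$$ *)

theory Defs
  imports
    "HOL-Analysis.Analysis"
    "HOL-Library.Poly_Mapping"
    "HOL-Library.Function_Algebras"
    "HOL-Library.Numeral_Type"
    "HOL-Library.Extended_Real"
    "HOL-Computational_Algebra.Polynomial"
    "Jordan_Normal_Form.Determinant"
begin

hide_const (open) Determinants.det

type_synonym 'x cpoly = "('x \<Rightarrow>\<^sub>0 nat) \<Rightarrow>\<^sub>0 complex"

text \<open>The ring \<open>\<complex>[x,y,z,w]\<close>: the four variables are the elements of the type \<^typ>\<open>4\<close>.\<close>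

type_synonym form = "4 cpoly"

definition mono_deg :: "('x \<Rightarrow>\<^sub>0 nat) \<Rightarrow> nat" where
  "mono_deg m = (\<Sum>i\<in>Poly_Mapping.keys m. Poly_Mapping.lookup m i)"

definition peval :: "'x cpoly \<Rightarrow> ('x \<Rightarrow> complex) \<Rightarrow> complex" where
  "peval p v = (\<Sum>m\<in>Poly_Mapping.keys p. Poly_Mapping.lookup p m *
     (\<Prod>i\<in>Poly_Mapping.keys m. v i ^ Poly_Mapping.lookup m i))"

text \<open>Degrees are integers; \<open>0\<close> is homogeneous of every degree, and it is the only
  homogeneous polynomial of a negative degree.\<close>

definition homog :: "int \<Rightarrow> 'x cpoly \<Rightarrow> bool" where
  "homog n p \<longleftrightarrow> (\<forall>m\<in>Poly_Mapping.keys p. int (mono_deg m) = n)"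

text \<open>A point of a projective space is the set of all its homogeneous coordinate vectors. Hence
  the affine cone over a set \<open>U\<close> of points, without the origin, is \<open>\<Union>U\<close>.\<close>

definition proj_pt :: "('x \<Rightarrow> complex) \<Rightarrow> ('x \<Rightarrow> complex) set" where
  "proj_pt v = {(\<lambda>i. c * v i) | c. c \<noteq> 0}"

definition proj_space :: "'x set \<Rightarrow> ('x \<Rightarrow> complex) set set" where
  "proj_space I = {proj_pt v | v. (\<exists>i. v i \<noteq> 0) \<and> (\<forall>i. i \<notin> I \<longrightarrow> v i = 0)}"

definition basic_open :: "'x set \<Rightarrow> 'x cpoly \<Rightarrow> ('x \<Rightarrow> complex) set set" where
  "basic_open I p = {x \<in> proj_space I. \<forall>v\<in>x. peval p v \<noteq> 0}"

definition zariski :: "'x set \<Rightarrow> ('x \<Rightarrow> complex) set topology" where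
  "zariski I = topology_generated_by {basic_open I p | p. \<exists>n. homog n p}"

definition irreducible_closedin :: "'a topology \<Rightarrow> 'a set \<Rightarrow> bool" where
  "irreducible_closedin X Z \<longleftrightarrow> closedin X Z \<and> Z \<noteq> {} \<and>
     (\<forall>Z1 Z2. closedin X Z1 \<and> closedin X Z2 \<and> Z = Z1 \<union> Z2 \<longrightarrow> Z = Z1 \<or> Z = Z2)"

definition krull_dim :: "'a topology \<Rightarrow> enat" where
  "krull_dim X = Sup {enat n | n. \<exists>Z. (\<forall>i\<le>n. irreducible_closedin X (Z i)) \<and>
     (\<forall>i<n. Z i \<subset> Z (Suc i))}"

text \<open>Of the sequences \<open>a\<close> and \<open>b\<close> only the entries with index \<open>1,\<dots>,t\<close> matter here.\<close>

definition admissible_pair :: "nat \<Rightarrow> (nat \<Rightarrow> int) \<Rightarrow> (nat \<Rightarrow> int) \<Rightarrow> bool" where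
  "admissible_pair t a b \<longleftrightarrow> t \<ge> 2 \<and> mono_on {1..t} a \<and> mono_on {1..t} b \<and>
     (\<forall>i\<in>{1..t}. \<forall>j\<in>{1..t}. a i < b j)"

definition pair_degree :: "nat \<Rightarrow> (nat \<Rightarrow> int) \<Rightarrow> (nat \<Rightarrow> int) \<Rightarrow> int" where
  "pair_degree t a b = (\<Sum>i=1..t. b i - a i)"

text \<open>The linear system \<open>|\<O>(d)|\<close> is the projective space of the forms of degree \<open>d\<close>, whose
  homogeneous coordinates are the coefficients.\<close>

definition linear_system :: "int \<Rightarrow> ((4 \<Rightarrow>\<^sub>0 nat) \<Rightarrow> complex) set topology" where
  "linear_system d = zariski {m. int (mono_deg m) = d}"

definition surface :: "form \<Rightarrow> ((4 \<Rightarrow>\<^sub>0 nat) \<Rightarrow> complex) set" where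
  "surface F = proj_pt (Poly_Mapping.lookup F)"

text \<open>Matrix indices start at \<open>0\<close>, those of \<open>a\<close> and \<open>b\<close> at \<open>1\<close>.\<close>

definition det_surfaces ::
    "nat \<Rightarrow> (nat \<Rightarrow> int) \<Rightarrow> (nat \<Rightarrow> int) \<Rightarrow> ((4 \<Rightarrow>\<^sub>0 nat) \<Rightarrow> complex) set set" where
  "det_surfaces t a b = {surface (det S) | S. S \<in> carrier_mat t t \<and>
     (\<forall>i<t. \<forall>j<t. homog (b (Suc j) - a (Suc i)) (S $$ (i, j))) \<and> det S \<noteq> 0}"

definition det_variety ::
    "nat \<Rightarrow> (nat \<Rightarrow> int) \<Rightarrow> (nat \<Rightarrow> int) \<Rightarrow> ((4 \<Rightarrow>\<^sub>0 nat) \<Rightarrow> complex) set set" where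
  "det_variety t a b = linear_system (pair_degree t a b) closure_of det_surfaces t a b"

type_synonym pt = "(4 \<Rightarrow> complex) set"

abbreviation P3 :: "pt topology" where
  "P3 \<equiv> zariski UNIV"

text \<open>Sections of \<open>\<O>(n)\<close> over \<open>U\<close>: functions on the cone over \<open>U\<close> (extended by \<open>0\<close>) that are
  locally a quotient of forms whose degrees differ by \<open>n\<close>.\<close>

definition twist :: "int \<Rightarrow> pt set \<Rightarrow> ((4 \<Rightarrow> complex) \<Rightarrow> complex) set" where
  "twist n U = {s. (\<forall>v. v \<notin> \<Union>U \<longrightarrow> s v = 0) \<and>
     (\<forall>x\<in>U. \<exists>V f g k. openin P3 V \<and> x \<in> V \<and> V \<subseteq> U \<and> homog (k + n) f \<and> homog k g \<and>
        (\<forall>v\<in>\<Union>V. peval g v \<noteq> 0 \<and> s v = peval f v / peval g v))}"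

text \<open>All sheaves needed are subsheaves of direct sums of sheaves \<open>\<O>(n)\<close>; a section is a tuple
  of functions, padded by zeros.\<close>

type_synonym tuple = "nat \<Rightarrow> (4 \<Rightarrow> complex) \<Rightarrow> complex"
type_synonym sheaf = "pt set \<Rightarrow> tuple set"
type_synonym sheaf_map = "pt set \<Rightarrow> tuple \<Rightarrow> tuple"

definition twist_sum :: "nat set \<Rightarrow> (nat \<Rightarrow> int) \<Rightarrow> sheaf" where
  "twist_sum J n U = {\<sigma>. (\<forall>i\<in>J. \<sigma> i \<in> twist (n i) U) \<and> (\<forall>i. i \<notin> J \<longrightarrow> \<sigma> i = 0)}"

definition restr :: "pt set \<Rightarrow> tuple \<Rightarrow> tuple" where
  "restr V \<sigma> = (\<lambda>i v. if v \<in> \<Union>V then \<sigma> i v else 0)"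

text \<open>The sections over \<open>W\<close> of the sheaf \<open>Hom(E,G)\<close>: morphisms of sheaves of modules from
  \<open>E|W\<close> to \<open>G|W\<close>. The last condition makes each morphism a unique function.\<close>

definition sheaf_hom :: "sheaf \<Rightarrow> sheaf \<Rightarrow> pt set \<Rightarrow> sheaf_map set" where
  "sheaf_hom E G W = {\<phi>.
     (\<forall>U. openin P3 U \<and> U \<subseteq> W \<longrightarrow>
        (\<forall>\<sigma>\<in>E U. \<phi> U \<sigma> \<in> G U) \<and>
        (\<forall>\<sigma>\<in>E U. \<forall>\<tau>\<in>E U. \<phi> U (\<sigma> + \<tau>) = \<phi> U \<sigma> + \<phi> U \<tau>) \<and>
        (\<forall>f\<in>twist 0 U. \<forall>\<sigma>\<in>E U. \<phi> U (\<lambda>i v. f v * \<sigma> i v) = (\<lambda>i v. f v * \<phi> U \<sigma> i v)) \<and>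
        (\<forall>V. openin P3 V \<and> V \<subseteq> U \<longrightarrow> (\<forall>\<sigma>\<in>E U. \<phi> V (restr V \<sigma>) = restr V (\<phi> U \<sigma>)))) \<and>
     (\<forall>U \<sigma>. \<not> (openin P3 U \<and> U \<subseteq> W \<and> \<sigma> \<in> E U) \<longrightarrow> \<phi> U \<sigma> = 0)}"

definition hom_dim :: "sheaf \<Rightarrow> sheaf \<Rightarrow> nat" where
  "hom_dim E G = vector_space.dim (\<lambda>(c::complex) (\<phi>::sheaf_map) U \<sigma> i v. c * \<phi> U \<sigma> i v)
     (sheaf_hom E G (topspace P3))"

lemma vector_space_sheaf_map:
  "vector_space (\<lambda>(c::complex) (\<phi>::sheaf_map) U \<sigma> i v. c * \<phi> U \<sigma> i v)"
  by unfold_locales (simp_all add: fun_eq_iff algebra_simps)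

text \<open>Exactness of \<open>0 \<rightarrow> E \<rightarrow> F \<rightarrow> G \<rightarrow> 0\<close> as sheaves: images are taken after sheafification.\<close>

definition short_exact :: "sheaf \<Rightarrow> sheaf \<Rightarrow> sheaf \<Rightarrow> sheaf_map \<Rightarrow> sheaf_map \<Rightarrow> bool" where
  "short_exact E F G \<phi> \<psi> \<longleftrightarrow>
     \<phi> \<in> sheaf_hom E F (topspace P3) \<and> \<psi> \<in> sheaf_hom F G (topspace P3) \<and>
     (\<forall>U. openin P3 U \<longrightarrow>
        (\<forall>\<sigma>\<in>E U. \<phi> U \<sigma> = 0 \<longrightarrow> \<sigma> = 0) \<and>
        (\<forall>\<sigma>\<in>F U. \<psi> U \<sigma> = 0 \<longleftrightarrow>
           (\<forall>x\<in>U. \<exists>V. openin P3 V \<and> x \<in> V \<and> V \<subseteq> U \<and> (\<exists>\<tau>\<in>E V. \<phi> V \<tau> = restr V \<sigma>))) \<and>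
        (\<forall>\<rho>\<in>G U. \<forall>x\<in>U. \<exists>V. openin P3 V \<and> x \<in> V \<and> V \<subseteq> U \<and>
           (\<exists>\<sigma>\<in>F V. \<psi> V \<sigma> = restr V \<rho>)))"

text \<open>A closed subscheme of \<open>\<P>\<^sup>3\<close> is given by a homogeneous ideal, not necessarily saturated;
  its ideal sheaf, Hilbert polynomial, degree and genus only depend on the saturation.\<close>

definition homogeneous_ideal :: "form set \<Rightarrow> bool" where
  "homogeneous_ideal C \<longleftrightarrow> 0 \<in> C \<and> (\<forall>F\<in>C. \<forall>G\<in>C. F + G \<in> C) \<and> (\<forall>F\<in>C. \<forall>G. G * F \<in> C) \<and>
     (\<forall>F\<in>C. \<exists>H. finite H \<and> H \<subseteq> C \<and> (\<forall>h\<in>H. \<exists>n. homog n h) \<and> F = \<Sum>H)"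

text \<open>The ideal sheaf is a subsheaf of \<open>\<O>\<close>, whose sections are tuples supported at index \<open>0\<close>.\<close>

definition ideal_sheaf :: "form set \<Rightarrow> sheaf" where
  "ideal_sheaf C U = {\<sigma> \<in> twist_sum {0} (\<lambda>_. 0) U.
     \<forall>x\<in>U. \<exists>V f g k. openin P3 V \<and> x \<in> V \<and> V \<subseteq> U \<and> f \<in> C \<and> homog k f \<and> homog k g \<and>
        (\<forall>v\<in>\<Union>V. peval g v \<noteq> 0 \<and> \<sigma> 0 v = peval f v / peval g v)}"

definition scale_form :: "complex \<Rightarrow> form \<Rightarrow> form" where
  "scale_form c F = Poly_Mapping.map ((*) c) F"

lemma lookup_scale_form:
  "Poly_Mapping.lookup (scale_form c F) m = c * Poly_Mapping.lookup F m"
  by (simp add: scale_form_def Poly_Mapping.map.rep_eq when_def)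

lemma vector_space_form: "vector_space scale_form"
  by unfold_locales
    (auto intro!: poly_mapping_eqI simp: lookup_scale_form lookup_add algebra_simps)

definition hilbert_fun :: "form set \<Rightarrow> nat \<Rightarrow> real" where
  "hilbert_fun C n = real (vector_space.dim scale_form {F. homog (int n) F})
     - real (vector_space.dim scale_form {F \<in> C. homog (int n) F})"

definition hilbert_poly :: "form set \<Rightarrow> real poly" where
  "hilbert_poly C = (THE P. \<forall>\<^sub>F n in sequentially. hilbert_fun C n = poly P (real n))"

definition curve :: "form set \<Rightarrow> bool" where
  "curve C \<longleftrightarrow> homogeneous_ideal C \<and> degree (hilbert_poly C) = 1"

definition curve_degree :: "form set \<Rightarrow> real" where
  "curve_degree C = coeff (hilbert_poly C) 1"

definition arith_genus :: "form set \<Rightarrow> real" where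
  "arith_genus C = 1 - poly (hilbert_poly C) 0"

text \<open>Here \<open>a\<close> is indexed by \<open>0,\<dots>,t\<close> and \<open>b\<close> by \<open>1,\<dots>,t\<close>.\<close>

definition d_C :: "nat \<Rightarrow> (nat \<Rightarrow> int) \<Rightarrow> (nat \<Rightarrow> int) \<Rightarrow> real" where
  "d_C t a b = 1 / 2 * real_of_int ((\<Sum>j=1..t. b j ^ 2) - (\<Sum>i=0..t. a i ^ 2))"

definition g_C :: "nat \<Rightarrow> (nat \<Rightarrow> int) \<Rightarrow> (nat \<Rightarrow> int) \<Rightarrow> real" where
  "g_C t a b = 1 + 1 / 6 * real_of_int ((\<Sum>j=1..t. b j ^ 3) - (\<Sum>i=0..t. a i ^ 3))
     - 2 * d_C t a b"

end

theory Submission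
  imports Defs "HOL-Computational_Algebra.Fundamental_Theorem_Algebra"
begin

text \<open>Two graded automorphisms \<open>1 + \<epsilon> \<alpha>\<close> and \<open>1 + \<epsilon> \<beta>\<close> act on matrices by \<open>S \<mapsto> (1 + \<epsilon> \<alpha>) S (1 + \<epsilon> \<beta>)\<close>
  and change the determinant only by a constant. For a suitable tridiagonal matrix \<open>S0\<close> the squares
  of the submaximal minors generate an ideal that contains powers of all four variables. By a depth
  argument a first-order deformation \<open>T\<close> of \<open>S0\<close> with \<open>tr (adj S0 T) = 0\<close> is then of the form
  \<open>\<alpha> S0 + S0 \<beta>\<close>, with \<open>(\<alpha>, \<beta>)\<close> unique up to the scalars \<open>(c, - c)\<close>. So a linear complement of these
  deformations parametrises a dense part of the determinantal variety with independent tangent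
  directions, which gives its dimension; the dimension theory used compares the growth of Hilbert
  functions along chains of irreducible closed sets.

  The ideal of the curve agrees in large degrees with the saturated ideal of a resolution of forms,
  whose Hilbert polynomial is a sum of binomial coefficients. A curve exists since the monomials
  \<open>x\<^sup>A y\<^sup>B\<close> with suitable exponents have a bidiagonal Hilbert--Burch matrix. Both dimension formulas
  then differ by an identity between sums of cubes.\<close>

text \<open>The complex behind the deformations with \<open>tr (adj S0 T) = 0\<close>, a relative of
  the Gulliksen--Negard complex of the submaximal minors, asks for depth four, and four is the
  codimension of the corank-two locus of generic square matrices. In four variables this means that
  the minors of \<open>S0\<close> vanish together only at the origin, so one explicit matrix is
  enough; a Nullstellensatz converts the absence of zeros into pure powers. Since all degrees
  \<open>b j - a i\<close> are positive, the parameters that make \<open>(\<alpha>, \<beta>)\<close>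
  ambiguous would have negative degree, apart from the scalars. The curve influences the formula
  only through numbers. Adjoining the index \<open>0\<close> changes
  \<open>hom(B,A) - hom(A,A)\<close> by the sum of all \<open>h0 (b j - d) - h0 (a j - d)\<close>,
  up to a constant. As \<open>d\<close> lies below all \<open>a j\<close> and \<open>b j\<close>,
  these are values of one cubic polynomial, and the power sums that remain are those of
  \<open>d_C\<close> and \<open>g_C\<close>. Krull dimension being defined by chains, the upper
  bound treats an arbitrary chain, while the lower bound needs one of full length; the closures over
  the first \<open>k\<close> coordinates of the slice provide it.\<close>

declare Union_iff [simp del]


section \<open>Polynomials\<close>

abbreviation mon :: "('x \<Rightarrow>\<^sub>0 nat) => complex => 'x cpoly" where
  "mon \<equiv> Poly_Mapping.single"

abbreviation coef :: "'x cpoly => ('x \<Rightarrow>\<^sub>0 nat) => complex" where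
  "coef \<equiv> Poly_Mapping.lookup"

abbreviation expo :: "('x \<Rightarrow>\<^sub>0 nat) => 'x => nat" where
  "expo \<equiv> Poly_Mapping.lookup"

abbreviation supp :: "('a \<Rightarrow>\<^sub>0 'b::zero) => 'a set" where
  "supp \<equiv> Poly_Mapping.keys"

definition meval :: "('x => complex) => ('x \<Rightarrow>\<^sub>0 nat) => complex" where
  "meval v m = (\<Prod>i\<in>supp m. v i ^ expo m i)"

lemma meval_superset:
  assumes "finite S" "supp m \<subseteq> S"
  shows "meval v m = (\<Prod>i\<in>S. v i ^ expo m i)"
  unfolding meval_def using assms
  by (intro prod.mono_neutral_left) (auto simp: in_keys_iff)

lemma meval_zero [simp]: "meval v 0 = 1"
  by (simp add: meval_def)

lemma meval_single [simp]: "meval v (Poly_Mapping.single i n) = v i ^ n"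
  by (simp add: meval_def)

lemma meval_add: "meval v (m + n) = meval v m * meval v n"
proof -
  let ?S = "supp m \<union> supp n"
  have "supp (m + n) \<subseteq> ?S" by (rule Poly_Mapping.keys_add)
  then show ?thesis
    by (simp add: meval_superset[of ?S] lookup_add power_add prod.distrib)
qed

lemma meval_one [simp]: "meval (\<lambda>_. 1) m = 1"
  by (simp add: meval_def)

lemma meval_times: "meval (\<lambda>i. u i * v i) m = meval u m * meval v m"
  by (simp add: meval_def power_mult_distrib prod.distrib)

lemma meval_scale: "meval (\<lambda>i. c * v i) m = c ^ mono_deg m * meval v m"
  by (simp add: meval_def mono_deg_def power_mult_distrib prod.distrib power_sum)

lemma peval_meval: "peval p v = (\<Sum>m\<in>supp p. coef p m * meval v m)"
  by (simp add: peval_def meval_def)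

lemma peval_superset:
  assumes "finite S" "supp p \<subseteq> S"
  shows "peval p v = (\<Sum>m\<in>S. coef p m * meval v m)"
  unfolding peval_meval using assms
  by (intro sum.mono_neutral_left) (auto simp: in_keys_iff)

lemma peval_zero [simp]: "peval 0 v = 0"
  by (simp add: peval_def)

lemma peval_mon [simp]: "peval (mon m c) v = c * meval v m"
  by (simp add: peval_meval)

lemma peval_one [simp]: "peval 1 v = 1"
  using peval_mon[of 0 1 v] by (simp add: single_one)

lemma peval_add [simp]: "peval (p + q) v = peval p v + peval q v"
proof -
  let ?S = "supp p \<union> supp q"
  have "supp (p + q) \<subseteq> ?S" by (rule Poly_Mapping.keys_add)
  then show ?thesis
    by (simp add: peval_superset[of ?S] lookup_add algebra_simps sum.distrib)
qed

lemma peval_sum [simp]: "peval (sum f A) v = (\<Sum>a\<in>A. peval (f a) v)"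
  by (induction A rule: infinite_finite_induct) auto

lemma cpoly_decomp: "p = (\<Sum>m\<in>supp p. mon m (coef p m))"
  by (rule poly_mapping_eqI) (simp add: lookup_sum lookup_single when_def in_keys_iff)

lemma cpoly_induct [case_names mon add]:
  assumes "\<And>m c. P (mon m c)" "\<And>p q. P p ==> P q ==> P (p + q)"
  shows "P (p :: 'x cpoly)"
proof -
  have "P (\<Sum>m\<in>S. mon m (coef p m))" if "finite S" for S
    using that
  proof induction
    case empty
    then show ?case using assms(1)[of 0 0] by simp
  qed (use assms in auto)
  then show ?thesis by (subst cpoly_decomp) auto
qed

lemma peval_mult [simp]: "peval (p * q) v = peval p v * peval q v"
proof (induction p rule: cpoly_induct)
  case (mon m c)
  show ?case
    by (induction q rule: cpoly_induct) (auto simp: mult_single meval_add algebra_simps)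
qed (auto simp: algebra_simps)

lemma peval_uminus [simp]: "peval (- p) v = - peval p v"
  using peval_add[of "- p" p v] by (simp add: eq_neg_iff_add_eq_0)

lemma peval_diff [simp]: "peval (p - q) v = peval p v - peval q v"
  using peval_add[of p "- q" v] by simp

lemma peval_prod [simp]: "peval (prod f A) v = (\<Prod>a\<in>A. peval (f a) v)"
  by (induction A rule: infinite_finite_induct) auto

lemma peval_power [simp]: "peval (p ^ n) v = peval p v ^ n"
  by (induction n) auto

lemma scale_form_eq: "scale_form c F = mon 0 c * F"
  unfolding scale_form_def by (rule mult_map_scale_conv_mult)

lemma peval_scale_form [simp]: "peval (scale_form c F) v = c * peval F v"
  by (simp add: scale_form_eq)

text \<open>Monomials are pairwise distinct characters of the multiplicative monoid of vectors, so this is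
  Dedekind's lemma.\<close>

lemma meval_independent:
  assumes "finite S" "\<And>m. m \<in> S ==> supp m \<subseteq> I"
    and "\<And>v. (\<forall>i. i \<notin> I --> v i = 0) ==> (\<Sum>m\<in>S. c m * meval v m) = 0"
    and "m \<in> S"
  shows "c m = 0"
  using assms
proof (induction S arbitrary: c m rule: finite_induct)
  case (insert m0 S)
  have *: "c m1 = 0" if m1: "m1 \<in> S" for m1
  proof -
    have "m0 \<noteq> m1" using insert.hyps m1 by auto
    then obtain i where i: "expo m0 i \<noteq> expo m1 i" by (metis poly_mapping_eqI)
    then have "i \<in> I" using insert.prems(1)[of m0] insert.prems(1)[of m1] m1
      by (metis in_keys_iff insertCI subsetD)
    \<comment> \<open>At this vector a character \<open>m\<close> takes the value
      \<open>2 ^ expo m i\<close>, which tells \<open>m0\<close> and \<open>m1\<close> apart.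
      Translating a relation by \<open>u\<close> and subtracting a multiple of the original removes
      \<open>m0\<close>.\<close>
    define u :: "'a => complex" where "u = (\<lambda>j. if j \<in> I then if j = i then 2 else 1 else 0)"
    have u: "meval u m = 2 ^ expo m i" if "supp m \<subseteq> I" for m
    proof -
      have "meval u m = (\<Prod>j\<in>insert i (supp m). u j ^ expo m j)"
        by (rule meval_superset) auto
      also have "\<dots> = (\<Prod>j\<in>insert i (supp m). if j = i then 2 ^ expo m i else 1)"
        by (rule prod.cong) (use that \<open>i \<in> I\<close> in \<open>auto simp: u_def\<close>)
      also have "\<dots> = 2 ^ expo m i" by simp
      finally show ?thesis .
    qed
    have "(\<Sum>m\<in>S. (c m * (meval u m - meval u m0)) * meval v m) = 0"
      if v: "\<forall>i. i \<notin> I --> v i = 0" for v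
    proof -
      have "(\<Sum>m\<in>insert m0 S. c m * meval (\<lambda>i. u i * v i) m) = 0"
        by (rule insert.prems(2)) (use v in auto)
      moreover have "(\<Sum>m\<in>insert m0 S. c m * meval v m) = 0"
        by (rule insert.prems(2)) (use v in auto)
      ultimately have "(\<Sum>m\<in>insert m0 S. c m * (meval u m * meval v m))
          - meval u m0 * (\<Sum>m\<in>insert m0 S. c m * meval v m) = 0"
        by (simp add: meval_times)
      then have "(\<Sum>m\<in>insert m0 S. (c m * (meval u m - meval u m0)) * meval v m) = 0"
        by (simp add: sum_distrib_left algebra_simps flip: sum_subtractf)
      then show ?thesis using insert.hyps by simp
    qed
    from insert.IH[OF _ this m1] have "c m1 * (meval u m1 - meval u m0) = 0"
      using insert.prems(1) by blast
    moreover have "meval u m1 \<noteq> meval u m0"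
    proof
      assume "meval u m1 = meval u m0"
      then have "(2::complex) ^ expo m1 i = 2 ^ expo m0 i"
        using u insert.prems(1) m1 by auto
      then have "(2::real) ^ expo m1 i = 2 ^ expo m0 i"
        by (metis norm_numeral norm_power)
      then show False using i by simp
    qed
    ultimately show ?thesis by simp
  qed
  define e :: "'a => complex" where "e = (\<lambda>j. if j \<in> I then 1 else 0)"
  have "meval e m0 = 1"
    unfolding meval_def using insert.prems(1)[of m0] by (intro prod.neutral) (auto simp: e_def)
  moreover have "(\<Sum>m\<in>insert m0 S. c m * meval e m) = 0"
    by (rule insert.prems(2)) (auto simp: e_def)
  ultimately have "c m0 = 0" using insert.hyps * by simp
  with * show ?case using insert.prems(3) by auto
qed simp

lemma peval_eq_0_imp:
  assumes "\<And>v. peval p v = 0"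
  shows "p = 0"
proof (rule poly_mapping_eqI)
  fix m
  show "coef p m = coef 0 m"
  proof (cases "m \<in> supp p")
    case True
    have "coef p m = 0"
      by (rule meval_independent[of "supp p" UNIV "coef p", OF _ _ _ True])
        (use assms in \<open>auto simp: peval_meval\<close>)
    then show ?thesis by simp
  qed (simp add: in_keys_iff)
qed

lemma peval_eq_imp:
  assumes "\<And>v. peval p v = peval q v"
  shows "p = q"
  using peval_eq_0_imp[of "p - q"] assms by simp

text \<open>The product \<open>h * (p - q)\<close> vanishes at every vector, hence is zero, and the
  ring has no zero divisors. The linear order on the variables supplies the monomial order behind
  that.\<close>

lemma peval_eq_on_dense:
  fixes p q h :: "('x :: linorder) cpoly"
  assumes "h \<noteq> 0" "\<And>v. peval h v \<noteq> 0 ==> peval p v = peval q v"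
  shows "p = q"
proof -
  have "h * (p - q) = 0"
    by (rule peval_eq_0_imp) (use assms(2) in auto)
  then show ?thesis using assms(1) by simp
qed

subsection \<open>Homogeneous polynomials\<close>

lemma mono_deg_superset:
  assumes "finite S" "supp m \<subseteq> S"
  shows "mono_deg m = (\<Sum>i\<in>S. expo m i)"
  unfolding mono_deg_def using assms
  by (intro sum.mono_neutral_left) (auto simp: in_keys_iff)

lemma mono_deg_UNIV: "mono_deg m = (\<Sum>i\<in>(UNIV :: 'x :: finite set). expo m i)"
  by (rule mono_deg_superset) auto

lemma mono_deg_zero [simp]: "mono_deg 0 = 0"
  by (simp add: mono_deg_def)

lemma mono_deg_single [simp]: "mono_deg (Poly_Mapping.single i n) = n"
  by (simp add: mono_deg_def)

lemma mono_deg_add [simp]: "mono_deg (m + n) = mono_deg m + mono_deg n"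
proof -
  let ?S = "supp m \<union> supp n"
  have "supp (m + n) \<subseteq> ?S" by (rule Poly_Mapping.keys_add)
  then show ?thesis
    by (simp add: mono_deg_superset[of ?S] lookup_add sum.distrib)
qed

lemma expo_le_mono_deg: "expo m i \<le> mono_deg m"
proof (cases "i \<in> supp m")
  case True
  then show ?thesis unfolding mono_deg_def by (intro member_le_sum) auto
qed (simp add: in_keys_iff)

lemma homogD: "homog n p ==> coef p m \<noteq> 0 ==> int (mono_deg m) = n"
  by (simp add: homog_def in_keys_iff)

lemma homogI: "(\<And>m. coef p m \<noteq> 0 ==> int (mono_deg m) = n) ==> homog n p"
  by (simp add: homog_def in_keys_iff)

lemma homog_zero [simp]: "homog n 0"
  by (simp add: homog_def)

lemma homog_mon: "int (mono_deg m) = n ==> homog n (mon m c)"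
  by (simp add: homog_def)

lemma homog_one: "homog 0 1"
  using homog_mon[of 0 0 1] by (simp add: single_one)

lemma homog_add: "homog n p ==> homog n q ==> homog n (p + q)"
  by (rule homogI) (metis add.right_neutral homogD lookup_add)

lemma homog_uminus: "homog n p ==> homog n (- p)"
  by (simp add: homog_def)

lemma homog_diff: "homog n p ==> homog n q ==> homog n (p - q)"
  using homog_add[of n p "- q"] homog_uminus[of n q] by simp

lemma homog_sum: "(\<And>a. a \<in> A ==> homog n (f a)) ==> homog n (sum f A)"
  by (induction A rule: infinite_finite_induct) (auto intro: homog_add)

lemma homog_mult: "homog n p ==> homog k q ==> homog (n + k) (p * q)"
  unfolding homog_def using keys_mult[of p q] by fastforce

lemma homog_mult': "homog n p ==> homog k q ==> l = n + k ==> homog l (p * q)"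
  using homog_mult by blast

lemma homog_power: "homog n p ==> homog (int k * n) (p ^ k)"
  by (induction k) (auto simp: homog_one algebra_simps intro: homog_mult')

lemma homog_prod: "(\<And>a. a \<in> A ==> homog (n a) (f a)) ==> homog (sum n A) (prod f A)"
  by (induction A rule: infinite_finite_induct) (auto intro: homog_mult homog_one)

lemma homog_scale_form: "homog n p ==> homog n (scale_form c p)"
  by (rule homogI) (auto simp: lookup_scale_form dest: homogD)

lemma homog_neg: "homog n p ==> n < 0 ==> p = 0"
  by (rule poly_mapping_eqI) (metis homogD lookup_zero not_less of_nat_0_le_iff)

lemma peval_homog_scale:
  assumes "homog n p"
  shows "peval p (\<lambda>i. c * v i) = c ^ nat n * peval p v"
  unfolding peval_meval sum_distrib_left
  by (rule sum.cong) (use assms in \<open>auto simp: meval_scale homog_def\<close>)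

lemma mono_deg_0_iff [simp]: "mono_deg m = 0 \<longleftrightarrow> m = 0"
proof
  assume "mono_deg m = 0"
  then show "m = 0"
    by (intro poly_mapping_eqI) (metis expo_le_mono_deg le_zero_eq lookup_zero)
qed simp

lemma homog_0_const:
  assumes "homog 0 p"
  shows "p = mon 0 (coef p 0)"
  by (rule poly_mapping_eqI) (use homogD[OF assms] in \<open>force simp: lookup_single when_def\<close>)

definition hcomp :: "int => 'x cpoly => 'x cpoly" where
  "hcomp n p = (\<Sum>m | m \<in> supp p \<and> int (mono_deg m) = n. mon m (coef p m))"

lemma coef_hcomp: "coef (hcomp n p) m = (if int (mono_deg m) = n then coef p m else 0)"
  by (auto simp: hcomp_def lookup_sum lookup_single when_def in_keys_iff)

lemma homog_hcomp: "homog n (hcomp n p)"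
  by (rule homogI) (auto simp: coef_hcomp split: if_splits)

lemma hcomp_homog: "homog n p ==> hcomp n p = p"
  by (rule poly_mapping_eqI) (auto simp: coef_hcomp dest: homogD)

lemma hcomp_homog_other: "homog k p ==> k \<noteq> n ==> hcomp n p = 0"
  by (rule poly_mapping_eqI) (auto simp: coef_hcomp dest: homogD)

lemma hcomp_zero [simp]: "hcomp n 0 = 0"
  by (simp add: hcomp_def)

lemma hcomp_add: "hcomp n (p + q) = hcomp n p + hcomp n q"
  by (rule poly_mapping_eqI) (auto simp: coef_hcomp lookup_add)

lemma hcomp_sum: "hcomp n (sum f A) = (\<Sum>a\<in>A. hcomp n (f a))"
  by (induction A rule: infinite_finite_induct) (auto simp: hcomp_add)

lemma hcomp_mult_homog:
  assumes "homog k q"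
  shows "hcomp n (p * q) = hcomp (n - k) p * q"
proof (induction p rule: cpoly_induct)
  case (mon m c)
  have 1: "homog (int (mono_deg m)) (mon m c)" by (rule homog_mon) simp
  then have 2: "homog (int (mono_deg m) + k) (mon m c * q)" by (rule homog_mult[OF _ assms])
  show ?case
  proof (cases "int (mono_deg m) + k = n")
    case True
    then show ?thesis using hcomp_homog[of n "mon m c * q"] hcomp_homog[OF 1] 2 by auto
  next
    case False
    then show ?thesis
      using hcomp_homog_other[OF 2, of n] hcomp_homog_other[OF 1, of "n - k"] by auto
  qed
qed (auto simp: hcomp_add algebra_simps)

lemma hcomp_homog_mult: "homog k q ==> hcomp n (q * p) = q * hcomp (n - k) p"
  using hcomp_mult_homog[of k q n p] by (simp add: mult.commute)

lemma hcomp_decomp: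
  assumes "finite S" "\<And>m. m \<in> supp p ==> int (mono_deg m) \<in> S"
  shows "p = (\<Sum>n\<in>S. hcomp n p)"
proof (rule poly_mapping_eqI)
  fix m
  show "coef p m = coef (\<Sum>n\<in>S. hcomp n p) m"
    using assms by (auto simp: lookup_sum coef_hcomp in_keys_iff)
qed

lemma hcomp_decomp_keys: "p = (\<Sum>n\<in>(int \<circ> mono_deg) ` supp p. hcomp n p)"
  by (rule hcomp_decomp) auto

subsection \<open>Powers of variables and the ideals they generate\<close>

definition xp :: "'x => nat => 'x cpoly" where
  "xp i n = mon (Poly_Mapping.single i n) 1"

lemma peval_xp [simp]: "peval (xp i n) v = v i ^ n"
  by (simp add: xp_def)

lemma homog_xp: "homog (int n) (xp i n)"
  by (simp add: xp_def homog_mon)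

lemma xp_neq_0 [simp]: "xp i n \<noteq> 0"
  by (metis lookup_single_eq lookup_zero xp_def zero_neq_one)

lemma xp_add: "xp i (m + n) = xp i m * xp i n"
  by (simp add: xp_def mult_single single_add)

lemma xp_0 [simp]: "xp i 0 = 1"
  by (simp add: xp_def)

lemma coef_mon_mult: "coef (mon a c * p) (a + m) = c * coef p m"
proof -
  have "a + k = a + m \<longleftrightarrow> k = m" for k by simp
  then show ?thesis
    by (induction p rule: cpoly_induct)
      (simp_all add: mult_single lookup_single lookup_add distrib_left when_def)
qed

lemma coef_mon_mult_other:
  assumes "\<forall>m. m' \<noteq> a + m"
  shows "coef (mon a c * p) m' = 0"
  by (induction p rule: cpoly_induct)
    (use assms in \<open>auto simp: mult_single lookup_single lookup_add distrib_left when_def\<close>)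

lemma keys_xp_mult:
  "supp (xp i n * p) = (+) (Poly_Mapping.single i n) ` supp p"
proof -
  have "m' \<in> supp (xp i n * p) \<longleftrightarrow>
      (\<exists>m. m' = Poly_Mapping.single i n + m \<and> coef p m \<noteq> 0)" for m'
  proof (cases "\<exists>m. m' = Poly_Mapping.single i n + m")
    case True
    then obtain m where "m' = Poly_Mapping.single i n + m" by blast
    then show ?thesis by (simp add: in_keys_iff xp_def coef_mon_mult)
  next
    case False
    then show ?thesis
      using coef_mon_mult_other[of m' "Poly_Mapping.single i n" 1 p] by (auto simp: in_keys_iff xp_def)
  qed
  then show ?thesis by (auto simp: in_keys_iff image_iff)
qed

lemma homog_xp_mult_iff: "homog (n + int k) (xp i k * p) \<longleftrightarrow> homog n p"
  by (auto simp: homog_def keys_xp_mult)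

lemma mon_le_decomp:
  assumes "n \<le> expo m i"
  shows "Poly_Mapping.single i n + (m - Poly_Mapping.single i n) = m"
  by (rule poly_mapping_eqI)
    (use assms in \<open>auto simp: lookup_add lookup_minus lookup_single when_def\<close>)

lemma xp_dvdI:
  assumes "\<And>m. m \<in> supp p ==> n \<le> expo m i"
  obtains q where "p = xp i n * q"
proof -
  have "p = (\<Sum>m\<in>supp p. mon m (coef p m))" by (rule cpoly_decomp)
  also have "\<dots> = (\<Sum>m\<in>supp p. xp i n * mon (m - Poly_Mapping.single i n) (coef p m))"
    by (rule sum.cong) (simp_all add: xp_def mult_single mon_le_decomp assms)
  finally show ?thesis unfolding sum_distrib_left[symmetric] using that by blast
qed

text \<open>Powers of different variables are coprime: multiplication by \<open>xp i m\<close> does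
  not change the exponents at \<open>j\<close>, so they are already at least \<open>n\<close> in
  \<open>p\<close>.\<close>

lemma xp_dvd_cancel:
  assumes "xp i m * p = xp j n * q" "i \<noteq> j"
  obtains r where "p = xp j n * r"
proof (rule xp_dvdI[of p n j])
  fix k assume "k \<in> supp p"
  then have "Poly_Mapping.single i m + k \<in> supp (xp j n * q)"
    unfolding assms(1)[symmetric] keys_xp_mult by blast
  then obtain x where "Poly_Mapping.single i m + k = Poly_Mapping.single j n + x"
    unfolding keys_xp_mult by blast
  then have "n \<le> expo (Poly_Mapping.single i m + k) j"
    by (simp add: lookup_add)
  then show "n \<le> expo k j" using assms(2) by (simp add: lookup_add lookup_single when_def)
qed (use that in blast)

text \<open>The ideal generated by the powers \<open>xp i N\<close> with \<open>i \<in> S\<close>.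
  Stated through monomials, membership can be checked term by term.\<close>

definition mono_ideal :: "'x set => nat => 'x cpoly set" where
  "mono_ideal S N = {p. \<forall>m\<in>supp p. \<exists>i\<in>S. N \<le> expo m i}"

lemma mono_ideal_empty: "p \<in> mono_ideal {} N \<longleftrightarrow> p = 0"
  by (auto simp: mono_ideal_def)

lemma mono_ideal_0 [simp]: "0 \<in> mono_ideal S N"
  by (auto simp: mono_ideal_def)

lemma mono_ideal_add: "p \<in> mono_ideal S N ==> q \<in> mono_ideal S N ==> p + q \<in> mono_ideal S N"
  using Poly_Mapping.keys_add[of p q] by (force simp: mono_ideal_def)

lemma mono_ideal_mult: "p \<in> mono_ideal S N ==> q * p \<in> mono_ideal S N"
proof -
  assume p: "p \<in> mono_ideal S N"
  have "\<exists>i\<in>S. N \<le> expo m i" if m: "m \<in> supp (q * p)" for m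
  proof -
    obtain a b where "m = a + b" "b \<in> supp p" using m keys_mult[of q p] by auto
    then obtain i where "i \<in> S" "N \<le> expo b i" using p by (auto simp: mono_ideal_def)
    then show ?thesis using \<open>m = a + b\<close> by (auto simp: lookup_add intro!: bexI[of _ i])
  qed
  then show ?thesis by (auto simp: mono_ideal_def)
qed

lemma mono_ideal_uminus: "p \<in> mono_ideal S N ==> - p \<in> mono_ideal S N"
  by (auto simp: mono_ideal_def)

lemma mono_ideal_diff: "p \<in> mono_ideal S N ==> q \<in> mono_ideal S N ==> p - q \<in> mono_ideal S N"
  using mono_ideal_add[of p S N "- q"] mono_ideal_uminus[of q S N] by simp

lemma mono_ideal_sum: "(\<And>a. a \<in> A ==> f a \<in> mono_ideal S N) ==> sum f A \<in> mono_ideal S N"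
  by (induction A rule: infinite_finite_induct) (auto intro: mono_ideal_add)

lemma xp_in_mono_ideal: "i \<in> S ==> xp i N \<in> mono_ideal S N"
  by (auto simp: mono_ideal_def xp_def intro!: bexI[of _ i])

text \<open>The powers of the variables form a regular sequence: multiplication by
  \<open>xp k N\<close> leaves the exponents at all other variables alone.\<close>

lemma mono_ideal_cancel:
  assumes "xp k N * p \<in> mono_ideal S N" "k \<notin> S"
  shows "p \<in> mono_ideal S N"
proof -
  have "\<exists>i\<in>S. N \<le> expo m i" if "m \<in> supp p" for m
  proof -
    have "Poly_Mapping.single k N + m \<in> supp (xp k N * p)"
      using that by (auto simp: keys_xp_mult)
    then obtain i where "i \<in> S" "N \<le> expo (Poly_Mapping.single k N + m) i"
      using assms(1) by (auto simp: mono_ideal_def)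
    then show ?thesis using assms(2) by (auto simp: lookup_add lookup_single when_def split: if_splits)
  qed
  then show ?thesis by (auto simp: mono_ideal_def)
qed

text \<open>Peels off one generator: the monomials of \<open>p\<close> whose exponent at
  \<open>k\<close> is at least \<open>N\<close> make up the multiple of
  \<open>xp k N\<close>.\<close>

lemma mono_ideal_insert:
  assumes "p \<in> mono_ideal (insert k S) N"
  obtains q where "p - xp k N * q \<in> mono_ideal S N"
proof -
  define p1 where "p1 = (\<Sum>m | m \<in> supp p \<and> N \<le> expo m k. mon m (coef p m))"
  have c: "coef p1 m = (if N \<le> expo m k then coef p m else 0)" for m
    by (auto simp: p1_def lookup_sum lookup_single when_def in_keys_iff)
  have "N \<le> expo m k" if "m \<in> supp p1" for m
    using that by (auto simp: in_keys_iff c split: if_splits)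
  then obtain q where q: "p1 = xp k N * q" by (rule xp_dvdI)
  have "p - p1 \<in> mono_ideal S N"
    using assms by (auto simp: mono_ideal_def in_keys_iff lookup_minus c split: if_splits)
  with q that show ?thesis by blast
qed

lemma mono_ideal_mono: "S \<subseteq> S' ==> mono_ideal S N \<subseteq> mono_ideal S' N"
  unfolding mono_ideal_def by blast

section \<open>The Zariski topology\<close>

definition nz :: "('x => complex) => bool" where
  "nz v \<longleftrightarrow> (\<exists>i. v i \<noteq> 0)"

lemma nz_scale: "c \<noteq> 0 ==> nz (\<lambda>i. c * v i) \<longleftrightarrow> nz v"
  by (simp add: nz_def)

lemma proj_pt_iff: "u \<in> proj_pt v \<longleftrightarrow> (\<exists>c. c \<noteq> 0 \<and> u = (\<lambda>i. c * v i))"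
  by (auto simp: proj_pt_def)

lemma mem_proj_pt [simp]: "v \<in> proj_pt v"
  by (auto simp: proj_pt_iff intro!: exI[of _ 1])

lemma proj_pt_scale: "c \<noteq> 0 ==> proj_pt (\<lambda>i. c * v i) = proj_pt v"
proof (rule Set.set_eqI)
  fix u assume c: "c \<noteq> 0"
  have "(\<exists>d. d \<noteq> 0 \<and> u = (\<lambda>i. d * v i)) ==> (\<exists>d. d \<noteq> 0 \<and> u = (\<lambda>i. d * (c * v i)))"
  proof -
    assume "\<exists>d. d \<noteq> 0 \<and> u = (\<lambda>i. d * v i)"
    then obtain d where "d \<noteq> 0" "u = (\<lambda>i. d * v i)" by blast
    then show ?thesis using c by (intro exI[of _ "d / c"]) auto
  qed
  moreover have "(\<exists>d. d \<noteq> 0 \<and> u = (\<lambda>i. d * (c * v i))) ==> (\<exists>d. d \<noteq> 0 \<and> u = (\<lambda>i. d * v i))"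
    using c by (metis (no_types) mult.assoc mult_eq_0_iff)
  ultimately show "u \<in> proj_pt (\<lambda>i. c * v i) \<longleftrightarrow> u \<in> proj_pt v"
    unfolding proj_pt_iff by blast
qed

lemma proj_pt_eqI: "u \<in> proj_pt v ==> proj_pt u = proj_pt v"
  by (auto simp: proj_pt_iff proj_pt_scale)

lemma proj_pt_in_space: "proj_pt v \<in> proj_space I \<longleftrightarrow> nz v \<and> (\<forall>i. i \<notin> I --> v i = 0)"
proof
  assume "proj_pt v \<in> proj_space I"
  then obtain w where w: "proj_pt v = proj_pt w" "\<exists>i. w i \<noteq> 0" "\<forall>i. i \<notin> I --> w i = 0"
    by (auto simp: proj_space_def)
  then obtain c where "c \<noteq> 0" "v = (\<lambda>i. c * w i)" by (metis mem_proj_pt proj_pt_iff)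
  with w show "nz v \<and> (\<forall>i. i \<notin> I --> v i = 0)" by (auto simp: nz_def)
qed (auto simp: proj_space_def nz_def)

lemma proj_space_eq: "x \<in> proj_space I ==> v \<in> x ==> x = proj_pt v"
  by (auto simp: proj_space_def proj_pt_eqI)

text \<open>Cones stay written as unions throughout; \<open>Union_iff\<close> is kept out of the
  simplifier so that it does not take membership in them apart.\<close>

lemma cone_iff:
  assumes "U \<subseteq> proj_space I"
  shows "v \<in> \<Union>U \<longleftrightarrow> proj_pt v \<in> U"
  using assms proj_space_eq by (metis UnionE UnionI mem_proj_pt subsetD)

lemma proj_space_ex: "x \<in> proj_space I ==> \<exists>v. x = proj_pt v \<and> nz v \<and> (\<forall>i. i \<notin> I --> v i = 0)"
  by (auto simp: proj_space_def nz_def)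

lemma homog_zero_iff:
  assumes "homog n p" "u \<in> proj_pt v"
  shows "peval p u = 0 \<longleftrightarrow> peval p v = 0"
proof -
  obtain c where c: "c \<noteq> 0" "u = (\<lambda>i. c * v i)" using assms(2) by (auto simp: proj_pt_iff)
  show ?thesis unfolding c(2) peval_homog_scale[OF assms(1)] using c(1) by simp
qed

lemma basic_open_iff:
  assumes "homog n p"
  shows "proj_pt v \<in> basic_open I p \<longleftrightarrow> proj_pt v \<in> proj_space I \<and> peval p v \<noteq> 0"
proof -
  have "peval p u \<noteq> 0" if "peval p v \<noteq> 0" "u \<in> proj_pt v" for u
    using that peval_homog_scale[OF assms] by (auto simp: proj_pt_iff)
  then show ?thesis by (auto simp: basic_open_def)
qed

lemma basic_open_subset: "basic_open I p \<subseteq> proj_space I"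
  by (auto simp: basic_open_def)

lemma basic_open_one [simp]: "basic_open I 1 = proj_space I"
  by (auto simp: basic_open_def)

lemma basic_open_mult: "basic_open I (p * q) = basic_open I p \<inter> basic_open I q"
  by (auto simp: basic_open_def)

text \<open>The basic open sets form a basis and not only a subbasis, because the product of two
  forms cuts out the intersection of their basic open sets.\<close>

lemma openin_zariski:
  "openin (zariski I) U \<longleftrightarrow> U \<subseteq> proj_space I \<and>
     (\<forall>x\<in>U. \<exists>n p. homog n p \<and> x \<in> basic_open I p \<and> basic_open I p \<subseteq> U)"
  (is "_ \<longleftrightarrow> ?R U")
proof
  let ?S = "{basic_open I p | p. \<exists>n. homog n p}"
  assume "openin (zariski I) U"
  then have "generate_topology_on ?S U"
    by (simp add: zariski_def openin_topology_generated_by_iff)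
  then show "?R U"
  proof induction
    case (Int a b)
    have "\<exists>n p. homog n p \<and> x \<in> basic_open I p \<and> basic_open I p \<subseteq> a \<inter> b" if x: "x \<in> a \<inter> b" for x
    proof -
      obtain n p k q where "homog n p" "x \<in> basic_open I p" "basic_open I p \<subseteq> a"
        "homog k q" "x \<in> basic_open I q" "basic_open I q \<subseteq> b"
        using Int.IH x by (meson IntD1 IntD2)
      then show ?thesis
        by (intro exI[of _ "n + k"] exI[of _ "p * q"]) (auto simp: basic_open_mult intro: homog_mult)
    qed
    with Int.IH show ?case by auto
  next
    case (UN K)
    have "\<exists>n p. homog n p \<and> x \<in> basic_open I p \<and> basic_open I p \<subseteq> \<Union>K" if x: "x \<in> \<Union>K" for x
    proof -
      obtain k where k: "k \<in> K" "x \<in> k" using x by blast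
      then obtain n p where "homog n p" "x \<in> basic_open I p" "basic_open I p \<subseteq> k"
        using UN.IH by meson
      then show ?thesis using k by blast
    qed
    with UN.IH show ?case by blast
  next
    case (Basis s)
    then obtain n p where "s = basic_open I p" "homog n p" by blast
    then show ?case using basic_open_subset by blast
  qed auto
next
  assume R: "?R U"
  have "openin (zariski I) (\<Union>{basic_open I p | p. (\<exists>n. homog n p) \<and> basic_open I p \<subseteq> U})"
    unfolding zariski_def by (rule openin_Union) (auto intro: topology_generated_by_Basis)
  moreover have "\<Union>{basic_open I p | p. (\<exists>n. homog n p) \<and> basic_open I p \<subseteq> U} = U"
    using R by blast
  ultimately show "openin (zariski I) U" by simp
qed

lemma openin_basic: "homog n p ==> openin (zariski I) (basic_open I p)"
  unfolding openin_zariski using basic_open_subset by blast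

lemma topspace_zariski [simp]: "topspace (zariski I) = proj_space I"
proof
  show "topspace (zariski I) \<subseteq> proj_space I"
    using openin_zariski openin_topspace by blast
  show "proj_space I \<subseteq> topspace (zariski I)"
    using openin_basic[OF homog_one, of I] openin_subset by fastforce
qed

lemma openin_zariski_subset: "openin (zariski I) U ==> U \<subseteq> proj_space I"
  by (simp add: openin_zariski)

definition zeros :: "'x set => 'x cpoly => ('x => complex) set set" where
  "zeros I p = {x \<in> proj_space I. \<forall>v\<in>x. peval p v = 0}"

lemma closedin_zeros:
  assumes "homog n p"
  shows "closedin (zariski I) (zeros I p)"
proof -
  have "zeros I p = proj_space I - basic_open I p"
  proof (rule Set.set_eqI)
    fix x
    show "x \<in> zeros I p \<longleftrightarrow> x \<in> proj_space I - basic_open I p"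
    proof (cases "x \<in> proj_space I")
      case True
      then obtain v where v: "x = proj_pt v" using proj_space_ex by blast
      have "(\<forall>u\<in>x. peval p u = 0) \<longleftrightarrow> peval p v = 0"
        unfolding v using homog_zero_iff[OF assms] mem_proj_pt by blast
      then show ?thesis using True basic_open_iff[OF assms, of v I] unfolding v
        by (auto simp: zeros_def)
    qed (auto simp: zeros_def)
  qed
  moreover have "closedin (zariski I) (topspace (zariski I) - basic_open I p)"
    by (intro closedin_diff closedin_topspace openin_basic[OF assms])
  ultimately show ?thesis by simp
qed

lemma closedin_separate:
  assumes "closedin (zariski I) Z" "proj_pt v \<in> proj_space I" "proj_pt v \<notin> Z"
  obtains n p where "homog n p" "peval p v \<noteq> 0" "\<And>u. u \<in> \<Union>Z ==> peval p u = 0"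
proof -
  have "openin (zariski I) (proj_space I - Z)" using assms(1) by (metis closedin_def topspace_zariski)
  with assms obtain n p where p: "homog n p" "proj_pt v \<in> basic_open I p"
      "basic_open I p \<subseteq> proj_space I - Z"
    unfolding openin_zariski by blast
  have "peval p u = 0" if u: "u \<in> \<Union>Z" for u
  proof (rule ccontr)
    assume "peval p u \<noteq> 0"
    moreover have Z: "Z \<subseteq> proj_space I" using closedin_subset[OF assms(1)] by simp
    then have "proj_pt u \<in> Z" using u cone_iff by blast
    moreover from this Z have "proj_pt u \<in> proj_space I" by blast
    ultimately have "proj_pt u \<in> basic_open I p" using basic_open_iff[OF p(1)] by blast
    then show False using p(3) \<open>proj_pt u \<in> Z\<close> by blast
  qed
  with p that basic_open_iff[OF p(1)] show ?thesis by blast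
qed

lemma vanish_closure:
  assumes "homog n p" "Y \<subseteq> proj_space I" "\<And>u. u \<in> \<Union>Y ==> peval p u = 0"
    and "u \<in> \<Union>(zariski I closure_of Y)"
  shows "peval p u = 0"
proof -
  have "Y \<subseteq> zeros I p" using assms(2,3) by (auto simp: zeros_def)
  then have "zariski I closure_of Y \<subseteq> zeros I p"
    by (rule closure_of_minimal) (rule closedin_zeros[OF assms(1)])
  with assms(4) show ?thesis by (auto simp: zeros_def)
qed

text \<open>Primality is tested on \<open>Y\<close> alone. If two proper closed subsets covered the
  closure, each would miss a point of \<open>Y\<close>; forms separating these points from the
  subsets have a product that vanishes on \<open>Y\<close>.\<close>

lemma irreducible_closureI:
  assumes "Y \<subseteq> proj_space I" "Y \<noteq> {}"
    and prime: "\<And>n k p q. homog n p ==> homog k q ==>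
      (\<And>u. u \<in> \<Union>Y ==> peval p u * peval q u = 0) ==>
      (\<forall>u\<in>\<Union>Y. peval p u = 0) \<or> (\<forall>u\<in>\<Union>Y. peval q u = 0)"
  shows "irreducible_closedin (zariski I) (zariski I closure_of Y)"
  unfolding irreducible_closedin_def
proof (intro conjI allI impI)
  show "closedin (zariski I) (zariski I closure_of Y)" by simp
  have sub: "Y \<subseteq> zariski I closure_of Y" by (rule closure_of_subset) (use assms(1) in simp)
  then show "zariski I closure_of Y \<noteq> {}" using assms(2) by blast
  fix Z1 Z2
  assume Z: "closedin (zariski I) Z1 \<and> closedin (zariski I) Z2 \<and> zariski I closure_of Y = Z1 \<union> Z2"
  show "zariski I closure_of Y = Z1 \<or> zariski I closure_of Y = Z2"
  proof (rule ccontr)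
    assume *: "\<not> ?thesis"
    have "\<exists>n p. homog n p \<and> (\<exists>u\<in>\<Union>Y. peval p u \<noteq> 0) \<and> (\<forall>u\<in>\<Union>Z'. peval p u = 0)"
      if Z': "closedin (zariski I) Z'" "Z' \<subseteq> zariski I closure_of Y" "Z' \<noteq> zariski I closure_of Y" for Z'
    proof -
      have "\<not> Y \<subseteq> Z'" using Z' closure_of_minimal by (metis subset_antisym)
      then obtain y where y: "y \<in> Y" "y \<notin> Z'" by blast
      then obtain v where v: "y = proj_pt v" using assms(1) proj_space_ex by blast
      obtain n p where "homog n p" "peval p v \<noteq> 0" "\<And>u. u \<in> \<Union>Z' ==> peval p u = 0"
        using closedin_separate[OF Z'(1), of v] y assms(1) v by blast
      moreover have "v \<in> \<Union>Y" using y v mem_proj_pt by blast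
      ultimately show ?thesis by blast
    qed
    note ex = this
    have cl: "zariski I closure_of Y = Z1 \<union> Z2" "closedin (zariski I) Z1" "closedin (zariski I) Z2"
      using Z by blast+
    have ne: "Z1 \<subseteq> zariski I closure_of Y" "Z1 \<noteq> zariski I closure_of Y"
      "Z2 \<subseteq> zariski I closure_of Y" "Z2 \<noteq> zariski I closure_of Y"
      using cl(1) * by auto
    obtain n p where p: "homog n p" "\<exists>u\<in>\<Union>Y. peval p u \<noteq> 0" "\<forall>u\<in>\<Union>Z1. peval p u = 0"
      using ex[OF cl(2) ne(1,2)] by blast
    obtain k q where q: "homog k q" "\<exists>u\<in>\<Union>Y. peval q u \<noteq> 0" "\<forall>u\<in>\<Union>Z2. peval q u = 0"
      using ex[OF cl(3) ne(3,4)] by blast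
    have "peval p u * peval q u = 0" if "u \<in> \<Union>Y" for u
    proof -
      have "u \<in> \<Union>Z1 \<or> u \<in> \<Union>Z2" using that sub cl(1) by blast
      then show ?thesis using p(3) q(3) by auto
    qed
    from prime[OF p(1) q(1) this] p(2) q(2) show False by blast
  qed
qed

lemma irreducible_prime:
  assumes Z: "irreducible_closedin (zariski I) Z" and pq: "homog n p" "homog k q"
    and 0: "\<And>u. u \<in> \<Union>Z ==> peval p u * peval q u = 0"
  shows "(\<forall>u\<in>\<Union>Z. peval p u = 0) \<or> (\<forall>u\<in>\<Union>Z. peval q u = 0)"
proof -
  have cl: "closedin (zariski I) Z" using Z by (simp add: irreducible_closedin_def)
  then have sub: "Z \<subseteq> proj_space I" using closedin_subset by fastforce
  have "(\<forall>v\<in>x. peval p v = 0) \<or> (\<forall>v\<in>x. peval q v = 0)" if "x \<in> Z" for x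
  proof -
    have "x \<in> proj_space I" using sub \<open>x \<in> Z\<close> by blast
    then obtain v where v: "x = proj_pt v" using proj_space_ex by blast
    have "v \<in> \<Union>Z" using that v mem_proj_pt by blast
    then have "peval p v = 0 \<or> peval q v = 0" using 0[of v] by simp
    then show ?thesis
      unfolding v using homog_zero_iff[OF pq(1)] homog_zero_iff[OF pq(2)] by blast
  qed
  then have "Z = (Z \<inter> zeros I p) \<union> (Z \<inter> zeros I q)"
    using sub by (auto simp: zeros_def)
  moreover have "closedin (zariski I) (Z \<inter> zeros I p)" "closedin (zariski I) (Z \<inter> zeros I q)"
    by (intro closedin_Int cl closedin_zeros[OF pq(1)] closedin_zeros[OF pq(2)])+
  ultimately have "Z = Z \<inter> zeros I p \<or> Z = Z \<inter> zeros I q"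
    using Z by (metis irreducible_closedin_def)
  then show ?thesis by (auto simp: zeros_def)
qed

section \<open>Sections of the twisting sheaves\<close>

lemma cone_P3: "openin P3 U ==> v \<in> \<Union>U \<longleftrightarrow> proj_pt v \<in> U"
  by (rule cone_iff[OF openin_zariski_subset])

lemma cone_P3_nz: "openin P3 U ==> v \<in> \<Union>U ==> nz v"
  using cone_P3[of U v] openin_zariski_subset[of UNIV U] proj_pt_in_space[of v UNIV] by blast

lemma cone_scale: "openin P3 U ==> c \<noteq> 0 ==> (\<lambda>i. c * v i) \<in> \<Union>U \<longleftrightarrow> v \<in> \<Union>U"
  using cone_P3[of U v] cone_P3[of U "\<lambda>i. c * v i"] proj_pt_scale[of c v] by metis

lemma open_coneD:
  assumes "openin P3 U" "v \<in> \<Union>U"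
  shows "\<exists>k p. homog k p \<and> peval p v \<noteq> 0 \<and> (\<forall>u. nz u --> peval p u \<noteq> 0 --> u \<in> \<Union>U)"
proof -
  have "proj_pt v \<in> U" using assms cone_P3 by blast
  then obtain k p where p: "homog k p" "proj_pt v \<in> basic_open UNIV p" "basic_open UNIV p \<subseteq> U"
    using assms(1) unfolding openin_zariski by blast
  have "u \<in> \<Union>U" if "nz u" "peval p u \<noteq> 0" for u
    using that p basic_open_iff[OF p(1)] proj_pt_in_space[of u UNIV] cone_P3[OF assms(1)] by blast
  with p basic_open_iff[OF p(1)] show ?thesis by blast
qed

lemma cone_basic:
  fixes p :: form
  assumes "homog n p"
  shows "v \<in> \<Union>(basic_open UNIV p) \<longleftrightarrow> nz v \<and> peval p v \<noteq> 0"
  using cone_P3[OF openin_basic[OF assms]] basic_open_iff[OF assms] proj_pt_in_space by blast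

text \<open>The neighbourhood is the whole locus where the denominator \<open>q\<close> does not
  vanish, so that no separate open set has to be carried along. A given neighbourhood is brought
  into this form by multiplying numerator and denominator by a form that vanishes outside
  it.\<close>

definition local_form :: "int => (4 => complex) set => ((4 => complex) => complex) => (4 => complex) =>
    int => form => form => bool" where
  "local_form n C s v k q f \<longleftrightarrow> homog k q \<and> homog (k + n) f \<and> peval q v \<noteq> 0 \<and>
     (\<forall>u. nz u \<and> peval q u \<noteq> 0 --> u \<in> C \<and> s u = peval f u / peval q u)"

lemma twist_iff:
  assumes "openin P3 U"
  shows "s \<in> twist n U \<longleftrightarrow> (\<forall>v. v \<notin> \<Union>U --> s v = 0) \<and>
    (\<forall>v\<in>\<Union>U. \<exists>k q f. local_form n (\<Union>U) s v k q f)"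
    (is "_ \<longleftrightarrow> ?Z \<and> ?R")
proof
  assume s: "s \<in> twist n U"
  have "\<exists>k q f. local_form n (\<Union>U) s v k q f" if v: "v \<in> \<Union>U" for v
  proof -
    obtain V f g k where V: "openin P3 V" "proj_pt v \<in> V" "V \<subseteq> U" "homog (k + n) f" "homog k g"
      "\<And>u. u \<in> \<Union>V ==> peval g u \<noteq> 0 \<and> s u = peval f u / peval g u"
    proof -
      have "proj_pt v \<in> U" using v cone_P3[OF assms] by blast
      then have "\<exists>V f g k. openin P3 V \<and> proj_pt v \<in> V \<and> V \<subseteq> U \<and> homog (k + n) f \<and> homog k g \<and>
        (\<forall>u\<in>\<Union>V. peval g u \<noteq> 0 \<and> s u = peval f u / peval g u)"
        using s unfolding twist_def by blast
      then show ?thesis using that by blast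
    qed
    have vV: "v \<in> \<Union>V" using V(2) mem_proj_pt by blast
    obtain e p where p: "homog e p" "peval p v \<noteq> 0" "\<forall>u. nz u --> peval p u \<noteq> 0 --> u \<in> \<Union>V"
      using open_coneD[OF V(1) vV] by blast
    have "local_form n (\<Union>U) s v (e + k) (p * g) (p * f)"
      unfolding local_form_def
    proof (intro conjI allI impI)
      show "homog (e + k) (p * g)" "homog (e + k + n) (p * f)"
        using p(1) V(4,5) by (auto intro: homog_mult' simp: algebra_simps)
      show "peval (p * g) v \<noteq> 0" using p(2) V(6)[OF vV] by simp
      fix u assume u: "nz u \<and> peval (p * g) u \<noteq> 0"
      then have uV: "u \<in> \<Union>V" using p(3) by auto
      then show "u \<in> \<Union>U" using V(3) by blast
      show "s u = peval (p * f) u / peval (p * g) u" using V(6)[OF uV] u by simp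
    qed
    then show ?thesis by blast
  qed
  with s show "?Z \<and> ?R" by (auto simp: twist_def)
next
  assume R: "?Z \<and> ?R"
  have "\<exists>V f g k. openin P3 V \<and> x \<in> V \<and> V \<subseteq> U \<and> homog (k + n) f \<and> homog k g \<and>
        (\<forall>v\<in>\<Union>V. peval g v \<noteq> 0 \<and> s v = peval f v / peval g v)" if x: "x \<in> U" for x
  proof -
    have "x \<in> proj_space UNIV" using x openin_zariski_subset[OF assms] by blast
    then obtain v where v: "x = proj_pt v" using proj_space_ex by blast
    then have vU: "v \<in> \<Union>U" using x cone_P3[OF assms] by blast
    then obtain k q f where lf: "local_form n (\<Union>U) s v k q f" using R by meson
    then have q: "homog k q" by (simp add: local_form_def)
    have nz: "nz v" using vU by (rule cone_P3_nz[OF assms])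
    have "basic_open UNIV q \<subseteq> U"
    proof
      fix y assume y: "y \<in> basic_open UNIV q"
      then obtain u where u: "y = proj_pt u" using basic_open_subset proj_space_ex by blast
      then have "u \<in> \<Union>(basic_open UNIV q)" using y mem_proj_pt by blast
      then have "u \<in> \<Union>U" using lf by (auto simp: cone_basic[OF q] local_form_def)
      then show "y \<in> U" using u cone_P3[OF assms] by blast
    qed
    moreover have "x \<in> basic_open UNIV q"
      using lf nz by (auto simp: v local_form_def basic_open_iff proj_pt_in_space)
    moreover have "\<forall>v\<in>\<Union>(basic_open UNIV q). peval q v \<noteq> 0 \<and> s v = peval f v / peval q v"
      using lf by (auto simp: cone_basic[OF q] local_form_def)
    ultimately show ?thesis
      using lf openin_basic[OF q, of UNIV] unfolding local_form_def by blast
  qed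
  with R show "s \<in> twist n U" by (auto simp: twist_def)
qed

lemma twist_zero_outside: "s \<in> twist n U ==> v \<notin> \<Union>U ==> s v = 0"
  by (auto simp: twist_def)

lemma twist_local:
  assumes "openin P3 U" "s \<in> twist n U" "v \<in> \<Union>U"
  obtains k q f where "local_form n (\<Union>U) s v k q f"
  using that assms(2,3) unfolding twist_iff[OF assms(1)] by meson

lemma twistI:
  assumes "openin P3 U" "\<And>v. v \<notin> \<Union>U ==> s v = 0"
    and "\<And>v. v \<in> \<Union>U ==> \<exists>k q f. local_form n (\<Union>U) s v k q f"
  shows "s \<in> twist n U"
  unfolding twist_iff[OF assms(1)] by (intro conjI allI impI ballI assms(2,3))

lemma local_form_shrink:
  assumes "local_form n C s v k q f" "homog e p" "peval p v \<noteq> 0"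
    and "\<And>u. nz u ==> peval p u \<noteq> 0 ==> u \<in> C ==> u \<in> C' \<and> s' u = s u"
  shows "local_form n C' s' v (e + k) (p * q) (p * f)"
  using assms unfolding local_form_def by (auto intro!: homog_mult' simp: algebra_simps)

lemma twist_restrict:
  assumes "openin P3 U" "openin P3 V" "V \<subseteq> U" "s \<in> twist n U"
  shows "(\<lambda>v. if v \<in> \<Union>V then s v else 0) \<in> twist n V"
proof (rule twistI[OF assms(2)])
  fix v assume v: "v \<in> \<Union>V"
  then have "v \<in> \<Union>U" using assms(3) by blast
  then obtain k q f where lf: "local_form n (\<Union>U) s v k q f"
    by (rule twist_local[OF assms(1,4)])
  obtain e p where p: "homog e p" "peval p v \<noteq> 0" "\<forall>u. nz u --> peval p u \<noteq> 0 --> u \<in> \<Union>V"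
    using open_coneD[OF assms(2) v] by blast
  show "\<exists>k q f. local_form n (\<Union>V) (\<lambda>v. if v \<in> \<Union>V then s v else 0) v k q f"
    using local_form_shrink[OF lf p(1,2), of "\<Union>V" "\<lambda>v. if v \<in> \<Union>V then s v else 0"] p(3) by auto
qed simp

lemma twist_glue:
  assumes "openin P3 U" "\<And>v. v \<notin> \<Union>U ==> s v = 0"
    and loc: "\<And>v. v \<in> \<Union>U ==> \<exists>V r. openin P3 V \<and> v \<in> \<Union>V \<and> V \<subseteq> U \<and> r \<in> twist n V \<and> (\<forall>u\<in>\<Union>V. s u = r u)"
  shows "s \<in> twist n U"
proof (rule twistI[OF assms(1,2)])
  fix v assume "v \<in> \<Union>U"
  then obtain V r where V: "openin P3 V" "v \<in> \<Union>V" "V \<subseteq> U" "r \<in> twist n V" "\<forall>u\<in>\<Union>V. s u = r u"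
    using loc[of v] by meson
  then obtain k q f where "local_form n (\<Union>V) r v k q f" using twist_local[OF V(1,4,2)] by metis
  moreover have "\<Union>V \<subseteq> \<Union>U" using V(3) by blast
  ultimately have "local_form n (\<Union>U) s v k q f"
    using V(5) unfolding local_form_def by (metis subsetD)
  then show "\<exists>k q f. local_form n (\<Union>U) s v k q f" by blast
qed

lemma local_form_mult:
  assumes "local_form n C s v k q f" "local_form m C r v l p g"
  shows "local_form (n + m) C (\<lambda>v. s v * r v) v (k + l) (q * p) (f * g)"
  using assms unfolding local_form_def by (auto intro!: homog_mult' simp: algebra_simps)

lemma local_form_add:
  assumes "local_form n C s v k q f" "local_form n C r v l p g"
  shows "local_form n C (\<lambda>v. s v + r v) v (k + l) (q * p) (f * p + g * q)"
  using assms unfolding local_form_def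
  by (auto intro!: homog_mult' homog_add simp: algebra_simps add_frac_eq)

lemma twist_mult:
  assumes "openin P3 U" "s \<in> twist n U" "r \<in> twist m U"
  shows "(\<lambda>v. s v * r v) \<in> twist (n + m) U"
proof (rule twistI[OF assms(1)])
  fix v assume "v \<in> \<Union>U"
  then obtain k q f l p g where "local_form n (\<Union>U) s v k q f" "local_form m (\<Union>U) r v l p g"
    using assms twist_iff[OF assms(1)] by meson
  then show "\<exists>k q f. local_form (n + m) (\<Union>U) (\<lambda>v. s v * r v) v k q f"
    using local_form_mult by blast
qed (use twist_zero_outside[OF assms(2)] in auto)

lemma twist_add:
  assumes "openin P3 U" "s \<in> twist n U" "r \<in> twist n U"
  shows "(\<lambda>v. s v + r v) \<in> twist n U"
proof (rule twistI[OF assms(1)])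
  fix v assume "v \<in> \<Union>U"
  then obtain k q f l p g where "local_form n (\<Union>U) s v k q f" "local_form n (\<Union>U) r v l p g"
    using assms twist_iff[OF assms(1)] by meson
  then show "\<exists>k q f. local_form n (\<Union>U) (\<lambda>v. s v + r v) v k q f"
    using local_form_add by blast
qed (use twist_zero_outside[OF assms(2)] twist_zero_outside[OF assms(3)] in auto)

lemma twist_form:
  assumes "openin P3 U" "homog n f"
  shows "(\<lambda>v. if v \<in> \<Union>U then peval f v else 0) \<in> twist n U"
proof (rule twistI[OF assms(1)])
  fix v assume "v \<in> \<Union>U"
  note vU = this
  obtain e p where p: "homog e p" "peval p v \<noteq> 0" "\<forall>u. nz u --> peval p u \<noteq> 0 --> u \<in> \<Union>U"
    using open_coneD[OF assms(1) vU] by blast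
  then have "local_form n (\<Union>U) (\<lambda>v. if v \<in> \<Union>U then peval f v else 0) v e p (p * f)"
    using assms(2) vU by (auto simp: local_form_def intro: homog_mult)
  then show "\<exists>k q f'. local_form n (\<Union>U) (\<lambda>v. if v \<in> \<Union>U then peval f v else 0) v k q f'" by blast
qed simp

lemma twist_zero: "openin P3 U ==> (\<lambda>v. 0) \<in> twist n U"
  using twist_form[of U n 0] by (simp cong: if_cong)

lemma twist_sum_closed:
  assumes "openin P3 U" "\<And>a. a \<in> A ==> f a \<in> twist n U"
  shows "(\<lambda>v. \<Sum>a\<in>A. f a v) \<in> twist n U"
  using assms(2)
  by (induction A rule: infinite_finite_induct) (auto simp: twist_zero assms(1) intro!: twist_add)

section \<open>Standard charts and common denominators\<close>

definition chart :: "4 => pt set" where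
  "chart k = basic_open UNIV (xp k 1)"

lemma openin_chart [simp]: "openin P3 (chart k)"
  unfolding chart_def by (rule openin_basic[OF homog_xp])

lemma cone_chart: "v \<in> \<Union>(chart k) \<longleftrightarrow> v k \<noteq> 0"
  unfolding chart_def cone_basic[OF homog_xp[of 1 k]] by (auto simp: nz_def)

lemma twist_powi:
  assumes "openin P3 U" "U \<subseteq> chart k"
  shows "(\<lambda>v. if v \<in> \<Union>U then v k powi n else 0) \<in> twist n U"
proof -
  have "(\<lambda>v. if v \<in> \<Union>(chart k) then v k powi n else 0) \<in> twist n (chart k)"
  proof (cases "n \<ge> 0")
    case True
    then have "(\<lambda>v. if v \<in> \<Union>(chart k) then v k powi n else 0) =
        (\<lambda>v. if v \<in> \<Union>(chart k) then peval (xp k (nat n)) v else 0)"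
      by (intro ext) (simp add: power_int_def)
    moreover have "homog n (xp k (nat n))" using homog_xp[of "nat n" k] True by simp
    ultimately show ?thesis using twist_form[OF openin_chart] by simp
  next
    case False
    have "local_form n (\<Union>(chart k)) (\<lambda>v. if v \<in> \<Union>(chart k) then v k powi n else 0) v
        (- n) (xp k (nat (- n))) 1" if "v \<in> \<Union>(chart k)" for v
      unfolding local_form_def cone_chart using False that homog_xp[of "nat (- n)" k]
      by (auto simp: cone_chart power_int_def homog_one inverse_eq_divide power_one_over)
    note lf = this
    show ?thesis by (rule twistI[OF openin_chart]) (simp, intro exI, rule lf)
  qed
  note tw = twist_restrict[OF openin_chart assms this]
  have "v \<in> \<Union>(chart k)" if "v \<in> \<Union>U" for v using that assms(2) by blast
  then have "(\<lambda>v. if v \<in> \<Union>U then v k powi n else 0) =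
      (\<lambda>v. if v \<in> \<Union>U then if v \<in> \<Union>(chart k) then v k powi n else 0 else 0)"
    by (intro ext) simp
  then show ?thesis using tw by simp
qed

lemma common_denominator:
  assumes "openin P3 U" "finite J" "\<And>i. i \<in> J ==> \<sigma> i \<in> twist (n i) U" "v \<in> \<Union>U"
  obtains k q f where "homog k q" "peval q v \<noteq> 0" "\<And>i. i \<in> J ==> homog (k + n i) (f i)"
    "\<And>u. nz u ==> peval q u \<noteq> 0 ==> u \<in> \<Union>U"
    "\<And>u i. nz u ==> peval q u \<noteq> 0 ==> i \<in> J ==> \<sigma> i u = peval (f i) u / peval q u"
proof -
  have "\<exists>k q f. homog k q \<and> peval q v \<noteq> 0 \<and> (\<forall>i\<in>J. homog (k + n i) (f i)) \<and>
    (\<forall>u. nz u --> peval q u \<noteq> 0 --> u \<in> \<Union>U \<and> (\<forall>i\<in>J. \<sigma> i u = peval (f i) u / peval q u))"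
    using assms(2,3)
  proof (induction J rule: finite_induct)
    case empty
    obtain k p where "homog k p" "peval p v \<noteq> 0" "\<forall>u. nz u --> peval p u \<noteq> 0 --> u \<in> \<Union>U"
      using open_coneD[OF assms(1,4)] by blast
    then show ?case by auto
  next
    case (insert j J)
    obtain k q f where IH: "homog k q" "peval q v \<noteq> 0" "\<forall>i\<in>J. homog (k + n i) (f i)"
      "\<forall>u. nz u --> peval q u \<noteq> 0 --> u \<in> \<Union>U \<and> (\<forall>i\<in>J. \<sigma> i u = peval (f i) u / peval q u)"
      using insert.IH[OF insert.prems[OF insertI2]] by blast
    obtain l p g where "local_form (n j) (\<Union>U) (\<sigma> j) v l p g"
      using insert.prems[OF insertI1] assms(4) twist_iff[OF assms(1)] by meson
    then have lf: "homog l p" "homog (l + n j) g" "peval p v \<noteq> 0"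
      "\<And>u. nz u ==> peval p u \<noteq> 0 ==> u \<in> \<Union>U \<and> \<sigma> j u = peval g u / peval p u"
      by (auto simp: local_form_def)
    show ?case
    proof (intro exI conjI ballI allI impI)
      show "homog (k + l) (q * p)" "peval (q * p) v \<noteq> 0"
        using IH lf by (auto intro: homog_mult)
      show "homog (k + l + n i) ((\<lambda>i. if i = j then q * g else p * f i) i)" if "i \<in> insert j J" for i
        using that IH lf by (auto intro!: homog_mult' simp: algebra_simps)
      fix u assume "nz u" "peval (q * p) u \<noteq> 0"
      then show "u \<in> \<Union>U" and "\<And>i. i \<in> insert j J ==>
          \<sigma> i u = peval ((\<lambda>i. if i = j then q * g else p * f i) i) u / peval (q * p) u"
        using IH lf by auto
    qed
  qed
  then obtain k q f where "homog k q" "peval q v \<noteq> 0" "\<forall>i\<in>J. homog (k + n i) (f i)"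
    "\<forall>u. nz u --> peval q u \<noteq> 0 --> u \<in> \<Union>U \<and> (\<forall>i\<in>J. \<sigma> i u = peval (f i) u / peval q u)"
    by blast
  then show ?thesis by (intro that) auto
qed

section \<open>Global sections of the twisting sheaves\<close>

text \<open>Starting from one representation \<open>f0 / q0\<close>, each root \<open>r\<close> of
  \<open>q0\<close> is removed: a representation valid at \<open>r\<close> shows that
  \<open>f0\<close> vanishes there too, so a linear factor cancels. When no root is left,
  \<open>q0\<close> is constant.\<close>

lemma locally_rational_imp_poly:
  fixes h :: "complex => complex"
  assumes "\<And>x. \<exists>q f. poly q x \<noteq> 0 \<and> (\<forall>y. poly q y \<noteq> 0 --> h y = poly f y / poly q y)"
  shows "\<exists>R. \<forall>y. h y = poly R y"
proof -
  have *: "\<exists>R. \<forall>y. h y = poly R y"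
    if "q0 \<noteq> 0" "\<forall>y. poly q0 y \<noteq> 0 --> h y = poly f0 y / poly q0 y" for q0 f0
    using that
  proof (induction "degree q0" arbitrary: q0 f0 rule: less_induct)
    case less
    show ?case
    proof (cases "\<exists>r. poly q0 r = 0")
      case False
      have "degree q0 = 0"
        using fundamental_theorem_of_algebra[of q0] constant_degree[of q0] False by blast
      then obtain c where c: "q0 = [:c:]" by (metis degree_eq_zeroE)
      then have "c \<noteq> 0" using less.prems(1) by auto
      then have "\<forall>y. h y = poly (Polynomial.smult (inverse c) f0) y"
        using less.prems(2) by (simp add: c divide_inverse mult.commute)
      then show ?thesis by blast
    next
      case True
      then obtain r where r: "poly q0 r = 0" by blast
      obtain q f where q: "poly q r \<noteq> 0" "\<forall>y. poly q y \<noteq> 0 --> h y = poly f y / poly q y"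
        using assms by blast
      have "poly (q * q0 * (f0 * q - f * q0)) y = 0" for y
        using less.prems(2)[rule_format, of y] q(2)[rule_format, of y]
        by (cases "poly q y = 0"; cases "poly q0 y = 0") (auto simp: field_simps)
      then have "q * q0 * (f0 * q - f * q0) = 0" by (simp add: poly_eq_poly_eq_iff[symmetric] fun_eq_iff)
      moreover have "q \<noteq> 0" using q(1) by auto
      ultimately have eq: "f0 * q = f * q0" using less.prems(1) by simp
      then have "poly f0 r * poly q r = 0" using r by (metis mult_zero_right poly_mult)
      then have "poly f0 r = 0" using q(1) by simp
      then obtain f1 where f1: "f0 = [:- r, 1:] * f1" by (metis dvdE poly_eq_0_iff_dvd)
      obtain q1 where q1: "q0 = [:- r, 1:] * q1" using r by (metis dvdE poly_eq_0_iff_dvd)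
      have q1n: "q1 \<noteq> 0" using q1 less.prems(1) by auto
      have "degree q0 = degree [:- r, 1:] + degree q1"
        unfolding q1 by (rule degree_mult_eq) (use q1n in auto)
      then have "degree q1 < degree q0" by simp
      moreover have "\<forall>y. poly q1 y \<noteq> 0 --> h y = poly f1 y / poly q1 y"
      proof (intro allI impI)
        fix y assume y: "poly q1 y \<noteq> 0"
        show "h y = poly f1 y / poly q1 y"
        proof (cases "y = r")
          case True
          have "[:- r, 1:] * (f1 * q) = [:- r, 1:] * (f * q1)"
            using eq unfolding f1 q1 by (simp add: algebra_simps)
          moreover have "[:- r, 1:] \<noteq> 0" by simp
          ultimately have "f1 * q = f * q1" using mult_left_cancel by blast
          then have "poly f1 r * poly q r = poly f r * poly q1 r" by (metis poly_mult)
          moreover have "h r = poly f r / poly q r" using q by blast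
          ultimately show ?thesis using q(1) True y by (simp add: frac_eq_eq)
        next
          case False
          have e: "poly q0 y = (y - r) * poly q1 y" "poly f0 y = (y - r) * poly f1 y"
            by (simp_all add: q1 f1 algebra_simps)
          have "h y = poly f0 y / poly q0 y" using less.prems(2) e(1) y False by simp
          then show ?thesis unfolding e using False by simp
        qed
      qed
      ultimately show ?thesis using less.hyps[of q1 f1] q1n by blast
    qed
  qed
  obtain q f where "poly q 0 \<noteq> 0" "\<forall>y. poly q y \<noteq> 0 --> h y = poly f y / poly q y"
    using assms by blast
  then show ?thesis using *[of q f] by force
qed

lemma poly_eq_cofinite:
  fixes P Q :: "complex poly"
  assumes "\<And>x. x \<noteq> 0 ==> poly P x = poly Q x"
  shows "P = Q"
proof -
  have "poly ([:0, 1:] * (P - Q)) x = 0" for x by (cases "x = 0") (auto simp: assms)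
  then have "[:0, 1:] * (P - Q) = 0" by (simp add: poly_eq_poly_eq_iff[symmetric] fun_eq_iff)
  moreover have "[:0, 1:] \<noteq> (0 :: complex poly)" by simp
  ultimately have "P - Q = 0" using mult_eq_0_iff by blast
  then show ?thesis by simp
qed

definition line :: "('x => complex) => ('x => complex) => complex => 'x => complex" where
  "line u w x = (\<lambda>i. u i + x * w i)"

lemma peval_line: "\<exists>P. \<forall>x. peval p (line u w x) = poly P x"
proof (induction p rule: cpoly_induct)
  case (mon m c)
  have "peval (mon m c) (line u w x) =
      poly ([:c:] * (\<Prod>i\<in>supp m. [:u i, w i:] ^ expo m i)) x" for x
    by (simp add: meval_def line_def poly_prod mult.commute)
  then show ?case by blast
next
  case (add p q)
  then obtain P Q where "\<forall>x. peval p (line u w x) = poly P x" "\<forall>x. peval q (line u w x) = poly Q x"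
    by blast
  then have "\<forall>x. peval (p + q) (line u w x) = poly (P + Q) x" by simp
  then show ?case by blast
qed

abbreviation whole :: "pt set" where "whole \<equiv> proj_space UNIV"

lemma openin_whole [simp]: "openin P3 whole"
  using openin_topspace[of P3] by simp

lemma cone_whole: "v \<in> \<Union>whole \<longleftrightarrow> nz v"
  using cone_P3[OF openin_whole] proj_pt_in_space by blast

lemma section_line_poly:
  assumes "s \<in> twist n whole" "\<And>x. nz (line u w x)"
  shows "\<exists>R. \<forall>x. s (line u w x) = poly R x"
proof (rule locally_rational_imp_poly)
  fix x
  have "line u w x \<in> \<Union>whole" using assms(2) cone_whole by blast
  then obtain k q f where lf: "local_form n (\<Union>whole) s (line u w x) k q f"
    by (rule twist_local[OF openin_whole assms(1)])
  obtain Q where Q: "\<forall>x. peval q (line u w x) = poly Q x" using peval_line by blast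
  obtain F where F: "\<forall>x. peval f (line u w x) = poly F x" using peval_line by blast
  show "\<exists>q f. poly q x \<noteq> 0 \<and> (\<forall>y. poly q y \<noteq> 0 --> s (line u w y) = poly f y / poly q y)"
    using lf Q F assms(2) unfolding local_form_def by (intro exI[of _ Q] exI[of _ F]) auto
qed

lemma twist_homogeneous:
  assumes "openin P3 U" "s \<in> twist n U" "c \<noteq> 0"
  shows "s (\<lambda>i. c * v i) = c powi n * s v"
proof (cases "v \<in> \<Union>U")
  case True
  then obtain k q f where "local_form n (\<Union>U) s v k q f" by (rule twist_local[OF assms(1,2)])
  then have lf: "homog k q" "homog (k + n) f" "peval q v \<noteq> 0"
    "\<And>u. nz u ==> peval q u \<noteq> 0 ==> s u = peval f u / peval q u"
    by (auto simp: local_form_def)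
  have nz: "nz v" "nz (\<lambda>i. c * v i)"
    using cone_P3_nz[OF assms(1) True] nz_scale[OF assms(3)] by auto
  have "q \<noteq> 0" using lf(3) by auto
  then have k: "k \<ge> 0" using homog_neg[OF lf(1)] by force
  have "s (\<lambda>i. c * v i) = (c ^ nat (k + n) * peval f v) / (c ^ nat k * peval q v)"
    using lf(4)[OF nz(2)] lf(3) assms(3)
    by (simp add: peval_homog_scale[OF lf(1)] peval_homog_scale[OF lf(2)])
  also have "\<dots> = c powi n * (peval f v / peval q v)"
  proof (cases "f = 0")
    case False
    then have "k + n \<ge> 0" using homog_neg[OF lf(2)] by force
    then have "c powi n = c ^ nat (k + n) / c ^ nat k"
      using power_int_diff[of c "k + n" k] assms(3) k by (simp add: power_int_def)
    then show ?thesis by simp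
  qed simp
  finally show ?thesis using lf(4)[OF nz(1) lf(3)] by simp
next
  case False
  then have "(\<lambda>i. c * v i) \<notin> \<Union>U" using cone_scale[OF assms(1,3)] by blast
  then show ?thesis using twist_zero_outside[OF assms(2)] False by simp
qed

text \<open>Exchanging \<open>u\<close> and \<open>w\<close> describes the section near the point at
  infinity of the line. Homogeneity gives \<open>R x = x powi n * T (1 / x)\<close> with a
  polynomial \<open>T\<close>, which bounds the degree.\<close>

lemma section_line_degree:
  assumes s: "s \<in> twist n whole"
    and uw: "\<And>x. nz (line u w x)" "\<And>x. nz (line w u x)"
    and R: "\<forall>x. s (line u w x) = poly R x" "R \<noteq> 0"
  shows "int (degree R) \<le> n"
proof -
  obtain T where T: "\<forall>x. s (line w u x) = poly T x"
    using section_line_poly[OF s uw(2)] by blast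
  \<comment> \<open>The positive and the negative part of \<open>n\<close>, so that the comparison
    becomes an identity of polynomials.\<close>
  define a b where "a = nat n" and "b = nat (- n)"
  have eq: "poly (monom 1 (degree T + b) * R) x = poly (monom 1 a * reflect_poly T) x"
    if x: "x \<noteq> 0" for x
  proof -
    have "line u w x = (\<lambda>i. x * line w u (inverse x) i)"
      using x by (auto simp: line_def fun_eq_iff algebra_simps)
    then have "poly R x = x powi n * poly T (inverse x)"
      using R(1) T twist_homogeneous[OF openin_whole s x] by metis
    moreover have "x ^ b * x powi n = x ^ a"
      using x by (auto simp: a_def b_def power_int_def field_simps)
    ultimately show ?thesis
      using x by (simp add: poly_monom poly_reflect_poly_nz power_add algebra_simps)
  qed
  have "monom 1 (degree T + b) * R = monom 1 a * reflect_poly T"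
    by (rule poly_eq_cofinite) (rule eq)
  then have "degree T + b + degree R = degree (monom 1 a * reflect_poly T)"
    using R(2) by (metis degree_monom_eq degree_mult_eq monom_eq_0_iff one_neq_zero)
  also have "\<dots> \<le> a + degree T"
    using degree_mult_le[of "monom 1 a" "reflect_poly T"] degree_reflect_poly_le[of T]
      degree_monom_le[of "1::complex" a] by linarith
  finally show ?thesis by (simp add: a_def b_def split: if_splits)
qed

definition lagr :: "nat => nat => complex => complex" where
  "lagr n j x = (\<Prod>l\<in>{..n} - {j}. (x - of_nat l) / (of_nat j - of_nat l))"

lemma lagrange_interpolation:
  fixes R :: "complex poly"
  assumes "degree R \<le> n"
  shows "poly R x = (\<Sum>j\<le>n. lagr n j x * poly R (of_nat j))"
proof -
  define Lp :: "nat => complex poly" where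
    "Lp j = (\<Prod>l\<in>{..n} - {j}. Polynomial.smult (inverse (of_nat j - of_nat l)) [:- of_nat l, 1:])" for j
  have Lp: "poly (Lp j) x = lagr n j x" for j x
    by (simp add: Lp_def lagr_def poly_prod divide_inverse algebra_simps)
  define T where "T = (\<Sum>j\<le>n. Polynomial.smult (poly R (of_nat j)) (Lp j))"
  have dL: "degree (Lp j) \<le> n" if "j \<le> n" for j
  proof -
    have "degree (Lp j) \<le> (\<Sum>l\<in>{..n} - {j}. 1)"
      unfolding Lp_def by (rule order.trans[OF degree_prod_sum_le sum_mono]) auto
    then show ?thesis using that by simp
  qed
  have T: "degree T \<le> n"
    unfolding T_def by (rule degree_sum_le) (auto simp: dL)
  have lij: "lagr n j (of_nat i) = (if i = j then 1 else 0)" if "i \<le> n" "j \<le> n" for i j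
  proof (cases "i = j")
    case True
    then show ?thesis by (auto simp: lagr_def intro!: prod.neutral)
  next
    case False
    then show ?thesis using that by (auto simp: lagr_def intro!: prod_zero bexI[of _ i])
  qed
  have "R = T"
  proof (rule poly_eqI_degree[of "of_nat ` {..n}"])
    fix x :: complex assume "x \<in> of_nat ` {..n}"
    then obtain i where i: "i \<le> n" "x = of_nat i" by auto
    have "poly T x = (\<Sum>j\<le>n. if j = i then poly R (of_nat j) else 0)"
      unfolding T_def poly_sum
      by (rule sum.cong) (use i lij in \<open>auto simp: Lp\<close>)
    then show "poly R x = poly T x" using i by simp
  next
    have "card (of_nat ` {..n} :: complex set) = Suc n"
      by (subst card_image) (auto simp: inj_on_def)
    then show "degree R < card (of_nat ` {..n} :: complex set)"
      "degree T < card (of_nat ` {..n} :: complex set)" using assms T by auto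
  qed
  then have "poly R x = poly T x" by simp
  also have "\<dots> = (\<Sum>j\<le>n. lagr n j x * poly R (of_nat j))"
    by (simp add: T_def poly_sum Lp mult.commute)
  finally show ?thesis .
qed

lemma line_fun_upd: "line (v(i := 0)) ((\<lambda>_. 0)(i := 1)) x = v(i := x)"
  by (auto simp: line_def fun_eq_iff)

lemma peval_of_nat [simp]: "peval (of_nat n) v = of_nat n"
  by (induction n) auto

text \<open>Moving the coordinate \<open>i\<close> traces a line that avoids the origin because
  \<open>v k \<noteq> 0\<close>. Along it the section is a polynomial of degree at most
  \<open>n\<close>, hence determined by its values at \<open>0, ..., n\<close>.\<close>

lemma section_interpolate:
  assumes s: "s \<in> twist (int n) whole" and k: "v k \<noteq> 0" "i \<noteq> k"
  shows "s v = (\<Sum>j\<le>n. lagr n j (v i) * s (v(i := of_nat j)))"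
proof -
  let ?u = "v(i := 0)" and ?w = "(\<lambda>_. 0)(i := 1) :: 4 => complex"
  have nz1: "nz (line ?u ?w x)" for x
    unfolding line_fun_upd nz_def using k by (intro exI[of _ k]) auto
  have nz2: "nz (line ?w ?u x)" for x
    unfolding line_def nz_def by (intro exI[of _ i]) auto
  obtain R where R: "\<forall>x. s (line ?u ?w x) = poly R x"
    using section_line_poly[OF s nz1] by blast
  have "degree R \<le> n"
    using section_line_degree[OF s nz1 nz2 R] by (cases "R = 0") auto
  note li = lagrange_interpolation[OF this, of "v i"]
  have "s (v(i := x)) = poly R x" for x
    using R unfolding line_fun_upd by simp
  from this[of "v i"] this show ?thesis using li by simp
qed

text \<open>The polynomial \<open>lagr n j\<close> in the quotient of the variables \<open>i\<close>
  and \<open>k\<close>, made homogeneous with powers of variable \<open>k\<close>.\<close>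

definition hlagr :: "4 => nat => nat => 4 => form" where
  "hlagr k n j i = (\<Prod>l\<in>{..n} - {j}. mon 0 (1 / (of_nat j - of_nat l)) *
     (xp i 1 - mon 0 (of_nat l) * xp k 1))"

lemma homog_hlagr:
  assumes "j \<le> n"
  shows "homog (int n) (hlagr k n j i)"
proof -
  have "homog (\<Sum>l\<in>{..n} - {j}. 1) (hlagr k n j i)"
    unfolding hlagr_def
  proof (rule homog_prod)
    fix l
    have "homog 1 (xp i 1)" "homog 1 (xp k 1)" using homog_xp[of 1] by auto
    then show "homog 1 (mon 0 (1 / (of_nat j - of_nat l)) * (xp i 1 - mon 0 (of_nat l) * xp k 1))"
      by (intro homog_mult'[of 0 _ 1] homog_diff homog_mon) (auto intro: homog_mult'[of 0 _ 1] homog_mon)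
  qed
  then show ?thesis using assms by simp
qed

lemma peval_hlagr:
  assumes "j \<le> n" "v k \<noteq> 0"
  shows "peval (hlagr k n j i) v = v k ^ n * lagr n j (v i / v k)"
proof -
  have "v k ^ n = (\<Prod>l\<in>{..n} - {j}. v k)" using assms by simp
  moreover have "v k * ((v i / v k - c) / e) = (v i - c * v k) / e" for c e
    using assms(2) by (simp add: right_diff_distrib mult.commute)
  ultimately show ?thesis
    unfolding hlagr_def lagr_def peval_prod
    by (simp only: prod.distrib[symmetric], intro prod.cong refl) simp
qed

lemma UNIV_4: "(UNIV :: 4 set) = {0, 1, 2, 3}"
proof -
  have "card {0, 1, 2, 3 :: 4} = 4" by simp
  then have "{0, 1, 2, 3 :: 4} = UNIV" by (intro card_subset_eq) auto
  then show ?thesis by simp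
qed

text \<open>Interpolation in the three coordinates other than \<open>k\<close> writes
  \<open>s\<close> on the chart as a polynomial with finitely many values of \<open>s\<close> as
  coefficients. Each coordinate contributes degree \<open>n\<close>, which gives
  \<open>3 * n\<close> in total and, after homogenising, the factor
  \<open>v k ^ (2 * n)\<close>.\<close>

lemma chart_form:
  assumes s: "s \<in> twist (int n) whole" and k: "UNIV = {k, i1, i2, i3}" "distinct [k, i1, i2, i3]"
  shows "\<exists>Q. homog (int (3 * n)) Q \<and> (\<forall>v. v k \<noteq> 0 --> v k ^ (2 * n) * s v = peval Q v)"
proof -
  define pt where "pt j1 j2 j3 = ((\<lambda>_. 1)(i1 := of_nat j1, i2 := of_nat j2, i3 := of_nat j3) :: 4 => complex)"
    for j1 j2 j3 :: nat
  define Q where "Q = (\<Sum>j1\<le>n. \<Sum>j2\<le>n. \<Sum>j3\<le>n. mon 0 (s (pt j1 j2 j3)) *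
     (hlagr k n j1 i1 * (hlagr k n j2 i2 * hlagr k n j3 i3)))"
  have "homog (int (3 * n)) Q"
    unfolding Q_def
    by (intro homog_sum homog_mult'[of 0 _ "int (3 * n)"] homog_mult'[of "int n" _ "int (2 * n)"]
        homog_mult'[of "int n" _ "int n"] homog_hlagr homog_mon) auto
  moreover have "v k ^ (2 * n) * s v = peval Q v" if v: "v k \<noteq> 0" for v
  proof -
    define w where "w = (\<lambda>i. inverse (v k) * v i)"
    have wk: "w k = 1" using v by (simp add: w_def)
    have ptw: "w(i1 := of_nat j1, i2 := of_nat j2, i3 := of_nat j3) = pt j1 j2 j3" for j1 j2 j3 :: nat
    proof
      fix i :: 4
      have "i \<in> {k, i1, i2, i3}" using k(1) by blast
      then show "(w(i1 := of_nat j1, i2 := of_nat j2, i3 := of_nat j3)) i = pt j1 j2 j3 i"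
        using k(2) wk by (auto simp: pt_def)
    qed
    have d: "i1 \<noteq> k" "i2 \<noteq> k" "i3 \<noteq> k" "i2 \<noteq> i1" "i3 \<noteq> i1" "i3 \<noteq> i2"
      using k(2) by auto
    have e2: "s (w(i1 := of_nat j)) =
        (\<Sum>j2\<le>n. lagr n j2 (w i2) * s (w(i1 := of_nat j, i2 := of_nat j2)))" for j
      using section_interpolate[OF s, of "w(i1 := of_nat j)" k i2] d wk by simp
    have e3: "s (w(i1 := of_nat j, i2 := of_nat j')) =
        (\<Sum>j3\<le>n. lagr n j3 (w i3) * s (pt j j' j3))" for j j'
      using section_interpolate[OF s, of "w(i1 := of_nat j, i2 := of_nat j')" k i3] d wk
      by (simp add: ptw)
    have "s w = (\<Sum>j1\<le>n. lagr n j1 (w i1) * s (w(i1 := of_nat j1)))"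
      by (rule section_interpolate[OF s, of w k]) (use d wk in auto)
    also have "\<dots> = (\<Sum>j1\<le>n. lagr n j1 (w i1) *
        (\<Sum>j2\<le>n. lagr n j2 (w i2) * s (w(i1 := of_nat j1, i2 := of_nat j2))))"
      by (simp only: e2)
    also have "\<dots> = (\<Sum>j1\<le>n. lagr n j1 (w i1) * (\<Sum>j2\<le>n. lagr n j2 (w i2) *
        (\<Sum>j3\<le>n. lagr n j3 (w i3) * s (pt j1 j2 j3))))"
      by (simp only: e3)
    finally have sw: "s w = (\<Sum>j1\<le>n. \<Sum>j2\<le>n. \<Sum>j3\<le>n.
        lagr n j1 (w i1) * (lagr n j2 (w i2) * (lagr n j3 (w i3) * s (pt j1 j2 j3))))"
      by (simp add: sum_distrib_left)
    have "peval Q v = (\<Sum>j1\<le>n. \<Sum>j2\<le>n. \<Sum>j3\<le>n. v k ^ (3 * n) *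
        (lagr n j1 (w i1) * (lagr n j2 (w i2) * (lagr n j3 (w i3) * s (pt j1 j2 j3)))))"
      unfolding Q_def peval_sum
      by (intro sum.cong refl)
        (use v in \<open>simp add: peval_hlagr w_def divide_inverse mult.commute mult.left_commute
          power_mult power3_eq_cube numeral_3_eq_3 power_add\<close>)
    also have "\<dots> = v k ^ (3 * n) * s w"
      by (simp add: sw sum_distrib_left)
    also have "v k ^ (3 * n) = v k ^ (2 * n) * v k ^ n" by (simp flip: power_add)
    also have "v k ^ (2 * n) * v k ^ n * s w = v k ^ (2 * n) * s (\<lambda>i. v k * w i)"
      using twist_homogeneous[OF openin_whole s v, of w] by (simp add: mult.assoc)
    also have "(\<lambda>i. v k * w i) = v" using v by (simp add: w_def mult.assoc[symmetric])
    finally show ?thesis by simp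
  qed
  ultimately show ?thesis by blast
qed

text \<open>Comparing the charts \<open>0\<close> and \<open>1\<close> gives
  \<open>xp 1 (2 * m) * Q0 = xp 0 (2 * m) * Q1\<close>, so coprimality makes the denominator of the
  first representation cancel. In negative degree the section is zero along suitable lines through
  each point.\<close>

theorem global_sections:
  assumes s: "s \<in> twist n whole"
  shows "\<exists>f. homog n f \<and> (\<forall>v. nz v --> s v = peval f v)"
proof (cases "n < 0")
  case True
  have "s v = 0" if v: "nz v" for v
  proof -
    obtain i where i: "v i \<noteq> 0" using v by (auto simp: nz_def)
    obtain k where k: "k \<noteq> i" by (metis zero_neq_one)
    define w :: "4 => complex" where "w = (\<lambda>_. 0)(k := 1)"
    have nz1: "nz (line v w x)" for x
      unfolding nz_def line_def using i k by (intro exI[of _ i]) (auto simp: w_def)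
    have nz2: "nz (line w v x)" for x
    proof (cases "x = 0")
      case True
      then show ?thesis by (auto simp: nz_def line_def w_def)
    next
      case False
      then show ?thesis using i k by (auto simp: nz_def line_def w_def intro!: exI[of _ i])
    qed
    obtain R where R: "\<forall>x. s (line v w x) = poly R x"
      using section_line_poly[OF s nz1] by blast
    have "R = 0" using section_line_degree[OF s nz1 nz2 R] True by force
    then have "s (line v w 0) = 0" using R by simp
    then show ?thesis by (simp add: line_def)
  qed
  then show ?thesis by (intro exI[of _ 0]) simp
next
  case False
  define m where "m = nat n"
  have n: "n = int m" using False by (simp add: m_def)
  note s' = s[unfolded n]
  obtain Q0 where Q0: "homog (int (3 * m)) Q0" "\<forall>v. v 0 \<noteq> 0 --> v 0 ^ (2 * m) * s v = peval Q0 v"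
    using chart_form[OF s', of 0 1 2 3] UNIV_4 by auto
  obtain Q1 where Q1: "\<forall>v. v 1 \<noteq> 0 --> v 1 ^ (2 * m) * s v = peval Q1 v"
    using chart_form[OF s', of 1 0 2 3] UNIV_4 by (auto simp: insert_commute)
  have "xp 1 (2 * m) * Q0 = xp 0 (2 * m) * Q1"
  proof (rule peval_eq_on_dense[of "xp 0 1 * xp 1 1"])
    fix v :: "4 => complex" assume "peval (xp 0 1 * xp 1 1) v \<noteq> 0"
    then have "v 0 \<noteq> 0" "v 1 \<noteq> 0" by auto
    then show "peval (xp 1 (2 * m) * Q0) v = peval (xp 0 (2 * m) * Q1) v"
      using Q0(2) Q1 by (simp flip: Q0(2) Q1)
  qed simp
  then obtain f where f: "Q0 = xp 0 (2 * m) * f"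
    by (rule xp_dvd_cancel) (simp, blast)
  have "homog n f"
    using Q0(1) homog_xp_mult_iff[of n "2 * m" 0 f] by (simp add: f n algebra_simps)
  have f0: "s v = peval f v" if "v 0 \<noteq> 0" for v
    using Q0(2) that by (simp add: f)
  have "s v = peval f v" if v: "nz v" for v
  proof (cases "v 0 = 0")
    case True
    then obtain i where i: "v i \<noteq> 0" "i \<noteq> 0" using v unfolding nz_def by metis
    \<comment> \<open>The line through \<open>v\<close> in the direction of this axis meets the
      hyperplane of variable \<open>0\<close> only in \<open>v\<close>. The two polynomials along
      the line agree at all its other points, hence at \<open>v\<close> as well.\<close>
    define w :: "4 => complex" where "w = (\<lambda>_. 0)(0 := 1)"
    have nz1: "nz (line v w x)" for x
      unfolding nz_def line_def using i by (intro exI[of _ i]) (auto simp: w_def)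
    obtain R where R: "\<forall>x. s (line v w x) = poly R x"
      using section_line_poly[OF s nz1] by blast
    obtain P where P: "\<forall>x. peval f (line v w x) = poly P x" using peval_line by blast
    have "poly R x = poly P x" if "x \<noteq> 0" for x
      using f0[of "line v w x"] R P True that by (simp add: line_def w_def)
    then have "R = P" by (rule poly_eq_cofinite)
    then have "s (line v w 0) = peval f (line v w 0)" using R P by simp
    then show ?thesis by (simp add: line_def)
  qed (rule f0)
  with \<open>homog n f\<close> show ?thesis by blast
qed

lemma peval_eq_nz:
  fixes p q :: form
  assumes "\<And>v. nz v ==> peval p v = peval q v"
  shows "p = q"
  by (rule peval_eq_on_dense[of "xp 0 1"]) (auto intro!: assms simp: nz_def)

section \<open>Morphisms between sums of twisting sheaves\<close>

text \<open>Counts indices, not vectors: the independence hypothesis, stated for coefficients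
  indexed by \<open>X\<close>, makes \<open>e\<close> injective on \<open>X\<close>.\<close>

lemma (in vector_space) dim_family:
  assumes "finite X" "\<And>x. x \<in> X ==> e x \<in> V"
    and indep: "\<And>c. (\<Sum>x\<in>X. scale (c x) (e x)) = 0 ==> \<forall>x\<in>X. c x = 0"
    and span: "\<And>v. v \<in> V ==> \<exists>c. v = (\<Sum>x\<in>X. scale (c x) (e x))"
  shows "dim V = card X"
proof -
  have inj: "inj_on e X"
  proof (rule inj_onI, rule ccontr)
    fix x y assume xy: "x \<in> X" "y \<in> X" "e x = e y" "x \<noteq> y"
    define c :: "'c => 'a" where "c = (\<lambda>z. if z = x then 1 else if z = y then - 1 else 0)"
    have "(\<Sum>z\<in>X. scale (c z) (e z)) = (\<Sum>z\<in>{x, y}. scale (c z) (e z))"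
      by (rule sum.mono_neutral_right) (use assms(1) xy in \<open>auto simp: c_def\<close>)
    also have "\<dots> = 0" using xy by (simp add: c_def)
    finally have "c x = 0" using indep xy(1) by blast
    then show False by (simp add: c_def)
  qed
  have "independent (e ` X)"
    unfolding independent_explicit_finite_subsets
  proof (intro allI impI ballI)
    fix A u b assume A: "A \<subseteq> e ` X" "finite A" "(\<Sum>v\<in>A. scale (u v) v) = 0" "b \<in> A"
    define c where "c = (\<lambda>x. if e x \<in> A then u (e x) else 0)"
    have "(\<Sum>x\<in>X. scale (c x) (e x)) = (\<Sum>v\<in>e ` X. scale (if v \<in> A then u v else 0) v)"
      by (simp add: sum.reindex[OF inj] c_def)
    also have "\<dots> = (\<Sum>v\<in>A. scale (u v) v)"
      by (rule sum.mono_neutral_cong_right) (use A assms(1) in auto)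
    finally have "\<forall>x\<in>X. c x = 0" using A(3) indep by simp
    moreover obtain x where "x \<in> X" "e x = b" using A(1,4) by blast
    ultimately show "u b = 0" using A(4) unfolding c_def by force
  qed
  moreover have "V \<subseteq> span (e ` X)"
  proof
    fix v assume "v \<in> V"
    then obtain c where "v = (\<Sum>x\<in>X. scale (c x) (e x))" using span by blast
    then show "v \<in> span (e ` X)" by (simp only:) (intro span_sum span_scale span_base, blast)
  qed
  moreover have "card (e ` X) = card X" by (rule card_image[OF inj])
  ultimately show ?thesis using assms(2) by (intro dim_unique[of "e ` X"]) auto
qed

lemma sum_apply: "(\<Sum>x\<in>A. F x) i = (\<Sum>x\<in>A. F x i)"
  by (induction A rule: infinite_finite_induct) auto

subsection \<open>Counting monomials\<close>

text \<open>Equals \<open>h^0\<close> of the sheaf \<open>O(k)\<close> on projective three-space, by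
  \<open>global_sections\<close> and \<open>dim_homog\<close>.\<close>

definition h0 :: "int => nat" where
  "h0 k = card {m :: 4 \<Rightarrow>\<^sub>0 nat. int (mono_deg m) = k}"

lemma mono_deg_4: "mono_deg (m :: 4 \<Rightarrow>\<^sub>0 nat) = expo m 0 + expo m 1 + expo m 2 + expo m 3"
  unfolding mono_deg_UNIV UNIV_4 by simp

lemma monomials_bij:
  "bij_betw (\<lambda>m :: 4 \<Rightarrow>\<^sub>0 nat. [expo m 0, expo m 1, expo m 2, expo m 3])
     {m. mono_deg m = N} {l. length l = 4 \<and> sum_list l = N}"
proof (rule bij_betw_byWitness[where f' = "\<lambda>l. Poly_Mapping.single 0 (l ! 0) + Poly_Mapping.single 1 (l ! 1)
      + Poly_Mapping.single 2 (l ! 2) + Poly_Mapping.single 3 (l ! 3)"])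
  show "\<forall>m\<in>{m :: 4 \<Rightarrow>\<^sub>0 nat. mono_deg m = N}.
      Poly_Mapping.single 0 ([expo m 0, expo m 1, expo m 2, expo m 3] ! 0) +
      Poly_Mapping.single 1 ([expo m 0, expo m 1, expo m 2, expo m 3] ! 1) +
      Poly_Mapping.single 2 ([expo m 0, expo m 1, expo m 2, expo m 3] ! 2) +
      Poly_Mapping.single 3 ([expo m 0, expo m 1, expo m 2, expo m 3] ! 3) = m"
  proof (intro ballI poly_mapping_eqI)
    fix m :: "4 \<Rightarrow>\<^sub>0 nat" and i :: 4
    consider "i = 0" | "i = 1" | "i = 2" | "i = 3" using UNIV_4 by blast
    then show "expo (Poly_Mapping.single 0 ([expo m 0, expo m 1, expo m 2, expo m 3] ! 0) +
        Poly_Mapping.single 1 ([expo m 0, expo m 1, expo m 2, expo m 3] ! 1) +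
        Poly_Mapping.single 2 ([expo m 0, expo m 1, expo m 2, expo m 3] ! 2) +
        Poly_Mapping.single 3 ([expo m 0, expo m 1, expo m 2, expo m 3] ! 3)) i = expo m i"
      by cases (simp_all add: lookup_add lookup_single)
  qed
  show "\<forall>l\<in>{l. length l = 4 \<and> sum_list l = N}.
      [expo (Poly_Mapping.single 0 (l ! 0) + Poly_Mapping.single 1 (l ! 1) +
        Poly_Mapping.single 2 (l ! 2) + Poly_Mapping.single (3 :: 4) (l ! 3)) 0,
       expo (Poly_Mapping.single 0 (l ! 0) + Poly_Mapping.single 1 (l ! 1) +
        Poly_Mapping.single 2 (l ! 2) + Poly_Mapping.single (3 :: 4) (l ! 3)) 1,
       expo (Poly_Mapping.single 0 (l ! 0) + Poly_Mapping.single 1 (l ! 1) +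
        Poly_Mapping.single 2 (l ! 2) + Poly_Mapping.single (3 :: 4) (l ! 3)) 2,
       expo (Poly_Mapping.single 0 (l ! 0) + Poly_Mapping.single 1 (l ! 1) +
        Poly_Mapping.single 2 (l ! 2) + Poly_Mapping.single (3 :: 4) (l ! 3)) 3] = l"
    by (auto simp: lookup_add lookup_single length_Suc_conv numeral_eq_Suc)
  show "(\<lambda>m :: 4 \<Rightarrow>\<^sub>0 nat. [expo m 0, expo m 1, expo m 2, expo m 3]) ` {m. mono_deg m = N}
      \<subseteq> {l. length l = 4 \<and> sum_list l = N}"
    by (auto simp: mono_deg_4)
  show "(\<lambda>l. Poly_Mapping.single 0 (l ! 0) + Poly_Mapping.single 1 (l ! 1)
      + Poly_Mapping.single 2 (l ! 2) + Poly_Mapping.single 3 (l ! 3)) `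
      {l. length l = 4 \<and> sum_list l = N} \<subseteq> {m :: 4 \<Rightarrow>\<^sub>0 nat. mono_deg m = N}"
    by (auto simp: length_Suc_conv numeral_eq_Suc)
qed

lemma finite_monomials [simp]: "finite {m :: 4 \<Rightarrow>\<^sub>0 nat. mono_deg m = N}"
proof -
  have "{l :: nat list. length l = 4 \<and> sum_list l = N} \<subseteq> {l. set l \<subseteq> {..N} \<and> length l = 4}"
    by (auto intro: member_le_sum_list)
  then have "finite {l :: nat list. length l = 4 \<and> sum_list l = N}"
    using finite_lists_length_eq[of "{..N}" 4] finite_subset by blast
  then show ?thesis using bij_betw_finite[OF monomials_bij] by blast
qed

lemma finite_monomials_int [simp]: "finite {m :: 4 \<Rightarrow>\<^sub>0 nat. int (mono_deg m) = k}"
proof -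
  have "{m :: 4 \<Rightarrow>\<^sub>0 nat. int (mono_deg m) = k} \<subseteq> {m. mono_deg m = nat k}" by auto
  then show ?thesis using finite_monomials finite_subset by blast
qed

lemma h0_eq: "h0 k = (if k < 0 then 0 else (nat k + 3) choose 3)"
proof (cases "k < 0")
  case True
  then have "{m :: 4 \<Rightarrow>\<^sub>0 nat. int (mono_deg m) = k} = {}" by auto
  then show ?thesis using True by (simp add: h0_def)
next
  case False
  then have "{m :: 4 \<Rightarrow>\<^sub>0 nat. int (mono_deg m) = k} = {m. mono_deg m = nat k}" by auto
  then have "h0 k = card {l :: nat list. length l = 4 \<and> sum_list l = nat k}"
    using bij_betw_same_card[OF monomials_bij[of "nat k"]] by (simp add: h0_def)
  also have "\<dots> = (nat k + 4 - 1) choose (nat k)"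
    by (rule card_length_sum_list)
  also have "\<dots> = (nat k + 3) choose 3"
    using binomial_symmetric[of 3 "nat k + 3"] by (simp add: add.commute)
  finally show ?thesis using False by simp
qed

interpretation fvs: vector_space scale_form
  by (rule vector_space_form)

lemma homog_expand:
  fixes p :: form
  assumes "homog k p"
  shows "p = (\<Sum>m | int (mono_deg m) = k. scale_form (coef p m) (mon m 1))"
proof (rule poly_mapping_eqI)
  fix m
  have "coef (\<Sum>m | int (mono_deg m) = k. scale_form (coef p m) (mon m 1)) m =
      (\<Sum>m' | int (mono_deg m') = k. if m' = m then coef p m else 0)"
    unfolding lookup_sum by (rule sum.cong) (auto simp: lookup_scale_form lookup_single when_def)
  then show "coef p m = coef (\<Sum>m | int (mono_deg m) = k. scale_form (coef p m) (mon m 1)) m"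
    using homogD[OF assms, of m] by auto
qed

lemma dim_homog: "fvs.dim {F :: form. homog k F} = h0 k"
  unfolding h0_def
proof (rule fvs.dim_family[where e = "\<lambda>m. mon m 1"])
  fix c :: "(4 \<Rightarrow>\<^sub>0 nat) => complex"
  assume 0: "(\<Sum>m | int (mono_deg m) = k. scale_form (c m) (mon m 1)) = 0"
  have "c m = 0" if m: "int (mono_deg m) = k" for m
  proof -
    have "coef (\<Sum>m | int (mono_deg m) = k. scale_form (c m) (mon m 1)) m =
        (\<Sum>m' | int (mono_deg m') = k. if m' = m then c m else 0)"
      unfolding lookup_sum by (rule sum.cong) (auto simp: lookup_scale_form lookup_single when_def)
    then show ?thesis using 0 m by simp
  qed
  then show "\<forall>m\<in>{m. int (mono_deg m) = k}. c m = 0" by simp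
next
  fix v :: form assume "v \<in> {F. homog k F}"
  then show "\<exists>c. v = (\<Sum>m | int (mono_deg m) = k. scale_form (c m) (mon m 1))"
    using homog_expand[of k v] by blast
qed (auto intro: homog_mon)

subsection \<open>Matrices of forms\<close>

lemma twist_sum_comp: "\<sigma> \<in> twist_sum J n U ==> i \<in> J ==> \<sigma> i \<in> twist (n i) U"
  by (auto simp: twist_sum_def)

lemma twist_sum_other: "\<sigma> \<in> twist_sum J n U ==> i \<notin> J ==> \<sigma> i = 0"
  by (auto simp: twist_sum_def)

lemma twist_sum_outside:
  assumes "\<sigma> \<in> twist_sum J n U" "v \<notin> \<Union>U"
  shows "\<sigma> i v = 0"
  using assms twist_zero_outside[of "\<sigma> i" "n i" U v] by (cases "i \<in> J") (auto simp: twist_sum_def)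

lemma twist_sum_add:
  assumes "openin P3 U" "\<sigma> \<in> twist_sum J n U" "\<tau> \<in> twist_sum J n U"
  shows "\<sigma> + \<tau> \<in> twist_sum J n U"
  using assms by (auto simp: twist_sum_def plus_fun_def intro!: twist_add)

lemma twist_sum_mult:
  assumes "openin P3 U" "f \<in> twist 0 U" "\<sigma> \<in> twist_sum J n U"
  shows "(\<lambda>i v. f v * \<sigma> i v) \<in> twist_sum J n U"
  using assms twist_mult[OF assms(1,2)] by (fastforce simp: twist_sum_def zero_fun_def)

lemma twist_sum_restr:
  assumes "openin P3 U" "openin P3 V" "V \<subseteq> U" "\<sigma> \<in> twist_sum J n U"
  shows "restr V \<sigma> \<in> twist_sum J n V"
  using assms twist_restrict[OF assms(1-3)] by (auto simp: twist_sum_def restr_def zero_fun_def)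

lemma zero_in_twist_sum: "openin P3 U ==> 0 \<in> twist_sum J n U"
  by (auto simp: twist_sum_def zero_fun_def intro: twist_zero)

text \<open>The morphism given by a matrix of forms. It is set to zero outside its domain, as
  \<open>sheaf_hom\<close> demands.\<close>

definition mat_map :: "nat set => (nat => int) => nat set => (nat => nat => form) => sheaf_map" where
  "mat_map J n J' M = (\<lambda>U \<sigma>. if openin P3 U \<and> \<sigma> \<in> twist_sum J n U
     then (\<lambda>i v. if i \<in> J' then \<Sum>j\<in>J. peval (M i j) v * \<sigma> j v else 0) else 0)"

lemma mat_map_apply:
  "openin P3 U ==> \<sigma> \<in> twist_sum J n U ==>
    mat_map J n J' M U \<sigma> i v = (if i \<in> J' then \<Sum>j\<in>J. peval (M i j) v * \<sigma> j v else 0)"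
  by (simp add: mat_map_def)

lemma mat_map_in:
  assumes "openin P3 U" "\<sigma> \<in> twist_sum J n U"
    and M: "\<And>i j. i \<in> J' ==> j \<in> J ==> homog (n' i - n j) (M i j)"
  shows "mat_map J n J' M U \<sigma> \<in> twist_sum J' n' U"
proof -
  have "(\<lambda>v. \<Sum>j\<in>J. peval (M i j) v * \<sigma> j v) \<in> twist (n' i) U" if i: "i \<in> J'" for i
  proof (rule twist_sum_closed[OF assms(1)])
    fix j assume j: "j \<in> J"
    have "(\<lambda>v. (if v \<in> \<Union>U then peval (M i j) v else 0) * \<sigma> j v) \<in> twist (n' i - n j + n j) U"
      by (rule twist_mult[OF assms(1) twist_form[OF assms(1) M[OF i j]] twist_sum_comp[OF assms(2) j]])
    moreover have "(\<lambda>v. (if v \<in> \<Union>U then peval (M i j) v else 0) * \<sigma> j v) = (\<lambda>v. peval (M i j) v * \<sigma> j v)"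
      using twist_sum_outside[OF assms(2)] by (intro ext) auto
    ultimately show "(\<lambda>v. peval (M i j) v * \<sigma> j v) \<in> twist (n' i) U" by simp
  qed
  then show ?thesis using assms(1,2) by (auto simp: mat_map_def twist_sum_def zero_fun_def)
qed

lemma mat_map_sheaf_hom:
  assumes G: "\<And>U \<sigma>. openin P3 U ==> \<sigma> \<in> twist_sum J n U ==> mat_map J n J' M U \<sigma> \<in> G U"
  shows "mat_map J n J' M \<in> sheaf_hom (twist_sum J n) G (topspace P3)"
  unfolding sheaf_hom_def mem_Collect_eq
proof (intro conjI allI impI ballI)
  fix U assume U: "openin P3 U \<and> U \<subseteq> topspace P3"
  then have oU: "openin P3 U" by blast
  show "mat_map J n J' M U \<sigma> \<in> G U" if "\<sigma> \<in> twist_sum J n U" for \<sigma>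
    by (rule G[OF oU that])
  show "mat_map J n J' M U (\<sigma> + \<tau>) = mat_map J n J' M U \<sigma> + mat_map J n J' M U \<tau>"
    if "\<sigma> \<in> twist_sum J n U" "\<tau> \<in> twist_sum J n U" for \<sigma> \<tau>
    using twist_sum_add[OF oU that] that oU
    by (intro ext) (simp add: mat_map_apply sum.distrib distrib_left)
  show "mat_map J n J' M U (\<lambda>i v. f v * \<sigma> i v) = (\<lambda>i v. f v * mat_map J n J' M U \<sigma> i v)"
    if "f \<in> twist 0 U" "\<sigma> \<in> twist_sum J n U" for f \<sigma>
    using twist_sum_mult[OF oU that] that oU
    by (intro ext) (simp add: mat_map_apply sum_distrib_left mult.left_commute)
  show "mat_map J n J' M V (restr V \<sigma>) = restr V (mat_map J n J' M U \<sigma>)"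
    if "openin P3 V \<and> V \<subseteq> U" "\<sigma> \<in> twist_sum J n U" for V \<sigma>
  proof -
    have V: "openin P3 V" "V \<subseteq> U" using that by auto
    show ?thesis
      using twist_sum_restr[OF oU V that(2)] that(2) oU V
      by (intro ext) (simp add: mat_map_apply restr_def)
  qed
next
  fix U \<sigma> assume "\<not> (openin P3 U \<and> U \<subseteq> topspace P3 \<and> \<sigma> \<in> twist_sum J n U)"
  then show "mat_map J n J' M U \<sigma> = 0"
    using openin_subset[of P3 U] by (auto simp: mat_map_def)
qed

lemma sheaf_homD:
  assumes "\<phi> \<in> sheaf_hom E G (topspace P3)" "openin P3 U"
  shows "\<sigma> \<in> E U ==> \<phi> U \<sigma> \<in> G U"
    "\<sigma> \<in> E U ==> \<tau> \<in> E U ==> \<phi> U (\<sigma> + \<tau>) = \<phi> U \<sigma> + \<phi> U \<tau>"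
    "f \<in> twist 0 U ==> \<sigma> \<in> E U ==> \<phi> U (\<lambda>i v. f v * \<sigma> i v) = (\<lambda>i v. f v * \<phi> U \<sigma> i v)"
    "openin P3 V ==> V \<subseteq> U ==> \<sigma> \<in> E U ==> \<phi> V (restr V \<sigma>) = restr V (\<phi> U \<sigma>)"
  using assms openin_subset[OF assms(2)] unfolding sheaf_hom_def by auto

lemma sheaf_hom_outside:
  assumes "\<phi> \<in> sheaf_hom E G (topspace P3)" "\<not> (openin P3 U \<and> \<sigma> \<in> E U)"
  shows "\<phi> U \<sigma> = 0"
proof -
  have "\<not> (openin P3 U \<and> U \<subseteq> topspace P3 \<and> \<sigma> \<in> E U)" using assms(2) by blast
  moreover have "\<forall>U \<sigma>. \<not> (openin P3 U \<and> U \<subseteq> topspace P3 \<and> \<sigma> \<in> E U) --> \<phi> U \<sigma> = 0"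
    using assms(1) unfolding sheaf_hom_def mem_Collect_eq by (rule conjunct2)
  ultimately show ?thesis by (elim allE impE)
qed

text \<open>The local generator of the \<open>j\<close>-th summand on a chart: there the power of
  the coordinate \<open>k\<close> trivialises the twist.\<close>

definition unit_tuple :: "(nat => int) => nat => 4 => pt set => tuple" where
  "unit_tuple n j k U = (\<lambda>i v. if i = j then if v \<in> \<Union>U then v k powi n j else 0 else 0)"

lemma unit_tuple_in:
  assumes "openin P3 U" "U \<subseteq> chart k" "j \<in> J"
  shows "unit_tuple n j k U \<in> twist_sum J n U"
proof -
  have "unit_tuple n j k U i \<in> twist (n i) U" for i
    using twist_powi[OF assms(1,2), of "n j"] twist_zero[OF assms(1), of "n i"]
    by (cases "i = j") (simp_all add: unit_tuple_def)
  moreover have "unit_tuple n j k U i = 0" if "i \<notin> J" for i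
    using that assms(3) by (auto simp: unit_tuple_def zero_fun_def)
  ultimately show ?thesis by (simp add: twist_sum_def)
qed

lemma unit_tuple_restr: "V \<subseteq> U ==> unit_tuple n j k V = restr V (unit_tuple n j k U)"
  by (intro ext) (auto simp: unit_tuple_def restr_def)

text \<open>A morphism is determined by the images of the local generators. Divided by the
  trivialising powers, these images agree on overlaps of charts, so they glue to global sections of
  \<open>O(n' i - n j)\<close>, and such sections are forms.\<close>

theorem sheaf_hom_mat_map:
  assumes \<phi>: "\<phi> \<in> sheaf_hom (twist_sum J n) G (topspace P3)" and J: "finite J"
    and G: "\<And>U. openin P3 U ==> G U \<subseteq> twist_sum J' n' U"
  shows "\<exists>M. (\<forall>i\<in>J'. \<forall>j\<in>J. homog (n' i - n j) (M i j)) \<and> \<phi> = mat_map J n J' M"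
proof -
  let ?E = "twist_sum J n"
  define g where "g i j k v = \<phi> (chart k) (unit_tuple n j k (chart k)) i v" for i j k v
  have gU: "\<phi> U (unit_tuple n j k U) i v = g i j k v"
    if U: "openin P3 U" "U \<subseteq> chart k" and j: "j \<in> J" and v: "v \<in> \<Union>U" for U i j k v
  proof -
    have "\<phi> U (unit_tuple n j k U) = restr U (\<phi> (chart k) (unit_tuple n j k (chart k)))"
      unfolding unit_tuple_restr[OF U(2)]
      by (rule sheaf_homD(4)[OF \<phi> openin_chart U unit_tuple_in[OF openin_chart order.refl j]])
    then show ?thesis using v by (simp add: g_def restr_def)
  qed
  have cons: "v k powi (- n j) * g i j k v = v l powi (- n j) * g i j l v"
    if kl: "v k \<noteq> 0" "v l \<noteq> 0" and j: "j \<in> J" for i j k l v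
  proof -
    define U where "U = chart k \<inter> chart l"
    have U: "openin P3 U" "U \<subseteq> chart k" "U \<subseteq> chart l" by (auto simp: U_def)
    have mU: "u \<in> \<Union>U \<longleftrightarrow> u k \<noteq> 0 \<and> u l \<noteq> 0" for u
      using cone_P3[OF U(1), of u] cone_P3[OF openin_chart, of u k] cone_P3[OF openin_chart, of u l]
        cone_chart[of u k] cone_chart[of u l] by (auto simp: U_def)
    define f where "f = (\<lambda>u. (if u \<in> \<Union>U then u k powi n j else 0) * (if u \<in> \<Union>U then u l powi (- n j) else 0))"
    have f: "f \<in> twist 0 U"
      using twist_mult[OF U(1) twist_powi[OF U(1,2), of "n j"] twist_powi[OF U(1,3), of "- n j"]]
      by (simp add: f_def)
    have e: "unit_tuple n j k U = (\<lambda>i v. f v * unit_tuple n j l U i v)"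
    proof (intro ext)
      fix i u
      show "unit_tuple n j k U i u = f u * unit_tuple n j l U i u"
        by (cases "u \<in> \<Union>U") (simp_all add: unit_tuple_def f_def mU power_int_minus)
    qed
    have vU: "v \<in> \<Union>U" using kl mU by blast
    have "g i j k v = \<phi> U (unit_tuple n j k U) i v" using gU[OF U(1,2) j vU] by simp
    also have "\<dots> = f v * \<phi> U (unit_tuple n j l U) i v"
      unfolding e using sheaf_homD(3)[OF \<phi> U(1) f unit_tuple_in[OF U(1,3) j]] by simp
    also have "\<dots> = f v * g i j l v" using gU[OF U(1,3) j vU] by simp
    finally show ?thesis using vU kl by (simp add: f_def power_int_minus)
  qed
  \<comment> \<open>Every chart containing \<open>v\<close> yields the same value, by
    \<open>cons\<close>; the choice of one merely turns the local data into a function.\<close>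
  define s where "s i j v = (if nz v then v (SOME k. v k \<noteq> 0) powi (- n j) * g i j (SOME k. v k \<noteq> 0) v else 0)"
    for i j v
  have s: "s i j v = v k powi (- n j) * g i j k v" if "v k \<noteq> 0" "j \<in> J" for i j k v
  proof -
    have "v (SOME k. v k \<noteq> 0) \<noteq> 0" using that(1) by (rule someI)
    moreover have "nz v" using that(1) by (auto simp: nz_def)
    ultimately show ?thesis unfolding s_def
      using cons[where v = v and k = "SOME k. v k \<noteq> 0" and l = k and j = j and i = i] that by simp
  qed
  have gt: "g i j k \<in> twist (n' i) (chart k)" if "i \<in> J'" "j \<in> J" for i j k
  proof -
    have "\<phi> (chart k) (unit_tuple n j k (chart k)) \<in> twist_sum J' n' (chart k)"
      using sheaf_homD(1)[OF \<phi> openin_chart unit_tuple_in[OF openin_chart order.refl that(2)]]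
        G[OF openin_chart] by blast
    then show ?thesis using twist_sum_comp[OF _ that(1)] by (simp add: g_def[abs_def])
  qed
  have st: "s i j \<in> twist (n' i - n j) whole" if ij: "i \<in> J'" "j \<in> J" for i j
  proof (rule twist_glue[OF openin_whole])
    fix v assume "v \<in> \<Union>whole"
    then obtain k where k: "v k \<noteq> 0" unfolding cone_whole nz_def by blast
    let ?r = "\<lambda>v. (if v \<in> \<Union>(chart k) then v k powi (- n j) else 0) * g i j k v"
    have "?r \<in> twist (- n j + n' i) (chart k)"
      by (rule twist_mult[OF openin_chart twist_powi[OF openin_chart order.refl] gt[OF ij]])
    then have "?r \<in> twist (n' i - n j) (chart k)" by simp
    moreover have "\<forall>u\<in>\<Union>(chart k). s i j u = ?r u"
      using s[OF _ ij(2)] by (simp add: cone_chart)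
    moreover have "v \<in> \<Union>(chart k)" using k by (simp add: cone_chart)
    moreover have "chart k \<subseteq> whole" using openin_zariski_subset[OF openin_chart] .
    ultimately show "\<exists>V r. openin P3 V \<and> v \<in> \<Union>V \<and> V \<subseteq> whole \<and> r \<in> twist (n' i - n j) V \<and> (\<forall>u\<in>\<Union>V. s i j u = r u)"
      using openin_chart by meson
  qed (simp add: s_def cone_whole)
  have "\<exists>f. homog (n' i - n j) f \<and> (\<forall>v. nz v --> s i j v = peval f v)" if "i \<in> J'" "j \<in> J" for i j
    by (rule global_sections[OF st[OF that]])
  then obtain M where M: "\<And>i j. i \<in> J' ==> j \<in> J ==> homog (n' i - n j) (M i j)"
    "\<And>i j v. i \<in> J' ==> j \<in> J ==> nz v ==> s i j v = peval (M i j) v"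
    by metis
  have eq: "\<phi> U \<sigma> i v = (\<Sum>j\<in>J. peval (M i j) v * \<sigma> j v)"
    if U: "openin P3 U" and \<sigma>: "\<sigma> \<in> ?E U" and v: "v \<in> \<Union>U" and i: "i \<in> J'" for U \<sigma> i v
  proof -
    have nz: "nz v" by (rule cone_P3_nz[OF U v])
    then obtain k where k: "v k \<noteq> 0" unfolding nz_def by blast
    define V where "V = U \<inter> chart k"
    have V: "openin P3 V" "V \<subseteq> U" "V \<subseteq> chart k" using U by (auto simp: V_def)
    have vV: "v \<in> \<Union>V"
      using cone_P3[OF V(1), of v] cone_P3[OF openin_chart, of v k] cone_P3[OF U, of v]
        cone_chart[of v k] v k by (auto simp: V_def)
    have kV: "u k \<noteq> 0" if "u \<in> \<Union>V" for u
    proof -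
      have "u \<in> \<Union>(chart k)" using that V(3) by blast
      then show ?thesis by (simp add: cone_chart)
    qed
    \<comment> \<open>The coordinates of \<open>restr V \<sigma>\<close> with respect to the local
      generators. They are regular functions, so linearity over \<open>twist 0 V\<close>
      applies.\<close>
    define f where "f j = (\<lambda>u. restr V \<sigma> j u * (if u \<in> \<Union>V then u k powi (- n j) else 0))" for j
    have rs: "restr V \<sigma> \<in> ?E V" by (rule twist_sum_restr[OF U V(1,2) \<sigma>])
    have f: "f j \<in> twist 0 V" if "j \<in> J" for j
      using twist_mult[OF V(1) twist_sum_comp[OF rs that] twist_powi[OF V(1,3), of "- n j"]]
      by (simp add: f_def)
    have part: "\<phi> V (\<Sum>j\<in>K. (\<lambda>i u. f j u * unit_tuple n j k V i u)) =
        (\<Sum>j\<in>K. (\<lambda>i u. f j u * \<phi> V (unit_tuple n j k V) i u)) \<and>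
        (\<Sum>j\<in>K. (\<lambda>i u. f j u * unit_tuple n j k V i u)) \<in> ?E V" if "finite K" "K \<subseteq> J" for K
      using that
    proof (induction K rule: finite_induct)
      case empty
      have z: "0 \<in> ?E V" by (rule zero_in_twist_sum[OF V(1)])
      from sheaf_homD(2)[OF \<phi> V(1) z z] have "\<phi> V 0 = 0" by simp
      with z show ?case unfolding sum.empty by blast
    next
      case (insert j K)
      then have j: "j \<in> J" by blast
      note ut = unit_tuple_in[OF V(1,3) j, of n]
      note ft = twist_sum_mult[OF V(1) f[OF j] ut]
      have "K \<subseteq> J" using insert.prems by blast
      note IH = insert.IH[OF this]
      show ?case
        unfolding sum.insert[OF insert.hyps]
        using sheaf_homD(2)[OF \<phi> V(1) ft conjunct2[OF IH]] twist_sum_add[OF V(1) ft conjunct2[OF IH]]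
        by (simp only: conjunct1[OF IH] sheaf_homD(3)[OF \<phi> V(1) f[OF j] ut])
    qed
    have decomp: "restr V \<sigma> = (\<Sum>j\<in>J. (\<lambda>i u. f j u * unit_tuple n j k V i u))"
    proof (intro ext)
      fix i u
      have "(\<Sum>j\<in>J. (\<lambda>i u. f j u * unit_tuple n j k V i u)) i u =
          (\<Sum>j\<in>J. if j = i then f j u * unit_tuple n i k V i u else 0)"
        unfolding sum_apply by (rule sum.cong) (auto simp: unit_tuple_def)
      also have "\<dots> = (if i \<in> J then f i u * unit_tuple n i k V i u else 0)"
        using J by simp
      also have "\<dots> = restr V \<sigma> i u"
        using twist_sum_other[OF rs, of i] twist_sum_outside[OF rs, of u i] kV[of u]
        by (auto simp: f_def unit_tuple_def power_int_minus)
      finally show "restr V \<sigma> i u = (\<Sum>j\<in>J. (\<lambda>i u. f j u * unit_tuple n j k V i u)) i u" by simp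
    qed
    have "\<phi> U \<sigma> i v = restr V (\<phi> U \<sigma>) i v" using vV by (simp add: restr_def)
    also have "\<dots> = \<phi> V (restr V \<sigma>) i v" using sheaf_homD(4)[OF \<phi> U V(1,2) \<sigma>] by simp
    also have "\<dots> = (\<Sum>j\<in>J. f j v * \<phi> V (unit_tuple n j k V) i v)"
      unfolding decomp conjunct1[OF part[OF J order.refl]] by (simp only: sum_apply)
    also have "\<dots> = (\<Sum>j\<in>J. peval (M i j) v * \<sigma> j v)"
    proof (rule sum.cong)
      fix j assume j: "j \<in> J"
      have "f j v * \<phi> V (unit_tuple n j k V) i v = \<sigma> j v * (v k powi (- n j) * g i j k v)"
        using gU[OF V(1,3) j vV] vV by (simp add: f_def restr_def)
      also have "\<dots> = \<sigma> j v * peval (M i j) v"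
        using s[where v = v and k = k and j = j and i = i] k j M(2)[OF i j nz] by simp
      finally show "f j v * \<phi> V (unit_tuple n j k V) i v = peval (M i j) v * \<sigma> j v" by simp
    qed simp
    finally show ?thesis .
  qed
  have "\<phi> = mat_map J n J' M"
  proof (intro ext)
    fix U \<sigma> i v
    show "\<phi> U \<sigma> i v = mat_map J n J' M U \<sigma> i v"
    proof (cases "openin P3 U \<and> \<sigma> \<in> ?E U")
      case True
      then have in': "\<phi> U \<sigma> \<in> twist_sum J' n' U"
        using sheaf_homD(1)[OF \<phi>] G by blast
      show ?thesis
        using True eq[of U \<sigma> v i] twist_sum_other[OF in', of i] twist_sum_outside[OF in', of v i]
          twist_sum_outside[of \<sigma> J n U v]
        by (cases "v \<in> \<Union>U") (auto simp: mat_map_apply)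
    next
      case False
      then show ?thesis using sheaf_hom_outside[OF \<phi> False] by (auto simp: mat_map_def)
    qed
  qed
  with M(1) show ?thesis by blast
qed

lemma mat_map_unit:
  assumes "finite J" "j \<in> J" "i \<in> J'" "v 0 \<noteq> 0"
  shows "mat_map J n J' M (chart 0) (unit_tuple n j 0 (chart 0)) i v = peval (M i j) v * v 0 powi n j"
proof -
  have "mat_map J n J' M (chart 0) (unit_tuple n j 0 (chart 0)) i v =
      (\<Sum>j'\<in>J. if j' = j then peval (M i j) v * v 0 powi n j else 0)"
    unfolding mat_map_apply[OF openin_chart unit_tuple_in[OF openin_chart order.refl assms(2)]]
    using assms(3,4) by (auto simp: unit_tuple_def cone_chart intro!: sum.cong)
  then show ?thesis using assms by simp
qed

lemma mat_map_eq_0: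
  assumes "finite J" "mat_map J n J' M = 0" "i \<in> J'" "j \<in> J"
  shows "M i j = 0"
proof (rule peval_eq_on_dense[of "xp 0 1"])
  fix v :: "4 => complex" assume "peval (xp 0 1) v \<noteq> 0"
  then have v: "v 0 \<noteq> 0" by simp
  show "peval (M i j) v = peval 0 v"
    using mat_map_unit[where M = M and n = n and v = v, OF assms(1,4,3) v] v by (simp add: assms(2))
qed simp

lemma mat_map_expand:
  assumes M: "\<And>i j. i \<in> J' ==> j \<in> J ==> M i j = (\<Sum>m | int (mono_deg m) = n' i - n j. scale_form (c ((i, j), m)) (mon m 1))"
    and "finite J" "finite J'"
  shows "mat_map J n J' M = (\<Sum>x\<in>Sigma (J' \<times> J) (\<lambda>ij. {m. int (mono_deg m) = n' (fst ij) - n (snd ij)}).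
     (\<lambda>U \<sigma> i v. c x * mat_map J n J' (\<lambda>i j. if (i, j) = fst x then mon (snd x) 1 else 0) U \<sigma> i v))"
    (is "_ = (\<Sum>x\<in>?X. ?F x)")
proof (intro ext)
  fix U \<sigma> i v
  show "mat_map J n J' M U \<sigma> i v = (\<Sum>x\<in>?X. ?F x) U \<sigma> i v"
  proof (cases "openin P3 U \<and> \<sigma> \<in> twist_sum J n U \<and> i \<in> J'")
    case True
    have "(\<Sum>x\<in>?X. ?F x) U \<sigma> i v = (\<Sum>x\<in>?X. ?F x U \<sigma> i v)"
      by (simp only: sum_apply)
    also have "\<dots> = (\<Sum>ij\<in>J' \<times> J. \<Sum>m | int (mono_deg m) = n' (fst ij) - n (snd ij). ?F (ij, m) U \<sigma> i v)"
      by (subst sum.Sigma) (simp_all add: assms case_prod_beta cong: if_cong)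
    also have "\<dots> = (\<Sum>i'\<in>J'. \<Sum>j\<in>J. \<Sum>m | int (mono_deg m) = n' i' - n j. ?F ((i', j), m) U \<sigma> i v)"
      by (subst sum.cartesian_product, intro sum.cong refl) auto
    also have "\<dots> = (\<Sum>i'\<in>J'. \<Sum>j\<in>J. if i' = i then peval (M i j) v * \<sigma> j v else 0)"
    proof (intro sum.cong refl)
      fix i' j assume ij: "i' \<in> J'" "j \<in> J"
      have F: "?F ((i', j), m) U \<sigma> i v = (if i' = i then c ((i, j), m) * (meval v m * \<sigma> j v) else 0)" for m
      proof -
        have "(\<Sum>j'\<in>J. peval (if (i, j') = (i', j) then mon m 1 else 0) v * \<sigma> j' v) =
            (\<Sum>j'\<in>J. if j' = j then if i' = i then meval v m * \<sigma> j v else 0 else 0)"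
          by (rule sum.cong) auto
        also have "\<dots> = (if i' = i then meval v m * \<sigma> j v else 0)" using ij(2) assms(2) by simp
        finally show ?thesis using True by (simp add: mat_map_apply cong: if_cong)
      qed
      show "(\<Sum>m | int (mono_deg m) = n' i' - n j. ?F ((i', j), m) U \<sigma> i v) =
          (if i' = i then peval (M i j) v * \<sigma> j v else 0)"
      proof (cases "i' = i")
        case True
        then show ?thesis unfolding F using M[OF ij] by (simp add: sum_distrib_right mult.assoc)
      next
        case False
        then show ?thesis unfolding F by simp
      qed
    qed
    also have "\<dots> = (\<Sum>i'\<in>J'. if i' = i then \<Sum>j\<in>J. peval (M i j) v * \<sigma> j v else 0)"
      by (rule sum.cong) auto
    also have "\<dots> = (\<Sum>j\<in>J. peval (M i j) v * \<sigma> j v)" using True assms(3) by simp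
    finally show ?thesis using True by (simp add: mat_map_apply)
  next
    case False
    then have "mat_map J n J' N U \<sigma> i v = 0" for N by (auto simp: mat_map_def)
    then show ?thesis by (simp add: sum_apply)
  qed
qed

theorem hom_dim_twist_sum:
  assumes "finite J" "finite J'"
  shows "hom_dim (twist_sum J n) (twist_sum J' n') = (\<Sum>i\<in>J'. \<Sum>j\<in>J. h0 (n' i - n j))"
proof -
  define X where "X = Sigma (J' \<times> J) (\<lambda>ij. {m :: 4 \<Rightarrow>\<^sub>0 nat. int (mono_deg m) = n' (fst ij) - n (snd ij)})"
  define e :: "(nat \<times> nat) \<times> (4 \<Rightarrow>\<^sub>0 nat) => sheaf_map" where
    "e x = mat_map J n J' (\<lambda>i j. if (i, j) = fst x then mon (snd x) 1 else 0)" for x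
  define sc :: "complex => sheaf_map => sheaf_map" where "sc = (\<lambda>c \<phi> U \<sigma> i v. c * \<phi> U \<sigma> i v)"
  interpret v: vector_space sc unfolding sc_def by (rule vector_space_sheaf_map)
  have fX: "finite X" unfolding X_def using assms by (intro finite_SigmaI) auto
  have ex: "mat_map J n J' M = (\<Sum>x\<in>X. sc (c x) (e x))"
    if "\<And>i j. i \<in> J' ==> j \<in> J ==> M i j = (\<Sum>m | int (mono_deg m) = n' i - n j. scale_form (c ((i, j), m)) (mon m 1))"
    for M c
    unfolding X_def e_def sc_def using mat_map_expand[where c = c, OF that assms] by simp
  have "v.dim (sheaf_hom (twist_sum J n) (twist_sum J' n') (topspace P3)) = card X"
  proof (rule v.dim_family[where e = e, OF fX])
    fix x assume "x \<in> X"
    then have "\<And>i j. i \<in> J' ==> j \<in> J ==> homog (n' i - n j) (if (i, j) = fst x then mon (snd x) 1 else 0)"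
      by (auto simp: X_def intro: homog_mon)
    then show "e x \<in> sheaf_hom (twist_sum J n) (twist_sum J' n') (topspace P3)"
      unfolding e_def by (intro mat_map_sheaf_hom mat_map_in) auto
  next
    fix c assume 0: "(\<Sum>x\<in>X. sc (c x) (e x)) = 0"
    define M where "M i j = (\<Sum>m | int (mono_deg m) = n' i - n j. scale_form (c ((i, j), m)) (mon m 1))" for i j
    have "mat_map J n J' M = 0" using ex[of M c] 0 by (simp add: M_def)
    then have M0: "M i j = 0" if "i \<in> J'" "j \<in> J" for i j
      using mat_map_eq_0[OF assms(1) _ that] by blast
    show "\<forall>x\<in>X. c x = 0"
    proof
      fix x assume x: "x \<in> X"
      then obtain i j m where ij: "x = ((i, j), m)" "i \<in> J'" "j \<in> J" "int (mono_deg m) = n' i - n j"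
        by (auto simp: X_def)
      have "coef (M i j) m = (\<Sum>m' | int (mono_deg m') = n' i - n j. if m' = m then c ((i, j), m) else 0)"
        unfolding M_def lookup_sum
        by (rule sum.cong) (auto simp: lookup_scale_form lookup_single when_def)
      then show "c x = 0" using M0[OF ij(2,3)] ij by simp
    qed
  next
    fix \<phi> assume \<phi>: "\<phi> \<in> sheaf_hom (twist_sum J n) (twist_sum J' n') (topspace P3)"
    obtain M where M: "\<forall>i\<in>J'. \<forall>j\<in>J. homog (n' i - n j) (M i j)" "\<phi> = mat_map J n J' M"
      using sheaf_hom_mat_map[OF \<phi> assms(1) order.refl] by blast
    have "\<phi> = (\<Sum>x\<in>X. sc (coef (M (fst (fst x)) (snd (fst x))) (snd x)) (e x))"
      unfolding M(2)
    proof (rule ex)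
      fix i j assume "i \<in> J'" "j \<in> J"
      then have "homog (n' i - n j) (M i j)" using M(1) by blast
      from homog_expand[OF this]
      show "M i j = (\<Sum>m | int (mono_deg m) = n' i - n j.
          scale_form (coef (M (fst (fst ((i, j), m))) (snd (fst ((i, j), m)))) (snd ((i, j), m))) (mon m 1))"
        by simp
    qed
    then show "\<exists>c. \<phi> = (\<Sum>x\<in>X. sc (c x) (e x))"
      by (intro exI[of _ "\<lambda>x. coef (M (fst (fst x)) (snd (fst x))) (snd x)"])
  qed
  also have "card X = (\<Sum>ij\<in>J' \<times> J. h0 (n' (fst ij) - n (snd ij)))"
    unfolding X_def h0_def using assms by (subst card_SigmaI) (auto simp: case_prod_beta)
  also have "\<dots> = (\<Sum>i\<in>J'. \<Sum>j\<in>J. h0 (n' i - n j))"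
    by (simp add: sum.cartesian_product case_prod_beta)
  finally show ?thesis unfolding hom_dim_def sc_def .
qed

section \<open>First syzygies of the submaximal minors of a square matrix\<close>

text \<open>Matrices are plain functions of which only the entries with both indices below
  \<open>n\<close> count; products, sums and multiples can then be rewritten without carrier
  conditions.\<close>

definition mm :: "nat => (nat => nat => 'a::comm_ring_1) => (nat => nat => 'a) => nat => nat => 'a" where
  "mm n A B = (\<lambda>i j. \<Sum>k<n. A i k * B k j)"

definition scal :: "'a::comm_ring_1 => nat => nat => 'a" where
  "scal y = (\<lambda>i j. if i = j then y else 0)"

lemma mm_assoc: "mm n (mm n A B) C = mm n A (mm n B C)"
proof (intro ext)
  fix i j
  have "mm n (mm n A B) C i j = (\<Sum>l<n. \<Sum>k<n. A i k * B k l * C l j)"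
    by (simp add: mm_def sum_distrib_right)
  also have "\<dots> = (\<Sum>k<n. \<Sum>l<n. A i k * B k l * C l j)" by (rule sum.swap)
  also have "\<dots> = mm n A (mm n B C) i j"
    by (simp add: mm_def sum_distrib_left mult.assoc)
  finally show "mm n (mm n A B) C i j = mm n A (mm n B C) i j" .
qed

lemma mm_add_left: "mm n (A + B) C = mm n A C + mm n B C"
  by (intro ext) (simp add: mm_def sum.distrib distrib_right)

lemma mm_add_right: "mm n A (B + C) = mm n A B + mm n A C"
  by (intro ext) (simp add: mm_def sum.distrib distrib_left)

lemma mm_diff_left: "mm n (A - B) C = mm n A C - mm n B C"
  by (intro ext) (simp add: mm_def sum_subtractf left_diff_distrib)

lemma mm_diff_right: "mm n A (B - C) = mm n A B - mm n A C"
  by (intro ext) (simp add: mm_def sum_subtractf right_diff_distrib)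

lemma mm_uminus_right: "mm n A (- C) = - mm n A C"
  by (intro ext) (simp add: mm_def sum_negf)

lemma mm_smult_left: "mm n (\<lambda>i j. c * A i j) B = (\<lambda>i j. c * mm n A B i j)"
  by (intro ext) (simp add: mm_def sum_distrib_left mult.assoc)

lemma mm_smult_right: "mm n A (\<lambda>i j. c * B i j) = (\<lambda>i j. c * mm n A B i j)"
  by (intro ext) (simp add: mm_def sum_distrib_left mult.left_commute)

lemma mm_scal_right: "j < n ==> mm n A (scal y) i j = y * A i j"
proof -
  assume "j < n"
  have "mm n A (scal y) i j = (\<Sum>k<n. if k = j then A i j * y else 0)"
    unfolding mm_def scal_def by (rule sum.cong) auto
  then show ?thesis using \<open>j < n\<close> by (simp add: mult.commute)
qed

lemma mm_scal_left: "i < n ==> mm n (scal y) A i j = y * A i j"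
proof -
  assume "i < n"
  have "mm n (scal y) A i j = (\<Sum>k<n. if k = i then y * A i j else 0)"
    unfolding mm_def scal_def by (rule sum.cong) auto
  then show ?thesis using \<open>i < n\<close> by simp
qed

lemma mm_cong_right: "(\<And>k. k < n ==> B k j = B' k j) ==> mm n A B i j = mm n A B' i j"
  by (simp add: mm_def)

lemma mm_cong_left: "(\<And>k. k < n ==> A i k = A' i k) ==> mm n A B i j = mm n A' B i j"
  by (simp add: mm_def)

text \<open>The trace of the product of \<open>A\<close> and \<open>V\<close>. For the adjugate
  \<open>A\<close> of a matrix it is the derivative of the determinant in the direction
  \<open>V\<close>.\<close>

definition mtr :: "nat => (nat => nat => 'a::comm_ring_1) => (nat => nat => 'a) => 'a" where
  "mtr n A V = (\<Sum>i<n. \<Sum>j<n. A i j * V j i)"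

text \<open>\<open>D\<close> is the derivative of the adjugate at \<open>S\<close> in the direction \<open>V\<close>: the equations arise by
  differentiating \<open>S * adj S = det S = adj S * S\<close>.\<close>

definition adj_deriv where
  "adj_deriv n S A V D y \<longleftrightarrow> (\<forall>i<n. \<forall>j<n.
     mm n S D i j + mm n V A i j = scal y i j \<and> mm n D S i j + mm n A V i j = scal y i j)"

lemma adj_deriv_mult:
  assumes "adj_deriv n S A V D y"
  shows "j < n ==> mm n X (mm n S D) i j + mm n X (mm n V A) i j = y * X i j"
    and "i < n ==> mm n (mm n S D) X i j + mm n (mm n V A) X i j = y * X i j"
    and "j < n ==> mm n X (mm n D S) i j + mm n X (mm n A V) i j = y * X i j"
    and "i < n ==> mm n (mm n D S) X i j + mm n (mm n A V) X i j = y * X i j"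
proof -
  note a = assms[unfolded adj_deriv_def, rule_format]
  show "mm n X (mm n S D) i j + mm n X (mm n V A) i j = y * X i j" if "j < n"
  proof -
    have "mm n X (mm n S D) i j + mm n X (mm n V A) i j = mm n X (mm n S D + mm n V A) i j"
      by (simp add: mm_add_right)
    also have "\<dots> = mm n X (scal y) i j" using a that by (intro mm_cong_right) auto
    finally show ?thesis using that by (simp add: mm_scal_right)
  qed
  show "mm n X (mm n D S) i j + mm n X (mm n A V) i j = y * X i j" if "j < n"
  proof -
    have "mm n X (mm n D S) i j + mm n X (mm n A V) i j = mm n X (mm n D S + mm n A V) i j"
      by (simp add: mm_add_right)
    also have "\<dots> = mm n X (scal y) i j" using a that by (intro mm_cong_right) auto
    finally show ?thesis using that by (simp add: mm_scal_right)
  qed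
  show "mm n (mm n S D) X i j + mm n (mm n V A) X i j = y * X i j" if "i < n"
  proof -
    have "mm n (mm n S D) X i j + mm n (mm n V A) X i j = mm n (mm n S D + mm n V A) X i j"
      by (simp add: mm_add_left)
    also have "\<dots> = mm n (scal y) X i j" using a that by (intro mm_cong_left) auto
    finally show ?thesis using that by (simp add: mm_scal_left)
  qed
  show "mm n (mm n D S) X i j + mm n (mm n A V) X i j = y * X i j" if "i < n"
  proof -
    have "mm n (mm n D S) X i j + mm n (mm n A V) X i j = mm n (mm n D S + mm n A V) X i j"
      by (simp add: mm_add_left)
    also have "\<dots> = mm n (scal y) X i j" using a that by (intro mm_cong_left) auto
    finally show ?thesis using that by (simp add: mm_scal_left)
  qed
qed

definition is_ideal :: "'a::comm_ring_1 set => bool" where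
  "is_ideal I \<longleftrightarrow> 0 \<in> I \<and> (\<forall>x\<in>I. \<forall>y\<in>I. x + y \<in> I) \<and> (\<forall>x\<in>I. \<forall>r. r * x \<in> I)"

lemma is_idealD:
  assumes "is_ideal I"
  shows "0 \<in> I" "x \<in> I ==> y \<in> I ==> x + y \<in> I" "x \<in> I ==> r * x \<in> I" "x \<in> I ==> x * r \<in> I"
    "x \<in> I ==> - x \<in> I" "x \<in> I ==> y \<in> I ==> x - y \<in> I"
proof -
  show I: "0 \<in> I" "x \<in> I ==> y \<in> I ==> x + y \<in> I" and m: "x \<in> I ==> r * x \<in> I" for r x y
    using assms by (auto simp: is_ideal_def)
  show "x \<in> I ==> x * r \<in> I" using m[of x r] by (simp add: mult.commute)
  show u: "x \<in> I ==> - x \<in> I" for x using m[of x "- 1"] by simp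
  show "x \<in> I ==> y \<in> I ==> x - y \<in> I" using I(2)[of x "- y"] u[of y] by simp
qed

lemma is_ideal_sum: "is_ideal I ==> (\<And>a. a \<in> A ==> f a \<in> I) ==> sum f A \<in> I"
  by (induction A rule: infinite_finite_induct) (auto intro: is_idealD)

definition matI :: "nat => 'a::comm_ring_1 set => (nat => nat => 'a) => bool" where
  "matI n I M \<longleftrightarrow> (\<forall>i<n. \<forall>j<n. M i j \<in> I)"

lemma matI_mm_left: "is_ideal I ==> matI n I M ==> matI n I (mm n M X)"
  by (auto simp: matI_def mm_def intro!: is_ideal_sum is_idealD(4))

lemma matI_mm_right: "is_ideal I ==> matI n I M ==> matI n I (mm n X M)"
  by (auto simp: matI_def mm_def intro!: is_ideal_sum is_idealD(3))

text \<open>First part of a null homotopy for multiplication by \<open>y\<close>. The pair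
  \<open>(T D, - D' V)\<close> lifts \<open>y T\<close>, since the equations of the two derivatives
  give \<open>T D S + T A V = y T\<close> and \<open>S D' V + T A V = 0\<close>.\<close>

lemma syzygy_homotopy_0:
  assumes V: "adj_deriv n S A V D y" and T: "adj_deriv n S A T D' 0"
    and ij: "i < n" "j < n"
  shows "y * T i j = mm n (mm n T D) S i j + mm n S (- mm n D' V) i j"
proof -
  have "y * T i j = mm n T (mm n D S) i j + mm n T (mm n A V) i j"
    using adj_deriv_mult(3)[OF V ij(2)] by simp
  moreover have "mm n (mm n S D') V i j + mm n (mm n T A) V i j = 0"
    using adj_deriv_mult(2)[OF T ij(1)] by simp
  ultimately show ?thesis by (simp add: mm_assoc mm_uminus_right eq_neg_iff_add_eq_0 add.commute)
qed

text \<open>The null homotopy one place further, modulo \<open>I\<close>. For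
  \<open>\<alpha>\<close> the error is exactly \<open>(\<alpha> S + S \<beta>) D\<close>. For
  \<open>\<beta>\<close> the error is first seen to lie in \<open>I\<close> after multiplication by
  \<open>S\<close>; multiplying by \<open>A\<close> turns this into \<open>F\<close> times the
  error, and \<open>F\<close> cancels modulo \<open>I\<close>.\<close>

lemma syzygy_homotopy_1:
  assumes I: "is_ideal I"
    and V: "adj_deriv n S A V D y" and aV: "adj_deriv n S A (mm n \<alpha> V) D' f"
    and AS: "\<And>i j. i < n ==> j < n ==> mm n A S i j = scal F i j"
    and F: "\<And>x. F * x \<in> I ==> x \<in> I"
    and R: "matI n I (mm n \<alpha> S + mm n S \<beta>)"
    and h: "h = - mm n \<beta> D - D'"
  shows "matI n I (\<lambda>i j. y * \<alpha> i j - (scal f i j + mm n S h i j))"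
    and "matI n I (\<lambda>i j. y * \<beta> i j + (scal f i j + mm n h S i j))"
proof -
  define X where "X i j = y * \<alpha> i j - (scal f i j + mm n S h i j)" for i j
  have X: "X i j = mm n (mm n \<alpha> S + mm n S \<beta>) D i j" if ij: "i < n" "j < n" for i j
  proof -
    have e1: "mm n \<alpha> (mm n S D) i j + mm n \<alpha> (mm n V A) i j = y * \<alpha> i j"
      by (rule adj_deriv_mult(1)[OF V ij(2)])
    have e2: "mm n S D' i j + mm n \<alpha> (mm n V A) i j = scal f i j"
      using aV ij by (simp add: adj_deriv_def mm_assoc)
    have e3: "mm n S h i j = - mm n S (mm n \<beta> D) i j - mm n S D' i j"
      by (simp add: h mm_diff_right mm_uminus_right)
    have e4: "mm n (mm n \<alpha> S + mm n S \<beta>) D i j = mm n \<alpha> (mm n S D) i j + mm n S (mm n \<beta> D) i j"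
      by (simp add: mm_add_left mm_assoc)
    show ?thesis unfolding X_def e1[symmetric] e2[symmetric] e3 e4 by simp
  qed
  show XI: "matI n I (\<lambda>i j. y * \<alpha> i j - (scal f i j + mm n S h i j))"
    using matI_mm_left[OF I R, of D] X by (simp add: matI_def X_def)
  define B where "B i j = y * \<beta> i j + (scal f i j + mm n h S i j)" for i j
  have "mm n S B i j \<in> I" if ij: "i < n" "j < n" for i j
  proof -
    have "mm n S B i j = mm n S ((\<lambda>i j. y * \<beta> i j) + (scal f + mm n h S)) i j"
      unfolding B_def by (intro mm_cong_right) simp
    also have "\<dots> = y * mm n S \<beta> i j + (f * S i j + mm n (mm n S h) S i j)"
      using ij by (simp add: mm_add_right mm_smult_right mm_scal_right mm_assoc)
    finally have 1: "mm n S B i j = y * mm n S \<beta> i j + (f * S i j + mm n (mm n S h) S i j)" .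
    have "mm n X S i j = mm n ((\<lambda>i j. y * \<alpha> i j) - (scal f + mm n S h)) S i j"
      unfolding X_def by (intro mm_cong_left) simp
    also have "\<dots> = y * mm n \<alpha> S i j - (f * S i j + mm n (mm n S h) S i j)"
      using ij by (simp add: mm_diff_left mm_add_left mm_smult_left mm_scal_left)
    finally have 2: "mm n X S i j = y * mm n \<alpha> S i j - (f * S i j + mm n (mm n S h) S i j)" .
    have "mm n S B i j = y * (mm n \<alpha> S + mm n S \<beta>) i j - mm n X S i j"
      unfolding 1 2 by (simp add: algebra_simps)
    moreover have "mm n X S i j \<in> I"
      using matI_mm_left[OF I XI, of S] ij by (simp add: matI_def X_def[abs_def])
    moreover have "y * (mm n \<alpha> S + mm n S \<beta>) i j \<in> I"
      by (rule is_idealD(3)[OF I]) (use R ij in \<open>simp add: matI_def\<close>)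
    ultimately show ?thesis using is_idealD(6)[OF I] by metis
  qed
  then have "matI n I (mm n S B)" by (simp add: matI_def)
  then have "matI n I (mm n A (mm n S B))" by (rule matI_mm_right[OF I])
  moreover have "mm n A (mm n S B) i j = F * B i j" if "i < n" "j < n" for i j
  proof -
    have "mm n A (mm n S B) i j = mm n (mm n A S) B i j" by (simp add: mm_assoc)
    also have "\<dots> = mm n (scal F) B i j" using AS that by (intro mm_cong_left) auto
    finally show ?thesis using that by (simp add: mm_scal_left)
  qed
  ultimately show "matI n I (\<lambda>i j. y * \<beta> i j + (scal f i j + mm n h S i j))"
    using F by (simp add: matI_def B_def)
qed

definition unit_mat :: "nat => nat => nat => nat => 'a::comm_ring_1" where
  "unit_mat p q = (\<lambda>i j. if i = p \<and> j = q then 1 else 0)"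

lemma mm_unit_mat_left:
  "q < n ==> mm n (unit_mat p q) B i j = (if i = p then B q j else 0)"
proof -
  assume "q < n"
  have "mm n (unit_mat p q) B i j = (\<Sum>k<n. if k = q then if i = p then B q j else 0 else 0)"
    unfolding mm_def unit_mat_def by (rule sum.cong) auto
  then show ?thesis using \<open>q < n\<close> by simp
qed

lemma mm_unit_mat_right:
  "p < n ==> mm n A (unit_mat p q) i j = (if j = q then A i p else 0)"
proof -
  assume "p < n"
  have "mm n A (unit_mat p q) i j = (\<Sum>k<n. if k = p then if j = q then A i p else 0 else 0)"
    unfolding mm_def unit_mat_def by (rule sum.cong) auto
  then show ?thesis using \<open>p < n\<close> by simp
qed

lemma mm_unit_mat_both:
  "p < n ==> q < n ==> mm n A (mm n (unit_mat p q) B) i j = A i p * B q j"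
proof -
  assume "p < n" "q < n"
  have "mm n A (mm n (unit_mat p q) B) i j = (\<Sum>k<n. if k = p then A i p * B q j else 0)"
    unfolding mm_def[of n A] by (rule sum.cong) (auto simp: mm_unit_mat_left[OF \<open>q < n\<close>])
  then show ?thesis using \<open>p < n\<close> by simp
qed

text \<open>Multiplication by the square of a minor is needed here: the minor itself only yields the
  proportionality of \<open>h\<close> and \<open>A\<close> along one row and one column.\<close>

lemma syzygy_homotopy_2:
  assumes I: "is_ideal I" and pq: "p < n" "q < n"
    and V: "adj_deriv n S A (unit_mat p q) D (A q p)"
    and AS: "\<And>i j. i < n ==> j < n ==> mm n A S i j = scal F i j"
    and 1: "matI n I (scal f + mm n S h)" and 2: "matI n I (scal f + mm n h S)"
  defines "g \<equiv> - (A q p * h q p)"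
  shows "matI n I (\<lambda>i j. (A q p)\<^sup>2 * h i j + g * A i j)" "(A q p)\<^sup>2 * f - g * F \<in> I"
proof -
  let ?y = "A q p"
  note idl = is_idealD[OF I]
  have fA: "f * A i j + F * h i j \<in> I" if ij: "i < n" "j < n" for i j
  proof -
    have "mm n A (scal f + mm n S h) i j = mm n A (scal f) i j + mm n (mm n A S) h i j"
      by (simp add: mm_add_right mm_assoc)
    also have "mm n (mm n A S) h i j = mm n (scal F) h i j" using AS ij by (intro mm_cong_left) auto
    finally have e: "mm n A (scal f + mm n S h) i j = mm n A (scal f) i j + mm n (scal F) h i j" .
    have "mm n A (scal f + mm n S h) i j \<in> I"
      using matI_mm_right[OF I 1, of A] ij unfolding matI_def by blast
    then show ?thesis unfolding e using ij by (simp add: mm_scal_left mm_scal_right)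
  qed
  have hA: "?y * h i j + f * D i j - h i p * A q j \<in> I" if ij: "i < n" "j < n" for i j
  proof -
    have "mm n h (mm n S D) i j + mm n h (mm n (unit_mat p q) A) i j = ?y * h i j"
      by (rule adj_deriv_mult(1)[OF V ij(2)])
    then have e: "mm n (mm n h S) D i j + h i p * A q j = ?y * h i j"
      by (simp add: mm_unit_mat_both[OF pq] mm_assoc)
    have m: "mm n (scal f + mm n h S) D i j = f * D i j + mm n (mm n h S) D i j"
      using ij by (simp add: mm_add_left mm_scal_left)
    have "?y * h i j + f * D i j - h i p * A q j = mm n (scal f + mm n h S) D i j"
      unfolding m e[symmetric] by simp
    moreover have "mm n (scal f + mm n h S) D i j \<in> I"
      using matI_mm_left[OF I 2, of D] ij unfolding matI_def by blast
    ultimately show ?thesis by simp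
  qed
  have Ah: "?y * h i j + f * D i j - A i p * h q j \<in> I" if ij: "i < n" "j < n" for i j
  proof -
    have "mm n (mm n D S) h i j + mm n (mm n A (unit_mat p q)) h i j = ?y * h i j"
      by (rule adj_deriv_mult(4)[OF V ij(1)])
    then have e: "mm n D (mm n S h) i j + A i p * h q j = ?y * h i j"
      by (simp add: mm_unit_mat_both[OF pq] mm_assoc)
    have m: "mm n D (scal f + mm n S h) i j = f * D i j + mm n D (mm n S h) i j"
      using ij by (simp add: mm_add_right mm_scal_right)
    have "?y * h i j + f * D i j - A i p * h q j = mm n D (scal f + mm n S h) i j"
      unfolding m e[symmetric] by simp
    moreover have "mm n D (scal f + mm n S h) i j \<in> I"
      using matI_mm_right[OF I 1, of D] ij unfolding matI_def by blast
    ultimately show ?thesis by simp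
  qed
  have AA: "A i p * A q j = ?y * A i j - F * D i j" if ij: "i < n" "j < n" for i j
  proof -
    have "mm n A (mm n S D) i j + mm n A (mm n (unit_mat p q) A) i j = ?y * A i j"
      by (rule adj_deriv_mult(1)[OF V ij(2)])
    moreover have "mm n A (mm n S D) i j = F * D i j"
    proof -
      have "mm n A (mm n S D) i j = mm n (mm n A S) D i j" by (simp add: mm_assoc)
      also have "\<dots> = mm n (scal F) D i j" using AS ij by (intro mm_cong_left) auto
      finally show ?thesis using ij by (simp add: mm_scal_left)
    qed
    ultimately show ?thesis by (simp add: mm_unit_mat_both[OF pq] algebra_simps)
  qed
  show "matI n I (\<lambda>i j. ?y\<^sup>2 * h i j + g * A i j)"
    unfolding matI_def
  proof (intro allI impI)
    fix i j assume ij: "i < n" "j < n"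
    \<comment> \<open>For \<open>j = p\<close> the term subtracted in \<open>hA\<close> is
      \<open>h i p\<close> times the minor itself, so this element is the difference of
      \<open>Ah\<close> and \<open>hA\<close>.\<close>
    have hip: "?y * h i p - A i p * h q p \<in> I"
      using idl(6)[OF Ah[OF ij(1) pq(1)] hA[OF ij(1) pq(1)]] idl(2)[OF _ Ah[OF ij(1) pq(1)]]
        idl(6)[OF Ah[OF ij(1) pq(1)] hA[OF ij(1) pq(1)]]
      by (simp add: algebra_simps)
    have "?y\<^sup>2 * h i j + g * A i j =
        ?y * (?y * h i j + f * D i j - h i p * A q j) + A q j * (?y * h i p - A i p * h q p)
        - D i j * (f * A q p + F * h q p) + h q p * (A i p * A q j - (?y * A i j - F * D i j))"
      by (simp add: g_def power2_eq_square algebra_simps)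
    then have "?y\<^sup>2 * h i j + g * A i j =
        ?y * (?y * h i j + f * D i j - h i p * A q j) + A q j * (?y * h i p - A i p * h q p)
        - D i j * (f * A q p + F * h q p)"
      using AA[OF ij] by simp
    also have "\<dots> \<in> I"
      by (rule idl(6)[OF idl(2)[OF idl(3)[OF hA[OF ij]] idl(3)[OF hip]] idl(3)[OF fA[OF pq(2,1)]]])
    finally show "?y\<^sup>2 * h i j + g * A i j \<in> I" .
  qed
  have "?y\<^sup>2 * f - g * F = ?y * (f * A q p + F * h q p)"
    by (simp add: g_def power2_eq_square algebra_simps)
  then show "?y\<^sup>2 * f - g * F \<in> I" using idl(3)[OF fA[OF pq(2,1)]] by simp
qed

subsection \<open>The derivative of the adjugate\<close>

definition mentry :: "'a mat => nat => nat => 'a" where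
  "mentry S = (\<lambda>i j. S $$ (i, j))"

lemma mentry_mult:
  assumes "A \<in> carrier_mat n n" "B \<in> carrier_mat n n" "i < n" "j < n"
  shows "(A * B) $$ (i, j) = mm n (mentry A) (mentry B) i j"
  using assms by (auto simp: mm_def mentry_def scalar_prod_def atLeast0LessThan)

lemma adj_mat_entry:
  assumes "S \<in> carrier_mat n n" "i < n" "j < n"
  shows "adj_mat S $$ (i, j) = cofactor S j i"
  using assms by (auto simp: adj_mat_def)

lemma adj_mm:
  fixes S :: "'a::comm_ring_1 mat"
  assumes S: "S \<in> carrier_mat n n" and ij: "i < n" "j < n"
  shows "mm n (mentry S) (mentry (adj_mat S)) i j = scal (det S) i j"
    "mm n (mentry (adj_mat S)) (mentry S) i j = scal (det S) i j"
  using mentry_mult[OF S adj_mat(1)[OF S] ij] mentry_mult[OF adj_mat(1)[OF S] S ij]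
    adj_mat(2,3)[OF S] ij by (auto simp: scal_def)

text \<open>Adding the unit matrix changes the determinant by a cofactor, as it is affine in each
  single entry. The cofactors along column \<open>q\<close> and row \<open>p\<close> do not involve
  the changed entry, so the difference of the two adjugates satisfies the equations without a
  second-order error.\<close>

lemma adj_deriv_unit:
  fixes S :: "'a::comm_ring_1 mat"
  assumes S: "S \<in> carrier_mat n n" and pq: "p < n" "q < n"
  shows "\<exists>D. adj_deriv n (mentry S) (mentry (adj_mat S)) (unit_mat p q) D (adj_mat S $$ (q, p))"
proof -
  define S' where "S' = mat n n (\<lambda>(i, j). S $$ (i, j) + unit_mat p q i j)"
  have S': "S' \<in> carrier_mat n n" by (simp add: S'_def)
  let ?A = "mentry (adj_mat S)" and ?A' = "mentry (adj_mat S')" and ?y = "adj_mat S $$ (q, p)"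
  have del1: "mat_delete S' i q = mat_delete S i q" if "i < n" for i
    using S S' that pq by (intro eq_matI) (auto simp: mat_delete_def S'_def unit_mat_def)
  have del2: "mat_delete S' p j = mat_delete S p j" if "j < n" for j
    using S S' that pq by (intro eq_matI) (auto simp: mat_delete_def S'_def unit_mat_def)
  have cof1: "?A' q i = ?A q i" if "i < n" for i
    using del1[OF that] that pq by (simp add: mentry_def adj_mat_entry[OF S] adj_mat_entry[OF S'] cofactor_def)
  have cof2: "?A' j p = ?A j p" if "j < n" for j
    using del2[OF that] that pq by (simp add: mentry_def adj_mat_entry[OF S] adj_mat_entry[OF S'] cofactor_def)
  have det: "det S' = det S + ?y"
  proof -
    have "det S' = (\<Sum>i<n. S' $$ (i, q) * cofactor S' i q)"
      by (rule laplace_expansion_column[OF S' pq(2)])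
    also have "\<dots> = (\<Sum>i<n. S $$ (i, q) * cofactor S i q + (if i = p then cofactor S p q else 0))"
      by (rule sum.cong) (use pq del1 in \<open>auto simp: S'_def unit_mat_def cofactor_def algebra_simps\<close>)
    also have "\<dots> = det S + cofactor S p q"
      using pq by (simp add: sum.distrib laplace_expansion_column[OF S pq(2)])
    finally show ?thesis using pq by (simp add: adj_mat_entry[OF S])
  qed
  have S'eq: "mentry S' i j = (mentry S + unit_mat p q) i j" if "i < n" "j < n" for i j
    using that by (simp add: mentry_def S'_def)
  have "adj_deriv n (mentry S) ?A (unit_mat p q) (?A' - ?A) ?y"
    unfolding adj_deriv_def
  proof (intro allI impI conjI)
    fix i j assume ij: "i < n" "j < n"
    have "scal (det S') i j = mm n (mentry S') ?A' i j" using adj_mm(1)[OF S' ij] by simp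
    also have "\<dots> = mm n (mentry S + unit_mat p q) ?A' i j"
      using S'eq ij by (intro mm_cong_left) auto
    finally have fin: "scal (det S') i j = mm n (mentry S) ?A' i j + mm n (unit_mat p q) ?A i j"
      using ij by (simp add: mm_add_left mm_unit_mat_left[OF pq(2)] cof1)
    have "mm n (mentry S) ?A' i j + mm n (unit_mat p q) ?A i j = scal (det S) i j + scal ?y i j"
      unfolding fin[symmetric] by (simp add: scal_def det)
    then show "mm n (mentry S) (?A' - ?A) i j + mm n (unit_mat p q) ?A i j = scal ?y i j"
      using adj_mm(1)[OF S ij] by (simp add: mm_diff_right algebra_simps)
    have "scal (det S') i j = mm n ?A' (mentry S') i j" using adj_mm(2)[OF S' ij] by simp
    also have "\<dots> = mm n ?A' (mentry S + unit_mat p q) i j"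
      using S'eq ij by (intro mm_cong_right) auto
    finally have fin: "scal (det S') i j = mm n ?A' (mentry S) i j + mm n ?A (unit_mat p q) i j"
      using ij by (simp add: mm_add_right mm_unit_mat_right[OF pq(1)] cof2)
    have "mm n ?A' (mentry S) i j + mm n ?A (unit_mat p q) i j = scal (det S) i j + scal ?y i j"
      unfolding fin[symmetric] by (simp add: scal_def det)
    then show "mm n (?A' - ?A) (mentry S) i j + mm n ?A (unit_mat p q) i j = scal ?y i j"
      using adj_mm(2)[OF S ij] by (simp add: mm_diff_left algebra_simps)
  qed
  then show ?thesis by blast
qed

lemma adj_deriv_add:
  assumes "adj_deriv n S A V D y" "adj_deriv n S A V' D' y'"
  shows "adj_deriv n S A (V + (\<lambda>i j. c * V' i j)) (D + (\<lambda>i j. c * D' i j)) (y + c * y')"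
  unfolding adj_deriv_def
proof (intro allI impI conjI)
  fix i j assume ij: "i < n" "j < n"
  have a: "mm n S D i j + mm n V A i j = scal y i j" "mm n D S i j + mm n A V i j = scal y i j"
    "mm n S D' i j + mm n V' A i j = scal y' i j" "mm n D' S i j + mm n A V' i j = scal y' i j"
    using assms ij by (auto simp: adj_deriv_def)
  have s: "scal (y + c * y') i j = scal y i j + c * scal y' i j" by (simp add: scal_def)
  show "mm n S (D + (\<lambda>i j. c * D' i j)) i j + mm n (V + (\<lambda>i j. c * V' i j)) A i j = scal (y + c * y') i j"
    unfolding s a(1)[symmetric] a(3)[symmetric]
    by (simp add: mm_add_left mm_add_right mm_smult_left mm_smult_right algebra_simps)
  show "mm n (D + (\<lambda>i j. c * D' i j)) S i j + mm n A (V + (\<lambda>i j. c * V' i j)) i j = scal (y + c * y') i j"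
    unfolding s a(2)[symmetric] a(4)[symmetric]
    by (simp add: mm_add_left mm_add_right mm_smult_left mm_smult_right algebra_simps)
qed

lemma adj_deriv_exists:
  fixes S :: "'a::comm_ring_1 mat"
  assumes S: "S \<in> carrier_mat n n"
  shows "\<exists>D. adj_deriv n (mentry S) (mentry (adj_mat S)) V D (mtr n (mentry (adj_mat S)) V)"
proof -
  let ?S = "mentry S" and ?A = "mentry (adj_mat S)"
  define trunc where "trunc K = (\<lambda>i j. if (i, j) \<in> K then V i j else 0)" for K
  have "\<exists>D. adj_deriv n ?S ?A (trunc K) D (\<Sum>(p, q)\<in>K. V p q * ?A q p)"
    if "finite K" "K \<subseteq> {..<n} \<times> {..<n}" for K
    using that
  proof (induction K rule: finite_induct)
    case empty
    have "adj_deriv n ?S ?A (trunc {}) (\<lambda>i j. 0) (\<Sum>(p, q)\<in>{}. V p q * ?A q p)"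
      by (simp add: adj_deriv_def trunc_def mm_def scal_def)
    then show ?case by blast
  next
    case (insert x K)
    obtain p q where x: "x = (p, q)" by (cases x)
    have pq: "p < n" "q < n" using insert.prems x by auto
    obtain D where D: "adj_deriv n ?S ?A (trunc K) D (\<Sum>(p, q)\<in>K. V p q * ?A q p)"
      using insert by auto
    obtain D' where D': "adj_deriv n ?S ?A (unit_mat p q) D' (?A q p)"
      using adj_deriv_unit[OF S pq] by (auto simp: mentry_def)
    have "trunc (insert x K) = trunc K + (\<lambda>i j. V p q * unit_mat p q i j)"
      using insert.hyps(2) by (intro ext) (auto simp: trunc_def x unit_mat_def)
    moreover have "(\<Sum>(p, q)\<in>insert x K. V p q * ?A q p) = (\<Sum>(p, q)\<in>K. V p q * ?A q p) + V p q * ?A q p"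
      using insert.hyps x by (simp add: add.commute)
    ultimately show ?case using adj_deriv_add[OF D D', of "V p q"] by metis
  qed
  from this[of "{..<n} \<times> {..<n}"] obtain D where
    D: "adj_deriv n ?S ?A (trunc ({..<n} \<times> {..<n})) D (\<Sum>(p, q)\<in>{..<n} \<times> {..<n}. V p q * ?A q p)"
    by auto
  have "(\<Sum>(p, q)\<in>{..<n} \<times> {..<n}. V p q * ?A q p) = (\<Sum>p<n. \<Sum>q<n. V p q * ?A q p)"
    by (simp add: sum.cartesian_product)
  also have "\<dots> = mtr n ?A V"
    unfolding mtr_def by (subst sum.swap) (simp add: mult.commute)
  finally have y: "(\<Sum>(p, q)\<in>{..<n} \<times> {..<n}. V p q * ?A q p) = mtr n ?A V" .
  have "mm n (trunc ({..<n} \<times> {..<n})) ?A i j = mm n V ?A i j" if "i < n" for i j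
    using that by (intro mm_cong_left) (auto simp: trunc_def)
  moreover have "mm n ?A (trunc ({..<n} \<times> {..<n})) i j = mm n ?A V i j" if "j < n" for i j
    using that by (intro mm_cong_right) (auto simp: trunc_def)
  ultimately have "adj_deriv n ?S ?A V D (mtr n ?A V)"
    using D unfolding y adj_deriv_def by simp
  then show ?thesis by blast
qed

subsection \<open>Depth: exactness from a regular sequence of pure powers\<close>

lemma is_ideal_mono_ideal: "is_ideal (mono_ideal S N)"
  by (simp add: is_ideal_def mono_ideal_add mono_ideal_mult)

lemma mono_ideal_lift:
  assumes "p \<in> mono_ideal (insert k S) N"
  shows "\<exists>q. p - xp k N * q \<in> mono_ideal S N"
  using mono_ideal_insert[OF assms] by metis

text \<open>Since \<open>(f, h) \<mapsto> (f + S h, - f - h S)\<close> kills \<open>(det S, - adj S)\<close>, the maps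
  \<open>g \<mapsto> (g det S, - g adj S)\<close>, \<open>(f, h) \<mapsto> (f + S h, - f - h S)\<close> and \<open>(\<alpha>, \<beta>) \<mapsto> \<alpha> S + S \<beta>\<close> form a
  complex of free modules. Its homology is killed by the pure powers in the ideal generated by the
  squares of the submaximal minors, so it is exact, also modulo few of these powers.\<close>

locale pure_powers =
  fixes S :: "'x::linorder cpoly mat" and n N :: nat and c :: "'x => nat => nat => 'x cpoly" and K :: "'x set"
  assumes S: "S \<in> carrier_mat n n"
    and pow: "\<And>k. k \<in> K ==> (\<Sum>p<n. \<Sum>q<n. c k p q * (adj_mat S $$ (q, p))\<^sup>2) = xp k N"
begin

abbreviation "s \<equiv> mentry S"
abbreviation "A \<equiv> mentry (adj_mat S)"
abbreviation "F \<equiv> det S"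

lemma pow': "k \<in> K ==> (\<Sum>p<n. \<Sum>q<n. c k p q * (A q p)\<^sup>2) = xp k N"
  using pow by (simp add: mentry_def)

definition V where "V k = (\<lambda>p q. c k p q * A q p)"

lemma mtr_V: "k \<in> K ==> mtr n A (V k) = xp k N"
  unfolding mtr_def V_def pow'[symmetric]
  by (subst sum.swap) (simp add: power2_eq_square mult.left_commute)

text \<open>Summing the entries with the coefficients \<open>c k p q * A q p\<close> turns
  \<open>g A\<close> into \<open>g\<close> times a pure power, which cancels.\<close>

lemma exact_3:
  assumes "k \<in> K" "k \<notin> L" "matI n (mono_ideal L N) (\<lambda>i j. g * A i j)"
  shows "g \<in> mono_ideal L N"
proof -
  have "c k p q * A q p * (g * A q p) \<in> mono_ideal L N" if "p < n" "q < n" for p q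
    using assms(3) that by (intro mono_ideal_mult[of "g * A q p"]) (auto simp: matI_def)
  then have "(\<Sum>p<n. \<Sum>q<n. c k p q * A q p * (g * A q p)) \<in> mono_ideal L N"
    by (intro mono_ideal_sum) auto
  also have "(\<Sum>p<n. \<Sum>q<n. c k p q * A q p * (g * A q p)) = xp k N * g"
    unfolding pow'[OF assms(1), symmetric]
    by (simp add: sum_distrib_left sum_distrib_right power2_eq_square algebra_simps)
  finally show ?thesis by (rule mono_ideal_cancel[OF _ assms(2)])
qed

lemma kill_2:
  assumes k: "k \<in> K"
    and 1: "matI n (mono_ideal L N) (scal f + mm n s h)" and 2: "matI n (mono_ideal L N) (scal f + mm n h s)"
  shows "\<exists>g. matI n (mono_ideal L N) (\<lambda>i j. xp k N * h i j + g * A i j) \<and>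
    xp k N * f - g * F \<in> mono_ideal L N"
proof -
  let ?I = "mono_ideal L N"
  define g where "g p q = - (A q p * h q p)" for p q
  have *: "matI n ?I (\<lambda>i j. (A q p)\<^sup>2 * h i j + g p q * A i j)" "(A q p)\<^sup>2 * f - g p q * F \<in> ?I"
    if pq: "p < n" "q < n" for p q
  proof -
    obtain D where "adj_deriv n s A (unit_mat p q) D (A q p)"
      using adj_deriv_unit[OF S pq] by (auto simp: mentry_def)
    from syzygy_homotopy_2[OF is_ideal_mono_ideal pq this adj_mm(2)[OF S] 1 2]
    show "matI n ?I (\<lambda>i j. (A q p)\<^sup>2 * h i j + g p q * A i j)" "(A q p)\<^sup>2 * f - g p q * F \<in> ?I"
      unfolding g_def by auto
  qed
  define g' where "g' = (\<Sum>p<n. \<Sum>q<n. c k p q * g p q)"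
  have "xp k N * h i j + g' * A i j \<in> ?I" if ij: "i < n" "j < n" for i j
  proof -
    have "xp k N * h i j + g' * A i j =
        (\<Sum>p<n. \<Sum>q<n. c k p q * ((A q p)\<^sup>2 * h i j + g p q * A i j))"
      unfolding pow'[OF k, symmetric] g'_def
      by (simp add: sum_distrib_left sum_distrib_right sum.distrib algebra_simps)
    also have "\<dots> \<in> ?I" using *(1) ij by (intro mono_ideal_sum mono_ideal_mult) (auto simp: matI_def)
    finally show ?thesis .
  qed
  moreover have "xp k N * f - g' * F \<in> ?I"
  proof -
    have "xp k N * f - g' * F = (\<Sum>p<n. \<Sum>q<n. c k p q * ((A q p)\<^sup>2 * f - g p q * F))"
      unfolding pow'[OF k, symmetric] g'_def
      by (simp add: sum_distrib_left sum_distrib_right sum_subtractf algebra_simps)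
    also have "\<dots> \<in> ?I" using *(2) by (intro mono_ideal_sum mono_ideal_mult) auto
    finally show ?thesis .
  qed
  ultimately show ?thesis by (intro exI[of _ g']) (auto simp: matI_def)
qed

text \<open>The descent typical of depth arguments. The homotopy leaves a multiple \<open>g\<close>
  of the neighbouring term; modulo one more power \<open>g\<close> is a cycle there, so exactness at
  that place makes it divisible by \<open>xp k N\<close> up to \<open>mono_ideal L N\<close>, and
  the power cancels. Each further place costs one more power.\<close>

lemma exact_2:
  assumes k: "k \<in> K" "k \<notin> L" and l: "l \<in> K" "l \<notin> insert k L"
    and 1: "matI n (mono_ideal L N) (scal f + mm n s h)" and 2: "matI n (mono_ideal L N) (scal f + mm n h s)"
  shows "\<exists>g. matI n (mono_ideal L N) (\<lambda>i j. h i j + g * A i j) \<and> f - g * F \<in> mono_ideal L N"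
proof -
  let ?I = "mono_ideal L N"
  obtain g where g: "matI n ?I (\<lambda>i j. xp k N * h i j + g * A i j)" "xp k N * f - g * F \<in> ?I"
    using kill_2[OF k(1) 1 2] by blast
  have "matI n (mono_ideal (insert k L) N) (\<lambda>i j. g * A i j)"
    unfolding matI_def
  proof (intro allI impI)
    fix i j assume "i < n" "j < n"
    then have "xp k N * h i j + g * A i j \<in> mono_ideal (insert k L) N"
      using g(1) mono_ideal_mono[of L "insert k L" N] by (auto simp: matI_def)
    moreover have "h i j * xp k N \<in> mono_ideal (insert k L) N"
      by (intro mono_ideal_mult xp_in_mono_ideal) simp
    ultimately have "(xp k N * h i j + g * A i j) - h i j * xp k N \<in> mono_ideal (insert k L) N"
      by (rule mono_ideal_diff)
    then show "g * A i j \<in> mono_ideal (insert k L) N" by (simp add: mult.commute)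
  qed
  then have "g \<in> mono_ideal (insert k L) N" by (rule exact_3[OF l])
  then obtain g' where g': "g - xp k N * g' \<in> ?I" using mono_ideal_lift[of g k L N] by blast
  have "h i j + g' * A i j \<in> ?I" if "i < n" "j < n" for i j
  proof (rule mono_ideal_cancel[OF _ k(2)])
    have "xp k N * (h i j + g' * A i j) = (xp k N * h i j + g * A i j) - A i j * (g - xp k N * g')"
      by (simp add: algebra_simps)
    also have "\<dots> \<in> ?I"
      by (rule mono_ideal_diff[OF _ mono_ideal_mult[OF g']]) (use g(1) that in \<open>simp add: matI_def\<close>)
    finally show "xp k N * (h i j + g' * A i j) \<in> ?I" .
  qed
  moreover have "f - g' * F \<in> ?I"
  proof (rule mono_ideal_cancel[OF _ k(2)])
    have "xp k N * (f - g' * F) = (xp k N * f - g * F) + F * (g - xp k N * g')"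
      by (simp add: algebra_simps)
    also have "\<dots> \<in> ?I" by (rule mono_ideal_add[OF g(2) mono_ideal_mult[OF g']])
    finally show "xp k N * (f - g' * F) \<in> ?I" .
  qed
  ultimately show ?thesis by (auto simp: matI_def)
qed

lemma exact_1:
  assumes k: "k \<in> K" "k \<notin> L" and l: "l \<in> K" "l \<notin> insert k L" and m: "m \<in> K" "m \<notin> insert l (insert k L)"
    and F: "\<And>x. F * x \<in> mono_ideal L N ==> x \<in> mono_ideal L N"
    and R: "matI n (mono_ideal L N) (mm n \<alpha> s + mm n s \<beta>)"
  shows "\<exists>f h. matI n (mono_ideal L N) (\<lambda>i j. \<alpha> i j - (scal f i j + mm n s h i j)) \<and>
    matI n (mono_ideal L N) (\<lambda>i j. \<beta> i j + (scal f i j + mm n h s i j))"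
proof -
  let ?I = "mono_ideal L N" and ?J = "mono_ideal (insert k L) N"
  obtain D where D: "adj_deriv n s A (V k) D (xp k N)"
    using adj_deriv_exists[OF S, of "V k"] mtr_V[OF k(1)] by auto
  obtain D' where D': "adj_deriv n s A (mm n \<alpha> (V k)) D' (mtr n A (mm n \<alpha> (V k)))"
    using adj_deriv_exists[OF S] by blast
  define f where "f = mtr n A (mm n \<alpha> (V k))"
  define h where "h = - mm n \<beta> D - D'"
  have X: "matI n ?I (\<lambda>i j. xp k N * \<alpha> i j - (scal f i j + mm n s h i j))"
    and Y: "matI n ?I (\<lambda>i j. xp k N * \<beta> i j + (scal f i j + mm n h s i j))"
    using syzygy_homotopy_1[OF is_ideal_mono_ideal D D' adj_mm(2)[OF S] F R h_def]
    by (simp_all add: f_def)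
  \<comment> \<open>The homotopy expresses \<open>(f, h)\<close> through \<open>xp k N\<close> times
    the pair, so \<open>(f, h)\<close> is a cycle modulo this power.\<close>
  have J: "matI n ?J (scal f + mm n s h)" "matI n ?J (scal f + mm n h s)"
    unfolding matI_def
  proof (safe)
    fix i j assume ij: "i < n" "j < n"
    have a: "\<alpha> i j * xp k N \<in> ?J" "\<beta> i j * xp k N \<in> ?J"
      by (intro mono_ideal_mult xp_in_mono_ideal; simp)+
    have b: "xp k N * \<alpha> i j - (scal f i j + mm n s h i j) \<in> ?J"
      "xp k N * \<beta> i j + (scal f i j + mm n h s i j) \<in> ?J"
      using X Y ij mono_ideal_mono[of L "insert k L" N] unfolding matI_def by blast+
    show "(scal f + mm n s h) i j \<in> ?J" using mono_ideal_diff[OF a(1) b(1)] by (simp add: algebra_simps)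
    show "(scal f + mm n h s) i j \<in> ?J" using mono_ideal_diff[OF b(2) a(2)] by (simp add: algebra_simps)
  qed
  obtain g where g: "matI n ?J (\<lambda>i j. h i j + g * A i j)" "f - g * F \<in> ?J"
    using exact_2[OF l m J] by blast
  have "\<exists>q. i < n --> j < n --> (h i j + g * A i j) - xp k N * q \<in> ?I" for i j
    using mono_ideal_lift[of "h i j + g * A i j" k L N] g(1) by (auto simp: matI_def)
  then obtain h' where h': "\<And>i j. i < n ==> j < n ==> (h i j + g * A i j) - xp k N * h' i j \<in> ?I"
    by metis
  obtain f' where f': "(f - g * F) - xp k N * f' \<in> ?I" using mono_ideal_lift[OF g(2)] by blast
  define e where "e = (\<lambda>i j. (h i j + g * A i j) - xp k N * h' i j)"
  have e: "matI n ?I e" using h' by (simp add: matI_def e_def)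
  have he: "h = (\<lambda>i j. xp k N * h' i j) - (\<lambda>i j. g * A i j) + e"
    by (intro ext) (simp add: e_def)
  have sA: "mm n s A i j = scal F i j" "mm n A s i j = scal F i j" if "i < n" "j < n" for i j
    using adj_mm[OF S that] by auto
  have sc: "scal f i j - g * scal F i j - xp k N * scal f' i j = scal ((f - g * F) - xp k N * f') i j" for i j
    by (simp add: scal_def)
  have sI: "scal ((f - g * F) - xp k N * f') i j \<in> ?I" for i j
    using f' by (simp add: scal_def)
  have 1: "(scal f i j + mm n s h i j) - xp k N * (scal f' i j + mm n s h' i j) \<in> ?I" if ij: "i < n" "j < n" for i j
  proof -
    have "mm n s h i j = xp k N * mm n s h' i j - g * scal F i j + mm n s e i j"
      by (subst he) (use sA ij in \<open>simp add: mm_add_right mm_diff_right mm_smult_right\<close>)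
    then have "(scal f i j + mm n s h i j) - xp k N * (scal f' i j + mm n s h' i j) =
        scal ((f - g * F) - xp k N * f') i j + mm n s e i j"
      unfolding sc[symmetric] by (simp add: algebra_simps)
    also have "\<dots> \<in> ?I"
      using sI matI_mm_right[OF is_ideal_mono_ideal e, of s] ij
      by (intro mono_ideal_add) (auto simp: matI_def)
    finally show ?thesis .
  qed
  have 2: "(scal f i j + mm n h s i j) - xp k N * (scal f' i j + mm n h' s i j) \<in> ?I" if ij: "i < n" "j < n" for i j
  proof -
    have "mm n h s i j = xp k N * mm n h' s i j - g * scal F i j + mm n e s i j"
      by (subst he) (use sA ij in \<open>simp add: mm_add_left mm_diff_left mm_smult_left\<close>)
    then have "(scal f i j + mm n h s i j) - xp k N * (scal f' i j + mm n h' s i j) =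
        scal ((f - g * F) - xp k N * f') i j + mm n e s i j"
      unfolding sc[symmetric] by (simp add: algebra_simps)
    also have "\<dots> \<in> ?I"
      using sI matI_mm_left[OF is_ideal_mono_ideal e, of s] ij
      by (intro mono_ideal_add) (auto simp: matI_def)
    finally show ?thesis .
  qed
  have "\<alpha> i j - (scal f' i j + mm n s h' i j) \<in> ?I" if ij: "i < n" "j < n" for i j
  proof (rule mono_ideal_cancel[OF _ k(2)])
    have "xp k N * (\<alpha> i j - (scal f' i j + mm n s h' i j)) =
        (xp k N * \<alpha> i j - (scal f i j + mm n s h i j)) +
        ((scal f i j + mm n s h i j) - xp k N * (scal f' i j + mm n s h' i j))"
      by (simp add: algebra_simps)
    also have "\<dots> \<in> ?I" by (rule mono_ideal_add[OF _ 1[OF ij]]) (use X ij in \<open>simp add: matI_def\<close>)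
    finally show "xp k N * (\<alpha> i j - (scal f' i j + mm n s h' i j)) \<in> ?I" .
  qed
  moreover have "\<beta> i j + (scal f' i j + mm n h' s i j) \<in> ?I" if ij: "i < n" "j < n" for i j
  proof (rule mono_ideal_cancel[OF _ k(2)])
    have "xp k N * (\<beta> i j + (scal f' i j + mm n h' s i j)) =
        (xp k N * \<beta> i j + (scal f i j + mm n h s i j)) -
        ((scal f i j + mm n h s i j) - xp k N * (scal f' i j + mm n h' s i j))"
      by (simp add: algebra_simps)
    also have "\<dots> \<in> ?I" by (rule mono_ideal_diff[OF _ 2[OF ij]]) (use Y ij in \<open>simp add: matI_def\<close>)
    finally show "xp k N * (\<beta> i j + (scal f' i j + mm n h' s i j)) \<in> ?I" .
  qed
  ultimately show ?thesis by (intro exI[of _ f'] exI[of _ h']) (auto simp: matI_def)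
qed

text \<open>The homotopy uses the first power, and \<open>exact_1\<close> is applied modulo it with
  the three others, so all four variables are exhausted here. The determinant has to cancel modulo
  the first power.\<close>

lemma exact_0:
  assumes K: "{k0, k1, k2, k3} \<subseteq> K" "distinct [k0, k1, k2, k3]"
    and F: "\<And>x. F * x \<in> mono_ideal {k0} N ==> x \<in> mono_ideal {k0} N"
    and T: "mtr n A T = 0"
  shows "\<exists>\<alpha> \<beta>. \<forall>i<n. \<forall>j<n. T i j = mm n \<alpha> s i j + mm n s \<beta> i j"
proof -
  obtain D where D: "adj_deriv n s A (V k0) D (xp k0 N)"
    using adj_deriv_exists[OF S, of "V k0"] mtr_V[of k0] K by auto
  obtain D' where D': "adj_deriv n s A T D' 0"
    using adj_deriv_exists[OF S, of T] T by auto
  define \<alpha> where "\<alpha> = mm n T D"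
  define \<beta> where "\<beta> = - mm n D' (V k0)"
  have yT: "xp k0 N * T i j = mm n \<alpha> s i j + mm n s \<beta> i j" if "i < n" "j < n" for i j
    using syzygy_homotopy_0[OF D D' that] by (simp add: \<alpha>_def \<beta>_def)
  have "matI n (mono_ideal {k0} N) (mm n \<alpha> s + mm n s \<beta>)"
    unfolding matI_def
  proof (intro allI impI)
    fix i j assume ij: "i < n" "j < n"
    have "T i j * xp k0 N \<in> mono_ideal {k0} N" by (intro mono_ideal_mult xp_in_mono_ideal) simp
    then show "(mm n \<alpha> s + mm n s \<beta>) i j \<in> mono_ideal {k0} N"
      using yT[OF ij] by (simp add: mult.commute)
  qed
  then obtain f h where
    a: "matI n (mono_ideal {k0} N) (\<lambda>i j. \<alpha> i j - (scal f i j + mm n s h i j))"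
    and b: "matI n (mono_ideal {k0} N) (\<lambda>i j. \<beta> i j + (scal f i j + mm n h s i j))"
    using exact_1[of k1 "{k0}" k2 k3 \<alpha> \<beta>] K F by auto
  have "\<exists>q. i < n --> j < n --> \<alpha> i j - (scal f i j + mm n s h i j) = xp k0 N * q" for i j
    using mono_ideal_lift[of "\<alpha> i j - (scal f i j + mm n s h i j)" k0 "{}" N] a
    by (auto simp: matI_def mono_ideal_empty)
  then obtain \<alpha>' where \<alpha>': "\<And>i j. i < n ==> j < n ==> \<alpha> i j - (scal f i j + mm n s h i j) = xp k0 N * \<alpha>' i j"
    by metis
  have "\<exists>q. i < n --> j < n --> \<beta> i j + (scal f i j + mm n h s i j) = xp k0 N * q" for i j
    using mono_ideal_lift[of "\<beta> i j + (scal f i j + mm n h s i j)" k0 "{}" N] b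
    by (auto simp: matI_def mono_ideal_empty)
  then obtain \<beta>' where \<beta>': "\<And>i j. i < n ==> j < n ==> \<beta> i j + (scal f i j + mm n h s i j) = xp k0 N * \<beta>' i j"
    by metis
  have "T i j = mm n \<alpha>' s i j + mm n s \<beta>' i j" if ij: "i < n" "j < n" for i j
  proof -
    have "mm n \<alpha> s i j = mm n ((scal f + mm n s h) + (\<lambda>i j. xp k0 N * \<alpha>' i j)) s i j"
      by (intro mm_cong_left) (use \<alpha>' ij in \<open>simp add: algebra_simps\<close>)
    also have "\<dots> = f * s i j + mm n (mm n s h) s i j + xp k0 N * mm n \<alpha>' s i j"
      using ij by (simp add: mm_add_left mm_scal_left mm_smult_left)
    finally have 1: "mm n \<alpha> s i j = f * s i j + mm n s (mm n h s) i j + xp k0 N * mm n \<alpha>' s i j"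
      by (simp add: mm_assoc)
    have "mm n s \<beta> i j = mm n s ((\<lambda>i j. xp k0 N * \<beta>' i j) - (scal f + mm n h s)) i j"
      by (intro mm_cong_right) (use \<beta>' ij in \<open>simp add: algebra_simps\<close>)
    also have "\<dots> = xp k0 N * mm n s \<beta>' i j - (f * s i j + mm n s (mm n h s) i j)"
      using ij by (simp add: mm_add_right mm_diff_right mm_scal_right mm_smult_right)
    finally have "xp k0 N * T i j = xp k0 N * (mm n \<alpha>' s i j + mm n s \<beta>' i j)"
      using yT[OF ij] 1 by (simp add: algebra_simps)
    then show ?thesis by simp
  qed
  then show ?thesis by blast
qed

lemma exact_kernel:
  assumes K: "{k0, k1, k2} \<subseteq> K" "distinct [k0, k1, k2]" and F: "F \<noteq> 0"
    and 0: "\<And>i j. i < n ==> j < n ==> mm n \<alpha> s i j + mm n s \<beta> i j = 0"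
  shows "\<exists>f h. \<forall>i<n. \<forall>j<n. \<alpha> i j = scal f i j + mm n s h i j \<and> \<beta> i j = - (scal f i j + mm n h s i j)"
proof -
  have "matI n (mono_ideal {} N) (mm n \<alpha> s + mm n s \<beta>)" using 0 by (simp add: matI_def mono_ideal_empty)
  then obtain f h where "matI n (mono_ideal {} N) (\<lambda>i j. \<alpha> i j - (scal f i j + mm n s h i j))"
    "matI n (mono_ideal {} N) (\<lambda>i j. \<beta> i j + (scal f i j + mm n h s i j))"
    using exact_1[of k0 "{}" k1 k2 \<alpha> \<beta>] K F by (auto simp: mono_ideal_empty)
  then show ?thesis
    unfolding matI_def mono_ideal_empty eq_neg_iff_add_eq_0
    by (intro exI[of _ f] exI[of _ h]) auto
qed

end

text \<open>A polynomial that does not vanish identically on the hyperplane of the variable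
  \<open>k\<close> is a nonzerodivisor modulo every power of this variable, because the variable is
  prime.\<close>

lemma mono_ideal_prime:
  fixes F p :: "'x::linorder cpoly"
  assumes F: "peval F v \<noteq> 0" "v k = 0" and Fp: "F * p \<in> mono_ideal {k} N"
  shows "p \<in> mono_ideal {k} N"
  using Fp
proof (induction N arbitrary: p)
  case (Suc N)
  have "mono_ideal {k} (Suc N) \<subseteq> mono_ideal {k} 1" by (auto simp: mono_ideal_def)
  then have Fp1: "F * p \<in> mono_ideal {k} 1" using Suc.prems by blast
  have zero: "peval q u = 0" if q: "q \<in> mono_ideal {k} 1" and u: "u k = 0" for q :: "'x cpoly" and u
  proof -
    obtain r where "q - xp k 1 * r \<in> mono_ideal {} 1" using mono_ideal_lift[OF q] by blast
    then have "q = xp k 1 * r" by (simp add: mono_ideal_empty)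
    then show ?thesis using u by simp
  qed
  \<comment> \<open>The restriction of \<open>q\<close> to the hyperplane, as a polynomial free of
    the variable \<open>k\<close>.\<close>
  define part where "part q = (\<Sum>m | m \<in> supp q \<and> expo m k = 0. mon m (coef q m))" for q :: "'x cpoly"
  have cp: "coef (part q) m = (if expo m k = 0 then coef q m else 0)" for q m
    by (auto simp: part_def lookup_sum lookup_single when_def in_keys_iff)
  have qp: "q - part q \<in> mono_ideal {k} 1" for q
    by (auto simp: mono_ideal_def in_keys_iff lookup_minus cp split: if_splits)
  have part_eval: "peval (part q) u = peval (part q) (u(k := 0))" for q u
  proof -
    have "meval u m = meval (u(k := 0)) m" if "m \<in> supp (part q)" for m
    proof -
      have "expo m k = 0" using that by (auto simp: in_keys_iff cp split: if_splits)
      then show ?thesis unfolding meval_def by (intro prod.cong) (auto simp: in_keys_iff)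
    qed
    then show ?thesis by (simp add: peval_meval)
  qed
  have val: "peval q (u(k := 0)) = peval (part q) u" for q u
    using zero[OF qp[of q], of "u(k := 0)"] part_eval[of q u] by simp
  have "part F * part p = 0"
  proof (rule peval_eq_0_imp)
    fix u
    show "peval (part F * part p) u = 0"
      using zero[OF Fp1, of "u(k := 0)"] by (simp flip: val)
  qed
  moreover have "part F \<noteq> 0"
  proof -
    have "v(k := 0) = v" using F(2) by auto
    then have "peval (part F) v \<noteq> 0" using F(1) val[of F v] by simp
    then show ?thesis by auto
  qed
  ultimately have "part p = 0" by simp
  then have "p \<in> mono_ideal {k} 1" using qp[of p] by simp
  then obtain r where r: "p = xp k 1 * r"
    using mono_ideal_lift[of p k "{}" 1] by (auto simp: mono_ideal_empty)
  have shift: "xp k 1 * q \<in> mono_ideal {k} (Suc N) \<longleftrightarrow> q \<in> mono_ideal {k} N" for q :: "'x cpoly"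
    by (auto simp: mono_ideal_def keys_xp_mult lookup_add)
  have "F * p = xp k 1 * (F * r)" by (simp add: r algebra_simps)
  then have "xp k 1 * (F * r) \<in> mono_ideal {k} (Suc N)" using Suc.prems by argo
  then have "F * r \<in> mono_ideal {k} N" using shift[of "F * r"] by blast
  then have "r \<in> mono_ideal {k} N" by (rule Suc.IH)
  then show ?case using shift r by simp
qed (simp add: mono_ideal_def)

section \<open>The Nullstellensatz\<close>

lemma (in vector_space) family_bound:
  assumes "finite X" "finite B" "\<And>x. x \<in> X ==> e x \<in> span B"
    and indep: "\<And>c. (\<Sum>x\<in>X. scale (c x) (e x)) = 0 ==> \<forall>x\<in>X. c x = 0"
  shows "card X \<le> card B"
proof -
  let ?V = "{v. \<exists>c. v = (\<Sum>x\<in>X. scale (c x) (e x))}"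
  have d: "dim ?V = card X"
  proof (rule dim_family[OF assms(1) _ indep])
    fix x assume "x \<in> X"
    then have "e x = (\<Sum>y\<in>X. scale (if y = x then 1 else 0) (e y))"
      using assms(1) by (simp add: if_distrib[of "\<lambda>c. scale c _"] cong: if_cong)
    then show "e x \<in> ?V" by (intro CollectI exI[of _ "\<lambda>y. if y = x then 1 else 0"])
  qed auto
  have "?V \<subseteq> span B" using assms(3) by (auto intro!: span_sum span_scale)
  then have "dim ?V \<le> card B" by (rule dim_le_card[OF _ assms(2)])
  with d show ?thesis by simp
qed

lemma ev_exists: "\<exists>q :: 'x cpoly. \<forall>v. peval q v = poly Q (v i)"
proof (induction Q)
  case 0
  then show ?case by (intro exI[of _ 0]) simp
next
  case (pCons c Q)
  then obtain q :: "'x cpoly" where "\<forall>v. peval q v = poly Q (v i)" by blast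
  then show ?case by (intro exI[of _ "mon 0 c + xp i 1 * q"]) simp
qed

text \<open>A polynomial in one variable evaluated at the variable \<open>i\<close>. Polynomials are
  determined by their values, so the choice is unique.\<close>

definition ev :: "'x => complex poly => 'x cpoly" where
  "ev i Q = (SOME q. \<forall>v. peval q v = poly Q (v i))"

lemma peval_ev: "peval (ev i Q) v = poly Q (v i)"
  unfolding ev_def using someI_ex[OF ev_exists[of Q i]] by blast

lemma ev_mult: "ev i (P * Q) = ev i P * ev i Q"
  by (rule peval_eq_imp) (simp add: peval_ev)

definition bdd_forms :: "nat => form set" where
  "bdd_forms n = {p. \<forall>m\<in>supp p. mono_deg m \<le> n}"

lemma finite_monomials_le: "finite {m :: 4 \<Rightarrow>\<^sub>0 nat. mono_deg m \<le> n}"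
proof -
  have "{m :: 4 \<Rightarrow>\<^sub>0 nat. mono_deg m \<le> n} = (\<Union>k\<le>n. {m. mono_deg m = k})" by auto
  then show ?thesis by simp
qed

lemma bdd_forms_span: "p \<in> bdd_forms n ==> p \<in> fvs.span ((\<lambda>m. mon m 1) ` {m. mono_deg m \<le> n})"
proof -
  assume p: "p \<in> bdd_forms n"
  have "p = (\<Sum>m\<in>supp p. scale_form (coef p m) (mon m 1))"
    using cpoly_decomp[of p] by (simp add: scale_form_eq mult_single)
  also have "\<dots> \<in> fvs.span ((\<lambda>m. mon m 1) ` {m. mono_deg m \<le> n})"
    using p by (intro fvs.span_sum fvs.span_scale fvs.span_base) (auto simp: bdd_forms_def)
  finally show ?thesis .
qed

definition ideal_adjoin :: "form set => form => form set" where
  "ideal_adjoin K g = {k + h * g | k h. k \<in> K}"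

lemma ideal_adjoinI: "k \<in> K ==> k + h * g \<in> ideal_adjoin K g"
  unfolding ideal_adjoin_def by blast

lemma is_ideal_adjoin:
  assumes "is_ideal K"
  shows "is_ideal (ideal_adjoin K g)"
  unfolding is_ideal_def
proof (intro conjI ballI allI)
  show "0 \<in> ideal_adjoin K g"
    using ideal_adjoinI[OF is_idealD(1)[OF assms], of 0 g] by simp
  fix x assume "x \<in> ideal_adjoin K g"
  then obtain k h where x: "x = k + h * g" "k \<in> K" by (auto simp: ideal_adjoin_def)
  show "r * x \<in> ideal_adjoin K g" for r
    using ideal_adjoinI[OF is_idealD(3)[OF assms x(2), of r], of "r * h" g]
    by (simp add: x(1) algebra_simps)
  fix y assume "y \<in> ideal_adjoin K g"
  then obtain k' h' where y: "y = k' + h' * g" "k' \<in> K" by (auto simp: ideal_adjoin_def)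
  show "x + y \<in> ideal_adjoin K g"
    using ideal_adjoinI[OF is_idealD(2)[OF assms x(2) y(2)], of "h + h'" g]
    by (simp add: x(1) y(1) algebra_simps)
qed

lemma ideal_adjoin_superset: "K \<subseteq> ideal_adjoin K g"
  using ideal_adjoinI[of _ K 0 g] by auto

lemma ideal_adjoin_mem: "is_ideal K ==> g \<in> ideal_adjoin K g"
  using ideal_adjoinI[of 0 K 1 g] is_idealD(1)[of K] by simp

text \<open>If no value of the variable is allowed, then all \<open>x - c\<close> have inverses modulo \<open>K\<close>. Uncountably
  many of these inverses have bounded degree, so they are linearly dependent. Clearing
  denominators puts a nonzero polynomial in \<open>x\<close> alone into \<open>K\<close>, and its linear factors cancel.\<close>

lemma proper_ideal_adjoin:
  assumes K: "is_ideal K" "1 \<notin> K"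
  shows "\<exists>c. 1 \<notin> ideal_adjoin K (xp i 1 - mon 0 c)"
proof (rule ccontr)
  assume "\<not> ?thesis"
  then have "\<exists>k h. 1 = k + h * (xp i 1 - mon 0 c) \<and> k \<in> K" for c
    unfolding ideal_adjoin_def by blast
  then obtain kk h where h: "\<And>c. 1 = kk c + h c * (xp i 1 - mon 0 c)" "\<And>c. kk c \<in> K" by metis
  have X: "xp i 1 - mon 0 c = ev i [:- c, 1:]" for c
    by (rule peval_eq_imp) (simp add: peval_ev)
  have inv: "h c * ev i [:- c, 1:] = 1 - kk c" for c
    using h(1)[of c] unfolding X by (simp add: algebra_simps)
  have cancel: "1 \<in> K" if "Q \<noteq> 0" "ev i Q \<in> K" for Q
    using that
  proof (induction "degree Q" arbitrary: Q rule: less_induct)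
    case less
    show ?case
    proof (cases "\<exists>r. poly Q r = 0")
      case True
      then obtain r where "poly Q r = 0" by blast
      then obtain Q1 where Q1: "Q = [:- r, 1:] * Q1" by (metis dvdE poly_eq_0_iff_dvd)
      have n: "Q1 \<noteq> 0" using Q1 less.prems(1) by auto
      have "degree Q = degree [:- r, 1:] + degree Q1"
        unfolding Q1 by (rule degree_mult_eq) (use n in auto)
      then have "degree Q1 < degree Q" by simp
      moreover have "ev i Q1 \<in> K"
      proof -
        have "h r * ev i Q = (1 - kk r) * ev i Q1"
          unfolding Q1 ev_mult by (simp add: inv mult.assoc[symmetric])
        then have "ev i Q1 = h r * ev i Q + ev i Q1 * kk r" by (simp add: algebra_simps)
        also have "\<dots> \<in> K"
          by (rule is_idealD(2)[OF K(1) is_idealD(3)[OF K(1) less.prems(2)] is_idealD(3)[OF K(1) h(2)]])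
        finally show ?thesis .
      qed
      ultimately show ?thesis using less.hyps n by blast
    next
      case False
      have "degree Q = 0"
        using fundamental_theorem_of_algebra[of Q] constant_degree[of Q] False by blast
      then obtain c where c: "Q = [:c:]" by (metis degree_eq_zeroE)
      then have "c \<noteq> 0" using less.prems(1) by auto
      then have "mon 0 (inverse c) * ev i Q = 1"
        by (intro peval_eq_imp) (simp add: peval_ev c)
      then show ?thesis using is_idealD(3)[OF K(1) less.prems(2), of "mon 0 (inverse c)"] by simp
    qed
  qed
  define C where "C n = {r :: real. h (of_real r) \<in> bdd_forms n}" for n
  have "(UNIV :: real set) = (\<Union>n. C n)"
  proof -
    have "\<exists>n. h (of_real r) \<in> bdd_forms n" for r :: real
    proof -
      let ?M = "insert 0 (mono_deg ` supp (h (of_real r)))"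
      have "h (of_real r) \<in> bdd_forms (Max ?M)" by (auto simp: bdd_forms_def)
      then show ?thesis by blast
    qed
    then show ?thesis by (auto simp: C_def)
  qed
  then have "\<exists>n. infinite (C n)"
    using uncountable_UNIV_real countable_UN[of "UNIV :: nat set" C] countable_finite by (metis countableI_type)
  then obtain n where "infinite (C n)" by blast
  let ?B = "(\<lambda>m :: 4 \<Rightarrow>\<^sub>0 nat. mon m (1 :: complex)) ` {m. mono_deg m \<le> n}"
  obtain R where R: "R \<subseteq> C n" "finite R" "card R = Suc (card ?B)"
    using infinite_arbitrarily_large[OF \<open>infinite (C n)\<close>] by blast
  have "\<not> (\<forall>u. (\<Sum>r\<in>R. scale_form (u r) (h (of_real r))) = 0 --> (\<forall>r\<in>R. u r = 0))"
  proof
    assume *: "\<forall>u. (\<Sum>r\<in>R. scale_form (u r) (h (of_real r))) = 0 --> (\<forall>r\<in>R. u r = 0)"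
    have "card R \<le> card ?B"
    proof (rule fvs.family_bound[OF R(2), where e = "\<lambda>r. h (of_real r)"])
      show "finite ?B" using finite_monomials_le by simp
      show "h (of_real r) \<in> fvs.span ?B" if "r \<in> R" for r
        by (rule bdd_forms_span) (use that R(1) in \<open>auto simp: C_def\<close>)
    qed (use * in blast)
    with R(3) show False by simp
  qed
  then obtain u r0 where u: "(\<Sum>r\<in>R. scale_form (u r) (h (of_real r))) = 0" "r0 \<in> R" "u r0 \<noteq> 0"
    by blast
  define lin :: "real => complex poly" where "lin r = [:- of_real r, 1:]" for r
  \<comment> \<open>The numerator of the sum of the fractions \<open>u r / (x - r)\<close>. At
    \<open>r0\<close> only the summand of \<open>r0\<close> survives.\<close>
  define Q where "Q = (\<Sum>r\<in>R. [:u r:] * (\<Prod>r'\<in>R - {r}. lin r'))"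
  have "poly Q (of_real r0) = (\<Sum>r\<in>R. if r = r0 then u r0 * (\<Prod>r'\<in>R - {r0}. of_real r0 - of_real r') else 0)"
    unfolding Q_def poly_sum
  proof (rule sum.cong)
    fix r assume "r \<in> R"
    show "poly ([:u r:] * (\<Prod>r'\<in>R - {r}. lin r')) (of_real r0) =
        (if r = r0 then u r0 * (\<Prod>r'\<in>R - {r0}. of_real r0 - of_real r') else 0)"
    proof (cases "r = r0")
      case False
      then have "(\<Prod>r'\<in>R - {r}. poly (lin r') (of_real r0)) = 0"
        using u(2) R(2) by (intro prod_zero) (auto simp: lin_def)
      then show ?thesis using False by (simp add: poly_prod)
    qed (simp add: poly_prod lin_def)
  qed simp
  also have "\<dots> = u r0 * (\<Prod>r'\<in>R - {r0}. of_real r0 - of_real r')" using R(2) u(2) by simp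
  also have "\<dots> \<noteq> 0" using u(3) R(2) by auto
  finally have "Q \<noteq> 0" by auto
  moreover have "ev i Q \<in> K"
  proof -
    define P where "P = (\<Prod>r\<in>R. lin r)"
    have P: "ev i P = ev i (lin r) * ev i (\<Prod>r'\<in>R - {r}. lin r')" if "r \<in> R" for r
      unfolding P_def ev_mult[symmetric] using that R(2) by (simp add: prod.remove)
    have "0 = (\<Sum>r\<in>R. scale_form (u r) (h (of_real r))) * ev i P" using u(1) by simp
    also have "\<dots> = (\<Sum>r\<in>R. mon 0 (u r) * ((1 - kk (of_real r)) * ev i (\<Prod>r'\<in>R - {r}. lin r')))"
      unfolding sum_distrib_right
    proof (rule sum.cong)
      fix r assume r: "r \<in> R"
      have "scale_form (u r) (h (of_real r)) * ev i P =
          mon 0 (u r) * ((h (of_real r) * ev i (lin r)) * ev i (\<Prod>r'\<in>R - {r}. lin r'))"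
        unfolding scale_form_eq P[OF r] by (simp add: mult.assoc)
      then show "scale_form (u r) (h (of_real r)) * ev i P =
          mon 0 (u r) * ((1 - kk (of_real r)) * ev i (\<Prod>r'\<in>R - {r}. lin r'))"
        unfolding lin_def inv by simp
    qed simp
    also have "\<dots> = (\<Sum>r\<in>R. mon 0 (u r) * ev i (\<Prod>r'\<in>R - {r}. lin r')) -
        (\<Sum>r\<in>R. mon 0 (u r) * ev i (\<Prod>r'\<in>R - {r}. lin r') * kk (of_real r))"
      unfolding sum_subtractf[symmetric] by (rule sum.cong) (simp_all add: algebra_simps)
    also have "(\<Sum>r\<in>R. mon 0 (u r) * ev i (\<Prod>r'\<in>R - {r}. lin r')) = ev i Q"
      by (rule peval_eq_imp) (simp add: peval_ev Q_def poly_sum)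
    finally have "ev i Q = (\<Sum>r\<in>R. mon 0 (u r) * ev i (\<Prod>r'\<in>R - {r}. lin r') * kk (of_real r))" by simp
    also have "\<dots> \<in> K" by (intro is_ideal_sum[OF K(1)] is_idealD(3)[OF K(1)] h(2))
    finally show ?thesis .
  qed
  ultimately show False using cancel K(2) by blast
qed

text \<open>One variable at a time is forced to a value while the ideal stays proper. Every
  polynomial is then congruent to its value at the resulting point, so the members of
  \<open>K\<close> vanish there.\<close>

theorem nullstellensatz:
  assumes K: "is_ideal K" "1 \<notin> (K :: form set)"
  shows "\<exists>v. \<forall>p\<in>K. peval p v = 0"
proof -
  have "\<exists>K' v. is_ideal K' \<and> 1 \<notin> K' \<and> K \<subseteq> K' \<and> (\<forall>i\<in>J. xp i 1 - mon 0 (v i) \<in> K')"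
    if "finite J" for J :: "4 set"
    using that
  proof (induction J rule: finite_induct)
    case empty
    then show ?case using K by blast
  next
    case (insert j J)
    then obtain K' v where K': "is_ideal K'" "1 \<notin> K'" "K \<subseteq> K'" "\<forall>i\<in>J. xp i 1 - mon 0 (v i) \<in> K'"
      by blast
    obtain c where c: "1 \<notin> ideal_adjoin K' (xp j 1 - mon 0 c)"
      using proper_ideal_adjoin[OF K'(1,2)] by blast
    show ?case
    proof (intro exI conjI)
      show "is_ideal (ideal_adjoin K' (xp j 1 - mon 0 c))" by (rule is_ideal_adjoin[OF K'(1)])
      show "K \<subseteq> ideal_adjoin K' (xp j 1 - mon 0 c)" using K'(3) ideal_adjoin_superset by blast
      show "\<forall>i\<in>insert j J. xp i 1 - mon 0 ((v(j := c)) i) \<in> ideal_adjoin K' (xp j 1 - mon 0 c)"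
        using K'(4) insert.hyps(2) ideal_adjoin_superset[of K'] ideal_adjoin_mem[OF K'(1)] by auto
    qed (rule c)
  qed
  from this[of UNIV] obtain K' v where K': "is_ideal K'" "1 \<notin> K'" "K \<subseteq> K'"
    "\<And>i. xp i 1 - mon 0 (v i) \<in> K'" by auto
  note idl = is_idealD[OF K'(1)]
  define G where "G = {p :: form. p - mon 0 (peval p v) \<in> K'}"
  have c: "mon 0 c \<in> G" for c using idl(1) by (simp add: G_def)
  have m: "p * q \<in> G" if "p \<in> G" "q \<in> G" for p q
  proof -
    have "p * q - mon 0 (peval (p * q) v) =
        p * (q - mon 0 (peval q v)) + mon 0 (peval q v) * (p - mon 0 (peval p v))"
      by (simp add: algebra_simps mult_single)
    also have "\<dots> \<in> K'" using that unfolding G_def by (intro idl(2) idl(3)[of "q - _"] idl(3)[of "p - _"]) auto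
    finally show ?thesis by (simp add: G_def)
  qed
  have pw: "xp i k \<in> G" for i k
  proof (induction k)
    case 0
    then show ?case using c[of 1] by simp
  next
    case (Suc k)
    have "xp i 1 \<in> G" using K'(4)[of i] by (simp add: G_def)
    from m[OF this Suc] show ?case by (simp flip: xp_add)
  qed
  have "p \<in> G" for p
  proof (induction p rule: cpoly_induct)
    case (mon m' c')
    have pr: "(\<Prod>i\<in>I. xp i (expo m' i)) \<in> G" for I
      by (induction I rule: infinite_finite_induct) (use c[of 1] m pw in auto)
    have "mon m' c' = mon 0 c' * (\<Prod>i\<in>supp m'. xp i (expo m' i))"
      by (rule peval_eq_imp) (simp add: meval_def)
    then show ?case using m[OF c pr] by simp
  next
    case (add p q)
    have "(p + q) - mon 0 (peval (p + q) v) = (p - mon 0 (peval p v)) + (q - mon 0 (peval q v))"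
      by (simp add: single_add)
    also have "\<dots> \<in> K'" by (rule idl(2)) (use add in \<open>auto simp: G_def\<close>)
    finally show ?case by (simp add: G_def)
  qed
  then have "peval p v = 0" if "p \<in> K" for p
  proof -
    have "p - (p - mon 0 (peval p v)) \<in> K'"
      by (rule idl(6)) (use \<open>\<And>p. p \<in> G\<close> K'(3) that in \<open>auto simp: G_def\<close>)
    then have "mon 0 (inverse (peval p v)) * mon 0 (peval p v) \<in> K'" by (intro idl(3)) simp
    then show ?thesis using K'(2) by (cases "peval p v = 0") (auto simp: mult_single)
  qed
  then show ?thesis by blast
qed

lemma xp_power_diff: "\<exists>r. xp k n - 1 = r * (xp k 1 - 1)"
proof (induction n)
  case (Suc n)
  then obtain r where r: "xp k n - 1 = r * (xp k 1 - 1)" by blast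
  have "xp k (Suc n) = xp k 1 * xp k n" by (simp flip: xp_add)
  then have "xp k (Suc n) - 1 = xp k 1 * (xp k n - 1) + (xp k 1 - 1)" by (simp add: algebra_simps)
  then have "xp k (Suc n) - 1 = (xp k 1 * r + 1) * (xp k 1 - 1)"
    unfolding r by (simp add: algebra_simps)
  then show ?case by blast
qed (intro exI[of _ 0], simp)

text \<open>Dehomogenisation at the value \<open>1\<close> of variable \<open>k\<close>. Elements of
  \<open>L\<close> are a single homogeneous member of \<open>K\<close> plus a multiple of
  \<open>xp k 1 - 1\<close>; sums stay of this kind because powers of the variable equalise the
  degrees. From \<open>1 \<in> L\<close> the homogeneous member is identified as a power of the
  variable.\<close>

theorem projective_nullstellensatz:
  assumes K: "is_ideal (K :: form set)"
    and g: "\<And>v. nz v ==> \<exists>g n. g \<in> K \<and> homog n g \<and> peval g v \<noteq> 0"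
  shows "\<exists>N. xp k N \<in> K"
proof -
  define L where "L = {q. \<exists>N Q h. homog (int N) Q \<and> Q \<in> K \<and> q = Q + h * (xp k 1 - 1)}"
  have LI: "Q + h * (xp k 1 - 1) \<in> L" if "homog (int N) Q" "Q \<in> K" for Q N h
    using that unfolding L_def by blast
  have L_add: "q + q' \<in> L" if qL: "q \<in> L" "q' \<in> L" for q q'
  proof -
    from qL(1) obtain N Q h where q: "homog (int N) Q" "Q \<in> K" "q = Q + h * (xp k 1 - 1)"
      unfolding L_def by blast
    from qL(2) obtain N' Q' h' where q': "homog (int N') Q'" "Q' \<in> K" "q' = Q' + h' * (xp k 1 - 1)"
      unfolding L_def by blast
    obtain r r' where r: "xp k N - 1 = r * (xp k 1 - 1)" "xp k N' - 1 = r' * (xp k 1 - 1)"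
      using xp_power_diff by meson
    have "q + q' = (xp k N' * Q + xp k N * Q') + (h + h' - r' * Q - r * Q') * (xp k 1 - 1)"
    proof -
      have e: "xp k N = r * (xp k 1 - 1) + 1" "xp k N' = r' * (xp k 1 - 1) + 1"
        using r by (auto simp: diff_eq_eq)
      show ?thesis unfolding q(3) q'(3) e by (simp add: algebra_simps)
    qed
    moreover have "homog (int (N + N')) (xp k N' * Q + xp k N * Q')"
      using q(1) q'(1) homog_xp[of N k] homog_xp[of N' k]
      by (intro homog_add) (auto intro: homog_mult')
    moreover have "xp k N' * Q + xp k N * Q' \<in> K"
      by (intro is_idealD(2)[OF K] is_idealD(3)[OF K] q(2) q'(2))
    ultimately show ?thesis using LI by metis
  qed
  have "r * q \<in> L" if qL: "q \<in> L" for q r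
  proof (induction r rule: cpoly_induct)
    case (mon m c)
    from qL obtain N Q h where q: "homog (int N) Q" "Q \<in> K" "q = Q + h * (xp k 1 - 1)"
      unfolding L_def by blast
    have "homog (int (mono_deg m + N)) (mon m c * Q)"
      by (rule homog_mult'[OF homog_mon[of m "int (mono_deg m)"] q(1)]) auto
    moreover have "mon m c * Q \<in> K" by (rule is_idealD(3)[OF K q(2)])
    moreover have "mon m c * q = mon m c * Q + (mon m c * h) * (xp k 1 - 1)"
      by (simp add: q(3) algebra_simps)
    ultimately show ?case using LI by metis
  next
    case (add p r)
    then show ?case using L_add[of "p * q" "r * q"] by (simp add: distrib_right)
  qed
  moreover have "0 \<in> L"
    using LI[of 0 0 0] is_idealD(1)[OF K] by simp
  ultimately have L: "is_ideal L" using L_add by (simp add: is_ideal_def)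
  have "1 \<in> L"
  proof (rule ccontr)
    assume "1 \<notin> L"
    then obtain v where v: "\<forall>p\<in>L. peval p v = 0" using nullstellensatz[OF L] by blast
    have "xp k 1 - 1 \<in> L"
      using LI[of 0 0 1] is_idealD(1)[OF K] by simp
    then have "peval (xp k 1 - 1) v = 0" using v by blast
    then have "v k = 1" by simp
    then have "nz v" by (auto simp: nz_def intro!: exI[of _ k])
    then obtain g n where gn: "g \<in> K" "homog n g" "peval g v \<noteq> 0" using g by blast
    then have "n \<ge> 0" using homog_neg[of n g] by force
    then have "homog (int (nat n)) g" using gn(2) by simp
    then have "g \<in> L"
      using LI[of "nat n" g 0] gn(1) by simp
    then show False using v gn(3) by blast
  qed
  then obtain N Q h where Q: "homog (int N) Q" "Q \<in> K" "1 = Q + h * (xp k 1 - 1)"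
    unfolding L_def by blast
  have "Q = xp k N"
  proof (rule peval_eq_on_dense[of "xp k 1"])
    fix v :: "4 => complex" assume "peval (xp k 1) v \<noteq> 0"
    then have v: "v k \<noteq> 0" by simp
    define w where "w = (\<lambda>i. inverse (v k) * v i)"
    have "peval 1 w = peval (Q + h * (xp k 1 - 1)) w" using Q(3) by simp
    then have "peval Q w = 1" using v by (simp add: w_def)
    moreover have "v = (\<lambda>i. v k * w i)" using v by (simp add: w_def mult.assoc[symmetric])
    ultimately show "peval Q v = peval (xp k N) v"
      using peval_homog_scale[OF Q(1), of "v k" w] by simp
  qed simp
  then show ?thesis using Q(2) by blast
qed

section \<open>Graded square matrices\<close>

definition graded :: "nat => (nat => int) => (nat => int) => (nat => nat => form) => bool" where
  "graded n a b M \<longleftrightarrow> (\<forall>i<n. \<forall>j<n. homog (b j - a i) (M i j))"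

lemma gradedD: "graded n a b M ==> i < n ==> j < n ==> homog (b j - a i) (M i j)"
  by (simp add: graded_def)

lemma homog_signof: "homog 0 (signof p :: form)"
  by (auto simp: sign_def intro: homog_one homog_uminus[OF homog_one])

lemma homog_det:
  fixes S :: "form mat"
  assumes "S \<in> carrier_mat n n" "\<And>i j. i < n ==> j < n ==> homog (b j - a i) (S $$ (i, j))"
  shows "homog ((\<Sum>j<n. b j) - (\<Sum>i<n. a i)) (det S)"
  unfolding det_def'[OF assms(1)]
proof (intro homog_sum)
  fix p assume "p \<in> {p. p permutes {0..<n}}"
  then have p: "p permutes {0..<n}" by simp
  have "homog (\<Sum>i\<in>{0..<n}. b (p i) - a i) (\<Prod>i = 0..<n. S $$ (i, p i))"
  proof (rule homog_prod)
    fix i assume i: "i \<in> {0..<n}"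
    then have "p i \<in> {0..<n}" using permutes_in_image[OF p] by blast
    then show "homog (b (p i) - a i) (S $$ (i, p i))" using i assms(2) by simp
  qed
  moreover have "(\<Sum>i\<in>{0..<n}. b (p i) - a i) = (\<Sum>j<n. b j) - (\<Sum>i<n. a i)"
    using sum.permute[OF p, of b] by (simp add: sum_subtractf atLeast0LessThan o_def)
  ultimately show "homog ((\<Sum>j<n. b j) - (\<Sum>i<n. a i)) (signof p * (\<Prod>i = 0..<n. S $$ (i, p i)))"
    by (intro homog_mult'[OF homog_signof]) auto
qed

lemma homog_cofactor:
  fixes S :: "form mat"
  assumes S: "S \<in> carrier_mat n n" and pq: "p < n" "q < n"
    and h: "\<And>i j. i < n ==> j < n ==> homog (b j - a i) (S $$ (i, j))"
  shows "\<exists>d. homog d (cofactor S p q)"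
proof -
  have "homog ((\<Sum>j<n - 1. b (if j < q then j else Suc j)) - (\<Sum>i<n - 1. a (if i < p then i else Suc i)))
      (det (mat_delete S p q))"
  proof (rule homog_det[OF mat_delete_carrier[OF S]])
    fix i j assume ij: "i < n - 1" "j < n - 1"
    define i' j' where "i' = (if i < p then i else Suc i)" and "j' = (if j < q then j else Suc j)"
    have "i' < n" "j' < n" using ij by (auto simp: i'_def j'_def)
    moreover have "mat_delete S p q $$ (i, j) = S $$ (i', j')"
      using ij S by (simp add: mat_delete_def i'_def j'_def)
    ultimately show "homog (b (if j < q then j else Suc j) - a (if i < p then i else Suc i)) (mat_delete S p q $$ (i, j))"
      using h by (simp add: i'_def j'_def)
  qed
  note h1 = this
  have h2: "homog 0 ((- 1) ^ (p + q) :: form)"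
    using homog_power[OF homog_uminus[OF homog_one], of "p + q"] by simp
  show ?thesis unfolding cofactor_def using homog_mult[OF h2 h1] by blast
qed

lemma peval_ring_hom: "comm_ring_hom (\<lambda>p. peval p v)"
  by unfold_locales auto

lemma peval_det: "peval (det S) v = det (map_mat (\<lambda>p. peval p v) S)"
proof -
  interpret h: comm_ring_hom "\<lambda>p. peval p v" by (rule peval_ring_hom)
  show ?thesis by (simp add: h.hom_det)
qed

lemma hcomp_neg: "n < 0 ==> hcomp n p = 0"
  using homog_neg[OF homog_hcomp] by blast

text \<open>A matrix whose rank drops by at most one away from the origin: where the first two
  coordinates vanish it is diagonal, and at most one diagonal entry vanishes there.\<close>

definition tridiag :: "nat => (nat => nat => nat) => form mat" where
  "tridiag n e = mat n n (\<lambda>(i, j).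
     if i = j then (xp 2 1 - mon 0 (of_nat i) * xp 3 1) ^ e i j
     else if i = Suc j then xp 0 (e i j) else if j = Suc i then xp 1 (e i j) else 0)"

lemma tridiag_carrier [simp]: "tridiag n e \<in> carrier_mat n n"
  by (simp add: tridiag_def)

lemma homog_tridiag:
  assumes "i < n" "j < n"
  shows "homog (int (e i j)) (tridiag n e $$ (i, j))"
proof -
  have "homog 1 (xp 2 1 - mon 0 (of_nat i) * xp 3 1 :: form)"
    using homog_xp[of 1 "2::4"] homog_xp[of 1 "3::4"]
    by (intro homog_diff homog_mult'[of 0 _ 1] homog_mon) auto
  from homog_power[OF this, of "e i j"] show ?thesis
    using assms homog_xp[of "e i j"] by (auto simp: tridiag_def)
qed

lemma det_triangular_neq_0:
  fixes A :: "complex mat"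
  assumes "A \<in> carrier_mat n n" "\<And>i. i < n ==> A $$ (i, i) \<noteq> 0"
    and "(\<forall>i j. j < i --> i < n --> A $$ (i, j) = 0) \<or> (\<forall>i j. i < j --> j < n --> A $$ (i, j) = 0)"
  shows "det A \<noteq> 0"
proof -
  have "det A = prod_list (diag_mat A)"
    using assms(3)
  proof
    assume "\<forall>i j. j < i --> i < n --> A $$ (i, j) = 0"
    then have "upper_triangular A" using assms(1) by auto
    then show ?thesis by (rule det_upper_triangular[OF _ assms(1)])
  next
    assume "\<forall>i j. i < j --> j < n --> A $$ (i, j) = 0"
    then show ?thesis using det_lower_triangular[OF _ assms(1)] by blast
  qed
  moreover have "0 \<notin> set (diag_mat A)" using assms(1,2) by (auto simp: diag_mat_def)
  ultimately show ?thesis by (simp add: prod_list_zero_iff)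
qed

lemma tridiag_cofactor:
  assumes v: "nz v" and n: "n > 0" and e: "\<And>i j. i < n ==> j < n ==> e i j > 0"
  shows "\<exists>p<n. \<exists>q<n. peval (cofactor (tridiag n e) p q) v \<noteq> 0"
proof -
  define M where "M p q = map_mat (\<lambda>f. peval f v) (mat_delete (tridiag n e) p q)" for p q
  have M: "M p q \<in> carrier_mat (n - 1) (n - 1)" for p q
    using mat_delete_carrier[OF tridiag_carrier] by (simp add: M_def)
  have Mij: "M p q $$ (i, j) = peval (tridiag n e $$ (if i < p then i else Suc i, if j < q then j else Suc j)) v"
    if "i < n - 1" "j < n - 1" for p q i j
    using that by (simp add: M_def mat_delete_def tridiag_def)
  have cof: "peval (cofactor (tridiag n e) p q) v \<noteq> 0" if "det (M p q) \<noteq> 0" for p q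
  proof -
    have "peval ((- 1) ^ (p + q) :: form) v \<noteq> 0" by simp
    then show ?thesis using that by (simp add: cofactor_def peval_det M_def)
  qed
  consider "v 0 \<noteq> 0" | "v 1 \<noteq> 0" | "v 0 = 0" "v 1 = 0" by blast
  then show ?thesis
  proof cases
    case 1
    \<comment> \<open>Without row \<open>0\<close> and the last column, the subdiagonal becomes the
      diagonal of a triangular matrix. The next case is its mirror image.\<close>
    have "det (M 0 (n - 1)) \<noteq> 0"
    proof (rule det_triangular_neq_0[OF M])
      show "M 0 (n - 1) $$ (i, i) \<noteq> 0" if "i < n - 1" for i
        using that 1 by (simp add: Mij tridiag_def)
      have "M 0 (n - 1) $$ (i, j) = 0" if "j < i" "i < n - 1" for i j
        using that by (simp add: Mij tridiag_def)
      then show "(\<forall>i j. j < i --> i < n - 1 --> M 0 (n - 1) $$ (i, j) = 0) \<or>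
          (\<forall>i j. i < j --> j < n - 1 --> M 0 (n - 1) $$ (i, j) = 0)" by blast
    qed
    then show ?thesis using cof n by (intro exI[of _ 0] conjI exI[of _ "n - 1"]) auto
  next
    case 2
    have "det (M (n - 1) 0) \<noteq> 0"
    proof (rule det_triangular_neq_0[OF M])
      show "M (n - 1) 0 $$ (i, i) \<noteq> 0" if "i < n - 1" for i
        using that 2 by (simp add: Mij tridiag_def)
      have "M (n - 1) 0 $$ (i, j) = 0" if "i < j" "j < n - 1" for i j
        using that by (simp add: Mij tridiag_def)
      then show "(\<forall>i j. j < i --> i < n - 1 --> M (n - 1) 0 $$ (i, j) = 0) \<or>
          (\<forall>i j. i < j --> j < n - 1 --> M (n - 1) 0 $$ (i, j) = 0)" by blast
    qed
    then show ?thesis using cof n by (intro exI[of _ "n - 1"] conjI exI[of _ 0]) auto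
  next
    case 3
    have 23: "v 2 \<noteq> 0 \<or> v 3 \<noteq> 0"
    proof -
      obtain i where "v i \<noteq> 0" using v by (auto simp: nz_def)
      moreover have "i \<in> {0, 1, 2, 3}" using UNIV_4 by blast
      ultimately show ?thesis using 3 by auto
    qed
    have uniq: "i = j" if "v 2 = of_nat i * v 3" "v 2 = of_nat j * v 3" for i j :: nat
      using that 23 by auto
    obtain p where p: "p < n" "\<And>i. i < n ==> i \<noteq> p ==> v 2 \<noteq> of_nat i * v 3"
    proof (cases "\<exists>p<n. v 2 = of_nat p * v 3")
      case True
      then show ?thesis using that uniq by blast
    next
      case False
      then show ?thesis using that[of 0] n by blast
    qed
    have ent: "peval (tridiag n e $$ (i, j)) v = (if i = j then (v 2 - of_nat i * v 3) ^ e i i else 0)"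
      if "i < n" "j < n" for i j
      using that e[OF that] 3 by (auto simp: tridiag_def)
    have "det (M p p) \<noteq> 0"
    proof (rule det_triangular_neq_0[OF M])
      show "M p p $$ (i, i) \<noteq> 0" if "i < n - 1" for i
      proof -
        define k where "k = (if i < p then i else Suc i)"
        have k: "k < n" "k \<noteq> p" using that by (auto simp: k_def)
        then have "M p p $$ (i, i) = (v 2 - of_nat k * v 3) ^ e k k"
          using Mij[OF that that, of p p] ent[OF k(1) k(1)] by (simp add: k_def)
        then show ?thesis using p(2)[OF k] by simp
      qed
      have "M p p $$ (i, j) = 0" if "j < i" "i < n - 1" for i j
        using that by (simp add: Mij ent)
      then show "(\<forall>i j. j < i --> i < n - 1 --> M p p $$ (i, j) = 0) \<or>
          (\<forall>i j. i < j --> j < n - 1 --> M p p $$ (i, j) = 0)" by blast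
    qed
    then show ?thesis using cof p(1) by blast
  qed
qed

text \<open>At this point the matrix is the identity. The point lies in the hyperplane of variable
  \<open>0\<close>, which makes the determinant a nonzerodivisor modulo the powers of that
  variable.\<close>

lemma tridiag_det_point:
  assumes "\<And>i j. i < n ==> j < n ==> e i j > 0"
  shows "peval (det (tridiag n e)) ((\<lambda>_. 0)(2 := 1)) \<noteq> 0"
proof -
  have "map_mat (\<lambda>p. peval p ((\<lambda>_. 0)(2 := 1))) (tridiag n e) = 1\<^sub>m n"
    using assms by (intro eq_matI) (auto simp: tridiag_def)
  then show ?thesis by (simp add: peval_det)
qed

text \<open>Outside the origin some submaximal minor is nonzero, so the ideal of their squares has
  no projective zero and contains a power of each variable.\<close>

lemma tridiag_pure_powers:
  assumes n: "n > 0" and e: "\<And>i j. i < n ==> j < n ==> int (e i j) = b j - a i" "\<And>i j. i < n ==> j < n ==> e i j > 0"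
  shows "\<exists>N c. pure_powers (tridiag n e) n N c UNIV"
proof -
  let ?S = "tridiag n e"
  define A where "A p q = adj_mat ?S $$ (q, p)" for p q
  have A: "A p q = cofactor ?S p q" if "p < n" "q < n" for p q
    using that by (simp add: A_def adj_mat_entry[OF tridiag_carrier])
  define K where "K = {\<Sum>p<n. \<Sum>q<n. c p q * (A p q)\<^sup>2 | c :: nat => nat => form. True}"
  have KI: "(\<Sum>p<n. \<Sum>q<n. c p q * (A p q)\<^sup>2) \<in> K" for c by (auto simp: K_def)
  have K: "is_ideal K"
    unfolding is_ideal_def
  proof (intro conjI ballI allI)
    show "0 \<in> K" using KI[of "\<lambda>p q. 0"] by simp
    fix x assume "x \<in> K"
    then obtain c where x: "x = (\<Sum>p<n. \<Sum>q<n. c p q * (A p q)\<^sup>2)" by (auto simp: K_def)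
    show "r * x \<in> K" for r
      using KI[of "\<lambda>p q. r * c p q"] by (simp add: x sum_distrib_left mult.assoc)
    fix y assume "y \<in> K"
    then obtain c' where y: "y = (\<Sum>p<n. \<Sum>q<n. c' p q * (A p q)\<^sup>2)" by (auto simp: K_def)
    show "x + y \<in> K"
      using KI[of "\<lambda>p q. c p q + c' p q"] by (simp add: x y distrib_right sum.distrib)
  qed
  have "\<exists>N. xp k N \<in> K" for k
  proof (rule projective_nullstellensatz[OF K])
    fix v :: "4 => complex" assume "nz v"
    then obtain p q where pq: "p < n" "q < n" "peval (cofactor ?S p q) v \<noteq> 0"
      using tridiag_cofactor[of v n e] n e(2) by blast
    have "homog (b j - a i) (?S $$ (i, j))" if "i < n" "j < n" for i j
      using homog_tridiag[OF that, of e] e(1)[OF that] by simp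
    then obtain d where d: "homog d (cofactor ?S p q)"
      using homog_cofactor[OF tridiag_carrier pq(1,2), of b a] by blast
    have ite: "(if P then 1 else 0) * x = (if P then x else 0)" for P and x :: form by simp
    have "(\<Sum>p'<n. \<Sum>q'<n. (if p' = p \<and> q' = q then 1 else 0) * (A p' q')\<^sup>2) =
        (\<Sum>p'<n. if p' = p then (\<Sum>q'<n. if q' = q then (A p q)\<^sup>2 else 0) else 0)"
      by (intro sum.cong refl) (auto simp: ite)
    also have "\<dots> = (A p q)\<^sup>2" using pq by simp
    finally have "(A p q)\<^sup>2 \<in> K" using KI[of "\<lambda>p' q'. if p' = p \<and> q' = q then 1 else 0"] by simp
    moreover have "homog (int 2 * d) ((A p q)\<^sup>2)" using homog_power[OF d, of 2] A pq by simp
    moreover have "peval ((A p q)\<^sup>2) v \<noteq> 0" using pq A by simp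
    ultimately show "\<exists>g n. g \<in> K \<and> homog n g \<and> peval g v \<noteq> 0" by blast
  qed
  then obtain Nk where Nk: "\<And>k. xp k (Nk k) \<in> K" by metis
  define N where "N = (\<Sum>k\<in>UNIV. Nk k)"
  have "xp k N \<in> K" for k
  proof -
    have "Nk k \<le> N" unfolding N_def by (intro member_le_sum) auto
    then have "xp k N = xp k (N - Nk k) * xp k (Nk k)" by (simp flip: xp_add)
    then show ?thesis using is_idealD(3)[OF K Nk] by simp
  qed
  then have "\<exists>c. (\<Sum>p<n. \<Sum>q<n. c p q * (A p q)\<^sup>2) = xp k N" for k
    unfolding K_def by (auto dest: sym)
  note ex = this
  define c where "c k = (SOME c. (\<Sum>p<n. \<Sum>q<n. c p q * (A p q)\<^sup>2) = xp k N)" for k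
  have "(\<Sum>p<n. \<Sum>q<n. c k p q * (A p q)\<^sup>2) = xp k N" for k
    unfolding c_def by (rule someI_ex[OF ex])
  then have "pure_powers ?S n N c UNIV"
    by unfold_locales (auto simp: A_def)
  then show ?thesis by blast
qed

subsection \<open>The infinitesimal action of the automorphism groups\<close>

text \<open>Exactness expresses the pair through \<open>f\<close> and \<open>h\<close> without
  regard to degrees. In the graded components the entries of \<open>h\<close> would have degrees
  \<open>a j - b i < 0\<close> and disappear, and \<open>f\<close> is left with its constant
  term.\<close>

lemma graded_kernel:
  assumes n: "n > 0" and e: "\<And>i j. i < n ==> j < n ==> int (e i j) = b j - a i" "\<And>i j. i < n ==> j < n ==> e i j > 0"
    and gr: "graded n a a \<alpha>" "graded n b b \<beta>"
    and 0: "\<And>i j. i < n ==> j < n ==> mm n \<alpha> (mentry (tridiag n e)) i j + mm n (mentry (tridiag n e)) \<beta> i j = 0"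
  shows "\<exists>c. \<forall>i<n. \<forall>j<n. \<alpha> i j = scal (mon 0 c) i j \<and> \<beta> i j = - scal (mon 0 c) i j"
proof -
  let ?S = "mentry (tridiag n e)"
  have "\<exists>N c. pure_powers (tridiag n e) n N c UNIV"
    by (rule tridiag_pure_powers[of n e b a, OF n]) (simp_all add: e)
  then obtain N c where "pure_powers (tridiag n e) n N c UNIV" by blast
  then interpret pure_powers "tridiag n e" n N c UNIV .
  have "peval F ((\<lambda>_. 0)(2 := 1)) \<noteq> 0" by (rule tridiag_det_point) (rule e(2))
  then have "F \<noteq> 0" by auto
  then obtain f h where fh: "\<And>i j. i < n ==> j < n ==> \<alpha> i j = scal f i j + mm n s h i j \<and> \<beta> i j = - (scal f i j + mm n h s i j)"
    using exact_kernel[of 0 1 2 \<alpha> \<beta>] 0 by auto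
  have hs: "homog (b j - a i) (?S i j)" if "i < n" "j < n" for i j
    using homog_tridiag[OF that, of e] e(1)[OF that] by (simp add: mentry_def)
  have ab: "a i - b j < 0" if "i < n" "j < n" for i j
    using e(1)[OF that] e(2)[OF that] by simp
  have f0: "hcomp 0 f = mon 0 (coef f 0)"
    using homog_0_const[OF homog_hcomp[of 0 f]] by (simp add: coef_hcomp)
  have sc: "hcomp (d j - d i) (scal f i j) = scal (mon 0 (coef f 0)) i j" for i j and d :: "nat => int"
    by (simp add: scal_def f0)
  have "\<alpha> i j = scal (mon 0 (coef f 0)) i j" if ij: "i < n" "j < n" for i j
  proof -
    have "\<alpha> i j = hcomp (a j - a i) (scal f i j + mm n s h i j)"
      using hcomp_homog[OF gradedD[OF gr(1) ij]] fh[OF ij] by simp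
    also have "\<dots> = scal (mon 0 (coef f 0)) i j + (\<Sum>k<n. hcomp (a j - a i) (s i k * h k j))"
      by (simp add: hcomp_add sc mm_def hcomp_sum)
    also have "(\<Sum>k<n. hcomp (a j - a i) (s i k * h k j)) = 0"
    proof (rule sum.neutral, intro ballI)
      fix k assume "k \<in> {..<n}"
      then have k: "k < n" by simp
      have "hcomp (a j - a i) (s i k * h k j) = s i k * hcomp (a j - a i - (b k - a i)) (h k j)"
        by (rule hcomp_homog_mult[OF hs[OF ij(1) k]])
      also have "hcomp (a j - a i - (b k - a i)) (h k j) = 0"
        by (rule hcomp_neg) (use ab[OF ij(2) k] in simp)
      finally show "hcomp (a j - a i) (s i k * h k j) = 0" by simp
    qed
    finally show ?thesis by simp
  qed
  moreover have "\<beta> i j = - scal (mon 0 (coef f 0)) i j" if ij: "i < n" "j < n" for i j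
  proof -
    have "- \<beta> i j = hcomp (b j - b i) (scal f i j + mm n h s i j)"
      using hcomp_homog[OF homog_uminus[OF gradedD[OF gr(2) ij]]] fh[OF ij] by (simp add: add.commute)
    also have "\<dots> = scal (mon 0 (coef f 0)) i j + (\<Sum>k<n. hcomp (b j - b i) (h i k * s k j))"
      by (simp add: hcomp_add sc mm_def hcomp_sum)
    also have "(\<Sum>k<n. hcomp (b j - b i) (h i k * s k j)) = 0"
    proof (rule sum.neutral, intro ballI)
      fix k assume "k \<in> {..<n}"
      then have k: "k < n" by simp
      have "hcomp (b j - b i) (h i k * s k j) = hcomp (b j - b i - (b j - a k)) (h i k) * s k j"
        by (rule hcomp_mult_homog[OF hs[OF k ij(2)]])
      also have "hcomp (b j - b i - (b j - a k)) (h i k) = 0"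
        by (rule hcomp_neg) (use ab[OF k ij(1)] in simp)
      finally show "hcomp (b j - b i) (h i k * s k j) = 0" by simp
    qed
    finally show ?thesis by (metis add.right_neutral minus_minus)
  qed
  ultimately show ?thesis by blast
qed

text \<open>The solution found by exactness need not be graded, but its components of the right
  degrees solve the same equation.\<close>

lemma graded_image:
  assumes n: "n > 0" and e: "\<And>i j. i < n ==> j < n ==> int (e i j) = b j - a i" "\<And>i j. i < n ==> j < n ==> e i j > 0"
    and T: "graded n a b T" "mtr n (mentry (adj_mat (tridiag n e))) T = 0"
  shows "\<exists>\<alpha> \<beta>. graded n a a \<alpha> \<and> graded n b b \<beta> \<and>
    (\<forall>i<n. \<forall>j<n. T i j = mm n \<alpha> (mentry (tridiag n e)) i j + mm n (mentry (tridiag n e)) \<beta> i j)"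
proof -
  let ?S = "mentry (tridiag n e)"
  have "\<exists>N c. pure_powers (tridiag n e) n N c UNIV"
    by (rule tridiag_pure_powers[of n e b a, OF n]) (simp_all add: e)
  then obtain N c where "pure_powers (tridiag n e) n N c UNIV" by blast
  then interpret pure_powers "tridiag n e" n N c UNIV .
  have Fv: "peval F ((\<lambda>_. 0)(2 := 1)) \<noteq> 0" by (rule tridiag_det_point) (rule e(2))
  have Fc: "x \<in> mono_ideal {0} N" if "F * x \<in> mono_ideal {0} N" for x
    by (rule mono_ideal_prime[OF Fv _ that]) simp
  obtain \<alpha> \<beta> where ab: "\<And>i j. i < n ==> j < n ==> T i j = mm n \<alpha> s i j + mm n s \<beta> i j"
    using exact_0[of 0 1 2 3 T] Fc T(2) by auto
  have hs: "homog (b j - a i) (?S i j)" if "i < n" "j < n" for i j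
    using homog_tridiag[OF that, of e] e(1)[OF that] by (simp add: mentry_def)
  define \<alpha>' where "\<alpha>' i k = hcomp (a k - a i) (\<alpha> i k)" for i k
  define \<beta>' where "\<beta>' l j = hcomp (b j - b l) (\<beta> l j)" for l j
  have "T i j = mm n \<alpha>' ?S i j + mm n ?S \<beta>' i j" if ij: "i < n" "j < n" for i j
  proof -
    have "T i j = hcomp (b j - a i) (mm n \<alpha> s i j + mm n s \<beta> i j)"
      using hcomp_homog[OF gradedD[OF T(1) ij]] ab[OF ij] by simp
    also have "\<dots> = (\<Sum>k<n. hcomp (b j - a i) (\<alpha> i k * s k j)) + (\<Sum>k<n. hcomp (b j - a i) (s i k * \<beta> k j))"
      by (simp add: hcomp_add mm_def hcomp_sum)
    also have "(\<Sum>k<n. hcomp (b j - a i) (\<alpha> i k * s k j)) = mm n \<alpha>' ?S i j"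
      unfolding mm_def \<alpha>'_def
    proof (rule sum.cong)
      fix k assume "k \<in> {..<n}"
      then have "hcomp (b j - a i) (\<alpha> i k * s k j) = hcomp (b j - a i - (b j - a k)) (\<alpha> i k) * s k j"
        using ij by (intro hcomp_mult_homog hs) auto
      then show "hcomp (b j - a i) (\<alpha> i k * s k j) = hcomp (a k - a i) (\<alpha> i k) * s k j" by simp
    qed simp
    also have "(\<Sum>k<n. hcomp (b j - a i) (s i k * \<beta> k j)) = mm n ?S \<beta>' i j"
      unfolding mm_def \<beta>'_def
    proof (rule sum.cong)
      fix k assume "k \<in> {..<n}"
      then have "hcomp (b j - a i) (s i k * \<beta> k j) = s i k * hcomp (b j - a i - (b k - a i)) (\<beta> k j)"
        using ij by (intro hcomp_homog_mult hs) auto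
      then show "hcomp (b j - a i) (s i k * \<beta> k j) = s i k * hcomp (b j - b k) (\<beta> k j)" by simp
    qed simp
    finally show ?thesis .
  qed
  moreover have "graded n a a \<alpha>'" "graded n b b \<beta>'"
    by (simp_all add: graded_def \<alpha>'_def \<beta>'_def homog_hcomp)
  ultimately show ?thesis by blast
qed

subsection \<open>The derivative of the determinant\<close>

lemma coeff_1_pderiv: "coeff P 1 = poly (pderiv P) 0" for P :: "form poly"
  by (simp add: poly_0_coeff_0 coeff_pderiv)

text \<open>Jacobi's formula. Over the ring of polynomials in the parameter the Leibniz sum is
  differentiated factor by factor. This gives determinants with one row of \<open>S\<close> replaced
  by that of \<open>T\<close>, each of which is expanded along this row.\<close>

lemma det_pencil:
  fixes S T :: "form mat"
  assumes S: "S \<in> carrier_mat n n" and T: "T \<in> carrier_mat n n"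
  shows "\<exists>P. (\<forall>x. det (S + x \<cdot>\<^sub>m T) = poly P x) \<and> coeff P 0 = det S \<and>
    coeff P 1 = mtr n (mentry (adj_mat S)) (mentry T)"
proof -
  define M where "M = mat n n (\<lambda>(i, j). [:S $$ (i, j), T $$ (i, j):])"
  have M: "M \<in> carrier_mat n n" by (simp add: M_def)
  have ev: "poly (det M) x = det (S + x \<cdot>\<^sub>m T)" for x
  proof -
    interpret h: comm_ring_hom "\<lambda>p :: form poly. poly p x" by unfold_locales auto
    have "map_mat (\<lambda>p. poly p x) M = S + x \<cdot>\<^sub>m T"
      using S T by (intro eq_matI) (auto simp: M_def)
    then show ?thesis using h.hom_det[of M] by simp
  qed
  have "S + 0 \<cdot>\<^sub>m T = S" using S T by (intro eq_matI) auto
  then have c0: "coeff (det M) 0 = det S" using ev[of 0] by (simp add: poly_0_coeff_0)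
  define Ri where "Ri i = mat n n (\<lambda>(k, j). if k = i then T $$ (i, j) else S $$ (k, j))" for i
  have Ri: "Ri i \<in> carrier_mat n n" for i by (simp add: Ri_def)
  have perm: "p i < n" if "p permutes {0..<n}" "i < n" for p i
    using permutes_in_image[OF that(1), of i] that(2) by simp
  have sg: "poly (signof p :: form poly) 0 = signof p" and ps: "pderiv (signof p :: form poly) = 0" for p
    by (auto simp: sign_def pderiv_minus)
  have pderiv_sum: "pderiv (sum f B) = (\<Sum>b\<in>B. pderiv (f b))" for f :: "(nat => nat) => form poly" and B
    by (induction B rule: infinite_finite_induct) (auto simp: pderiv_add)
  have "coeff (det M) 1 = poly (pderiv (det M)) 0" by (rule coeff_1_pderiv)
  also have "\<dots> = (\<Sum>p | p permutes {0..<n}. signof p * (\<Sum>i\<in>{0..<n}. (\<Prod>k\<in>{0..<n} - {i}. S $$ (k, p k)) * T $$ (i, p i)))"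
    unfolding det_def'[OF M] pderiv_sum poly_sum
  proof (rule sum.cong)
    fix p assume "p \<in> {p. p permutes {0..<n}}"
    then have p: "p permutes {0..<n}" by simp
    have "poly (pderiv (\<Prod>i = 0..<n. M $$ (i, p i))) 0 =
        (\<Sum>i\<in>{0..<n}. (\<Prod>k\<in>{0..<n} - {i}. S $$ (k, p k)) * T $$ (i, p i))"
      unfolding pderiv_prod poly_sum
    proof (rule sum.cong)
      fix i assume "i \<in> {0..<n}"
      then show "poly ((\<Prod>k\<in>{0..<n} - {i}. M $$ (k, p k)) * pderiv (M $$ (i, p i))) 0 =
          (\<Prod>k\<in>{0..<n} - {i}. S $$ (k, p k)) * T $$ (i, p i)"
        using perm[OF p] by (simp add: M_def poly_prod pderiv_pCons)
    qed simp
    then show "poly (pderiv (signof p * (\<Prod>i = 0..<n. M $$ (i, p i)))) 0 =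
        signof p * (\<Sum>i\<in>{0..<n}. (\<Prod>k\<in>{0..<n} - {i}. S $$ (k, p k)) * T $$ (i, p i))"
      by (simp add: pderiv_mult sg ps)
  qed simp
  also have "\<dots> = (\<Sum>i\<in>{0..<n}. \<Sum>p | p permutes {0..<n}. signof p * ((\<Prod>k\<in>{0..<n} - {i}. S $$ (k, p k)) * T $$ (i, p i)))"
    by (simp only: sum_distrib_left) (rule sum.swap)
  also have "\<dots> = (\<Sum>i\<in>{0..<n}. det (Ri i))"
  proof (rule sum.cong)
    fix i assume i: "i \<in> {0..<n}"
    show "(\<Sum>p | p permutes {0..<n}. signof p * ((\<Prod>k\<in>{0..<n} - {i}. S $$ (k, p k)) * T $$ (i, p i))) = det (Ri i)"
      unfolding det_def'[OF Ri]
    proof (rule sum.cong)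
      fix p assume "p \<in> {p. p permutes {0..<n}}"
      then have p: "p permutes {0..<n}" by simp
      have "(\<Prod>k = 0..<n. Ri i $$ (k, p k)) = Ri i $$ (i, p i) * (\<Prod>k\<in>{0..<n} - {i}. Ri i $$ (k, p k))"
        using i by (intro prod.remove) auto
      also have "Ri i $$ (i, p i) = T $$ (i, p i)" using i perm[OF p] by (simp add: Ri_def)
      also have "(\<Prod>k\<in>{0..<n} - {i}. Ri i $$ (k, p k)) = (\<Prod>k\<in>{0..<n} - {i}. S $$ (k, p k))"
        using perm[OF p] by (intro prod.cong) (auto simp: Ri_def)
      finally show "signof p * ((\<Prod>k\<in>{0..<n} - {i}. S $$ (k, p k)) * T $$ (i, p i)) =
          signof p * (\<Prod>k = 0..<n. Ri i $$ (k, p k))" by (simp add: mult.commute)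
    qed simp
  qed simp
  also have "\<dots> = (\<Sum>i\<in>{0..<n}. \<Sum>j<n. T $$ (i, j) * cofactor S i j)"
  proof (rule sum.cong)
    fix i assume "i \<in> {0..<n}"
    then have i: "i < n" by simp
    have del: "mat_delete (Ri i) i j = mat_delete S i j" if "j < n" for j
      using S i that by (intro eq_matI) (auto simp: mat_delete_def Ri_def)
    have "det (Ri i) = (\<Sum>j<n. Ri i $$ (i, j) * cofactor (Ri i) i j)"
      by (rule laplace_expansion_row[OF Ri i])
    also have "\<dots> = (\<Sum>j<n. T $$ (i, j) * cofactor S i j)"
      by (rule sum.cong) (use i del in \<open>auto simp: Ri_def cofactor_def\<close>)
    finally show "det (Ri i) = (\<Sum>j<n. T $$ (i, j) * cofactor S i j)" .
  qed simp
  also have "\<dots> = (\<Sum>j<n. \<Sum>i<n. T $$ (i, j) * cofactor S i j)"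
    unfolding atLeast0LessThan by (rule sum.swap)
  also have "\<dots> = mtr n (mentry (adj_mat S)) (mentry T)"
    unfolding mtr_def mentry_def
    by (intro sum.cong refl) (simp add: adj_mat_entry[OF S] mult.commute)
  finally have c1: "coeff (det M) 1 = mtr n (mentry (adj_mat S)) (mentry T)" .
  show ?thesis
    by (rule exI[of _ "det M"], intro conjI allI) (rule ev[symmetric], rule c0, rule c1)
qed

section \<open>Families of polynomials\<close>

text \<open>Serves two purposes: with the constant filtration by all polynomial functions for
  irreducibility, and with \<open>bdd_polys\<close> for counting functions of bounded
  degree.\<close>

locale filtered_algebra =
  fixes A :: "nat => ('y => complex) set"
  assumes const: "(\<lambda>_. c) \<in> A 0"
    and mono: "m \<le> n ==> A m \<subseteq> A n"
    and add: "f \<in> A n ==> g \<in> A n ==> (\<lambda>s. f s + g s) \<in> A n"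
    and mult: "f \<in> A n ==> g \<in> A m ==> (\<lambda>s. f s * g s) \<in> A (n + m)"
begin

lemma const': "(\<lambda>_. c) \<in> A n"
  using const[of c] mono[of 0 n] by blast

lemma sum: "(\<And>x. x \<in> X ==> f x \<in> A n) ==> (\<lambda>s. \<Sum>x\<in>X. f x s) \<in> A n"
  by (induction X rule: infinite_finite_induct) (auto intro: add const')

lemma prod: "(\<And>x. x \<in> X ==> f x \<in> A (d x)) ==> (\<lambda>s. \<Prod>x\<in>X. f x s) \<in> A (\<Sum>x\<in>X. d x)"
proof (induction X rule: infinite_finite_induct)
  case (insert x X)
  then show ?case using mult[of "f x" "d x" "\<lambda>s. \<Prod>x\<in>X. f x s" "\<Sum>x\<in>X. d x"] by simp
qed (auto intro: const)

lemma power: "f \<in> A d ==> (\<lambda>s. f s ^ k) \<in> A (k * d)"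
  using prod[of "{..<k}" "\<lambda>_. f" "\<lambda>_. d"] by simp

lemma cmult: "f \<in> A n ==> (\<lambda>s. c * f s) \<in> A n"
  using mult[OF const[of c], of f n] by simp

lemma peval_in:
  assumes "homog (int d) p" "\<And>i. (\<lambda>s. g s i) \<in> A n"
  shows "(\<lambda>s. peval p (g s)) \<in> A (d * n)"
proof -
  have "(\<lambda>s. coef p m * meval (g s) m) \<in> A (d * n)" if m: "m \<in> supp p" for m
  proof (rule cmult)
    have "(\<lambda>s. \<Prod>i\<in>supp m. g s i ^ expo m i) \<in> A (\<Sum>i\<in>supp m. expo m i * n)"
      by (rule prod) (rule power[OF assms(2)])
    moreover have "(\<Sum>i\<in>supp m. expo m i * n) = mono_deg m * n"
      by (simp add: mono_deg_def sum_distrib_right)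
    moreover have "mono_deg m = d" using assms(1) m by (simp add: homog_def)
    ultimately show "(\<lambda>s. meval (g s) m) \<in> A (d * n)" by (simp add: meval_def)
  qed
  then show ?thesis unfolding peval_meval by (rule sum)
qed

definition forms :: "nat => ('y => form) set" where
  "forms n = {c. \<forall>m. (\<lambda>s. coef (c s) m) \<in> A n}"

end

lemma finite_antidiag: "finite {x. fst x + snd x = (m :: 4 \<Rightarrow>\<^sub>0 nat)}"
proof -
  have "{x. fst x + snd x = m} \<subseteq> {k. mono_deg k \<le> mono_deg m} \<times> {k. mono_deg k \<le> mono_deg m}"
    by auto
  then show ?thesis using finite_monomials_le finite_subset by blast
qed

lemma coef_mult:
  "coef (p * q) m = (\<Sum>x | fst x + snd x = (m :: 4 \<Rightarrow>\<^sub>0 nat). coef p (fst x) * coef q (snd x))"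
proof (induction p rule: cpoly_induct)
  case (mon a c)
  show ?case
  proof (induction q rule: cpoly_induct)
    case (mon b d)
    have "(\<Sum>x | fst x + snd x = m. coef (Poly_Mapping.single a c) (fst x) * coef (Poly_Mapping.single b d) (snd x)) =
        (\<Sum>x | fst x + snd x = m. if x = (a, b) then c * d else 0)"
      by (rule sum.cong) (auto simp: lookup_single when_def split: if_splits)
    also have "\<dots> = (if a + b = m then c * d else 0)"
      using finite_antidiag[of m] by simp
    finally show ?case by (simp add: mult_single lookup_single when_def)
  next
    case (add p q)
    then show ?case by (simp add: distrib_left lookup_add sum.distrib)
  qed
next
  case (add p q)
  then show ?case by (simp add: distrib_right lookup_add sum.distrib)
qed

context filtered_algebra
begin

lemma forms_const: "(\<lambda>_. F) \<in> forms n"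
  by (simp add: forms_def const')

lemma forms_add: "f \<in> forms n ==> g \<in> forms n ==> (\<lambda>s. f s + g s) \<in> forms n"
  by (simp add: forms_def lookup_add add)

lemma forms_sum: "(\<And>x. x \<in> X ==> f x \<in> forms n) ==> (\<lambda>s. \<Sum>x\<in>X. f x s) \<in> forms n"
  by (induction X rule: infinite_finite_induct) (auto intro: forms_add forms_const)

lemma forms_mult:
  assumes "f \<in> forms n" "g \<in> forms k"
  shows "(\<lambda>s. f s * g s) \<in> forms (n + k)"
  unfolding forms_def mem_Collect_eq
proof
  fix m
  have "(\<lambda>s. \<Sum>x | fst x + snd x = m. coef (f s) (fst x) * coef (g s) (snd x)) \<in> A (n + k)"
    using assms by (intro sum mult) (auto simp: forms_def)
  then show "(\<lambda>s. coef (f s * g s) m) \<in> A (n + k)"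
    by (simp only: coef_mult)
qed

lemma forms_prod: "(\<And>x. x \<in> X ==> f x \<in> forms 1) ==> (\<lambda>s. \<Prod>x\<in>X. f x s) \<in> forms (card X)"
proof (induction X rule: infinite_finite_induct)
  case (insert x X)
  then show ?case using forms_mult[of "f x" 1 "\<lambda>s. \<Prod>x\<in>X. f x s" "card X"] by simp
qed (auto intro: forms_const)

lemma det_in_forms:
  assumes "\<And>s. M s \<in> carrier_mat n n" "\<And>i j. i < n ==> j < n ==> (\<lambda>s. M s $$ (i, j)) \<in> forms 1"
  shows "(\<lambda>s. det (M s)) \<in> forms n"
proof -
  have "(\<lambda>s. \<Sum>p\<in>{p. p permutes {0..<n}}. signof p * (\<Prod>i = 0..<n. M s $$ (i, p i))) \<in> forms n"
  proof (rule forms_sum)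
    fix p assume "p \<in> {p. p permutes {0..<n}}"
    then have p: "p permutes {0..<n}" by simp
    have "(\<lambda>s. \<Prod>i = 0..<n. M s $$ (i, p i)) \<in> forms (card {0..<n})"
    proof (rule forms_prod)
      fix i assume "i \<in> {0..<n}"
      then show "(\<lambda>s. M s $$ (i, p i)) \<in> forms 1"
        using permutes_in_image[OF p, of i] by (intro assms(2)) auto
    qed
    from forms_mult[OF forms_const[of "signof p" 0] this]
    show "(\<lambda>s. signof p * (\<Prod>i = 0..<n. M s $$ (i, p i))) \<in> forms n" by simp
  qed
  then show ?thesis by (simp add: det_def'[OF assms(1)])
qed

end

definition poly_funs :: "(('z => complex) => complex) set" where
  "poly_funs = {f. \<exists>q. \<forall>v. f v = peval q v}"

interpretation poly_funs: filtered_algebra "\<lambda>_. poly_funs"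
proof
  fix f g :: "('a => complex) => complex" and c
  show "(\<lambda>_. c) \<in> poly_funs" unfolding poly_funs_def by (auto intro: exI[of _ "mon 0 c"])
  assume "f \<in> poly_funs" "g \<in> poly_funs"
  then obtain p q where "\<forall>v. f v = peval p v" "\<forall>v. g v = peval q v" by (auto simp: poly_funs_def)
  then have "\<forall>v. f v + g v = peval (p + q) v" "\<forall>v. f v * g v = peval (p * q) v" by auto
  then show "(\<lambda>s. f s + g s) \<in> poly_funs" "(\<lambda>s. f s * g s) \<in> poly_funs"
    unfolding poly_funs_def by blast+
qed simp

lemma coordinate_in_poly_funs: "(\<lambda>v. v i) \<in> poly_funs"
  unfolding poly_funs_def by (auto intro: exI[of _ "xp i 1"])

text \<open>On the line joining points where \<open>f\<close> and \<open>g\<close> are nonzero, both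
  become nonzero polynomials in one variable, whose product cannot vanish identically.\<close>

lemma poly_funs_prime:
  assumes f: "f \<in> poly_funs" and g: "g \<in> poly_funs" and 0: "\<And>v. f v * g v = 0"
  shows "(\<forall>v. f v = 0) \<or> (\<forall>v. g v = 0)"
proof (rule ccontr)
  assume "\<not> ?thesis"
  then obtain u w where u: "f u \<noteq> 0" and w: "g w \<noteq> 0" by blast
  obtain p q where p: "\<forall>v. f v = peval p v" and q: "\<forall>v. g v = peval q v"
    using f g by (auto simp: poly_funs_def)
  obtain P where P: "\<forall>x. peval p (line u (\<lambda>i. w i - u i) x) = poly P x" using peval_line by blast
  obtain Q where Q: "\<forall>x. peval q (line u (\<lambda>i. w i - u i) x) = poly Q x" using peval_line by blast
  have l0: "line u (\<lambda>i. w i - u i) 0 = u" and l1: "line u (\<lambda>i. w i - u i) 1 = w"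
    by (auto simp: line_def)
  have "poly P 0 = f u" using P p l0 by metis
  then have "P \<noteq> 0" using u by auto
  have "poly Q 1 = g w" using Q q l1 by metis
  then have "Q \<noteq> 0" using w by auto
  have "poly (P * Q) x = 0" for x
    using 0[of "line u (\<lambda>i. w i - u i) x"] P Q p q by simp
  then have "P * Q = 0" by (simp add: poly_eq_poly_eq_iff[symmetric] fun_eq_iff)
  then show False using \<open>P \<noteq> 0\<close> \<open>Q \<noteq> 0\<close> by simp
qed

section \<open>Spaces of functions and polynomials of bounded degree\<close>

lemma vector_space_functions: "vector_space (\<lambda>(c::complex) (f :: 'y => complex) s. c * f s)"
  by unfold_locales (simp_all add: fun_eq_iff algebra_simps)

interpretation fs: vector_space "\<lambda>(c::complex) (f :: 'y => complex) s. c * f s"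
  by (rule vector_space_functions)

text \<open>The degree is bounded in each of the \<open>k\<close> variables separately, which makes
  the bound \<open>(n + 1) ^ k\<close> on their number immediate.\<close>

definition bdd_monos :: "nat => nat => ((nat => complex) => complex) set" where
  "bdd_monos k n = (\<lambda>m s. \<Prod>j<k. s j ^ m j) ` (PiE {..<k} (\<lambda>_. {..n}))"

lemma finite_bdd_monos: "finite (bdd_monos k n)"
  unfolding bdd_monos_def by (intro finite_imageI finite_PiE) auto

lemma card_bdd_monos: "card (bdd_monos k n) \<le> (n + 1) ^ k"
  unfolding bdd_monos_def by (rule order.trans[OF card_image_le]) (auto simp: card_PiE intro: finite_PiE)

lemma bdd_monosI: "(\<And>j. j < k ==> m j \<le> n) ==> (\<lambda>s. \<Prod>j<k. s j ^ m j) \<in> bdd_monos k n"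
  unfolding bdd_monos_def
  by (intro image_eqI[of _ _ "\<lambda>j. if j < k then m j else undefined"]) (auto simp: PiE_def extensional_def)

definition bdd_polys :: "nat => nat => ((nat => complex) => complex) set" where
  "bdd_polys k n = fs.span (bdd_monos k n)"

lemma bdd_polys_mult:
  assumes "f \<in> bdd_polys k n" "g \<in> bdd_polys k m"
  shows "(\<lambda>s. f s * g s) \<in> bdd_polys k (n + m)"
proof -
  have sub1: "fs.subspace {g. (\<lambda>s. f s * g s) \<in> bdd_polys k (n + m)}" for f :: "(nat => complex) => complex"
  proof (rule fs.subspaceI)
    show "0 \<in> {g. (\<lambda>s. f s * g s) \<in> bdd_polys k (n + m)}"
      using fs.span_zero[of "bdd_monos k (n + m)"] by (simp add: bdd_polys_def zero_fun_def)
    fix x y assume "x \<in> {g. (\<lambda>s. f s * g s) \<in> bdd_polys k (n + m)}" "y \<in> {g. (\<lambda>s. f s * g s) \<in> bdd_polys k (n + m)}"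
    then have "(\<lambda>s. f s * x s) + (\<lambda>s. f s * y s) \<in> bdd_polys k (n + m)"
      unfolding bdd_polys_def by (intro fs.span_add) auto
    moreover have "(\<lambda>s. f s * x s) + (\<lambda>s. f s * y s) = (\<lambda>s. f s * (x + y) s)"
      by (rule ext) (simp add: distrib_left)
    ultimately show "x + y \<in> {g. (\<lambda>s. f s * g s) \<in> bdd_polys k (n + m)}" by simp
  next
    fix c x assume "x \<in> {g. (\<lambda>s. f s * g s) \<in> bdd_polys k (n + m)}"
    then have "(\<lambda>s. c * (f s * x s)) \<in> bdd_polys k (n + m)"
      unfolding bdd_polys_def using fs.span_scale by blast
    then show "(\<lambda>s. c * x s) \<in> {g. (\<lambda>s. f s * g s) \<in> bdd_polys k (n + m)}"
      by (simp add: mult.left_commute)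
  qed
  have mm: "(\<lambda>s. f s * g s) \<in> bdd_polys k (n + m)" if f: "f \<in> bdd_monos k n" and g: "g \<in> bdd_monos k m" for f g
  proof -
    obtain a where a: "f = (\<lambda>s. \<Prod>j<k. s j ^ a j)" "\<And>j. j < k ==> a j \<le> n" using f by (auto simp: bdd_monos_def)
    obtain b where b: "g = (\<lambda>s. \<Prod>j<k. s j ^ b j)" "\<And>j. j < k ==> b j \<le> m" using g by (auto simp: bdd_monos_def)
    have "(\<lambda>s. f s * g s) = (\<lambda>s. \<Prod>j<k. s j ^ (a j + b j))"
      by (simp add: a(1) b(1) power_add prod.distrib)
    moreover have "\<dots> \<in> bdd_monos k (n + m)" by (rule bdd_monosI) (simp add: a(2) b(2) add_mono)
    ultimately show ?thesis by (simp add: bdd_polys_def fs.span_base)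
  qed
  have 1: "(\<lambda>s. f' s * g s) \<in> bdd_polys k (n + m)" if f': "f' \<in> bdd_monos k n" for f'
  proof -
    have "fs.span (bdd_monos k m) \<subseteq> {g. (\<lambda>s. f' s * g s) \<in> bdd_polys k (n + m)}"
      by (rule fs.span_minimal[OF _ sub1]) (use mm f' in auto)
    then show ?thesis using assms(2) by (auto simp: bdd_polys_def)
  qed
  have "fs.span (bdd_monos k n) \<subseteq> {f. (\<lambda>s. g s * f s) \<in> bdd_polys k (n + m)}"
    by (rule fs.span_minimal[OF _ sub1]) (use 1 in \<open>auto simp: mult.commute\<close>)
  then show ?thesis using assms(1) by (auto simp: bdd_polys_def mult.commute)
qed

interpretation bdd_polys: filtered_algebra "bdd_polys k" for k
proof
  fix c :: complex
  have "(\<lambda>s. \<Prod>j<k. s j ^ 0) \<in> bdd_monos k 0" by (rule bdd_monosI) simp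
  then have "(\<lambda>s. 1) \<in> fs.span (bdd_monos k 0)" by (simp add: fs.span_base)
  from fs.span_scale[OF this, of c] show "(\<lambda>_. c) \<in> bdd_polys k 0" by (simp add: bdd_polys_def)
next
  fix m n :: nat assume "m \<le> n"
  then have "bdd_monos k m \<subseteq> bdd_monos k n"
    unfolding bdd_monos_def by (intro image_mono PiE_mono) auto
  then show "bdd_polys k m \<subseteq> bdd_polys k n" unfolding bdd_polys_def by (rule fs.span_mono)
next
  fix f g n assume "f \<in> bdd_polys k n" "g \<in> bdd_polys k n"
  then show "(\<lambda>s. f s + g s) \<in> bdd_polys k n"
    unfolding bdd_polys_def using fs.span_add by (fastforce simp: plus_fun_def)
qed (rule bdd_polys_mult)

lemma coordinate_in_bdd_polys:
  assumes "j < k"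
  shows "(\<lambda>s. s j) \<in> bdd_polys k 1"
proof -
  have "(\<lambda>s :: nat => complex. \<Prod>i<k. s i ^ (if i = j then 1 else 0)) \<in> bdd_monos k 1"
    by (rule bdd_monosI) simp
  moreover have "(\<Prod>i<k. s i ^ (if i = j then 1 else 0)) = s j" for s :: "nat => complex"
    using assms by (simp add: if_distrib[of "\<lambda>n. _ ^ n"] cong: if_cong)
  ultimately show ?thesis by (simp add: bdd_polys_def fs.span_base)
qed

section \<open>Dimension and the growth of Hilbert functions\<close>

text \<open>The Hilbert function of \<open>Z\<close> at \<open>n\<close> is the largest \<open>K\<close> with \<open>hilbert_ge Z n K\<close>.\<close>

definition hilbert_ge :: "('x => complex) set set => nat => nat => bool" where
  "hilbert_ge Z n K \<longleftrightarrow> (\<exists>p. (\<forall>i<K. homog (int n) (p i)) \<and>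
     (\<forall>c. (\<forall>v\<in>\<Union>Z. (\<Sum>i<K. c i * peval (p i) v) = 0) --> (\<forall>i<K. c i = 0)))"

lemma hilbert_ge_mono: "Z \<subseteq> Z' ==> hilbert_ge Z n K ==> hilbert_ge Z' n K"
proof -
  assume "Z \<subseteq> Z'" "hilbert_ge Z n K"
  then obtain p where p: "\<forall>i<K. homog (int n) (p i)"
    "\<And>c. (\<forall>v\<in>\<Union>Z. (\<Sum>i<K. c i * peval (p i) v) = 0) ==> (\<forall>i<K. c i = 0)"
    unfolding hilbert_ge_def by blast
  have sub: "\<Union>Z \<subseteq> \<Union>Z'" using \<open>Z \<subseteq> Z'\<close> by blast
  show "hilbert_ge Z' n K"
    unfolding hilbert_ge_def
  proof (intro exI conjI allI)
    show "i < K --> homog (int n) (p i)" for i using p(1) by blast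
    show "(\<forall>v\<in>\<Union>Z'. (\<Sum>i<K. c i * peval (p i) v) = 0) --> (\<forall>i<K. c i = 0)" for c
    proof
      assume c: "\<forall>v\<in>\<Union>Z'. (\<Sum>i<K. c i * peval (p i) v) = 0"
      show "\<forall>i<K. c i = 0"
      proof (rule p(2), rule ballI)
        fix v assume "v \<in> \<Union>Z"
        then have "v \<in> \<Union>Z'" using sub by (rule subsetD[rotated])
        then show "(\<Sum>i<K. c i * peval (p i) v) = 0" by (rule c[THEN bspec])
      qed
    qed
  qed
qed

lemma hilbert_ge_0: "hilbert_ge Z n 0"
  by (simp add: hilbert_ge_def)

lemma hilbert_ge_less:
  assumes "hilbert_ge Z n K" "K' \<le> K"
  shows "hilbert_ge Z n K'"
proof -
  obtain p where p: "\<forall>i<K. homog (int n) (p i)"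
    "\<And>c. (\<forall>v\<in>\<Union>Z. (\<Sum>i<K. c i * peval (p i) v) = 0) ==> (\<forall>i<K. c i = 0)"
    using assms(1) unfolding hilbert_ge_def by blast
  show ?thesis
    unfolding hilbert_ge_def
  proof (intro exI conjI allI impI)
    show "homog (int n) (p i)" if "i < K'" for i using p(1) that assms(2) by simp
    fix c i assume c: "\<forall>v\<in>\<Union>Z. (\<Sum>i<K'. c i * peval (p i) v) = 0" and i: "i < K'"
    define d where "d i = (if i < K' then c i else 0)" for i
    have "(\<Sum>i<K. d i * peval (p i) v) = (\<Sum>i<K'. c i * peval (p i) v)" for v
      by (rule sum.mono_neutral_cong_right) (use assms(2) in \<open>auto simp: d_def\<close>)
    then have "\<forall>i<K. d i = 0" using c by (intro p(2)) simp
    moreover have "i < K" using i assms(2) by simp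
    ultimately have "d i = 0" by blast
    then show "c i = 0" using i by (simp add: d_def)
  qed
qed

lemma hilbert_ge_1:
  assumes "Z \<subseteq> proj_space I" "Z \<noteq> {}"
  shows "hilbert_ge Z n 1"
proof -
  obtain x where "x \<in> Z" using assms(2) by blast
  then obtain v where v: "x = proj_pt v" "nz v" using assms(1) proj_space_ex by blast
  then have vZ: "v \<in> \<Union>Z" using \<open>x \<in> Z\<close> mem_proj_pt by blast
  obtain i where "v i \<noteq> 0" using v(2) by (auto simp: nz_def)
  then show ?thesis
    unfolding hilbert_ge_def using homog_xp[of n i] vZ
    by (intro exI[of _ "\<lambda>_. xp i n"]) auto
qed

text \<open>The inequality for a hypersurface section: the forms \<open>F * p i\<close> and
  \<open>q i\<close> together are independent on \<open>Z\<close>. Restricting a relation to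
  \<open>Z'\<close> kills the terms with \<open>F\<close> and leaves one between the
  \<open>q i\<close>; what remains is divisible by \<open>F\<close>, which cancels because
  \<open>Z\<close> is irreducible.\<close>

lemma hilbert_ge_step:
  assumes Z: "irreducible_closedin (zariski I) Z" and sub: "Z' \<subseteq> Z"
    and F: "homog (int e) F" "\<And>v. v \<in> \<Union>Z' ==> peval F v = 0" "v0 \<in> \<Union>Z" "peval F v0 \<noteq> 0"
    and 1: "hilbert_ge Z n K" and 2: "hilbert_ge Z' (n + e) K'"
  shows "hilbert_ge Z (n + e) (K + K')"
proof -
  obtain p where p: "\<forall>i<K. homog (int n) (p i)"
    "\<And>c. (\<forall>v\<in>\<Union>Z. (\<Sum>i<K. c i * peval (p i) v) = 0) ==> (\<forall>i<K. c i = 0)"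
    using 1 unfolding hilbert_ge_def by blast
  obtain q where q: "\<forall>i<K'. homog (int (n + e)) (q i)"
    "\<And>c. (\<forall>v\<in>\<Union>Z'. (\<Sum>i<K'. c i * peval (q i) v) = 0) ==> (\<forall>i<K'. c i = 0)"
    using 2 unfolding hilbert_ge_def by blast
  define r where "r i = (if i < K then F * p i else q (i - K))" for i
  have split: "(\<Sum>i<K + K'. g i) = (\<Sum>i<K. g i) + (\<Sum>i<K'. g (i + K))" for g :: "nat => complex"
    by (induction K') (simp_all add: add.commute algebra_simps)
  have r: "(\<Sum>i<K + K'. c i * peval (r i) v) =
      peval F v * (\<Sum>i<K. c i * peval (p i) v) + (\<Sum>i<K'. c (i + K) * peval (q i) v)" for c v
    unfolding split by (simp add: r_def sum_distrib_left algebra_simps)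
  show ?thesis
    unfolding hilbert_ge_def
  proof (intro exI conjI allI impI)
    show "homog (int (n + e)) (r i)" if "i < K + K'" for i
      using that p(1) q(1) F(1) by (auto simp: r_def intro: homog_mult')
    fix c i assume c: "\<forall>v\<in>\<Union>Z. (\<Sum>i<K + K'. c i * peval (r i) v) = 0" and i: "i < K + K'"
    have ZZ: "\<Union>Z' \<subseteq> \<Union>Z" using sub by blast
    have "\<forall>v\<in>\<Union>Z'. (\<Sum>i<K'. c (i + K) * peval (q i) v) = 0"
    proof
      fix v assume v: "v \<in> \<Union>Z'"
      then have "v \<in> \<Union>Z" using ZZ by blast
      then have "(\<Sum>i<K + K'. c i * peval (r i) v) = 0" using c by blast
      then show "(\<Sum>i<K'. c (i + K) * peval (q i) v) = 0" unfolding r F(2)[OF v] by simp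
    qed
    then have cK': "\<forall>i<K'. c (i + K) = 0" by (rule q(2))
    define P where "P = (\<Sum>i<K. mon 0 (c i) * p i)"
    have P: "homog (int n) P"
      unfolding P_def using p(1) by (intro homog_sum homog_mult'[of 0 _ "int n"] homog_mon) auto
    have "peval F v * peval P v = 0" if vZ: "v \<in> \<Union>Z" for v
    proof -
      have "(\<Sum>i<K + K'. c i * peval (r i) v) = 0" using c vZ by blast
      then show ?thesis using cK' by (simp add: r P_def)
    qed
    from irreducible_prime[OF Z F(1) P this] have "\<forall>v\<in>\<Union>Z. peval P v = 0" using F(3,4) by blast
    then have "\<forall>v\<in>\<Union>Z. (\<Sum>i<K. c i * peval (p i) v) = 0" by (simp add: P_def)
    then have cK: "\<forall>i<K. c i = 0" by (rule p(2))
    show "c i = 0"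
    proof (cases "i < K")
      case False
      then show ?thesis using cK'[rule_format, of "i - K"] i by simp
    qed (use cK in simp)
  qed
qed

text \<open>A form \<open>F\<close> of degree \<open>e\<close> vanishes on \<open>Z'\<close> but not
  on \<open>Z\<close>. Descending from degree \<open>n\<close> in steps of \<open>e\<close>, each
  application of \<open>hilbert_ge_step\<close> contributes the Hilbert function of
  \<open>Z'\<close> in the current degree; a number of summands proportional to \<open>n\<close>
  raises the degree of growth by one.\<close>

lemma hilbert_growth_step:
  assumes Z: "irreducible_closedin (zariski I) Z" "irreducible_closedin (zariski I) Z'" and sub: "Z' \<subset> Z"
    and E: "E \<ge> 1" "\<And>n. hilbert_ge Z' n ((n div E) ^ i)"
  shows "\<exists>E'\<ge>1. \<forall>n. hilbert_ge Z n ((n div E') ^ Suc i)"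
proof -
  have cl: "closedin (zariski I) Z" "closedin (zariski I) Z'" "Z' \<noteq> {}"
    using Z by (auto simp: irreducible_closedin_def)
  have ZI: "Z \<subseteq> proj_space I" "Z' \<subseteq> proj_space I"
    using closedin_subset[OF cl(1)] closedin_subset[OF cl(2)] by simp_all
  obtain x where x: "x \<in> Z" "x \<notin> Z'" using sub by blast
  then obtain v where v: "x = proj_pt v" using ZI proj_space_ex by blast
  have "proj_pt v \<in> proj_space I" "proj_pt v \<notin> Z'" using x v ZI by auto
  then obtain k F where F: "homog k F" "peval F v \<noteq> 0" "\<And>u. u \<in> \<Union>Z' ==> peval F u = 0"
    using closedin_separate[OF cl(2)] by metis
  have vZ: "v \<in> \<Union>Z" using x(1) v mem_proj_pt by blast
  have k: "k \<ge> 0" using homog_neg[OF F(1)] F(2) by force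
  define e where "e = nat k"
  have Fe: "homog (int e) F" using F(1) k by (simp add: e_def)
  \<comment> \<open>A constant that vanishes on the nonempty set \<open>Z'\<close> would be
    zero.\<close>
  have e: "e \<ge> 1"
  proof (rule ccontr)
    assume "\<not> e \<ge> 1"
    then have "e = 0" by simp
    then have "homog 0 F" using Fe by simp
    then have "F = mon 0 (coef F 0)" by (rule homog_0_const)
    then have Fc: "peval F u = coef F 0" for u by (metis peval_mon meval_zero mult.right_neutral)
    obtain y where "y \<in> Z'" using cl(3) by blast
    then obtain u where "u \<in> \<Union>Z'" using ZI(2) proj_space_ex mem_proj_pt by blast
    then have "coef F 0 = 0" using F(3) Fc by metis
    then show False using F(2) Fc by simp
  qed
  have rep: "r * e \<le> n ==> hilbert_ge Z n (r * ((n - r * e) div E) ^ i)" for r n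
  proof (induction r arbitrary: n)
    case (Suc r)
    have n: "n = (n - e) + e" "r * e \<le> n - e" using Suc.prems by auto
    have "n - Suc r * e = n - e - r * e" by simp
    then have IH: "hilbert_ge Z (n - e) (r * ((n - Suc r * e) div E) ^ i)"
      using Suc.IH[OF n(2)] by simp
    have "hilbert_ge Z' (n - e + e) (((n - Suc r * e) div E) ^ i)"
      using hilbert_ge_less[OF E(2)[of n]] n(1) by (simp add: power_mono div_le_mono)
    from hilbert_ge_step[OF Z(1) _ Fe F(3) vZ F(2) IH this] sub n(1)
    show ?case by (simp add: add.commute)
  qed (simp add: hilbert_ge_0)
  \<comment> \<open>Half of the degree is spent on powers of \<open>F\<close>, the other half stays
    for \<open>Z'\<close>.\<close>
  define E' where "E' = 2 * e * E"
  have "hilbert_ge Z n ((n div E') ^ Suc i)" for n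
  proof -
    define r where "r = n div (2 * e)"
    have r2: "r * e * 2 \<le> n" unfolding r_def using div_times_less_eq_dividend[of n "2 * e"] by (simp add: algebra_simps)
    then have re: "r * e \<le> n" by simp
    have "n div E' \<le> r"
    proof -
      have "n div E' = r div E" by (simp add: E'_def r_def div_mult2_eq)
      then show ?thesis by simp
    qed
    moreover have "n div E' \<le> (n - r * e) div E"
    proof -
      have "n div E' = n div 2 div e div E" by (simp add: E'_def div_mult2_eq)
      also have "\<dots> \<le> n div 2 div E" by (intro div_le_mono) simp
      also have "\<dots> \<le> (n - r * e) div E" using r2 by (intro div_le_mono) linarith
      finally show ?thesis .
    qed
    ultimately have "(n div E') ^ Suc i \<le> r * ((n - r * e) div E) ^ i"
      by (simp add: mult_mono power_mono)
    then show ?thesis using hilbert_ge_less[OF rep[OF re]] by blast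
  qed
  moreover have "E' \<ge> 1" using e E(1) by (simp add: E'_def)
  ultimately show ?thesis by blast
qed

lemma hilbert_growth_chain:
  assumes "\<forall>i\<le>n. irreducible_closedin (zariski I) (Z i)" "\<forall>i<n. Z i \<subset> Z (Suc i)"
  shows "\<exists>E\<ge>1. \<forall>m. hilbert_ge (Z n) m ((m div E) ^ n)"
  using assms
proof (induction n)
  case 0
  then have "closedin (zariski I) (Z 0)" "Z 0 \<noteq> {}" by (auto simp: irreducible_closedin_def)
  then have "hilbert_ge (Z 0) m 1" for m
    using hilbert_ge_1[of "Z 0" I m] closedin_subset by fastforce
  then show ?case by auto
next
  case (Suc n)
  then obtain E where "E \<ge> 1" "\<And>m. hilbert_ge (Z n) m ((m div E) ^ n)" by auto
  then show ?case using hilbert_growth_step[of I "Z (Suc n)" "Z n" E n] Suc.prems by auto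
qed

text \<open>Composition with the parametrisation \<open>g\<close> sends forms that are independent
  on \<open>Z\<close> to independent polynomials in \<open>k\<close> parameters, of degree at most
  \<open>n * D\<close> in each of them.\<close>

lemma hilbert_upper_bound:
  fixes g :: "(nat => complex) => ('x => complex)"
  assumes g: "\<And>i. (\<lambda>s. g s i) \<in> bdd_polys k D"
    and dense: "\<And>p. homog (int n) p ==> (\<And>s. peval p (g s) = 0) ==> (\<forall>v\<in>\<Union>Z. peval p v = 0)"
    and K: "hilbert_ge Z n K"
  shows "K \<le> (n * D + 1) ^ k"
proof -
  obtain p where p: "\<forall>i<K. homog (int n) (p i)"
    "\<And>c. (\<forall>v\<in>\<Union>Z. (\<Sum>i<K. c i * peval (p i) v) = 0) ==> (\<forall>i<K. c i = 0)"
    using K unfolding hilbert_ge_def by blast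
  have "card {..<K} \<le> card (bdd_monos k (n * D))"
  proof (rule fs.family_bound[where e = "\<lambda>i s. peval (p i) (g s)"])
    show "(\<lambda>s. peval (p i) (g s)) \<in> fs.span (bdd_monos k (n * D))" if "i \<in> {..<K}" for i
      using bdd_polys.peval_in[OF _ g, of n "p i"] p(1) that by (simp add: bdd_polys_def)
    fix c assume A: "(\<Sum>i\<in>{..<K}. (\<lambda>s. c i * peval (p i) (g s))) = 0"
    have c: "(\<Sum>i<K. c i * peval (p i) (g s)) = 0" for s
      using fun_cong[OF A, of s] by (simp add: sum_apply)
    define P where "P = (\<Sum>i<K. mon 0 (c i) * p i)"
    have P: "homog (int n) P"
      unfolding P_def using p(1) by (intro homog_sum homog_mult'[of 0 _ "int n"] homog_mon) auto
    have "\<forall>v\<in>\<Union>Z. peval P v = 0" by (rule dense[OF P]) (use c in \<open>simp add: P_def\<close>)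
    then have "\<forall>v\<in>\<Union>Z. (\<Sum>i<K. c i * peval (p i) v) = 0" by (simp add: P_def)
    from p(2)[OF this] show "\<forall>i\<in>{..<K}. c i = 0" by simp
  qed (auto simp: finite_bdd_monos)
  also have "\<dots> \<le> (n * D + 1) ^ k" by (rule card_bdd_monos)
  finally show ?thesis by simp
qed

lemma growth_compare:
  fixes E D :: nat
  assumes "E \<ge> 1" "\<And>n. (n div E) ^ m \<le> (n * D + 1) ^ k"
  shows "m \<le> (k :: nat)"
proof (rule ccontr)
  assume "\<not> m \<le> k"
  then have mk: "m = k + Suc (m - k - 1)" by simp
  \<comment> \<open>At \<open>n = E * s\<close> the inequality gives
    \<open>s ^ m \<le> B * s ^ k\<close>, which fails for \<open>s = B + 1\<close> if
    \<open>m > k\<close>.\<close>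
  define B where "B = (E * D + 1) ^ k"
  define s where "s = B + 1"
  have "s ^ m = (E * s div E) ^ m" using assms(1) by simp
  also have "\<dots> \<le> (E * s * D + 1) ^ k" by (rule assms(2))
  also have "\<dots> \<le> ((E * D + 1) * s) ^ k" by (intro power_mono) (auto simp: s_def algebra_simps)
  also have "\<dots> = B * s ^ k" by (simp only: B_def power_mult_distrib)
  finally have "s ^ k * s ^ Suc (m - k - 1) \<le> B * s ^ k" by (metis mk power_add)
  moreover have "s ^ k > 0" by (simp add: s_def)
  ultimately have "s ^ Suc (m - k - 1) \<le> B"
    by (metis mult.commute nat_mult_le_cancel1)
  moreover have "s \<le> s ^ Suc (m - k - 1)" by (rule self_le_power) (auto simp: s_def)
  ultimately show False by (simp add: s_def)
qed

lemma krull_dim_closed: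
  assumes Z: "closedin (zariski I) Z"
    and chain: "\<forall>i\<le>l. irreducible_closedin (zariski I) (C i)" "\<forall>i<l. C i \<subset> C (Suc i)" "C l \<subseteq> Z"
    and bound: "\<And>n K. hilbert_ge Z n K ==> K \<le> (n * D + 1) ^ l"
  shows "krull_dim (subtopology (zariski I) Z) = enat l"
proof -
  have irr: "irreducible_closedin (subtopology (zariski I) Z) W \<longleftrightarrow> irreducible_closedin (zariski I) W \<and> W \<subseteq> Z" for W
    unfolding irreducible_closedin_def closedin_closed_subtopology[OF Z] by blast
  let ?S = "{enat n | n. \<exists>W. (\<forall>i\<le>n. irreducible_closedin (subtopology (zariski I) Z) (W i)) \<and> (\<forall>i<n. W i \<subset> W (Suc i))}"
  have up: "x \<le> enat l" if x_in: "x \<in> ?S" for x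
  proof -
    obtain n W where x: "x = enat n" and W: "\<forall>i\<le>n. irreducible_closedin (subtopology (zariski I) Z) (W i)"
      "\<forall>i<n. W i \<subset> W (Suc i)" using x_in by blast
    then have W': "\<forall>i\<le>n. irreducible_closedin (zariski I) (W i)" "W n \<subseteq> Z" by (auto simp: irr)
    obtain E where E: "E \<ge> 1" "\<And>m. hilbert_ge (W n) m ((m div E) ^ n)"
      using hilbert_growth_chain[OF W'(1) W(2)] by blast
    have "n \<le> l"
      by (rule growth_compare[OF E(1)]) (rule bound[OF hilbert_ge_mono[OF W'(2) E(2)]])
    then show ?thesis by (simp add: x)
  qed
  have le: "C i \<subseteq> C l" if "i \<le> l" for i
    using that
  proof (induction "l - i" arbitrary: i)
    case (Suc d)
    then have "i < l" by simp
    then have "C (Suc i) \<subseteq> C l" using Suc.hyps(1)[of "Suc i"] Suc.hyps(2) by simp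
    then show ?case using chain(2) \<open>i < l\<close> by blast
  qed simp
  have "enat l \<in> ?S"
  proof -
    have "irreducible_closedin (subtopology (zariski I) Z) (C i)" if "i \<le> l" for i
      using chain(1,3) le[OF that] that irr by blast
    then show ?thesis using chain(2) by blast
  qed
  then show ?thesis
    unfolding krull_dim_def using up by (intro antisym Sup_least Sup_upper) auto
qed

subsection \<open>Dominance\<close>

lemma peval_shift: "\<exists>q'. \<forall>v. peval q' v = peval q (\<lambda>i. s i + v i)"
proof (induction q rule: cpoly_induct)
  case (mon m c)
  have "peval (mon 0 c * (\<Prod>i\<in>supp m. (mon 0 (s i) + xp i 1) ^ expo m i)) v =
      peval (Poly_Mapping.single m c) (\<lambda>i. s i + v i)" for v
    by (simp add: meval_def)
  then show ?case by blast
next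
  case (add p q)
  then obtain p' q' where "\<forall>v. peval p' v = peval p (\<lambda>i. s i + v i)" "\<forall>v. peval q' v = peval q (\<lambda>i. s i + v i)"
    by blast
  then have "\<forall>v. peval (p' + q') v = peval (p + q) (\<lambda>i. s i + v i)" by simp
  then show ?case by blast
qed

text \<open>Only the initial form of the polynomial at the base point matters: it vanishes in the
  direction of every curve in the zero set, and all directions are attained.\<close>

lemma dominance_0:
  fixes q :: "'x cpoly"
  assumes curves: "\<And>w. (\<forall>i. i \<notin> I --> w i = 0) ==> \<exists>u :: complex => 'x => complex.
      (\<forall>i. ((\<lambda>\<epsilon>. u \<epsilon> i) \<longlongrightarrow> w i) (at 0)) \<and> (\<forall>\<epsilon>. \<epsilon> \<noteq> 0 --> peval q (\<lambda>i. \<epsilon> * u \<epsilon> i) = 0)"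
    and keys: "\<And>m. m \<in> supp q ==> supp m \<subseteq> I"
  shows "q = 0"
proof (rule ccontr)
  assume "q \<noteq> 0"
  then have ne: "supp q \<noteq> {}" by simp
  define k where "k = Min (mono_deg ` supp q)"
  have k: "k \<le> mono_deg m" if "m \<in> supp q" for m
    unfolding k_def using that by simp
  obtain m0 where m0: "m0 \<in> supp q" "mono_deg m0 = k"
  proof -
    have "k \<in> mono_deg ` supp q" unfolding k_def using ne by (intro Min_in) auto
    then show ?thesis using that by auto
  qed
  define c where "c m = (if mono_deg m = k then coef q m else 0)" for m
  have "\<exists>w. (\<forall>i. i \<notin> I --> w i = 0) \<and> (\<Sum>m\<in>supp q. c m * meval w m) \<noteq> 0"
  proof (rule ccontr)
    assume "\<not> ?thesis"
    then have "c m0 = 0"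
      by (intro meval_independent[of "supp q" I c m0]) (use keys m0(1) in auto)
    then show False using m0 by (simp add: c_def in_keys_iff)
  qed
  then obtain w where w: "\<forall>i. i \<notin> I --> w i = 0" "(\<Sum>m\<in>supp q. c m * meval w m) \<noteq> 0" by blast
  obtain u :: "complex => 'x => complex" where
    u: "\<And>i. ((\<lambda>\<epsilon>. u \<epsilon> i) \<longlongrightarrow> w i) (at 0)" "\<And>\<epsilon>. \<epsilon> \<noteq> 0 ==> peval q (\<lambda>i. \<epsilon> * u \<epsilon> i) = 0"
    using curves[OF w(1)] by blast
  \<comment> \<open>This is \<open>q\<close> along the curve, divided by
    \<open>\<epsilon> ^ k\<close>; its limit is the initial form of \<open>q\<close> at
    \<open>w\<close>.\<close>
  define h where "h \<epsilon> = (\<Sum>m\<in>supp q. coef q m * (\<epsilon> ^ (mono_deg m - k) * meval (u \<epsilon>) m))" for \<epsilon>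
  have "h \<epsilon> = 0" if "\<epsilon> \<noteq> 0" for \<epsilon>
  proof -
    have "\<epsilon> ^ k * h \<epsilon> = peval q (\<lambda>i. \<epsilon> * u \<epsilon> i)"
      unfolding h_def peval_meval sum_distrib_left
    proof (rule sum.cong)
      fix m assume "m \<in> supp q"
      then have "\<epsilon> ^ mono_deg m = \<epsilon> ^ k * \<epsilon> ^ (mono_deg m - k)" using k by (simp flip: power_add)
      then show "\<epsilon> ^ k * (coef q m * (\<epsilon> ^ (mono_deg m - k) * meval (u \<epsilon>) m)) =
          coef q m * meval (\<lambda>i. \<epsilon> * u \<epsilon> i) m" by (simp add: meval_scale)
    qed simp
    then show ?thesis using u(2)[OF that] that by simp
  qed
  then have h0: "(h \<longlongrightarrow> 0) (at 0)"
    by (intro tendsto_eventually) (auto simp: eventually_at_filter)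
  have mt: "((\<lambda>\<epsilon>. meval (u \<epsilon>) m) \<longlongrightarrow> meval w m) (at 0)" for m
    unfolding meval_def by (intro tendsto_prod tendsto_power u(1))
  have "((\<lambda>\<epsilon>. coef q m * (\<epsilon> ^ (mono_deg m - k) * meval (u \<epsilon>) m)) \<longlongrightarrow> c m * meval w m) (at 0)"
    if m: "m \<in> supp q" for m
  proof -
    have "((\<lambda>\<epsilon>. coef q m * (\<epsilon> ^ (mono_deg m - k) * meval (u \<epsilon>) m)) \<longlongrightarrow>
        coef q m * (0 ^ (mono_deg m - k) * meval w m)) (at 0)"
      by (intro tendsto_mult tendsto_const tendsto_power mt tendsto_ident_at)
    moreover have "coef q m * (0 ^ (mono_deg m - k) * meval w m) = c m * meval w m"
      using k[OF m] by (auto simp: c_def power_0_left)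
    ultimately show ?thesis by simp
  qed
  then have "(h \<longlongrightarrow> (\<Sum>m\<in>supp q. c m * meval w m)) (at 0)"
    unfolding h_def by (intro tendsto_sum)
  then show False using tendsto_unique[OF _ h0] w(2) by simp
qed

theorem dominance:
  fixes q :: "'x cpoly"
  assumes s0: "\<forall>i. i \<notin> I --> s0 i = 0"
    and curves: "\<And>w. (\<forall>i. i \<notin> I --> w i = 0) ==> \<exists>u :: complex => 'x => complex.
      (\<forall>\<epsilon> i. i \<notin> I --> u \<epsilon> i = 0) \<and>
      (\<forall>i. ((\<lambda>\<epsilon>. u \<epsilon> i) \<longlongrightarrow> w i) (at 0)) \<and> (\<forall>\<epsilon>. \<epsilon> \<noteq> 0 --> peval q (\<lambda>i. s0 i + \<epsilon> * u \<epsilon> i) = 0)"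
    and v: "\<forall>i. i \<notin> I --> v i = 0"
  shows "peval q v = 0"
proof -
  obtain q' where q': "\<And>v. peval q' v = peval q (\<lambda>i. s0 i + v i)" using peval_shift[of q s0] by blast
  \<comment> \<open>Monomials that involve a variable outside \<open>I\<close> vanish on the
    subspace in question and are dropped before the initial form is taken.\<close>
  define q'' where "q'' = (\<Sum>m | m \<in> supp q' \<and> supp m \<subseteq> I. mon m (coef q' m))"
  have "coef q'' m = (if m \<in> supp q' \<and> supp m \<subseteq> I then coef q' m else 0)" for m
    by (simp add: q''_def lookup_sum lookup_single when_def)
  then have keys: "supp m \<subseteq> I" if "m \<in> supp q''" for m
    using that by (auto simp: in_keys_iff split: if_splits)
  have pq: "peval q'' v = peval q' v" if v: "\<forall>i. i \<notin> I --> v i = 0" for v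
  proof -
    have 0: "meval v m = 0" if km: "\<not> supp m \<subseteq> I" for m
    proof -
      obtain i where "i \<in> supp m" "i \<notin> I" using km by blast
      then show ?thesis unfolding meval_def using v by (intro prod_zero) (auto simp: in_keys_iff intro!: bexI[of _ i])
    qed
    have "peval q'' v = (\<Sum>m | m \<in> supp q' \<and> supp m \<subseteq> I. coef q' m * meval v m)"
      by (simp add: q''_def)
    also have "\<dots> = peval q' v"
      unfolding peval_meval by (rule sum.mono_neutral_left) (use 0 in auto)
    finally show ?thesis .
  qed
  have "q'' = 0"
  proof (rule dominance_0[OF _ keys])
    fix w :: "'x => complex" assume "\<forall>i. i \<notin> I --> w i = 0"
    from curves[OF this] obtain u where u: "\<forall>\<epsilon> i. i \<notin> I --> u \<epsilon> i = 0"
      "\<forall>i. ((\<lambda>\<epsilon>. u \<epsilon> i) \<longlongrightarrow> w i) (at 0)" "\<forall>\<epsilon>. \<epsilon> \<noteq> 0 --> peval q (\<lambda>i. s0 i + \<epsilon> * u \<epsilon> i) = 0"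
      by blast
    have "peval q'' (\<lambda>i. \<epsilon> * u \<epsilon> i) = peval q (\<lambda>i. s0 i + \<epsilon> * u \<epsilon> i)" for \<epsilon>
      using pq[of "\<lambda>i. \<epsilon> * u \<epsilon> i"] u(1) by (simp add: q')
    then show "\<exists>u :: complex => 'x => complex. (\<forall>i. ((\<lambda>\<epsilon>. u \<epsilon> i) \<longlongrightarrow> w i) (at 0)) \<and>
        (\<forall>\<epsilon>. \<epsilon> \<noteq> 0 --> peval q'' (\<lambda>i. \<epsilon> * u \<epsilon> i) = 0)"
      using u(2,3) by (intro exI[of _ u]) simp
  qed
  define v' where "v' = (\<lambda>i. v i - s0 i)"
  have "peval q v = peval q' v'" by (simp add: q' v'_def)
  also have "\<dots> = peval q'' v'" using pq[of v'] v s0 by (simp add: v'_def)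
  also have "\<dots> = 0" unfolding \<open>q'' = 0\<close> by (rule peval_zero)
  finally show ?thesis .
qed

section \<open>Linear algebra\<close>

lemma (in vector_space_pair) rank_nullity:
  assumes add: "\<And>u v. f (u + v) = f u + f v" and sc: "\<And>c u. f (s1 c u) = s2 c (f u)"
    and V: "vs1.subspace V" "V \<subseteq> vs1.span T" "finite T"
  shows "vs1.dim V = vs1.dim {v \<in> V. f v = 0} + vs2.dim (f ` V)"
proof -
  have f0: "f 0 = 0" using sc[of 0 0] by simp
  have fsum: "f (\<Sum>x\<in>X. s1 (c x) x) = (\<Sum>x\<in>X. s2 (c x) (f x))" for X c
    by (induction X rule: infinite_finite_induct) (auto simp: add sc f0)
  let ?K = "{v \<in> V. f v = 0}"
  obtain B0 where B0: "B0 \<subseteq> ?K" "vs1.independent B0" "?K \<subseteq> vs1.span B0" "card B0 = vs1.dim ?K"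
    using vs1.basis_exists by blast
  obtain B where B: "B0 \<subseteq> B" "B \<subseteq> V" "vs1.independent B" "V \<subseteq> vs1.span B"
    using vs1.maximal_independent_subset_extend[of B0 V] B0(1,2) by blast
  have finB: "finite B" using vs1.independent_span_bound[OF V(3) B(3)] B(2) V(2) by blast
  then have finB0: "finite B0" using B(1) finite_subset by blast
  let ?C = "B - B0"
  have "vs2.dim (f ` V) = card ?C"
  proof (rule vs2.dim_family[where e = f])
    show "finite ?C" using finB by simp
    show "f x \<in> f ` V" if "x \<in> ?C" for x using that B(2) by blast
    fix c assume 0: "(\<Sum>x\<in>?C. s2 (c x) (f x)) = 0"
    define w where "w = (\<Sum>x\<in>?C. s1 (c x) x)"
    have "w \<in> V" unfolding w_def using B(2) V(1) by (intro vs1.subspace_sum vs1.subspace_scale) auto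
    moreover have "f w = 0" unfolding w_def fsum by (rule 0)
    ultimately have "w \<in> vs1.span B0" using B0(3) by blast
    then obtain r where r: "w = (\<Sum>x\<in>B0. s1 (r x) x)" using vs1.span_finite[OF finB0] by auto
    define u where "u x = (if x \<in> B0 then - r x else c x)" for x
    have "(\<Sum>x\<in>B. s1 (u x) x) = (\<Sum>x\<in>B0. s1 (u x) x) + (\<Sum>x\<in>?C. s1 (u x) x)"
      using sum.subset_diff[OF B(1) finB, of "\<lambda>x. s1 (u x) x"] by (simp add: add.commute)
    also have "(\<Sum>x\<in>B0. s1 (u x) x) = - w" unfolding r by (simp add: u_def sum_negf)
    also have "(\<Sum>x\<in>?C. s1 (u x) x) = w" unfolding w_def by (rule sum.cong) (auto simp: u_def)
    finally have "(\<Sum>x\<in>B. s1 (u x) x) = 0" by simp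
    then have "\<forall>x\<in>B. u x = 0"
      using B(3) finB unfolding vs1.independent_explicit_finite_subsets by blast
    then show "\<forall>x\<in>?C. c x = 0" by (auto simp: u_def split: if_splits)
  next
    fix y assume "y \<in> f ` V"
    then obtain v where v: "v \<in> V" "y = f v" by blast
    then have "v \<in> vs1.span B" using B(4) by blast
    then obtain u where u: "v = (\<Sum>x\<in>B. s1 (u x) x)" using vs1.span_finite[OF finB] by auto
    have "y = (\<Sum>x\<in>B. s2 (u x) (f x))" unfolding v(2) u by (rule fsum)
    also have "\<dots> = (\<Sum>x\<in>?C. s2 (u x) (f x))"
      by (rule sum.mono_neutral_right) (use finB B0(1) in auto)
    finally show "\<exists>c. y = (\<Sum>x\<in>?C. s2 (c x) (f x))" by (intro exI[of _ u])
  qed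
  moreover have "vs1.dim V = card B" using vs1.basis_card_eq_dim[OF B(2,4,3)] by simp
  moreover have "card B = card B0 + card ?C"
    using finB finB0 B(1) by (metis card_Diff_subset card_mono le_add_diff_inverse)
  ultimately show ?thesis using B0(4) by simp
qed

lemma (in vector_space) complement_family:
  assumes U: "subspace U" "U \<subseteq> W" and W: "subspace W" "W \<subseteq> span T" "finite T"
  obtains l and v :: "nat => 'b" where "dim W = dim U + l" "\<And>j. j < l ==> v j \<in> W"
    "\<And>w. w \<in> W ==> \<exists>u c. u \<in> U \<and> w = u + (\<Sum>j<l. scale (c j) (v j))"
    "\<And>c. (\<Sum>j<l. scale (c j) (v j)) \<in> U ==> \<forall>j<l. c j = 0"
proof -
  obtain B0 where B0: "B0 \<subseteq> U" "independent B0" "U \<subseteq> span B0" "card B0 = dim U"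
    using basis_exists by blast
  obtain B where B: "B0 \<subseteq> B" "B \<subseteq> W" "independent B" "W \<subseteq> span B"
    using maximal_independent_subset_extend[of B0 W] B0(1,2) U(2) by blast
  have finB: "finite B" using independent_span_bound[OF W(3) B(3)] B(2) W(2) by blast
  then have finB0: "finite B0" using B(1) finite_subset by blast
  let ?C = "B - B0"
  define l where "l = card ?C"
  have "finite ?C" using finB by simp
  then obtain h where h: "bij_betw h {0..<l} ?C" unfolding l_def using ex_bij_betw_nat_finite by blast
  then have h: "bij_betw h {..<l} ?C" by (simp add: atLeast0LessThan)
  have re: "(\<Sum>j<l. g (h j)) = (\<Sum>x\<in>?C. g x)" for g :: "'b => 'b"
    by (rule sum.reindex_bij_betw[OF h])
  show ?thesis
  proof (rule that[of l h])
    have "dim W = card B" using basis_card_eq_dim[OF B(2,4,3)] by simp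
    moreover have "card B = card B0 + card ?C"
      using finB finB0 B(1) by (metis card_Diff_subset card_mono le_add_diff_inverse)
    ultimately show "dim W = dim U + l" using B0(4) by (simp add: l_def)
    show "h j \<in> W" if "j < l" for j using bij_betwE[OF h] that B(2) by blast
    show "\<exists>u c. u \<in> U \<and> w = u + (\<Sum>j<l. scale (c j) (h j))" if w: "w \<in> W" for w
    proof -
      have "w \<in> span B" using w B(4) by blast
      then obtain r where r: "w = (\<Sum>x\<in>B. scale (r x) x)" using span_finite[OF finB] by auto
      have "w = (\<Sum>x\<in>B0. scale (r x) x) + (\<Sum>x\<in>?C. scale (r x) x)"
        unfolding r using sum.subset_diff[OF B(1) finB, of "\<lambda>x. scale (r x) x"] by (simp add: add.commute)
      also have "(\<Sum>x\<in>?C. scale (r x) x) = (\<Sum>j<l. scale (r (h j)) (h j))"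
        using re[of "\<lambda>x. scale (r x) x"] by simp
      finally have "w = (\<Sum>x\<in>B0. scale (r x) x) + (\<Sum>j<l. scale ((\<lambda>j. r (h j)) j) (h j))" by simp
      moreover have "(\<Sum>x\<in>B0. scale (r x) x) \<in> U"
        using B0(1) U(1) by (intro subspace_sum subspace_scale) auto
      ultimately show ?thesis
        by (intro exI[of _ "\<Sum>x\<in>B0. scale (r x) x"] exI[of _ "\<lambda>j. r (h j)"] conjI)
    qed
    fix c assume cU: "(\<Sum>j<l. scale (c j) (h j)) \<in> U"
    define g where "g = the_inv_into {..<l} h"
    have gh: "g (h j) = j" if "j < l" for j
      unfolding g_def using h that by (intro the_inv_into_f_f) (auto simp: bij_betw_def)
    have "(\<Sum>j<l. scale (c j) (h j)) = (\<Sum>j<l. scale (c (g (h j))) (h j))"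
      using gh by (intro sum.cong) auto
    also have "\<dots> = (\<Sum>x\<in>?C. scale (c (g x)) x)" using re[of "\<lambda>x. scale (c (g x)) x"] by simp
    finally have e: "(\<Sum>j<l. scale (c j) (h j)) = (\<Sum>x\<in>?C. scale (c (g x)) x)" .
    have "(\<Sum>x\<in>?C. scale (c (g x)) x) \<in> span B0" using cU B0(3) unfolding e by blast
    then obtain r where r: "(\<Sum>x\<in>?C. scale (c (g x)) x) = (\<Sum>x\<in>B0. scale (r x) x)"
      using span_finite[OF finB0] by auto
    define u where "u x = (if x \<in> B0 then - r x else c (g x))" for x
    have "(\<Sum>x\<in>B. scale (u x) x) = (\<Sum>x\<in>B0. scale (u x) x) + (\<Sum>x\<in>?C. scale (u x) x)"
      using sum.subset_diff[OF B(1) finB, of "\<lambda>x. scale (u x) x"] by (simp add: add.commute)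
    also have "(\<Sum>x\<in>B0. scale (u x) x) = - (\<Sum>x\<in>B0. scale (r x) x)" by (simp add: u_def sum_negf)
    also have "(\<Sum>x\<in>?C. scale (u x) x) = (\<Sum>x\<in>?C. scale (c (g x)) x)"
      by (rule sum.cong) (auto simp: u_def)
    finally have "(\<Sum>x\<in>B. scale (u x) x) = 0" using r by simp
    then have u0: "\<forall>x\<in>B. u x = 0"
      using B(3) finB unfolding independent_explicit_finite_subsets by blast
    show "\<forall>j<l. c j = 0"
    proof (intro allI impI)
      fix j assume j: "j < l"
      then have "h j \<in> ?C" using bij_betwE[OF h] by blast
      then show "c j = 0" using u0 gh[OF j] by (auto simp: u_def split: if_splits)
    qed
  qed
qed

definition supported :: "'y set => ('y => complex) set" where
  "supported J = {f. \<forall>y. y \<notin> J --> f y = 0}"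

lemma supported_subspace: "fs.subspace (supported J)"
  by (rule fs.subspaceI) (auto simp: supported_def)

lemma supported_expand:
  assumes "finite J" "f \<in> supported J"
  shows "f = (\<Sum>y\<in>J. (\<lambda>s. f y * (if s = y then 1 else 0)))"
proof
  fix s
  have "(\<Sum>y\<in>J. (\<lambda>s. f y * (if s = y then 1 else 0))) s = (\<Sum>y\<in>J. if y = s then f s else 0)"
    unfolding sum_apply by (rule sum.cong) auto
  then show "f s = (\<Sum>y\<in>J. (\<lambda>s. f y * (if s = y then 1 else 0))) s"
    using assms by (simp add: supported_def)
qed

lemma dim_supported:
  fixes J :: "'y set"
  assumes "finite J"
  shows "fs.dim (supported J) = card J"
proof (rule fs.dim_family[where e = "\<lambda>y s. if s = y then 1 else 0", OF assms])
  show "(\<lambda>s. if s = y then 1 else 0) \<in> supported J" if "y \<in> J" for y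
    using that by (auto simp: supported_def)
  fix c :: "'y => complex" assume 0: "(\<Sum>y\<in>J. (\<lambda>s. c y * (if s = y then 1 else 0))) = 0"
  have "c y = 0" if "y \<in> J" for y
  proof -
    have "(\<Sum>x\<in>J. (\<lambda>s. c x * (if s = x then 1 else 0))) y = (\<Sum>x\<in>J. if x = y then c y else 0)"
      unfolding sum_apply by (rule sum.cong) (auto simp: eq_commute)
    then show ?thesis using fun_cong[OF 0, of y] assms that by simp
  qed
  then show "\<forall>y\<in>J. c y = 0" by blast
next
  fix f :: "'y => complex" assume "f \<in> supported J"
  from supported_expand[OF assms this]
  show "\<exists>c. f = (\<Sum>y\<in>J. (\<lambda>s. c y * (if s = y then 1 else 0)))" by (rule exI[of _ f])
qed

lemma supported_in_span:
  assumes "finite J"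
  shows "\<exists>T. finite T \<and> supported J \<subseteq> fs.span T"
proof -
  have "f \<in> fs.span ((\<lambda>y s. if s = y then 1 else 0) ` J)" if "f \<in> supported J" for f
    by (subst supported_expand[OF assms that]) (intro fs.span_sum fs.span_scale fs.span_base, blast)
  then show ?thesis using assms by (intro exI[of _ "(\<lambda>y s. if s = y then 1 else 0) ` J"]) auto
qed

section \<open>Closures of families of forms\<close>

lemma family_irreducible:
  fixes g :: "('z => complex) => ('x => complex)"
  assumes g: "\<And>i. (\<lambda>s. g s i) \<in> poly_funs" and I: "\<And>s i. i \<notin> I ==> g s i = 0" and nz: "nz (g s0)"
  shows "irreducible_closedin (zariski I) (zariski I closure_of {proj_pt (g s) | s. nz (g s)})"
proof (rule irreducible_closureI)
  let ?Y = "{proj_pt (g s) | s. nz (g s)}"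
  show "?Y \<subseteq> proj_space I" using I by (auto simp: proj_pt_in_space)
  show "?Y \<noteq> {}" using nz by blast
  fix n k p q assume p: "homog n p" and q: "homog k q"
    and pq: "\<And>u. u \<in> \<Union>?Y ==> peval p u * peval q u = 0"
  obtain i0 where i0: "g s0 i0 \<noteq> 0" using nz by (auto simp: nz_def)
  have in_alg: "(\<lambda>s. peval r (g s)) \<in> poly_funs" if r: "homog m r" for m and r :: "'x cpoly"
  proof (cases "r = 0")
    case True
    then show ?thesis using poly_funs.const[of 0] by simp
  next
    case False
    then have "m \<ge> 0" using homog_neg[OF r] by force
    then have "homog (int (nat m)) r" using r by simp
    then show ?thesis by (rule poly_funs.peval_in) (rule g)
  qed
  have inY: "g s \<in> \<Union>?Y" if "nz (g s)" for s using that mem_proj_pt by blast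
  \<comment> \<open>The extra factor is a coordinate that is not identically zero; it covers the
    parameters where \<open>g s\<close> is the zero vector and represents no point.\<close>
  have "(g s i0 * peval p (g s)) * peval q (g s) = 0" for s
  proof (cases "nz (g s)")
    case True
    then show ?thesis using pq[OF inY[OF True]] by simp
  qed (auto simp: nz_def)
  from poly_funs_prime[OF poly_funs.mult[OF g in_alg[OF p]] in_alg[OF q] this]
  have "(\<forall>s. peval p (g s) = 0) \<or> (\<forall>s. peval q (g s) = 0)"
  proof
    assume "\<forall>s. g s i0 * peval p (g s) = 0"
    then have "(\<forall>s. g s i0 = 0) \<or> (\<forall>s. peval p (g s) = 0)"
      by (intro poly_funs_prime[OF g in_alg[OF p]]) blast
    then show ?thesis using i0 by blast
  qed blast
  then show "(\<forall>u\<in>\<Union>?Y. peval p u = 0) \<or> (\<forall>u\<in>\<Union>?Y. peval q u = 0)"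
    using homog_zero_iff[OF p] homog_zero_iff[OF q] by blast
qed

lemma family_vanish:
  assumes I: "\<And>s i. i \<notin> I ==> g s i = 0" and p: "homog n p" "\<And>s. nz (g s) ==> peval p (g s) = 0"
  shows "\<forall>v\<in>\<Union>(zariski I closure_of {proj_pt (g s) | s. nz (g s)}). peval p v = 0"
proof
  let ?Y = "{proj_pt (g s) | s. nz (g s)}"
  fix v assume v: "v \<in> \<Union>(zariski I closure_of ?Y)"
  show "peval p v = 0"
  proof (rule vanish_closure[OF p(1) _ _ v])
  show "?Y \<subseteq> proj_space I" using I by (auto simp: proj_pt_in_space)
  show "peval p u = 0" if u: "u \<in> \<Union>?Y" for u
  proof -
    obtain s where s: "nz (g s)" "u \<in> proj_pt (g s)" using u by blast
    then show ?thesis using p(2)[OF s(1)] peval_homog_scale[OF p(1)] by (auto simp: proj_pt_def)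
  qed
  qed
qed

lemma hilbert_geI:
  assumes "finite X" "\<And>x. x \<in> X ==> homog (int n) (p x)"
    and "\<And>c. (\<forall>v\<in>\<Union>Z. (\<Sum>x\<in>X. c x * peval (p x) v) = 0) ==> \<forall>x\<in>X. c x = 0"
  shows "hilbert_ge Z n (card X)"
proof -
  obtain h where "bij_betw h {0..<card X} X" using ex_bij_betw_nat_finite[OF assms(1)] by blast
  then have h: "bij_betw h {..<card X} X" by (simp add: atLeast0LessThan)
  define g where "g = the_inv_into {..<card X} h"
  have gh: "g (h j) = j" if "j < card X" for j
    unfolding g_def using h that by (intro the_inv_into_f_f) (auto simp: bij_betw_def)
  have hX: "h j \<in> X" if "j < card X" for j using bij_betwE[OF h] that by blast
  show ?thesis
    unfolding hilbert_ge_def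
  proof (intro exI conjI allI impI)
    show "homog (int n) (p (h i))" if "i < card X" for i using assms(2) hX[OF that] by blast
    fix c i assume c: "\<forall>v\<in>\<Union>Z. (\<Sum>i<card X. c i * peval (p (h i)) v) = 0" and i: "i < card X"
    have "(\<Sum>i<card X. c i * peval (p (h i)) v) = (\<Sum>x\<in>X. c (g x) * peval (p x) v)" for v
    proof -
      have "(\<Sum>i<card X. c i * peval (p (h i)) v) = (\<Sum>i<card X. c (g (h i)) * peval (p (h i)) v)"
        using gh by (intro sum.cong) auto
      also have "\<dots> = (\<Sum>x\<in>X. c (g x) * peval (p x) v)"
        by (rule sum.reindex_bij_betw[OF h])
      finally show ?thesis .
    qed
    then have "\<forall>v\<in>\<Union>Z. (\<Sum>x\<in>X. c (g x) * peval (p x) v) = 0" using c by simp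
    then have "\<forall>x\<in>X. c (g x) = 0" by (rule assms(3))
    then show "c i = 0" using hX[OF i] gh[OF i] by force
  qed
qed

text \<open>The coordinate functionals of a basis extending the vectors \<open>f r\<close>,
  restricted to vectors supported in \<open>I\<close>, where they become linear forms.\<close>

lemma dual_functionals:
  fixes f :: "nat => ('x => complex)"
  assumes I: "finite I" "\<And>r. r < k ==> f r \<in> supported I"
    and indep: "\<And>c. (\<Sum>r<k. (\<lambda>s. c r * f r s)) = 0 ==> \<forall>r<k. c r = 0"
  shows "\<exists>(L :: nat => 'x cpoly) c. (\<forall>r. homog 1 (L r)) \<and> (\<forall>r x. peval (L r) x = (\<Sum>m\<in>I. c r m * x m)) \<and>
    (\<forall>r<k. \<forall>j<k. peval (L r) (f j) = (if r = j then 1 else 0))"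
proof -
  have dd: "inj_on f {..<k}" "fs.independent (f ` {..<k})"
  proof -
    show inj: "inj_on f {..<k}"
    proof (rule inj_onI, rule ccontr)
      fix x y assume xy: "x \<in> {..<k}" "y \<in> {..<k}" "f x = f y" "x \<noteq> y"
      define c :: "nat => complex" where "c = (\<lambda>z. if z = x then 1 else if z = y then - 1 else 0)"
      have "(\<Sum>r<k. (\<lambda>s. c r * f r s)) = (\<Sum>r\<in>{x, y}. (\<lambda>s. c r * f r s))"
        by (rule sum.mono_neutral_right) (use xy in \<open>auto simp: c_def zero_fun_def\<close>)
      also have "\<dots> = 0" using xy by (intro ext) (simp add: c_def)
      finally have "c x = 0" using indep xy(1) by blast
      then show False by (simp add: c_def)
    qed
    show "fs.independent (f ` {..<k})"
      unfolding fs.independent_explicit_finite_subsets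
    proof (intro allI impI ballI)
      fix A u b assume A: "A \<subseteq> f ` {..<k}" "finite A" "(\<Sum>v\<in>A. (\<lambda>s. u v * v s)) = 0" "b \<in> A"
      define c where "c r = (if f r \<in> A then u (f r) else 0)" for r
      have "(\<Sum>r<k. (\<lambda>s. c r * f r s)) = (\<Sum>v\<in>f ` {..<k}. (\<lambda>s. (if v \<in> A then u v else 0) * v s))"
        by (simp add: sum.reindex[OF inj] c_def)
      also have "\<dots> = (\<Sum>v\<in>A. (\<lambda>s. u v * v s))"
        by (rule sum.mono_neutral_cong_right) (use A in \<open>auto simp: zero_fun_def\<close>)
      finally have "\<forall>r<k. c r = 0" using A(3) by (intro indep) simp
      moreover obtain r where "r < k" "f r = b" using A(1,4) by blast
      ultimately show "u b = 0" using A(4) by (force simp: c_def)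
    qed
  qed
  let ?E = "fs.extend_basis (f ` {..<k})"
  define h where "h r v = fs.representation ?E v (f r)" for r v
  have E: "fs.independent ?E" "v \<in> fs.span ?E" for v
    using fs.independent_extend_basis[OF dd(2)] fs.span_extend_basis[OF dd(2)] by blast+
  have hb: "h r (f j) = (if r = j then 1 else 0)" if "r < k" "j < k" for r j
  proof -
    have "f j \<in> ?E" using fs.extend_basis_superset[OF dd(2)] that(2) by blast
    then have "h r (f j) = (if f r = f j then 1 else 0)"
      unfolding h_def by (subst fs.representation_basis[OF E(1)]) simp_all
    then show ?thesis using that dd(1) by (auto simp: inj_on_def)
  qed
  have hs: "h r (\<Sum>y\<in>I. (\<lambda>s. c y * e y s)) = (\<Sum>y\<in>I. c y * h r (e y))" for r c e
    unfolding h_def using fs.representation_sum[OF E(1), of I "\<lambda>y s. c y * e y s"] E(2)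
      fs.representation_scale[OF E(1) E(2)] by simp
  define L where "L r = (\<Sum>m\<in>I. mon 0 (h r (\<lambda>s. if s = m then 1 else 0)) * xp m 1)" for r
  have d1: "homog 1 (L r)" for r
    unfolding L_def by (intro homog_sum homog_mult'[of 0 _ 1] homog_mon) (use homog_xp[of 1] in auto)
  have d2: "peval (L r) x = (\<Sum>m\<in>I. h r (\<lambda>s. if s = m then 1 else 0) * x m)" for r x
    by (simp add: L_def)
  have d3: "peval (L r) (f j) = (if r = j then 1 else 0)" if "r < k" "j < k" for r j
  proof -
    have "h r (f j) = h r (\<Sum>y\<in>I. (\<lambda>s. f j y * (if s = y then 1 else 0)))"
      using supported_expand[OF I(1) I(2)[OF that(2)]] by simp
    also have "\<dots> = (\<Sum>y\<in>I. f j y * h r (\<lambda>s. if s = y then 1 else 0))"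
      by (rule hs)
    also have "\<dots> = peval (L r) (f j)" by (simp add: L_def mult.commute)
    finally show ?thesis using hb[OF that] by simp
  qed
  show ?thesis
    by (rule exI[of _ L], rule exI[of _ "\<lambda>r m. h r (\<lambda>s. if s = m then 1 else 0)"]) (use d1 d2 d3 in blast)
qed

lemma poly_difference_quotient:
  fixes R :: "complex poly"
  shows "((\<lambda>\<epsilon>. (poly R \<epsilon> - coeff R 0) / \<epsilon>) \<longlongrightarrow> coeff R 1) (at 0)"
proof -
  obtain a P where R: "R = pCons a P" by (cases R)
  have "((\<lambda>\<epsilon>. poly P \<epsilon>) \<longlongrightarrow> poly P 0) (at 0)"
    using poly_isCont[of 0 P] by (simp add: isCont_def)
  then have "((\<lambda>\<epsilon>. poly P \<epsilon>) \<longlongrightarrow> coeff R 1) (at 0)" by (simp add: R poly_0_coeff_0)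
  moreover have "\<forall>\<^sub>F \<epsilon> in at 0. poly P \<epsilon> = (poly R \<epsilon> - coeff R 0) / \<epsilon>"
    by (auto simp: eventually_at_filter R)
  ultimately show ?thesis by (rule Lim_transform_eventually)
qed

text \<open>A family of forms whose first-order behaviour at a base point spans a space of dimension
  \<open>k + 1\<close> has a cone of dimension at least \<open>k + 1\<close>: in dual coordinates the curves in it attain
  all directions, so no polynomial in these coordinates vanishes on it.\<close>

lemma family_hilbert_lower:
  fixes g :: "(nat => complex) => ('x => complex)" and f :: "nat => ('x => complex)"
  assumes I: "finite I" "\<And>s i. i \<notin> I ==> g s i = 0"
    and f: "\<And>r. r < Suc k ==> f r \<in> supported I"
    and indep: "\<And>c. (\<Sum>r<Suc k. (\<lambda>s. c r * f r s)) = 0 ==> \<forall>r<Suc k. c r = 0"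
    and tangent: "\<And>w m. \<exists>R. (\<forall>\<epsilon>. g (\<lambda>j. \<epsilon> * w j) m = poly R \<epsilon>) \<and> coeff R 0 = f 0 m \<and>
      coeff R 1 = (\<Sum>j<k. w j * f (Suc j) m)"
    and k: "k > 0"
  shows "hilbert_ge (zariski I closure_of {proj_pt (g s) | s. nz (g s)}) n ((n div (k + 1)) ^ k)"
proof (cases "n = 0")
  case True
  then show ?thesis using k by (simp add: hilbert_ge_0 zero_power)
next
  case False
  let ?Y = "{proj_pt (g s) | s. nz (g s)}" and ?M = "n div (k + 1)"
  have LL: "\<exists>(L :: nat => 'x cpoly) c. (\<forall>r. homog 1 (L r)) \<and> (\<forall>r x. peval (L r) x = (\<Sum>m\<in>I. c r m * x m)) \<and>
      (\<forall>r<Suc k. \<forall>j<Suc k. peval (L r) (f j) = (if r = j then 1 else 0))"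
    by (rule dual_functionals[OF I(1)]) (rule f, assumption, rule indep, assumption)
  obtain L :: "nat => 'x cpoly" and cf where L: "\<And>r. homog 1 (L r)"
    "\<And>r j. r < Suc k ==> j < Suc k ==> peval (L r) (f j) = (if r = j then 1 else 0)"
    and Lx: "\<And>r x. peval (L r) x = (\<Sum>m\<in>I. cf r m * x m)"
    using LL by blast
  have Y: "?Y \<subseteq> proj_space I" using I(2) by (auto simp: proj_pt_in_space)
  define X where "X = PiE {1..k} (\<lambda>_. {..<?M})"
  \<comment> \<open>The exponents of the variables \<open>1..k\<close> are free below
    \<open>n div (k + 1)\<close>, so their sum is at most \<open>n\<close> and the exponent of
    variable \<open>0\<close> fills up the degree.\<close>
  define mu where "mu a = Poly_Mapping.single 0 (n - (\<Sum>r\<in>{1..k}. a r)) + (\<Sum>r\<in>{1..k}. Poly_Mapping.single r (a r))"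
    for a :: "nat => nat"
  have small: "(\<Sum>r\<in>{1..k}. a r) \<le> n" if "a \<in> X" for a
  proof -
    have "(\<Sum>r\<in>{1..k}. a r) \<le> (\<Sum>r\<in>{1..k}. ?M)"
      by (rule sum_mono) (use that in \<open>force simp: X_def PiE_iff\<close>)
    also have "\<dots> \<le> ?M * (k + 1)" by simp
    also have "\<dots> \<le> n" by (rule div_times_less_eq_dividend)
    finally show ?thesis .
  qed
  have mu_expo: "expo (mu a) r = (if r = 0 then n - (\<Sum>r\<in>{1..k}. a r) else if r \<le> k then a r else 0)" for a r
  proof -
    have "(\<Sum>r'\<in>{1..k}. a r' when r' = r) = (\<Sum>r'\<in>{1..k}. if r' = r then a r else 0)"
      by (rule sum.cong) (auto simp: when_def)
    then show ?thesis
      unfolding mu_def lookup_add lookup_sum lookup_single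
      by (auto simp: when_def)
  qed
  have mu_keys: "supp (mu a) \<subseteq> {..<Suc k}" for a
    by (auto simp: in_keys_iff mu_expo split: if_splits)
  have mu_deg: "mono_deg (mu a) = n" if "a \<in> X" for a
  proof -
    have "mono_deg (mu a) = (\<Sum>r\<in>insert 0 {1..k}. expo (mu a) r)"
      by (rule mono_deg_superset) (use mu_keys[of a] in \<open>auto simp: subset_iff less_Suc_eq_le\<close>)
    also have "\<dots> = (n - (\<Sum>r\<in>{1..k}. a r)) + (\<Sum>r\<in>{1..k}. a r)"
      by (subst sum.insert) (auto simp: mu_expo)
    finally show ?thesis using small[OF that] by simp
  qed
  have mu_inj: "inj_on mu X"
  proof (rule inj_onI)
    fix a b assume ab: "a \<in> X" "b \<in> X" "mu a = mu b"
    show "a = b"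
    proof (rule PiE_ext[OF ab(1,2)[unfolded X_def]])
      fix r assume "r \<in> {1..k}"
      then show "a r = b r" using mu_expo[of a r] mu_expo[of b r] ab(3) by simp
    qed
  qed
  have finX: "finite X" unfolding X_def by (intro finite_PiE) auto
  define P where "P a = (\<Prod>r<Suc k. L r ^ expo (mu a) r)" for a
  have P: "peval (P a) v = meval (\<lambda>r. peval (L r) v) (mu a)" for a v
    unfolding P_def by (simp only: peval_prod peval_power meval_superset[OF finite_lessThan mu_keys])
  have Ph: "homog (int n) (P a)" if "a \<in> X" for a
  proof -
    have "homog (\<Sum>r<Suc k. int (expo (mu a) r) * 1) (P a)"
      unfolding P_def by (intro homog_prod homog_power L(1))
    moreover have "(\<Sum>r<Suc k. int (expo (mu a) r) * 1) = int (mono_deg (mu a))"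
      by (simp only: mono_deg_superset[OF finite_lessThan mu_keys] of_nat_sum mult_1_right)
    ultimately show ?thesis using mu_deg[OF that] by simp
  qed
  have "hilbert_ge (zariski I closure_of ?Y) n (card X)"
  proof (rule hilbert_geI[OF finX Ph])
    fix c assume c: "\<forall>v\<in>\<Union>(zariski I closure_of ?Y). (\<Sum>a\<in>X. c a * peval (P a) v) = 0"
    define q where "q = (\<Sum>a\<in>X. mon (mu a) (c a))"
    have q: "peval q z = (\<Sum>a\<in>X. c a * meval z (mu a))" for z by (simp add: q_def)
    have qh: "homog (int n) q" unfolding q_def by (intro homog_sum homog_mon) (simp add: mu_deg)
    have sub: "?Y \<subseteq> zariski I closure_of ?Y" by (rule closure_of_subset) (use Y in simp)
    have qL: "peval q (\<lambda>r. peval (L r) v) = 0" if v: "v \<in> \<Union>?Y" for v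
    proof -
      have "v \<in> \<Union>(zariski I closure_of ?Y)" using v sub by blast
      then have "(\<Sum>a\<in>X. c a * peval (P a) v) = 0" by (rule c[THEN bspec])
      then show ?thesis by (simp add: q P)
    qed
    have q0: "peval q (\<lambda>_. 0) = 0"
      using False peval_homog_scale[OF qh, of 0 "\<lambda>_. 0"] by (simp add: zero_power)
    \<comment> \<open>Homogeneity extends the vanishing to all multiples of the points of the
      family, the zero vector included, so that rescaled curves stay in the zero set.\<close>
    have cone: "peval q (\<lambda>r. l * peval (L r) (g s)) = 0" for l s
    proof (cases "l \<noteq> 0 \<and> nz (g s)")
      case True
      then have "(\<lambda>i. l * g s i) \<in> proj_pt (g s)" by (auto simp: proj_pt_iff)
      then have "(\<lambda>i. l * g s i) \<in> \<Union>?Y" using True by blast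
      from qL[OF this] show ?thesis using peval_homog_scale[OF L(1), of _ l "g s"] by simp
    next
      case F: False
      have "l * peval (L r) (g s) = 0" for r
      proof (cases "l = 0")
        case False
        then have "g s = (\<lambda>_. 0)" using F by (auto simp: nz_def)
        then show ?thesis by (simp add: Lx)
      qed simp
      then have "(\<lambda>r. l * peval (L r) (g s)) = (\<lambda>_. 0)" by blast
      then show ?thesis using q0 by simp
    qed
    have qz: "peval q z = 0" if z: "\<forall>r. r \<notin> {..<Suc k} --> z r = 0" for z
    proof (rule dominance[where I = "{..<Suc k}" and ?s0.0 = "\<lambda>r. if r = 0 then 1 else 0", OF _ _ z])
      show "\<forall>r. r \<notin> {..<Suc k} --> (if r = 0 then 1 else 0 :: complex) = 0" by simp
      fix w :: "nat => complex" assume w: "\<forall>r. r \<notin> {..<Suc k} --> w r = 0"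
      obtain R where R: "\<And>m \<epsilon>. g (\<lambda>j. \<epsilon> * w (Suc j)) m = poly (R m) \<epsilon>" "\<And>m. coeff (R m) 0 = f 0 m"
        "\<And>m. coeff (R m) 1 = (\<Sum>j<k. w (Suc j) * f (Suc j) m)"
        using tangent[of "\<lambda>j. w (Suc j)"] by metis
      \<comment> \<open>The factor \<open>1 + \<epsilon> w 0\<close> moves along the ray of the cone
        and realises the direction of \<open>f 0\<close>; the parameters realise the other
        directions.\<close>
      define Q where "Q r = [:1, w 0:] * (\<Sum>m\<in>I. Polynomial.smult (cf r m) (R m))" for r
      have Q: "(1 + \<epsilon> * w 0) * peval (L r) (g (\<lambda>j. \<epsilon> * w (Suc j))) = poly (Q r) \<epsilon>" for r \<epsilon>
        by (simp add: Q_def Lx poly_sum R(1) ring_distribs mult.assoc)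
      have cs: "coeff (\<Sum>m\<in>I. Polynomial.smult (cf r m) (R m)) i =
          (\<Sum>m\<in>I. cf r m * coeff (R m) i)" for r i
        by (simp add: coeff_sum)
      have c0: "coeff (Q r) 0 = peval (L r) (f 0)" for r
        unfolding Q_def by (simp add: coeff_mult cs R(2) Lx)
      have c1: "coeff (Q r) 1 = w 0 * peval (L r) (f 0) + (\<Sum>j<k. w (Suc j) * peval (L r) (f (Suc j)))" for r
      proof -
        have "(\<Sum>m\<in>I. cf r m * (\<Sum>j<k. w (Suc j) * f (Suc j) m)) =
            (\<Sum>j<k. w (Suc j) * peval (L r) (f (Suc j)))"
          unfolding Lx sum_distrib_left
          by (subst sum.swap) (simp add: mult.left_commute)
        then show ?thesis
          unfolding Q_def by (simp add: coeff_mult cs R(2) R(3)[unfolded One_nat_def] Lx)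
      qed
      have Qr0: "coeff (Q r) 0 = (if r = 0 then 1 else 0)" if "r < Suc k" for r
        using L(2)[OF that, of 0] c0 by simp
      have Qr1: "coeff (Q r) 1 = w r" if r: "r < Suc k" for r
      proof -
        have "(\<Sum>j<k. w (Suc j) * peval (L r) (f (Suc j))) = (\<Sum>j<k. if Suc j = r then w r else 0)"
          by (rule sum.cong) (use L(2)[OF r] in auto)
        also have "\<dots> = (if r = 0 then 0 else w r)"
        proof (cases r)
          case (Suc r')
          then show ?thesis using r by simp
        qed simp
        finally show ?thesis using c1[of r] L(2)[OF r, of 0] by simp
      qed
      define u where "u \<epsilon> r = (if r < Suc k then (poly (Q r) \<epsilon> - coeff (Q r) 0) / \<epsilon> else 0)" for \<epsilon> r
      show "\<exists>u :: complex => nat => complex. (\<forall>\<epsilon> i. i \<notin> {..<Suc k} --> u \<epsilon> i = 0) \<and>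
          (\<forall>i. ((\<lambda>\<epsilon>. u \<epsilon> i) \<longlongrightarrow> w i) (at 0)) \<and>
          (\<forall>\<epsilon>. \<epsilon> \<noteq> 0 --> peval q (\<lambda>i. (if i = 0 then 1 else 0) + \<epsilon> * u \<epsilon> i) = 0)"
      proof (intro exI conjI allI impI)
        show "u \<epsilon> i = 0" if "i \<notin> {..<Suc k}" for \<epsilon> i using that by (simp add: u_def)
        show "((\<lambda>\<epsilon>. u \<epsilon> i) \<longlongrightarrow> w i) (at 0)" for i
        proof (cases "i < Suc k")
          case True
          then show ?thesis
            unfolding u_def using poly_difference_quotient[of "Q i"] Qr1[OF True] by simp
        next
          case False
          then show ?thesis unfolding u_def using w by simp
        qed
        fix \<epsilon> :: complex assume e: "\<epsilon> \<noteq> 0"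
        have "meval (\<lambda>i. (if i = 0 then 1 else 0) + \<epsilon> * u \<epsilon> i) (mu a) =
            meval (\<lambda>r. (1 + \<epsilon> * w 0) * peval (L r) (g (\<lambda>j. \<epsilon> * w (Suc j)))) (mu a)" for a
          unfolding meval_superset[OF finite_lessThan mu_keys] Q
          by (rule prod.cong) (use e Qr0 in \<open>auto simp: u_def\<close>)
        then have "peval q (\<lambda>i. (if i = 0 then 1 else 0) + \<epsilon> * u \<epsilon> i) =
            peval q (\<lambda>r. (1 + \<epsilon> * w 0) * peval (L r) (g (\<lambda>j. \<epsilon> * w (Suc j))))"
          by (simp add: q)
        then show "peval q (\<lambda>i. (if i = 0 then 1 else 0) + \<epsilon> * u \<epsilon> i) = 0" using cone by simp
      qed
    qed
    show "\<forall>a\<in>X. c a = 0"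
    proof -
      have "(\<Sum>m\<in>mu ` X. c (the_inv_into X mu m) * meval z m) = 0" if "\<forall>r. r \<notin> {..<Suc k} --> z r = 0" for z
        using qz[OF that] mu_inj by (simp add: q sum.reindex the_inv_into_f_f)
      then have "c (the_inv_into X mu m) = 0" if "m \<in> mu ` X" for m
        using meval_independent[of "mu ` X" "{..<Suc k}" "\<lambda>m. c (the_inv_into X mu m)" m] finX mu_keys that by blast
      then show ?thesis using mu_inj by (force simp: the_inv_into_f_f)
    qed
  qed
  moreover have "card X = ?M ^ k" by (simp add: X_def card_PiE)
  ultimately show ?thesis by simp
qed

section \<open>Coordinates of graded matrices\<close>

type_synonym entry = "nat \<times> nat \<times> (4 \<Rightarrow>\<^sub>0 nat)"

definition gidx :: "nat => (nat => int) => (nat => int) => entry set" where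
  "gidx n a b = {(i, j, m). i < n \<and> j < n \<and> int (mono_deg m) = b j - a i}"

text \<open>\<open>gmat\<close> and \<open>crd\<close> pass between graded matrices and vectors of
  coefficients, so that polynomials in the coefficients and dimensions of spaces of matrices make
  sense.\<close>

definition gmat :: "(nat => int) => (nat => int) => (entry => complex) => nat => nat => form" where
  "gmat a b x = (\<lambda>i j. \<Sum>m | int (mono_deg m) = b j - a i. mon m (x (i, j, m)))"

definition crd :: "nat => (nat => int) => (nat => int) => (nat => nat => form) => entry => complex" where
  "crd n a b M = (\<lambda>(i, j, m). if (i, j, m) \<in> gidx n a b then coef (M i j) m else 0)"

lemma gidx_Sigma: "gidx n a b = Sigma {..<n} (\<lambda>i. Sigma {..<n} (\<lambda>j. {m. int (mono_deg m) = b j - a i}))"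
  by (auto simp: gidx_def)

lemma finite_gidx: "finite (gidx n a b)"
  unfolding gidx_Sigma by (intro finite_SigmaI finite_lessThan finite_monomials_int)

lemma card_gidx: "card (gidx n a b) = (\<Sum>i<n. \<Sum>j<n. h0 (b j - a i))"
  unfolding gidx_Sigma h0_def
  by (subst card_SigmaI, simp, intro ballI finite_SigmaI finite_lessThan finite_monomials_int)
    (simp add: card_SigmaI finite_monomials_int)

lemma coef_gmat: "coef (gmat a b x i j) m = (if int (mono_deg m) = b j - a i then x (i, j, m) else 0)"
proof -
  have "coef (gmat a b x i j) m = (\<Sum>m' | int (mono_deg m') = b j - a i. if m' = m then x (i, j, m) else 0)"
    unfolding gmat_def lookup_sum by (rule sum.cong) (auto simp: lookup_single when_def)
  then show ?thesis by (simp add: finite_monomials_int)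
qed

lemma graded_gmat: "graded n a b (gmat a b x)"
  unfolding graded_def gmat_def by (intro allI impI homog_sum homog_mon) auto

lemma gmat_add: "gmat a b (\<lambda>y. x y + x' y) i j = gmat a b x i j + gmat a b x' i j"
  by (rule poly_mapping_eqI) (simp add: coef_gmat lookup_add)

lemma gmat_cmult: "gmat a b (\<lambda>y. c * x y) i j = mon 0 c * gmat a b x i j"
  by (rule poly_mapping_eqI) (simp add: coef_gmat scale_form_eq[symmetric] lookup_scale_form)

lemma gmat_0: "gmat a b (\<lambda>y. 0) i j = 0"
  by (rule poly_mapping_eqI) (simp add: coef_gmat)

lemma gmat_crd: "graded n a b M ==> i < n ==> j < n ==> gmat a b (crd n a b M) i j = M i j"
  by (rule poly_mapping_eqI)
    (use homogD[OF gradedD] in \<open>force simp: coef_gmat crd_def gidx_def\<close>)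

lemma crd_gmat: "x \<in> supported (gidx n a b) ==> crd n a b (gmat a b x) = x"
  by (auto simp: fun_eq_iff coef_gmat crd_def gidx_def supported_def)

lemma crd_supported: "crd n a b M \<in> supported (gidx n a b)"
  by (auto simp: crd_def supported_def)

lemma crd_outside: "y \<notin> gidx n a b ==> crd n a b M y = 0"
  by (cases y) (simp add: crd_def)

lemma crd_add: "crd n a b (M + M') = (\<lambda>y. crd n a b M y + crd n a b M' y)"
  by (auto simp: fun_eq_iff crd_def lookup_add)

lemma crd_cmult: "crd n a b (\<lambda>i j. mon 0 c * M i j) = (\<lambda>y. c * crd n a b M y)"
  by (auto simp: fun_eq_iff crd_def scale_form_eq[symmetric] lookup_scale_form)

lemma crd_cong: "(\<And>i j. i < n ==> j < n ==> M i j = M' i j) ==> crd n a b M = crd n a b M'"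
  by (auto simp: fun_eq_iff crd_def gidx_def)

lemma graded_mm: "graded n a b M ==> graded n b c M' ==> graded n a c (mm n M M')"
  unfolding graded_def mm_def by (intro allI impI homog_sum) (rule homog_mult', auto)

lemma graded_add: "graded n a b M ==> graded n a b M' ==> graded n a b (M + M')"
  unfolding graded_def by (auto intro: homog_add)

lemma graded_scal: "graded n a a (scal (mon 0 c))"
  by (auto simp: graded_def scal_def intro: homog_mon)

lemma graded_cmult: "graded n a b M ==> graded n a b (\<lambda>i j. mon 0 c * M i j)"
  unfolding graded_def by (intro allI impI homog_mult'[of 0]) (auto intro: homog_mon)

definition detm :: "nat => (nat => nat => form) => form" where
  "detm n M = det (mat n n (\<lambda>(i, j). M i j))"

lemma detm_mentry: "S \<in> carrier_mat n n ==> detm n (mentry S) = det S"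
  unfolding detm_def mentry_def by (intro arg_cong[of _ _ det] eq_matI) auto

lemma detm_cong: "(\<And>i j. i < n ==> j < n ==> M i j = M' i j) ==> detm n M = detm n M'"
  unfolding detm_def by (intro arg_cong[of _ _ det] eq_matI) auto

lemma detm_mm: "detm n (mm n M M') = detm n M * detm n M'"
proof -
  have "mat n n (\<lambda>(i, j). mm n M M' i j) = mat n n (\<lambda>(i, j). M i j) * mat n n (\<lambda>(i, j). M' i j)"
    by (intro eq_matI) (auto simp: mm_def scalar_prod_def atLeast0LessThan)
  then show ?thesis unfolding detm_def by (simp add: det_mult[of _ n])
qed

lemma homog_detm: "graded n a b M ==> homog ((\<Sum>j<n. b j) - (\<Sum>i<n. a i)) (detm n M)"
  unfolding detm_def by (rule homog_det) (auto simp: graded_def)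

text \<open>The determinant of a graded endomorphism has degree zero; hence graded automorphisms
  change determinants only by constants.\<close>

lemma detm_const:
  assumes "graded n a a M"
  obtains c where "detm n M = mon 0 c"
  using homog_0_const[of "detm n M"] homog_detm[OF assms] by simp

lemma (in filtered_algebra) coef_detm_gmat:
  assumes "\<And>y. (\<lambda>s. x s y) \<in> A 1"
  shows "(\<lambda>s. coef (detm n (gmat a b (x s))) m) \<in> A n"
proof -
  have "(\<lambda>s. detm n (gmat a b (x s))) \<in> forms n"
    unfolding detm_def
  proof (rule det_in_forms)
    fix i j assume "i < n" "j < n"
    moreover have "(\<lambda>s. coef (gmat a b (x s) i j) m) \<in> A 1" for m
      using assms const'[of 0 1] by (cases "int (mono_deg m) = b j - a i") (simp_all add: coef_gmat)
    ultimately show "(\<lambda>s. mat n n (\<lambda>(i, j). gmat a b (x s) i j) $$ (i, j)) \<in> forms 1"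
      by (simp add: forms_def)
  qed simp
  then show ?thesis by (simp add: forms_def)
qed

lemma coef_poly_const:
  fixes P :: "form poly"
  shows "coef (poly P (mon 0 x)) m = poly (map_poly (\<lambda>F. coef F m) P) x"
proof (induction P)
  case (pCons F P)
  have "coef (mon 0 x * poly P (mon 0 x)) m = x * coef (poly P (mon 0 x)) m"
    by (simp add: scale_form_eq[symmetric] lookup_scale_form)
  then show ?case using pCons by (simp add: map_poly_pCons lookup_add)
qed simp

section \<open>The dimension of a determinantal family\<close>

locale det_family =
  fixes n :: nat and a b :: "nat => int"
  assumes n: "n > 0" and less: "\<And>i j. i < n ==> j < n ==> a i < b j"
begin

definition e :: "nat => nat => nat" where "e i j = nat (b j - a i)"

lemma e: "i < n ==> j < n ==> int (e i j) = b j - a i" "i < n ==> j < n ==> e i j > 0"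
  using less[of i j] by (auto simp: e_def)

abbreviation "S0 \<equiv> mentry (tridiag n e)"
abbreviation "adj0 \<equiv> mentry (adj_mat (tridiag n e))"
abbreviation "W \<equiv> supported (gidx n a b)"
abbreviation "G \<equiv> gidx n a a <+> gidx n b b"

text \<open>The differential of the orbit map of the group of graded automorphisms at \<open>S0\<close>.\<close>

definition \<gamma> :: "(entry + entry => complex) => entry => complex" where
  "\<gamma> z = crd n a b (mm n (gmat a a (z \<circ> Inl)) S0 + mm n S0 (gmat b b (z \<circ> Inr)))"

lemma graded_S0: "graded n a b S0"
  unfolding graded_def mentry_def using homog_tridiag[of _ n _ e] e(1) by metis

lemma det_S0: "detm n S0 = det (tridiag n e)" "det (tridiag n e) \<noteq> 0"
proof -
  show "detm n S0 = det (tridiag n e)" by (simp add: detm_mentry)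
  have "peval (det (tridiag n e)) ((\<lambda>_. 0)(2 := 1)) \<noteq> 0"
    by (rule tridiag_det_point) (rule e(2))
  then show "det (tridiag n e) \<noteq> 0" by auto
qed

lemma \<gamma>_add: "\<gamma> (u + v) = \<gamma> u + \<gamma> v"
proof -
  have 1: "gmat a a ((u + v) \<circ> Inl) = gmat a a (u \<circ> Inl) + gmat a a (v \<circ> Inl)"
    by (intro ext) (simp add: comp_def gmat_add)
  have 2: "gmat b b ((u + v) \<circ> Inr) = gmat b b (u \<circ> Inr) + gmat b b (v \<circ> Inr)"
    by (intro ext) (simp add: comp_def gmat_add)
  show ?thesis unfolding \<gamma>_def 1 2 mm_add_left mm_add_right crd_add by (intro ext) simp
qed

lemma \<gamma>_scale: "\<gamma> (\<lambda>s. c * u s) = (\<lambda>y. c * \<gamma> u y)"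
proof -
  have 1: "gmat a a ((\<lambda>s. c * u s) \<circ> Inl) = (\<lambda>i j. mon 0 c * gmat a a (u \<circ> Inl) i j)"
    by (intro ext) (simp add: comp_def gmat_cmult)
  have 2: "gmat b b ((\<lambda>s. c * u s) \<circ> Inr) = (\<lambda>i j. mon 0 c * gmat b b (u \<circ> Inr) i j)"
    by (intro ext) (simp add: comp_def gmat_cmult)
  show ?thesis
    unfolding \<gamma>_def 1 2 mm_smult_left mm_smult_right crd_add crd_cmult
    by (intro ext) (simp add: distrib_left)
qed

lemma \<gamma>_crd:
  assumes "graded n a a \<alpha>" "graded n b b \<beta>"
  shows "\<exists>z\<in>supported G. \<gamma> z = crd n a b (mm n \<alpha> S0 + mm n S0 \<beta>)"
proof -
  define z where "z = case_sum (crd n a a \<alpha>) (crd n b b \<beta>)"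
  have "z y = 0" if "y \<notin> G" for y
  proof (cases y)
    case (Inl x)
    then show ?thesis using that by (auto simp: z_def intro!: crd_outside)
  next
    case (Inr x)
    then show ?thesis using that by (auto simp: z_def intro!: crd_outside)
  qed
  then have "z \<in> supported G" by (simp add: supported_def)
  moreover have "\<gamma> z = crd n a b (mm n \<alpha> S0 + mm n S0 \<beta>)"
  proof -
    have z: "z \<circ> Inl = crd n a a \<alpha>" "z \<circ> Inr = crd n b b \<beta>" by (auto simp: z_def)
    have "mm n (gmat a a (crd n a a \<alpha>)) S0 i j = mm n \<alpha> S0 i j"
      "mm n S0 (gmat b b (crd n b b \<beta>)) i j = mm n S0 \<beta> i j" if "i < n" "j < n" for i j
      using that by (auto intro!: mm_cong_left mm_cong_right gmat_crd assms)
    then show ?thesis unfolding \<gamma>_def z by (intro crd_cong) simp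
  qed
  ultimately show ?thesis by blast
qed

text \<open>By \<open>graded_kernel\<close> the kernel consists of the scalar pairs
  \<open>(c, - c)\<close>, the infinitesimal automorphisms that act trivially on all
  matrices.\<close>

lemma \<gamma>_kernel: "fs.dim {z \<in> supported G. \<gamma> z = 0} = 1"
proof -
  let ?z = "\<lambda>c. case_sum (crd n a a (scal (mon 0 c))) (\<lambda>y. - crd n b b (scal (mon 0 c)) y)"
  have zc: "?z c = (\<lambda>s. c * ?z 1 s)" for c
  proof
    fix s :: "entry + entry"
    have "scal (mon 0 c) = (\<lambda>i j. mon 0 c * scal (mon 0 1 :: form) i j)"
      by (auto simp: scal_def fun_eq_iff)
    then have "crd n a' a' (scal (mon 0 c)) = (\<lambda>y. c * crd n a' a' (scal (mon 0 1)) y)" for a'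
      by (metis crd_cmult)
    then show "?z c s = c * ?z 1 s" by (cases s) simp_all
  qed
  have "card {()} = fs.dim {z \<in> supported G. \<gamma> z = 0}"
  proof (rule fs.dim_family[symmetric, where e = "\<lambda>_. ?z 1"])
    have "\<gamma> (?z 1) = 0"
    proof -
      have "gmat a' a' (crd n a' a' (scal (mon 0 1))) i j = scal (mon 0 1) i j" if "i < n" "j < n" for a' i j
        using that by (intro gmat_crd graded_scal)
      then have g1: "gmat a a (?z 1 \<circ> Inl) i j = scal 1 i j" "gmat b b (?z 1 \<circ> Inr) i j = (- scal 1) i j"
        if "i < n" "j < n" for i j
        using that gmat_cmult[of b b "-1" "crd n b b (scal (mon 0 1))" i j]
        by (auto simp: comp_def single_uminus)
      have "mm n (gmat a a (?z 1 \<circ> Inl)) S0 i j = mm n (scal 1) S0 i j"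
        "mm n S0 (gmat b b (?z 1 \<circ> Inr)) i j = mm n S0 (- scal 1) i j" if "i < n" "j < n" for i j
        by (rule mm_cong_left, rule g1(1), use that in simp, assumption)
          (rule mm_cong_right, rule g1(2), assumption, use that in simp)
      then have "\<gamma> (?z 1) = crd n a b (\<lambda>i j. 0)"
        unfolding \<gamma>_def by (intro crd_cong) (simp add: mm_scal_left mm_uminus_right mm_scal_right)
      then show ?thesis by (auto simp: crd_def fun_eq_iff)
    qed
    moreover have "?z 1 \<in> supported G"
    proof -
      have "?z 1 y = 0" if "y \<notin> G" for y
      proof (cases y)
        case (Inl x)
        then show ?thesis using that by (auto intro!: crd_outside)
      next
        case (Inr x)
        then show ?thesis using that by (auto intro!: crd_outside)
      qed
      then show ?thesis unfolding supported_def by blast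
    qed
    ultimately show "?z 1 \<in> {z \<in> supported G. \<gamma> z = 0}" by blast
    fix c :: "unit => complex" assume 0: "(\<Sum>x\<in>{()}. (\<lambda>s. c x * ?z 1 s)) = 0"
    have "(0, 0, 0) \<in> gidx n a a" using n by (simp add: gidx_def)
    then have "?z 1 (Inl (0, 0, 0)) = 1" by (simp add: crd_def scal_def)
    then show "\<forall>x\<in>{()}. c x = 0" using fun_cong[OF 0, of "Inl (0, 0, 0)"] by simp
  next
    fix z assume "z \<in> {z \<in> supported G. \<gamma> z = 0}"
    then have z: "z \<in> supported G" "\<gamma> z = 0" by auto
    let ?\<alpha> = "gmat a a (z \<circ> Inl)" and ?\<beta> = "gmat b b (z \<circ> Inr)"
    have gr: "graded n a b (mm n ?\<alpha> S0 + mm n S0 ?\<beta>)"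
      by (intro graded_add graded_mm[OF graded_gmat graded_S0] graded_mm[OF graded_S0 graded_gmat])
    have k0: "mm n ?\<alpha> S0 i j + mm n S0 ?\<beta> i j = 0" if "i < n" "j < n" for i j
      using gmat_crd[OF gr that] z(2) by (simp add: \<gamma>_def gmat_0 zero_fun_def)
    have "\<exists>c. \<forall>i<n. \<forall>j<n. ?\<alpha> i j = scal (mon 0 c) i j \<and> ?\<beta> i j = - scal (mon 0 c) i j"
      by (rule graded_kernel[OF n e graded_gmat graded_gmat]) (assumption | rule k0)+
    then obtain c where c: "\<forall>i<n. \<forall>j<n. ?\<alpha> i j = scal (mon 0 c) i j \<and> ?\<beta> i j = - scal (mon 0 c) i j"
      by blast
    have "z = ?z c"
    proof
      fix y show "z y = ?z c y"
      proof (cases y)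
        case (Inl x)
        have "z \<circ> Inl \<in> supported (gidx n a a)" using z(1) by (auto simp: supported_def)
        moreover have "crd n a a ?\<alpha> = crd n a a (scal (mon 0 c))"
          by (rule crd_cong) (use c in blast)
        ultimately have "z \<circ> Inl = crd n a a (scal (mon 0 c))" by (simp only: crd_gmat)
        from fun_cong[OF this, of x] show ?thesis using Inl by simp
      next
        case (Inr x)
        have "z \<circ> Inr \<in> supported (gidx n b b)" using z(1) by (auto simp: supported_def)
        moreover have "crd n b b ?\<beta> = crd n b b (\<lambda>i j. mon 0 (- 1) * scal (mon 0 c) i j)"
          by (rule crd_cong) (use c in \<open>simp add: single_uminus\<close>)
        ultimately have "z \<circ> Inr = (\<lambda>y. (- 1) * crd n b b (scal (mon 0 c)) y)"
          by (simp only: crd_gmat crd_cmult)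
        from fun_cong[OF this, of x] show ?thesis using Inr by simp
      qed
    qed
    then show "\<exists>r. z = (\<Sum>x\<in>{()}. (\<lambda>s. r x * ?z 1 s))"
      using zc[of c] by (intro exI[of _ "\<lambda>_. c"]) simp
  qed simp
  then show ?thesis by simp
qed

lemma \<gamma>_image:
  "card (gidx n a a) + card (gidx n b b) = 1 + fs.dim (\<gamma> ` supported G)" "fs.subspace (\<gamma> ` supported G)"
  "\<gamma> ` supported G \<subseteq> W"
proof -
  have finG: "finite G" by (simp add: finite_gidx)
  obtain T where T: "finite T" "supported G \<subseteq> fs.span T" using supported_in_span[OF finG] by blast
  have "fs.dim (supported G) = fs.dim {z \<in> supported G. \<gamma> z = 0} + fs.dim (\<gamma> ` supported G)"
    by (rule vector_space_pair.rank_nullity[OF vector_space_pair.intro[OF vector_space_functions vector_space_functions]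
      \<gamma>_add \<gamma>_scale supported_subspace T(2,1)])
  then show "card (gidx n a a) + card (gidx n b b) = 1 + fs.dim (\<gamma> ` supported G)"
    unfolding dim_supported[OF finG] \<gamma>_kernel by (simp add: card_Plus finite_gidx)
  show "\<gamma> ` supported G \<subseteq> W" by (auto simp: \<gamma>_def crd_supported)
  show "fs.subspace (\<gamma> ` supported G)"
  proof (rule fs.subspaceI)
    have "\<gamma> (\<lambda>s. 0 * 0 s) = 0" unfolding \<gamma>_scale by (simp add: zero_fun_def)
    then show "0 \<in> \<gamma> ` supported G"
      by (intro image_eqI[of _ _ "\<lambda>s. 0 * 0 s"]) (auto simp: supported_def)
    show "x + y \<in> \<gamma> ` supported G" if xy: "x \<in> \<gamma> ` supported G" "y \<in> \<gamma> ` supported G" for x y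
    proof -
      obtain u v where "x = \<gamma> u" "y = \<gamma> v" "u \<in> supported G" "v \<in> supported G" using xy by blast
      then show ?thesis using fs.subspace_add[OF supported_subspace[of G]] \<gamma>_add[of u v] by (metis imageI)
    qed
    show "(\<lambda>s. c * x s) \<in> \<gamma> ` supported G" if x: "x \<in> \<gamma> ` supported G" for c x
    proof -
      obtain u where "x = \<gamma> u" "u \<in> supported G" using x by blast
      then show ?thesis using fs.subspace_scale[OF supported_subspace[of G]] \<gamma>_scale[of c u] by (metis imageI)
    qed
  qed
qed

definition point :: "(entry => complex) => (4 \<Rightarrow>\<^sub>0 nat) => complex" where
  "point x = coef (detm n (gmat a b x))"

abbreviation "d \<equiv> (\<Sum>j<n. b j) - (\<Sum>i<n. a i)"
abbreviation "I \<equiv> {m :: 4 \<Rightarrow>\<^sub>0 nat. int (mono_deg m) = d}"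

lemma homog_supported: "homog d F ==> coef F \<in> supported I"
  by (auto simp: supported_def homog_def in_keys_iff)

lemma point_supported: "point x \<in> supported I"
  unfolding point_def by (intro homog_supported homog_detm graded_gmat)

lemma point_outside: "m \<notin> I ==> point x m = 0"
  using point_supported[of x] by (simp add: supported_def)

definition family :: "(entry => complex) set => ((4 \<Rightarrow>\<^sub>0 nat) => complex) set set" where
  "family X = {proj_pt (point x) | x. x \<in> X \<and> nz (point x)}"

lemma point_S0: "point (crd n a b S0) = coef (det (tridiag n e))"
proof -
  have "detm n (gmat a b (crd n a b S0)) = detm n S0"
    by (intro detm_cong gmat_crd graded_S0)
  then show ?thesis by (simp add: point_def det_S0)
qed

lemma nz_S0: "nz (coef (det (tridiag n e)))"
  using det_S0(2) unfolding nz_def by (metis lookup_zero poly_mapping_eqI)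

lemma point_pencil:
  assumes "V \<in> W"
  shows "\<exists>R. (\<forall>\<epsilon>. point (\<lambda>y. crd n a b S0 y + \<epsilon> * V y) m = poly R \<epsilon>) \<and>
    coeff R 0 = coef (det (tridiag n e)) m \<and> coeff R 1 = coef (mtr n adj0 (gmat a b V)) m"
proof -
  define T where "T = mat n n (\<lambda>(i, j). gmat a b V i j)"
  have T: "T \<in> carrier_mat n n" by (simp add: T_def)
  obtain P where P: "\<And>x. det (tridiag n e + x \<cdot>\<^sub>m T) = poly P x" "coeff P 0 = det (tridiag n e)"
    "coeff P 1 = mtr n adj0 (mentry T)"
    using det_pencil[OF tridiag_carrier T] by blast
  have gS0: "gmat a b (crd n a b S0) i j = tridiag n e $$ (i, j)" if "i < n" "j < n" for i j
    using gmat_crd[OF graded_S0 that] by (simp add: mentry_def)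
  have A: "point (\<lambda>y. crd n a b S0 y + \<epsilon> * V y) m = coef (poly P (mon 0 \<epsilon>)) m" for \<epsilon>
  proof -
    have "mat n n (\<lambda>(i, j). gmat a b (\<lambda>y. crd n a b S0 y + \<epsilon> * V y) i j) = tridiag n e + mon 0 \<epsilon> \<cdot>\<^sub>m T"
      using tridiag_carrier[of n e]
      by (intro eq_matI) (auto simp: T_def gmat_add gmat_cmult gS0)
    then show ?thesis by (simp add: point_def detm_def P(1)[symmetric])
  qed
  have "mtr n adj0 (mentry T) = mtr n adj0 (gmat a b V)"
    unfolding mtr_def by (intro sum.cong) (auto simp: T_def mentry_def)
  then show ?thesis
    using P(2,3) by (intro exI[of _ "map_poly (\<lambda>F. coef F m) P"])
      (simp only: A coef_poly_const coeff_map_poly lookup_zero simp_thms)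
qed

end

context det_family
begin

lemma mtr_gmat_add:
  "mtr n A (gmat a b (\<lambda>y. x y + f y * c)) = mtr n A (gmat a b x) + mon 0 c * mtr n A (gmat a b f)"
proof -
  have "gmat a b (\<lambda>y. x y + f y * c) i j = gmat a b x i j + mon 0 c * gmat a b f i j" for i j
    using gmat_cmult[of a b c f i j] by (simp add: gmat_add mult.commute[of _ c])
  then show ?thesis by (simp add: mtr_def sum.distrib sum_distrib_left algebra_simps)
qed

lemma mtr_gmat_sum:
  "mtr n A (gmat a b (\<lambda>y. \<Sum>j<(k::nat). f j y * c j)) = (\<Sum>j<k. mon 0 (c j) * mtr n A (gmat a b (f j)))"
  by (induction k) (simp_all add: mtr_gmat_add mtr_def[of n A "\<lambda>_ _. 0"] gmat_0)

text \<open>\<open>l\<close> is the codimension of the orbit directions in the space of graded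
  matrices; it will turn out to be the dimension of the determinantal variety.\<close>

lemma complement:
  obtains l and v :: "nat => entry => complex" where
    "card (gidx n a b) + 1 = card (gidx n a a) + card (gidx n b b) + l" "\<And>j. j < l ==> v j \<in> W"
    "\<And>w. w \<in> W ==> \<exists>z c. z \<in> supported G \<and> w = (\<lambda>y. \<gamma> z y + (\<Sum>j<l. v j y * c j))"
    "\<And>c. (\<lambda>y. \<Sum>j<l. v j y * c j) \<in> \<gamma> ` supported G ==> \<forall>j<l. c j = 0"
proof -
  obtain T where T: "finite T" "W \<subseteq> fs.span T" using supported_in_span[OF finite_gidx] by blast
  obtain l and v :: "nat => entry => complex" where lv:
    "fs.dim W = fs.dim (\<gamma> ` supported G) + l" "\<And>j. j < l ==> v j \<in> W"
    "\<And>w. w \<in> W ==> \<exists>u c. u \<in> \<gamma> ` supported G \<and> w = u + (\<Sum>j<l. (\<lambda>y. c j * v j y))"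
    "\<And>c. (\<Sum>j<l. (\<lambda>y. c j * v j y)) \<in> \<gamma> ` supported G ==> \<forall>j<l. c j = 0"
    by (rule fs.complement_family[OF \<gamma>_image(2,3) supported_subspace T(2,1)]) (rule that)
  have s: "(\<Sum>j<l. (\<lambda>y. c j * v j y)) = (\<lambda>y. \<Sum>j<l. v j y * c j)" for c
    by (intro ext) (simp add: sum_apply mult.commute)
  show ?thesis
  proof (rule that)
    show "card (gidx n a b) + 1 = card (gidx n a a) + card (gidx n b b) + l"
      using lv(1) \<gamma>_image(1) by (simp add: dim_supported finite_gidx)
    show "\<exists>z c. z \<in> supported G \<and> w = (\<lambda>y. \<gamma> z y + (\<Sum>j<l. v j y * c j))" if w: "w \<in> W" for w
    proof -
      obtain u c where u: "u \<in> \<gamma> ` supported G" "w = u + (\<Sum>j<l. (\<lambda>y. c j * v j y))" using lv(3)[OF w] by blast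
      then obtain z where z: "z \<in> supported G" "u = \<gamma> z" by blast
      show ?thesis using z(1) u(2) unfolding s z(2) by (intro exI[of _ z] exI[of _ c]) (simp add: plus_fun_def)
    qed
    show "\<forall>j<l. c j = 0" if "(\<lambda>y. \<Sum>j<l. v j y * c j) \<in> \<gamma> ` supported G" for c
      using that by (intro lv(4)) (simp only: s)
  qed (rule lv(2))
qed

end

text \<open>Expansion of \<open>(1 + c \<alpha>) (S + c V) (1 + c \<beta>)\<close> by powers of
  \<open>c\<close>. For \<open>S0\<close>, the first-order term runs through all deformations when
  \<open>V\<close> runs through the complement of the orbit directions.\<close>

lemma mm_curve:
  assumes "i < n" "j < n"
  shows "mm n (mm n (scal 1 + (\<lambda>i j. c * \<alpha> i j)) (S + (\<lambda>i j. c * V i j))) (scal 1 + (\<lambda>i j. c * \<beta> i j)) i j =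
    S i j + c * ((mm n \<alpha> S + mm n S \<beta> + V) i j + c * ((mm n \<alpha> V + mm n V \<beta> + mm n (mm n \<alpha> S) \<beta>) i j +
      c * mm n (mm n \<alpha> V) \<beta> i j))"
proof -
  define X where "X = mm n (scal 1 + (\<lambda>i j. c * \<alpha> i j)) (S + (\<lambda>i j. c * V i j))"
  have X: "X i k = S i k + c * V i k + c * (mm n \<alpha> S i k + c * mm n \<alpha> V i k)" for k
    unfolding X_def mm_add_left mm_add_right mm_smult_left mm_smult_right
    using assms(1) by (simp add: mm_scal_left algebra_simps)
  have "mm n X (scal 1 + (\<lambda>i j. c * \<beta> i j)) i j = X i j + c * mm n X \<beta> i j"
    unfolding mm_add_right mm_smult_right using assms(2) by (simp add: mm_scal_right)
  moreover have "mm n X \<beta> i j =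
      mm n (S + (\<lambda>i j. c * V i j) + (\<lambda>i j. c * mm n \<alpha> S i j) + (\<lambda>i j. c * (c * mm n \<alpha> V i j))) \<beta> i j"
    by (rule mm_cong_left) (simp add: X algebra_simps)
  ultimately show ?thesis
    unfolding X_def[symmetric] by (simp add: X mm_add_left mm_smult_left algebra_simps)
qed

section \<open>The linear slice transverse to the orbit of \<open>S0\<close>\<close>

locale det_slice = det_family +
  fixes l :: nat and v :: "nat => entry => complex"
  assumes v: "\<And>j. j < l ==> v j \<in> W"
    and span: "\<And>w. w \<in> W ==> \<exists>z c. z \<in> supported G \<and> w = (\<lambda>y. \<gamma> z y + (\<Sum>j<l. v j y * c j))"
    and indep: "\<And>c. (\<lambda>y. \<Sum>j<l. v j y * c j) \<in> \<gamma> ` supported G ==> \<forall>j<l. c j = 0"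
begin

definition slice :: "nat => (nat => complex) => entry => complex" where
  "slice k s = (\<lambda>y. crd n a b S0 y + (\<Sum>j<k. v j y * s j))"

text \<open>The closures for the first \<open>k\<close> slice coordinates form the chain that bounds
  the dimension from below.\<close>

definition C :: "nat => ((4 \<Rightarrow>\<^sub>0 nat) => complex) set set" where
  "C k = zariski I closure_of {proj_pt (point (slice k s)) | s. nz (point (slice k s))}"

lemma slice_in_bdd_polys: "(\<lambda>s. point (slice k s) m) \<in> bdd_polys k n"
  unfolding point_def
proof (rule bdd_polys.coef_detm_gmat)
  fix y
  show "(\<lambda>s. slice k s y) \<in> bdd_polys k 1"
    unfolding slice_def
    by (intro bdd_polys.add bdd_polys.const' bdd_polys.sum bdd_polys.cmult coordinate_in_bdd_polys) simp
qed

lemma slice_in_poly_funs: "(\<lambda>s. point (slice k s) m) \<in> poly_funs"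
  unfolding point_def
proof (rule poly_funs.coef_detm_gmat)
  fix y
  show "(\<lambda>s. slice k s y) \<in> poly_funs"
    unfolding slice_def
    by (intro poly_funs.add poly_funs.const' poly_funs.sum poly_funs.cmult coordinate_in_poly_funs)
qed

lemma slice_0: "point (slice k (\<lambda>_. 0)) = coef (det (tridiag n e))"
  by (simp add: slice_def point_S0)

lemma C_irreducible: "irreducible_closedin (zariski I) (C k)"
  unfolding C_def
  by (rule family_irreducible[where g = "\<lambda>s. point (slice k s)" and ?s0.0 = "\<lambda>_. 0"])
    (simp_all only: slice_in_poly_funs point_outside slice_0 nz_S0 not_False_eq_True)

lemma C_mono: "C k \<subseteq> C (Suc k)"
  unfolding C_def
proof (rule closure_of_mono, rule subsetI)
  fix p assume "p \<in> {proj_pt (point (slice k s)) | s. nz (point (slice k s))}"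
  then obtain s where s: "p = proj_pt (point (slice k s))" "nz (point (slice k s))" by blast
  have "slice k s = slice (Suc k) (s(k := 0))" by (simp add: slice_def)
  then show "p \<in> {proj_pt (point (slice (Suc k) s)) | s. nz (point (slice (Suc k) s))}"
    using s by (auto intro!: exI[of _ "s(k := 0)"])
qed

lemma C_upper: "hilbert_ge (C k) N K ==> K \<le> (N * n + 1) ^ k"
proof (rule hilbert_upper_bound[where g = "\<lambda>s. point (slice k s)"])
  fix p :: "(4 \<Rightarrow>\<^sub>0 nat) cpoly"
  assume "homog (int N) p" "\<And>s. peval p (point (slice k s)) = 0"
  then show "\<forall>v\<in>\<Union>(C k). peval p v = 0"
    unfolding C_def by (intro family_vanish[where g = "\<lambda>s. point (slice k s)"] point_outside)
qed (rule slice_in_bdd_polys)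

lemma slice_W: "k \<le> l ==> (\<lambda>y. \<Sum>j<k. v j y * w j) \<in> W"
  using v by (auto simp: supported_def intro!: sum.neutral)

text \<open>Rescaling \<open>S0\<close> is an orbit direction, given by the scalar pair
  \<open>(1, 0)\<close>. Projectively it does not move the determinant.\<close>

lemma crd_S0_image: "crd n a b S0 \<in> \<gamma> ` supported G"
proof -
  obtain z where z: "z \<in> supported G" "\<gamma> z = crd n a b (mm n (scal (mon 0 1)) S0 + mm n S0 (scal (mon 0 0)))"
    using \<gamma>_crd[OF graded_scal graded_scal] by blast
  have "crd n a b (mm n (scal (mon 0 1)) S0 + mm n S0 (scal (mon 0 0))) = crd n a b S0"
    by (rule crd_cong) (simp add: mm_scal_left mm_scal_right)
  then show ?thesis using z by (metis imageI)
qed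

lemma slice_pencil:
  assumes "k \<le> l"
  shows "\<exists>R. (\<forall>\<epsilon>. point (slice k (\<lambda>j. \<epsilon> * w j)) m = poly R \<epsilon>) \<and> coeff R 0 = coef (det (tridiag n e)) m \<and>
    coeff R 1 = (\<Sum>j<k. w j * coef (mtr n adj0 (gmat a b (v j))) m)"
proof -
  have "slice k (\<lambda>j. \<epsilon> * w j) = (\<lambda>y. crd n a b S0 y + \<epsilon> * (\<Sum>j<k. v j y * w j))" for \<epsilon>
    by (simp add: slice_def sum_distrib_left mult.left_commute)
  moreover have "coef (mtr n adj0 (gmat a b (\<lambda>y. \<Sum>j<k. v j y * w j))) m =
      (\<Sum>j<k. w j * coef (mtr n adj0 (gmat a b (v j))) m)"
    unfolding mtr_gmat_sum lookup_sum by (simp add: scale_form_eq[symmetric] lookup_scale_form)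
  ultimately show ?thesis using point_pencil[OF slice_W[OF assms, of w], of m] by simp
qed

lemma tangent_supported: "j < l ==> coef (mtr n adj0 (gmat a b (v j))) \<in> supported I"
proof -
  assume j: "j < l"
  have "coef (mtr n adj0 (gmat a b (v j))) m = 0" if m: "m \<notin> I" for m
  proof -
    obtain R where R: "\<And>\<epsilon>. point (\<lambda>y. crd n a b S0 y + \<epsilon> * v j y) m = poly R \<epsilon>"
      "coeff R 1 = coef (mtr n adj0 (gmat a b (v j))) m"
      using point_pencil[OF v[OF j], of m] by blast
    have "poly R \<epsilon> = 0" for \<epsilon> using R(1)[of \<epsilon>] point_outside[OF m] by simp
    then have "R = 0" by (simp add: poly_eq_poly_eq_iff[symmetric] fun_eq_iff)
    then show ?thesis using R(2) by simp
  qed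
  then show ?thesis by (simp add: supported_def)
qed

text \<open>Index \<open>0\<close> is the base point itself, which stands for the direction of the
  ray in the cone; the other indices are the derivatives along the slice.\<close>

definition tangent :: "nat => (4 \<Rightarrow>\<^sub>0 nat) => complex" where
  "tangent r = (case r of 0 => coef (det (tridiag n e)) | Suc j => coef (mtr n adj0 (gmat a b (v j))))"

text \<open>Euler's relation for the determinant, which is homogeneous of degree \<open>n\<close> in
  the entries.\<close>

lemma mtr_S0: "mtr n adj0 (gmat a b (crd n a b S0)) = of_nat n * det (tridiag n e)"
proof -
  have "mtr n adj0 (gmat a b (crd n a b S0)) = (\<Sum>i<n. mm n adj0 S0 i i)"
    unfolding mtr_def mm_def by (intro sum.cong) (auto simp only: lessThan_iff gmat_crd[OF graded_S0])
  also have "\<dots> = (\<Sum>i<n. det (tridiag n e))"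
    by (intro sum.cong) (auto simp: adj_mm(2)[OF tridiag_carrier] scal_def)
  finally show ?thesis by simp
qed

text \<open>A linear relation yields a deformation \<open>V\<close> with vanishing trace, which is
  an orbit direction by \<open>graded_image\<close>. Subtracting the multiple of \<open>S0\<close>
  shows that the slice part is an orbit direction too, hence zero.\<close>

lemma tangent_indep:
  assumes k: "k \<le> l" and 0: "(\<Sum>r<Suc k. (\<lambda>s. c r * tangent r s)) = 0"
  shows "\<forall>r<Suc k. c r = 0"
proof -
  \<comment> \<open>By Euler's relation the multiple \<open>c 0 / of_nat n\<close> of
    \<open>S0\<close> contributes \<open>c 0\<close> times the determinant to the trace.\<close>
  define V where "V = (\<lambda>y. (\<Sum>j<k. v j y * c (Suc j)) + crd n a b S0 y * (c 0 / of_nat n))"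
  have V: "V \<in> W"
    using slice_W[OF k, of "\<lambda>j. c (Suc j)"] crd_supported[of n a b S0] by (auto simp: V_def supported_def)
  have z: "c 0 * coef (det (tridiag n e)) m + (\<Sum>j<k. c (Suc j) * coef (mtr n adj0 (gmat a b (v j))) m) = 0" for m
    using fun_cong[OF 0, of m] unfolding sum_apply sum.lessThan_Suc_shift by (simp add: tangent_def)
  have "mtr n adj0 (gmat a b V) = mtr n adj0 (gmat a b (\<lambda>y. \<Sum>j<k. v j y * c (Suc j))) +
      mon 0 (c 0 / of_nat n) * mtr n adj0 (gmat a b (crd n a b S0))"
    unfolding V_def by (rule mtr_gmat_add)
  also have "\<dots> = 0"
  proof (rule poly_mapping_eqI)
    fix m
    have "mon 0 (c 0 / of_nat n) * (of_nat n * det (tridiag n e)) = scale_form (c 0) (det (tridiag n e))"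
      using n by (simp add: scale_form_eq mult_single flip: mult.assoc single_of_nat)
    then show "coef (mtr n adj0 (gmat a b (\<lambda>y. \<Sum>j<k. v j y * c (Suc j))) +
        mon 0 (c 0 / of_nat n) * mtr n adj0 (gmat a b (crd n a b S0))) m = coef 0 m"
      unfolding mtr_S0 mtr_gmat_sum lookup_add lookup_sum using z[of m]
      by (simp add: scale_form_eq[symmetric] lookup_scale_form add.commute)
  qed
  finally have mtr0: "mtr n adj0 (gmat a b V) = 0" .
  have "\<exists>\<alpha> \<beta>. graded n a a \<alpha> \<and> graded n b b \<beta> \<and>
    (\<forall>i<n. \<forall>j<n. gmat a b V i j = mm n \<alpha> S0 i j + mm n S0 \<beta> i j)"
    by (rule graded_image[OF n e graded_gmat mtr0])
  then obtain \<alpha> \<beta> where ab: "graded n a a \<alpha>" "graded n b b \<beta>"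
    "\<And>i j. i < n ==> j < n ==> gmat a b V i j = mm n \<alpha> S0 i j + mm n S0 \<beta> i j" by blast
  have "crd n a b (gmat a b V) = crd n a b (mm n \<alpha> S0 + mm n S0 \<beta>)"
    by (rule crd_cong) (simp add: ab(3))
  then have "V = crd n a b (mm n \<alpha> S0 + mm n S0 \<beta>)" by (simp only: crd_gmat[OF V])
  then have "V \<in> \<gamma> ` supported G" using \<gamma>_crd[OF ab(1,2)] by (metis imageI)
  moreover have "(\<lambda>y. c 0 / of_nat n * crd n a b S0 y) \<in> \<gamma> ` supported G"
    by (rule fs.subspace_scale[OF \<gamma>_image(2) crd_S0_image])
  ultimately have "V - (\<lambda>y. c 0 / of_nat n * crd n a b S0 y) \<in> \<gamma> ` supported G"
    by (rule fs.subspace_diff[OF \<gamma>_image(2)])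
  moreover have "V - (\<lambda>y. c 0 / of_nat n * crd n a b S0 y) = (\<lambda>y. \<Sum>j<l. v j y * (if j < k then c (Suc j) else 0))"
  proof
    fix y
    have "(\<Sum>j<l. v j y * (if j < k then c (Suc j) else 0)) = (\<Sum>j<k. v j y * c (Suc j))"
      by (rule sum.mono_neutral_cong_right) (use k in auto)
    then show "(V - (\<lambda>y. c 0 / of_nat n * crd n a b S0 y)) y =
        (\<Sum>j<l. v j y * (if j < k then c (Suc j) else 0))"
      by (simp add: V_def)
  qed
  ultimately have "\<forall>j<l. (if j < k then c (Suc j) else 0) = 0"
    by (intro indep) simp
  then have cS: "c (Suc j) = 0" if "j < k" for j using that k by (metis order_less_le_trans)
  obtain m where "coef (det (tridiag n e)) m \<noteq> 0" using nz_S0 by (auto simp: nz_def)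
  moreover have "(\<Sum>j<k. c (Suc j) * coef (mtr n adj0 (gmat a b (v j))) m) = 0"
    by (rule sum.neutral) (simp add: cS)
  ultimately have "c 0 = 0" using z[of m] by simp
  then show ?thesis using cS by (auto simp: less_Suc_eq_0_disj)
qed

lemma C_lower:
  assumes "k \<le> l" "k > 0"
  shows "hilbert_ge (C k) N ((N div (k + 1)) ^ k)"
  unfolding C_def
proof (rule family_hilbert_lower[where f = tangent and g = "\<lambda>s. point (slice k s)"])
  have "I = {m. int (mono_deg m) = d}" by simp
  then show "finite I" by (simp only: finite_monomials_int)
  show "tangent r \<in> supported I" if "r < Suc k" for r
  proof (cases r)
    case 0
    then show ?thesis using point_supported[of "crd n a b S0"] by (simp add: tangent_def point_S0)
  next
    case (Suc j)
    then show ?thesis using tangent_supported[of j] that assms(1) by (simp add: tangent_def)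
  qed
  show "\<exists>R. (\<forall>\<epsilon>. point (slice k (\<lambda>j. \<epsilon> * w j)) m = poly R \<epsilon>) \<and> coeff R 0 = tangent 0 m \<and>
      coeff R 1 = (\<Sum>j<k. w j * tangent (Suc j) m)" for w m
    using slice_pencil[OF assms(1), of w m] by (simp add: tangent_def)
qed (rule point_outside, assumption, rule tangent_indep[OF assms(1)], assumption, rule assms(2))

text \<open>If the sets were equal, their common Hilbert function would grow at most with degree
  \<open>k\<close> and at least with degree \<open>Suc k\<close>.\<close>

lemma C_strict:
  assumes "k < l"
  shows "C k \<subset> C (Suc k)"
proof -
  have "C k \<noteq> C (Suc k)"
  proof
    assume eq: "C k = C (Suc k)"
    have G: "(N div (Suc k + 1)) ^ Suc k \<le> (N * n + 1) ^ k" for N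
      using C_upper[of k N] C_lower[of "Suc k" N] assms unfolding eq by simp
    have "Suc k \<le> k" by (rule growth_compare[OF _ G]) simp
    then show False by simp
  qed
  then show ?thesis using C_mono[of k] by blast
qed

definition Z :: "((4 \<Rightarrow>\<^sub>0 nat) => complex) set set" where
  "Z = zariski I closure_of {proj_pt (point x) | x. nz (point x)}"

text \<open>Up to terms of higher order, every deformation of \<open>S0\<close> is a deformation inside the slice
  followed by the action of the group, which changes the determinant only by a constant.\<close>

lemma vanish_on_slice:
  assumes p: "homog (int N) p" "\<And>s. peval p (point (slice l s)) = 0"
  shows "peval p (point x) = 0"
proof -
  have co: "(\<lambda>x :: entry => complex. point x m) \<in> poly_funs" for m
    unfolding point_def by (rule poly_funs.coef_detm_gmat) (rule coordinate_in_poly_funs)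
  have "(\<lambda>x. peval p (point x)) \<in> poly_funs" by (rule poly_funs.peval_in[OF p(1) co])
  then obtain q where q: "\<And>x. peval p (point x) = peval q x" unfolding poly_funs_def by blast
  have "peval q y = 0" if y: "y \<in> W" for y
  proof (rule dominance[where I = "gidx n a b" and ?s0.0 = "crd n a b S0"])
    show "\<forall>i. i \<notin> gidx n a b --> crd n a b S0 i = 0" using crd_outside by blast
    show "\<forall>i. i \<notin> gidx n a b --> y i = 0" using y by (simp add: supported_def)
    fix w :: "entry => complex" assume "\<forall>i. i \<notin> gidx n a b --> w i = 0"
    then have w: "w \<in> W" by (simp add: supported_def)
    obtain z c where zc: "z \<in> supported G" "w = (\<lambda>y. \<gamma> z y + (\<Sum>j<l. v j y * c j))"
      using span[OF w] by blast
    define \<alpha> where "\<alpha> = gmat a a (z \<circ> Inl)"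
    define \<beta> where "\<beta> = gmat b b (z \<circ> Inr)"
    define x where "x = (\<lambda>y. \<Sum>j<l. v j y * c j)"
    define V where "V = gmat a b x"
    have xW: "x \<in> W" unfolding x_def by (rule slice_W) simp
    have gr: "graded n a a \<alpha>" "graded n b b \<beta>" "graded n a b V"
      unfolding \<alpha>_def \<beta>_def V_def by (rule graded_gmat)+
    \<comment> \<open>\<open>N1\<close>, \<open>N2\<close> and \<open>N3\<close> are the
      coefficients of the first three powers of \<open>\<epsilon>\<close> in the expansion of
      \<open>mm_curve\<close>; the constant term is \<open>S0\<close>.\<close>
    define N1 where "N1 = mm n \<alpha> S0 + mm n S0 \<beta> + V"
    define N2 where "N2 = mm n \<alpha> V + mm n V \<beta> + mm n (mm n \<alpha> S0) \<beta>"
    define N3 where "N3 = mm n (mm n \<alpha> V) \<beta>"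
    have N: "graded n a b N1" "graded n a b N2" "graded n a b N3"
      unfolding N1_def N2_def N3_def
      by (intro graded_add gr graded_mm[OF gr(1) graded_S0] graded_mm[OF graded_S0 gr(2)] graded_mm[OF gr(1,3)]
          graded_mm[OF gr(3,2)] graded_mm[OF graded_mm[OF gr(1) graded_S0] gr(2)]
          graded_mm[OF graded_mm[OF gr(1,3)] gr(2)])+
    have wN: "crd n a b N1 = w"
      unfolding N1_def crd_add V_def crd_gmat[OF xW] zc(2) \<gamma>_def \<alpha>_def[symmetric] \<beta>_def[symmetric]
      unfolding x_def by simp
    define u where "u \<epsilon> = (\<lambda>y. crd n a b N1 y + \<epsilon> * (crd n a b N2 y + \<epsilon> * crd n a b N3 y))" for \<epsilon>
    have vanish: "peval q (\<lambda>i. crd n a b S0 i + \<epsilon> * u \<epsilon> i) = 0" for \<epsilon>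
    proof -
      let ?A = "scal 1 + (\<lambda>i j. mon 0 \<epsilon> * \<alpha> i j)" and ?B = "scal 1 + (\<lambda>i j. mon 0 \<epsilon> * \<beta> i j)"
        and ?V = "S0 + (\<lambda>i j. mon 0 \<epsilon> * V i j)"
      have g: "gmat a b (\<lambda>i. crd n a b S0 i + \<epsilon> * u \<epsilon> i) i j = mm n (mm n ?A ?V) ?B i j" if "i < n" "j < n" for i j
        unfolding mm_curve[OF that] N1_def[symmetric] N2_def[symmetric] N3_def[symmetric]
        by (simp only: u_def gmat_add gmat_cmult gmat_crd[OF graded_S0 that] gmat_crd[OF N(1) that]
          gmat_crd[OF N(2) that] gmat_crd[OF N(3) that])
      have "graded n a a ?A" "graded n b b ?B"
        using graded_scal[of n _ 1] gr(1,2) by (auto intro!: graded_add graded_cmult)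
      then obtain \<kappa> \<kappa>' where k: "detm n ?A = mon 0 \<kappa>" "detm n ?B = mon 0 \<kappa>'" by (metis detm_const)
      have s: "detm n ?V = detm n (gmat a b (slice l (\<lambda>j. \<epsilon> * c j)))"
      proof (rule detm_cong)
        fix i j assume ij: "i < n" "j < n"
        have "slice l (\<lambda>j. \<epsilon> * c j) = (\<lambda>y. crd n a b S0 y + \<epsilon> * x y)"
          by (simp add: slice_def x_def sum_distrib_left mult.left_commute)
        then show "?V i j = gmat a b (slice l (\<lambda>j. \<epsilon> * c j)) i j"
          by (simp only: gmat_add gmat_cmult gmat_crd[OF graded_S0 ij] V_def plus_fun_apply)
      qed
      have "detm n (gmat a b (\<lambda>i. crd n a b S0 i + \<epsilon> * u \<epsilon> i)) = detm n (mm n (mm n ?A ?V) ?B)"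
        by (rule detm_cong) (rule g)
      also have "\<dots> = mon 0 (\<kappa> * \<kappa>') * detm n (gmat a b (slice l (\<lambda>j. \<epsilon> * c j)))"
        by (simp add: detm_mm k s mult_single mult_ac flip: mult.assoc)
      finally have "point (\<lambda>i. crd n a b S0 i + \<epsilon> * u \<epsilon> i) = (\<lambda>m. (\<kappa> * \<kappa>') * point (slice l (\<lambda>j. \<epsilon> * c j)) m)"
        by (intro ext) (simp add: point_def scale_form_eq[symmetric] lookup_scale_form)
      then show ?thesis unfolding q[symmetric] using peval_homog_scale[OF p(1)] p(2) by simp
    qed
    show "\<exists>u :: complex => entry => complex. (\<forall>\<epsilon> i. i \<notin> gidx n a b --> u \<epsilon> i = 0) \<and>
        (\<forall>i. ((\<lambda>\<epsilon>. u \<epsilon> i) \<longlongrightarrow> w i) (at 0)) \<and>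
        (\<forall>\<epsilon>. \<epsilon> \<noteq> 0 --> peval q (\<lambda>i. crd n a b S0 i + \<epsilon> * u \<epsilon> i) = 0)"
    proof (intro exI[of _ u] conjI allI impI vanish)
      show "u \<epsilon> i = 0" if "i \<notin> gidx n a b" for \<epsilon> i using that by (simp add: u_def crd_outside)
      have "((\<lambda>\<epsilon>. u \<epsilon> i) \<longlongrightarrow> crd n a b N1 i + 0 * (crd n a b N2 i + 0 * crd n a b N3 i)) (at 0)" for i
        unfolding u_def by (intro tendsto_intros)
      then show "((\<lambda>\<epsilon>. u \<epsilon> i) \<longlongrightarrow> w i) (at 0)" for i by (simp add: wN)
    qed
  qed
  then have "peval p (point (crd n a b (gmat a b x))) = 0" using q crd_supported by metis
  moreover have "point (crd n a b (gmat a b x)) = point x"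
    unfolding point_def by (intro arg_cong[of _ _ coef] detm_cong gmat_crd graded_gmat)
  ultimately show ?thesis by simp
qed

lemma krull_dim_Z: "krull_dim (subtopology (zariski I) Z) = enat l"
proof (rule krull_dim_closed[where C = C and D = n])
  show "closedin (zariski I) Z" by (simp add: Z_def)
  show "\<forall>i\<le>l. irreducible_closedin (zariski I) (C i)" using C_irreducible by blast
  show "\<forall>i<l. C i \<subset> C (Suc i)" using C_strict by blast
  show "C l \<subseteq> Z" unfolding C_def Z_def by (rule closure_of_mono) blast
  fix N K assume "hilbert_ge Z N K"
  then show "K \<le> (N * n + 1) ^ l"
  proof (rule hilbert_upper_bound[where g = "\<lambda>s. point (slice l s)", OF slice_in_bdd_polys, rotated])
    fix p :: "(4 \<Rightarrow>\<^sub>0 nat) cpoly"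
    assume "homog (int N) p" "\<And>s. peval p (point (slice l s)) = 0"
    from this(1) vanish_on_slice[OF this] show "\<forall>v\<in>\<Union>Z. peval p v = 0"
      unfolding Z_def by (intro family_vanish point_outside)
  qed
qed

end

context det_family
begin

lemma closure_irreducible:
  "irreducible_closedin (zariski I) (zariski I closure_of {proj_pt (point x) | x. nz (point x)})"
proof (rule family_irreducible)
  show "(\<lambda>x :: entry => complex. point x m) \<in> poly_funs" for m
    unfolding point_def by (rule poly_funs.coef_detm_gmat) (rule coordinate_in_poly_funs)
  show "nz (point (crd n a b S0))" by (simp add: point_S0 nz_S0)
qed (rule point_outside)

lemma closure_krull_dim:
  "\<exists>l. card (gidx n a b) + 1 = card (gidx n a a) + card (gidx n b b) + l \<and>
    krull_dim (subtopology (zariski I) (zariski I closure_of {proj_pt (point x) | x. nz (point x)})) = enat l"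
proof -
  obtain l v where lv: "card (gidx n a b) + 1 = card (gidx n a a) + card (gidx n b b) + l" "\<And>j. j < l ==> v j \<in> W"
    "\<And>w. w \<in> W ==> \<exists>z c. z \<in> supported G \<and> w = (\<lambda>y. \<gamma> z y + (\<Sum>j<l. v j y * c j))"
    "\<And>c. (\<lambda>y. \<Sum>j<l. v j y * c j) \<in> \<gamma> ` supported G ==> \<forall>j<l. c j = 0"
    by (rule complement) (rule that)
  interpret det_slice n a b l v by unfold_locales (fact lv)+
  show ?thesis using lv(1) krull_dim_Z by (intro exI[of _ l]) (simp add: Z_def)
qed

end

section \<open>The determinantal variety as the closure of such a family\<close>

lemma det_variety_eq:
  assumes ap: "admissible_pair t a b"
  shows "det_family t (\<lambda>i. a (Suc i)) (\<lambda>j. b (Suc j))"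
    and "det_variety t a b = linear_system (pair_degree t a b) closure_of
      {proj_pt (det_family.point t (\<lambda>i. a (Suc i)) (\<lambda>j. b (Suc j)) x) | x.
        nz (det_family.point t (\<lambda>i. a (Suc i)) (\<lambda>j. b (Suc j)) x)}"
    and "pair_degree t a b = (\<Sum>j<t. b (Suc j)) - (\<Sum>i<t. a (Suc i))"
proof -
  let ?a = "\<lambda>i. a (Suc i)" and ?b = "\<lambda>j. b (Suc j)"
  show df: "det_family t ?a ?b"
    using ap by unfold_locales (auto simp: admissible_pair_def)
  interpret det_family t ?a ?b by (rule df)
  have nz0: "nz (coef F) \<longleftrightarrow> F \<noteq> 0" for F :: form
    unfolding nz_def by (metis lookup_zero poly_mapping_eqI)
  have "det_surfaces t a b = {proj_pt (point x) | x. nz (point x)}"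
  proof (intro equalityI subsetI)
    fix p assume "p \<in> det_surfaces t a b"
    then obtain S where S: "p = surface (det S)" "S \<in> carrier_mat t t"
      "\<forall>i<t. \<forall>j<t. homog (b (Suc j) - a (Suc i)) (S $$ (i, j))" "det S \<noteq> 0"
      unfolding det_surfaces_def by blast
    have gr: "graded t ?a ?b (mentry S)" using S(3) by (simp add: graded_def mentry_def)
    have "detm t (gmat ?a ?b (crd t ?a ?b (mentry S))) = det S"
      unfolding detm_mentry[OF S(2), symmetric] by (intro detm_cong gmat_crd gr)
    then have "point (crd t ?a ?b (mentry S)) = coef (det S)" by (simp add: point_def)
    then show "p \<in> {proj_pt (point x) | x. nz (point x)}"
      using S(1,4) nz0 unfolding surface_def mem_Collect_eq by metis
  next
    fix p assume "p \<in> {proj_pt (point x) | x. nz (point x)}"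
    then obtain x where x: "p = proj_pt (point x)" "nz (point x)" by blast
    have "homog (b (Suc j) - a (Suc i)) (gmat ?a ?b x i j)" if "i < t" "j < t" for i j
      using gradedD[OF graded_gmat that] .
    then show "p \<in> det_surfaces t a b"
      using x nz0 unfolding det_surfaces_def surface_def point_def detm_def
      by (intro CollectI exI[of _ "mat t t (\<lambda>(i, j). gmat ?a ?b x i j)"]) auto
  qed
  then show "det_variety t a b = linear_system (pair_degree t a b) closure_of {proj_pt (point x) | x. nz (point x)}"
    by (simp add: det_variety_def)
  have "(\<Sum>i=1..t. f i) = (\<Sum>i<t. f (Suc i))" for f :: "nat => int"
    by (rule sum.reindex_bij_witness[of _ Suc "\<lambda>i. i - 1"]) auto
  then show "pair_degree t a b = (\<Sum>j<t. b (Suc j)) - (\<Sum>i<t. a (Suc i))"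
    by (simp add: pair_degree_def sum_subtractf)
qed

lemma det_variety_dimension:
  assumes ap: "admissible_pair t a b"
  shows "irreducible_closedin (linear_system (pair_degree t a b)) (det_variety t a b)"
    and "\<exists>l. (\<Sum>i=1..t. \<Sum>j=1..t. h0 (b j - a i)) + 1 =
        (\<Sum>i=1..t. \<Sum>j=1..t. h0 (a j - a i)) + (\<Sum>i=1..t. \<Sum>j=1..t. h0 (b j - b i)) + l \<and>
      krull_dim (subtopology (linear_system (pair_degree t a b)) (det_variety t a b)) = enat l"
proof -
  interpret det_family t "\<lambda>i. a (Suc i)" "\<lambda>j. b (Suc j)" by (rule det_variety_eq(1)[OF ap])
  note e = det_variety_eq(2)[OF ap] linear_system_def det_variety_eq(3)[OF ap]
  have s: "(\<Sum>i=1..t. f i) = (\<Sum>i<t. f (Suc i))" for f :: "nat => nat"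
    by (rule sum.reindex_bij_witness[of _ Suc "\<lambda>i. i - 1"]) auto
  show "irreducible_closedin (linear_system (pair_degree t a b)) (det_variety t a b)"
    unfolding e by (rule closure_irreducible)
  show "\<exists>l. (\<Sum>i=1..t. \<Sum>j=1..t. h0 (b j - a i)) + 1 =
        (\<Sum>i=1..t. \<Sum>j=1..t. h0 (a j - a i)) + (\<Sum>i=1..t. \<Sum>j=1..t. h0 (b j - b i)) + l \<and>
      krull_dim (subtopology (linear_system (pair_degree t a b)) (det_variety t a b)) = enat l"
  proof -
    obtain l where l: "card (gidx t (\<lambda>i. a (Suc i)) (\<lambda>j. b (Suc j))) + 1 =
        card (gidx t (\<lambda>i. a (Suc i)) (\<lambda>i. a (Suc i))) + card (gidx t (\<lambda>j. b (Suc j)) (\<lambda>j. b (Suc j))) + l"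
      "krull_dim (subtopology (zariski I) (zariski I closure_of {proj_pt (point x) | x. nz (point x)})) = enat l"
      using closure_krull_dim by blast
    have "krull_dim (subtopology (linear_system (pair_degree t a b)) (det_variety t a b)) = enat l"
      unfolding e by (rule l(2))
    moreover have "(\<Sum>i=1..t. \<Sum>j=1..t. h0 (g j - f i)) = card (gidx t (\<lambda>i. f (Suc i)) (\<lambda>j. g (Suc j)))"
      for f g :: "nat => int"
      unfolding card_gidx s ..
    ultimately show ?thesis using l(1) by (intro exI[of _ l]) simp
  qed
qed

section \<open>Graded resolutions of length one\<close>

lemma vector_space_tuples: "vector_space (\<lambda>(c :: complex) (f :: nat => form) i. scale_form c (f i))"
  by unfold_locales (simp_all add: fun_eq_iff fvs.scale_right_distrib fvs.scale_left_distrib)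

interpretation tv: vector_space "\<lambda>(c :: complex) (f :: nat => form) i. scale_form c (f i)"
  by (rule vector_space_tuples)

text \<open>The degree \<open>n\<close> part of the graded free module with generators of degrees
  \<open>c i\<close>.\<close>

definition tuples :: "nat set => (nat => int) => int => (nat => form) set" where
  "tuples A c n = {f. (\<forall>i\<in>A. homog (n - c i) (f i)) \<and> (\<forall>i. i \<notin> A --> f i = 0)}"

lemma subspace_tuples: "tv.subspace (tuples A c n)"
  by (rule tv.subspaceI) (auto simp: tuples_def intro: homog_add homog_scale_form)

lemma tuple_monomials:
  assumes "finite X"
  shows "coef ((\<Sum>x\<in>X. (\<lambda>i. scale_form (r x) (if i = fst x then mon (snd x) 1 else 0))) k) m =
    (if (k, m) \<in> X then r (k, m) else 0)"
proof -
  have "coef ((\<Sum>x\<in>X. (\<lambda>i. scale_form (r x) (if i = fst x then mon (snd x) 1 else 0))) k) m =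
      (\<Sum>x\<in>X. if x = (k, m) then r (k, m) else 0)"
    unfolding sum_apply lookup_sum
    by (rule sum.cong) (auto simp: lookup_scale_form lookup_single when_def)
  then show ?thesis using assms by simp
qed

lemma dim_tuples:
  assumes A: "finite A"
  shows "tv.dim (tuples A c n) = (\<Sum>i\<in>A. h0 (n - c i))"
    and "\<exists>T. finite T \<and> tuples A c n \<subseteq> tv.span T"
proof -
  define X where "X = Sigma A (\<lambda>i. {m :: 4 \<Rightarrow>\<^sub>0 nat. int (mono_deg m) = n - c i})"
  define E :: "nat \<times> (4 \<Rightarrow>\<^sub>0 nat) => nat => form" where
    "E x = (\<lambda>i. if i = fst x then mon (snd x) 1 else 0)" for x
  have finX: "finite X" unfolding X_def using A by (intro finite_SigmaI finite_monomials_int)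
  note tm = tuple_monomials[OF finX, folded E_def]
  have E: "E x \<in> tuples A c n" if "x \<in> X" for x
    using that by (auto simp: E_def tuples_def X_def intro: homog_mon)
  have ex: "f = (\<Sum>x\<in>X. (\<lambda>i. scale_form (coef (f (fst x)) (snd x)) (E x i)))" if f: "f \<in> tuples A c n" for f
  proof
    fix k
    show "f k = (\<Sum>x\<in>X. (\<lambda>i. scale_form (coef (f (fst x)) (snd x)) (E x i))) k"
    proof (rule poly_mapping_eqI)
      fix m
      have "coef (f k) m = 0" if "(k, m) \<notin> X"
      proof (cases "k \<in> A")
        case True
        then have "homog (n - c k) (f k)" using f by (simp add: tuples_def)
        from homogD[OF this, of m] show ?thesis using that True by (auto simp: X_def)
      next
        case False
        then show ?thesis using f by (simp add: tuples_def)
      qed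
      moreover have "coef ((\<Sum>x\<in>X. (\<lambda>i. scale_form (coef (f (fst x)) (snd x)) (E x i))) k) m =
          (if (k, m) \<in> X then coef (f k) m else 0)"
        using tuple_monomials[OF finX, of "\<lambda>x. coef (f (fst x)) (snd x)" k m] by (simp add: E_def)
      ultimately show "coef (f k) m = coef ((\<Sum>x\<in>X. (\<lambda>i. scale_form (coef (f (fst x)) (snd x)) (E x i))) k) m"
        by simp
    qed
  qed
  have "tv.dim (tuples A c n) = card X"
  proof (rule tv.dim_family[OF finX E])
    fix r assume 0: "(\<Sum>x\<in>X. (\<lambda>i. scale_form (r x) (E x i))) = 0"
    have "r (k, m) = 0" if "(k, m) \<in> X" for k m
      using tuple_monomials[OF finX, of r k m] that fun_cong[OF 0, of k] by (simp add: E_def)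
    then show "\<forall>x\<in>X. r x = 0" by auto
  next
    fix f assume f: "f \<in> tuples A c n"
    show "\<exists>r. f = (\<Sum>x\<in>X. (\<lambda>i. scale_form (r x) (E x i)))"
      by (intro exI[of _ "\<lambda>x. coef (f (fst x)) (snd x)"] ex f)
  qed
  also have "card X = (\<Sum>i\<in>A. h0 (n - c i))" unfolding X_def h0_def using A by (simp add: card_SigmaI)
  finally show "tv.dim (tuples A c n) = (\<Sum>i\<in>A. h0 (n - c i))" .
  have "f \<in> tv.span (E ` X)" if "f \<in> tuples A c n" for f
    by (subst ex[OF that]) (intro tv.span_sum tv.span_scale tv.span_base imageI)
  then show "\<exists>T. finite T \<and> tuples A c n \<subseteq> tv.span T" using finX by (intro exI[of _ "E ` X"]) auto
qed

locale graded_generators =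
  fixes I :: "nat set" and a :: "nat => int" and p :: "nat => form"
  assumes finI: "finite I" and p: "\<And>i. i \<in> I ==> homog (a i) (p i)"
begin

definition Q :: "form set" where
  "Q = {\<Sum>i\<in>I. p i * f i | f. True}"

lemma Q_I: "(\<Sum>i\<in>I. p i * f i) \<in> Q"
  unfolding Q_def by blast

lemma Q_graded:
  assumes "F \<in> Q" "homog n F"
  shows "\<exists>f. (\<forall>i\<in>I. homog (n - a i) (f i)) \<and> F = (\<Sum>i\<in>I. p i * f i)"
proof -
  obtain f where f: "F = (\<Sum>i\<in>I. p i * f i)" using assms(1) by (auto simp: Q_def)
  have "F = hcomp n F" using assms(2) by (simp add: hcomp_homog)
  also have "\<dots> = (\<Sum>i\<in>I. p i * hcomp (n - a i) (f i))"
    unfolding f hcomp_sum by (rule sum.cong) (auto simp: hcomp_homog_mult[OF p])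
  finally show ?thesis by (intro exI[of _ "\<lambda>i. hcomp (n - a i) (f i)"]) (simp add: homog_hcomp)
qed

lemma is_ideal_Q: "is_ideal Q"
  unfolding is_ideal_def
proof (intro conjI ballI allI)
  show "0 \<in> Q" using Q_I[of "\<lambda>_. 0"] by simp
  fix x assume "x \<in> Q"
  then obtain f where f: "x = (\<Sum>i\<in>I. p i * f i)" by (auto simp: Q_def)
  show "r * x \<in> Q" for r
    using Q_I[of "\<lambda>i. r * f i"] unfolding f by (simp add: sum_distrib_left mult.left_commute)
  fix y assume "y \<in> Q"
  then obtain g where g: "y = (\<Sum>i\<in>I. p i * g i)" by (auto simp: Q_def)
  show "x + y \<in> Q" using Q_I[of "\<lambda>i. f i + g i"] unfolding f g by (simp add: sum.distrib distrib_left)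
qed

lemma homogeneous_ideal_Q: "homogeneous_ideal Q"
proof -
  have "\<exists>H. finite H \<and> H \<subseteq> Q \<and> (\<forall>h\<in>H. \<exists>n. homog n h) \<and> F = \<Sum>H" if F: "F \<in> Q" for F
  proof -
    obtain f where f: "F = (\<Sum>i\<in>I. p i * f i)" using F by (auto simp: Q_def)
    have hQ: "hcomp n F \<in> Q" for n
    proof -
      have "hcomp n F = (\<Sum>i\<in>I. p i * hcomp (n - a i) (f i))"
        unfolding f hcomp_sum by (rule sum.cong) (auto simp: hcomp_homog_mult[OF p])
      then show ?thesis using Q_I by simp
    qed
    let ?S = "(int \<circ> mono_deg) ` supp F"
    have inj: "inj_on (\<lambda>n. hcomp n F) ?S"
    proof (rule inj_onI)
      fix x y assume "x \<in> ?S" and e: "hcomp x F = hcomp y F"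
      then obtain m where m: "coef F m \<noteq> 0" "x = int (mono_deg m)" by (auto simp: in_keys_iff)
      have "coef (hcomp x F) m = coef (hcomp y F) m" by (simp only: e)
      then show "x = y" using m by (simp add: coef_hcomp split: if_splits)
    qed
    have "F = \<Sum>((\<lambda>n. hcomp n F) ` ?S)"
      using hcomp_decomp_keys[of F] unfolding sum.reindex[OF inj] by (simp only: comp_def)
    then show ?thesis
      using hQ by (intro exI[of _ "(\<lambda>n. hcomp n F) ` ?S"]) (auto intro: homog_hcomp)
  qed
  then show ?thesis
    using is_idealD[OF is_ideal_Q] unfolding homogeneous_ideal_def by blast
qed

end

text \<open>A graded free resolution of the ideal \<open>Q\<close>, with generators of degrees
  \<open>a i\<close>, relations of degrees \<open>b j\<close> and exactness expressed one degree at
  a time.\<close>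

locale graded_resolution = graded_generators +
  fixes K :: "nat set" and b :: "nat => int" and M :: "nat => nat => form"
  assumes finK: "finite K"
    and M: "\<And>i j. i \<in> I ==> j \<in> K ==> homog (b j - a i) (M i j)"
    and cplx: "\<And>j. j \<in> K ==> (\<Sum>i\<in>I. p i * M i j) = 0"
    and inj: "\<And>n g j. (\<And>j. j \<in> K ==> homog (n - b j) (g j)) ==>
      (\<And>i. i \<in> I ==> (\<Sum>j\<in>K. M i j * g j) = 0) ==> j \<in> K ==> g j = 0"
    and exact: "\<And>n f. (\<And>i. i \<in> I ==> homog (n - a i) (f i)) ==> (\<Sum>i\<in>I. p i * f i) = 0 ==>
      \<exists>g. (\<forall>j\<in>K. homog (n - b j) (g j)) \<and> (\<forall>i\<in>I. f i = (\<Sum>j\<in>K. M i j * g j))"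
begin

lemma cplx_apply: "(\<Sum>i\<in>I. p i * (\<Sum>j\<in>K. M i j * g j)) = 0"
proof -
  have "(\<Sum>i\<in>I. p i * (\<Sum>j\<in>K. M i j * g j)) = (\<Sum>i\<in>I. \<Sum>j\<in>K. p i * M i j * g j)"
    by (simp add: sum_distrib_left mult.assoc)
  also have "\<dots> = (\<Sum>j\<in>K. \<Sum>i\<in>I. p i * M i j * g j)" by (rule sum.swap)
  also have "\<dots> = (\<Sum>j\<in>K. (\<Sum>i\<in>I. p i * M i j) * g j)" by (simp add: sum_distrib_right)
  also have "\<dots> = 0" by (rule sum.neutral) (simp add: cplx)
  finally show ?thesis .
qed

text \<open>A Koszul relation between the lifts of \<open>x\<^sub>k\<^sup>N F\<close> for three variables, which holds by
  injectivity of \<open>M\<close>, shows that \<open>Q\<close> is saturated.\<close>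

lemma Q_saturated:
  assumes F: "homog n F" and mem: "\<And>k. xp k N * F \<in> Q"
  shows "F \<in> Q"
proof -
  let ?X = "\<lambda>k. xp k N :: form" and ?n = "n + int N"
  have "\<exists>f. (\<forall>i\<in>I. homog (?n - a i) (f i)) \<and> ?X k * F = (\<Sum>i\<in>I. p i * f i)" for k
    by (rule Q_graded[OF mem]) (rule homog_mult'[OF homog_xp F], simp)
  then obtain f where f: "\<And>k i. i \<in> I ==> homog (?n - a i) (f k i)" "\<And>k. ?X k * F = (\<Sum>i\<in>I. p i * f k i)"
    by metis
  define R where "R k l g \<longleftrightarrow> (\<forall>j\<in>K. homog (?n + int N - b j) (g j)) \<and>
      (\<forall>i\<in>I. ?X l * f k i - ?X k * f l i = (\<Sum>j\<in>K. M i j * g j))" for k l g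
  have R: "\<exists>g. R k l g" for k l
    unfolding R_def
  proof (rule exact)
    show "homog (?n + int N - a i) (?X l * f k i - ?X k * f l i)" if "i \<in> I" for i
      by (intro homog_diff homog_mult'[OF homog_xp f(1)[OF that]]) simp_all
    have "(\<Sum>i\<in>I. p i * (?X l * f k i - ?X k * f l i)) = ?X l * (\<Sum>i\<in>I. p i * f k i) - ?X k * (\<Sum>i\<in>I. p i * f l i)"
      by (simp add: sum_distrib_left right_diff_distrib sum_subtractf mult.left_commute)
    then show "(\<Sum>i\<in>I. p i * (?X l * f k i - ?X k * f l i)) = 0"
      by (simp add: f(2)[symmetric] mult.left_commute)
  qed
  define g where "g k l = (SOME g. R k l g)" for k l
  have g: "j \<in> K ==> homog (?n + int N - b j) (g k l j)"
    "i \<in> I ==> ?X l * f k i - ?X k * f l i = (\<Sum>j\<in>K. M i j * g k l j)" for k l i j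
  proof -
    have "R k l (g k l)" unfolding g_def by (rule someI_ex[OF R])
    then show "j \<in> K ==> homog (?n + int N - b j) (g k l j)"
      "i \<in> I ==> ?X l * f k i - ?X k * f l i = (\<Sum>j\<in>K. M i j * g k l j)"
      unfolding R_def by blast+
  qed
  have "\<exists>u v. g 0 1 j = ?X 1 * u + ?X 0 * v" if j: "j \<in> K" for j
  proof -
    \<comment> \<open>\<open>M\<close> maps this combination to the Koszul relation between three
      lifts, which is zero.\<close>
    let ?h = "\<lambda>j. ?X 2 * g 0 1 j - ?X 1 * g 0 2 j + ?X 0 * g 1 2 j"
    have "?h j = 0"
    proof (rule inj[of "?n + 2 * int N"])
      show "homog (?n + 2 * int N - b j) (?h j)" if "j \<in> K" for j
        by (intro homog_add homog_diff homog_mult'[OF homog_xp g(1)[OF that]]) simp_all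
      fix i assume i: "i \<in> I"
      have "(\<Sum>j\<in>K. M i j * ?h j) =
          ?X 2 * (\<Sum>j\<in>K. M i j * g 0 1 j) - ?X 1 * (\<Sum>j\<in>K. M i j * g 0 2 j) + ?X 0 * (\<Sum>j\<in>K. M i j * g 1 2 j)"
        by (simp add: sum_distrib_left sum.distrib sum_subtractf algebra_simps)
      then show "(\<Sum>j\<in>K. M i j * ?h j) = 0"
        unfolding g(2)[OF i, symmetric] by (simp add: algebra_simps)
    qed (rule j)
    then have "?X 2 * g 0 1 j = ?X 1 * g 0 2 j - ?X 0 * g 1 2 j" by (simp add: algebra_simps)
    moreover have "g 0 2 j * ?X 1 - g 1 2 j * ?X 0 \<in> mono_ideal {1, 0} N"
      by (intro mono_ideal_diff mono_ideal_mult xp_in_mono_ideal) simp_all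
    ultimately have "?X 2 * g 0 1 j \<in> mono_ideal {1, 0} N" by (simp add: mult.commute)
    then have "g 0 1 j \<in> mono_ideal {1, 0} N" by (rule mono_ideal_cancel) simp
    then obtain u where "g 0 1 j - ?X 1 * u \<in> mono_ideal {0} N" by (rule mono_ideal_insert)
    then obtain v where "g 0 1 j - ?X 1 * u - ?X 0 * v \<in> mono_ideal {} N" by (rule mono_ideal_insert)
    then show ?thesis by (intro exI[of _ u] exI[of _ v]) (simp add: mono_ideal_empty algebra_simps)
  qed
  then obtain u v where uv: "\<And>j. j \<in> K ==> g 0 1 j = ?X 1 * u j + ?X 0 * v j" by metis
  have "\<exists>r. f 0 i - (\<Sum>j\<in>K. M i j * u j) = ?X 0 * r" if i: "i \<in> I" for i
  proof -
    have "(\<Sum>j\<in>K. M i j * g 0 1 j) = ?X 1 * (\<Sum>j\<in>K. M i j * u j) + ?X 0 * (\<Sum>j\<in>K. M i j * v j)"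
      by (simp add: uv sum_distrib_left sum.distrib distrib_left mult.left_commute)
    then have "?X 1 * (f 0 i - (\<Sum>j\<in>K. M i j * u j)) = ?X 0 * (f 1 i + (\<Sum>j\<in>K. M i j * v j))"
      using g(2)[OF i, of 1 0] by (simp add: algebra_simps)
    then obtain r where "f 0 i - (\<Sum>j\<in>K. M i j * u j) = ?X 0 * r" by (rule xp_dvd_cancel) simp
    then show ?thesis by blast
  qed
  then obtain r where r: "\<And>i. i \<in> I ==> f 0 i - (\<Sum>j\<in>K. M i j * u j) = ?X 0 * r i" by metis
  \<comment> \<open>The lift \<open>f 0\<close>, corrected by the column combination with
    coefficients \<open>u\<close>, is divisible by \<open>?X 0\<close>, so this power
    cancels.\<close>
  have "?X 0 * F = (\<Sum>i\<in>I. p i * (f 0 i - (\<Sum>j\<in>K. M i j * u j)))"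
    using cplx_apply[of u] by (simp add: f(2) right_diff_distrib sum_subtractf)
  also have "\<dots> = ?X 0 * (\<Sum>i\<in>I. p i * r i)"
    by (simp add: r sum_distrib_left mult.left_commute)
  finally have "F = (\<Sum>i\<in>I. p i * r i)" by simp
  then show ?thesis using Q_I by simp
qed

text \<open>Rank and nullity for the generators \<open>p\<close> and for the matrix
  \<open>M\<close>, whose image is the kernel of the former.\<close>

lemma dim_Q:
  "fvs.dim {F \<in> Q. homog n F} + (\<Sum>j\<in>K. h0 (n - b j)) = (\<Sum>i\<in>I. h0 (n - a i))"
proof -
  define P where "P f = (\<Sum>i\<in>I. p i * f i)" for f
  define L where "L g = (\<lambda>i. if i \<in> I then \<Sum>j\<in>K. M i j * g j else 0)" for g
  obtain T where T: "finite T" "tuples I a n \<subseteq> tv.span T" using dim_tuples(2)[OF finI] by blast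
  obtain T' where T': "finite T'" "tuples K b n \<subseteq> tv.span T'" using dim_tuples(2)[OF finK] by blast
  have P1: "P (u + v) = P u + P v" for u v by (simp add: P_def distrib_left sum.distrib)
  have P2: "P (\<lambda>i. scale_form c (u i)) = scale_form c (P u)" for c u
    by (simp add: P_def scale_form_eq sum_distrib_left mult.left_commute)
  have L1: "L (u + v) = L u + L v" for u v by (simp add: L_def fun_eq_iff distrib_left sum.distrib)
  have L2: "L (\<lambda>i. scale_form c (u i)) = (\<lambda>i. scale_form c (L u i))" for c u
    by (simp add: L_def fun_eq_iff scale_form_eq sum_distrib_left mult.left_commute)
  have "tv.dim (tuples I a n) = tv.dim {f \<in> tuples I a n. P f = 0} + fvs.dim (P ` tuples I a n)"
    by (rule vector_space_pair.rank_nullity[OF vector_space_pair.intro[OF vector_space_tuples vector_space_form]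
      P1 P2 subspace_tuples T(2,1)])
  moreover have "tv.dim (tuples K b n) = tv.dim {g \<in> tuples K b n. L g = 0} + tv.dim (L ` tuples K b n)"
    by (rule vector_space_pair.rank_nullity[OF vector_space_pair.intro[OF vector_space_tuples vector_space_tuples]
      L1 L2 subspace_tuples T'(2,1)])
  moreover have "{g \<in> tuples K b n. L g = 0} = {0}"
  proof (intro equalityI subsetI)
    fix g assume "g \<in> {g \<in> tuples K b n. L g = 0}"
    then have g: "\<And>j. j \<in> K ==> homog (n - b j) (g j)" "\<And>j. j \<notin> K ==> g j = 0" "L g = 0"
      by (auto simp: tuples_def)
    have "(\<Sum>j\<in>K. M i j * g j) = 0" if "i \<in> I" for i using fun_cong[OF g(3), of i] that by (simp add: L_def)
    then have "g j = 0" for j using inj[of n g j] g(1,2) by blast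
    then show "g \<in> {0}" by (auto simp: fun_eq_iff)
  qed (auto simp: tuples_def L_def fun_eq_iff)
  moreover have "L ` tuples K b n = {f \<in> tuples I a n. P f = 0}"
  proof (intro equalityI subsetI)
    fix f assume "f \<in> L ` tuples K b n"
    then obtain g where g: "g \<in> tuples K b n" "f = L g" by blast
    have "P (L g) = (\<Sum>i\<in>I. p i * (\<Sum>j\<in>K. M i j * g j))" unfolding P_def L_def by (rule sum.cong) auto
    moreover have "homog (n - a i) (\<Sum>j\<in>K. M i j * g j)" if "i \<in> I" for i
      using g(1) by (intro homog_sum homog_mult'[OF M[OF that]]) (auto simp: tuples_def)
    ultimately show "f \<in> {f \<in> tuples I a n. P f = 0}"
      unfolding g(2) by (simp add: cplx_apply tuples_def) (simp add: L_def)
  next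
    fix f assume "f \<in> {f \<in> tuples I a n. P f = 0}"
    then have f: "\<And>i. i \<in> I ==> homog (n - a i) (f i)" "\<And>i. i \<notin> I ==> f i = 0" "(\<Sum>i\<in>I. p i * f i) = 0"
      by (auto simp: tuples_def P_def)
    obtain g where g: "\<forall>j\<in>K. homog (n - b j) (g j)" "\<forall>i\<in>I. f i = (\<Sum>j\<in>K. M i j * g j)"
      using exact[OF f(1,3)] by blast
    have "f = L (\<lambda>j. if j \<in> K then g j else 0)" using g(2) f(2) by (auto simp: L_def fun_eq_iff)
    moreover have "(\<lambda>j. if j \<in> K then g j else 0) \<in> tuples K b n" using g(1) by (simp add: tuples_def)
    ultimately show "f \<in> L ` tuples K b n" by blast
  qed
  moreover have "P ` tuples I a n = {F \<in> Q. homog n F}"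
  proof (intro equalityI subsetI)
    fix F assume "F \<in> P ` tuples I a n"
    then obtain f where f: "f \<in> tuples I a n" "F = P f" by blast
    have "homog n (P f)"
      unfolding P_def using f(1) by (intro homog_sum homog_mult'[OF p]) (auto simp: tuples_def)
    then show "F \<in> {F \<in> Q. homog n F}" using f(2) Q_I by (simp add: P_def)
  next
    fix F assume "F \<in> {F \<in> Q. homog n F}"
    then obtain f where f: "\<forall>i\<in>I. homog (n - a i) (f i)" "F = (\<Sum>i\<in>I. p i * f i)" using Q_graded[of F n] by blast
    have "F = P (\<lambda>i. if i \<in> I then f i else 0)" using f(2) by (simp add: P_def)
    moreover have "(\<lambda>i. if i \<in> I then f i else 0) \<in> tuples I a n" using f(1) by (simp add: tuples_def)
    ultimately show "F \<in> P ` tuples I a n" by blast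
  qed
  moreover have "tv.dim {0} = card ({} :: nat set)" by (rule tv.dim_family) auto
  ultimately show ?thesis by (simp add: dim_tuples(1) finI finK)
qed

end

subsection \<open>The Hilbert polynomial\<close>

lemma gchoose_3: "x gchoose 3 = x * (x - 1) * (x - 2) / (6 :: real)"
  by (simp add: gbinomial_prod_rev numeral_3_eq_3 atLeast0_lessThan_Suc fact_numeral algebra_simps)

lemma h0_real: "k \<ge> -3 ==> real (h0 k) = (real_of_int k + 1) * (real_of_int k + 2) * (real_of_int k + 3) / 6"
proof -
  assume k: "k \<ge> -3"
  show ?thesis
  proof (cases "k < 0")
    case True
    then have "k = -1 \<or> k = -2 \<or> k = -3" using k by linarith
    then show ?thesis by (auto simp: h0_eq)
  next
    case False
    then have "real (h0 k) = (real_of_int k + 3) gchoose 3" by (simp add: h0_eq binomial_gbinomial)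
    then show ?thesis by (simp add: gchoose_3 algebra_simps)
  qed
qed

lemma h0_real':
  "k \<ge> -3 ==> 6 * real (h0 k) = (real_of_int k + 1) * (real_of_int k + 2) * (real_of_int k + 3)"
  by (simp add: h0_real)

lemma eventually_poly_unique:
  fixes P R :: "real poly"
  assumes "\<forall>\<^sub>F n in sequentially. poly P (real n) = poly R (real n)"
  shows "P = R"
proof (rule ccontr)
  assume "P \<noteq> R"
  then have "finite {x. poly (P - R) x = 0}" by (intro poly_roots_finite) simp
  moreover obtain n0 where n0: "\<forall>n\<ge>n0. poly P (real n) = poly R (real n)"
    using assms by (auto simp: eventually_sequentially)
  have "real ` {n0..} \<subseteq> {x. poly (P - R) x = 0}" using n0 by auto
  ultimately have "finite (real ` {n0..})" by (metis finite_subset)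
  then show False by (simp add: finite_image_iff infinite_Ici)
qed

lemma hilbert_sum:
  fixes c :: "nat => int"
  assumes "finite A" "\<And>i. i \<in> A ==> c i \<le> int n"
  shows "6 * (\<Sum>i\<in>A. real (h0 (int n - c i))) =
    real (card A) * (real n ^ 3 + 6 * real n ^ 2 + 11 * real n + 6)
    - real_of_int (\<Sum>i\<in>A. c i) * (3 * real n ^ 2 + 12 * real n + 11)
    + real_of_int (\<Sum>i\<in>A. c i ^ 2) * (3 * real n + 6) - real_of_int (\<Sum>i\<in>A. c i ^ 3)"
  using assms
proof (induction A rule: finite_induct)
  case (insert x A)
  have "6 * real (h0 (int n - c x)) = (real n ^ 3 + 6 * real n ^ 2 + 11 * real n + 6)
      - real_of_int (c x) * (3 * real n ^ 2 + 12 * real n + 11)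
      + real_of_int (c x ^ 2) * (3 * real n + 6) - real_of_int (c x ^ 3)"
    using h0_real'[of "int n - c x"] insert.prems[of x]
    by (simp add: power2_eq_square power3_eq_cube algebra_simps)
  then show ?case using insert by (simp add: algebra_simps)
qed simp

text \<open>There is one generator more than relations, and the degrees have equal sums, so the
  cubic and quadratic terms cancel against those of the whole ring. The sums of squares and cubes
  leave \<open>d_C\<close> and \<open>g_C\<close>.\<close>

lemma hilbert_poly_eq:
  assumes r: "graded_resolution {0..t} a p {1..t} b M"
    and C: "\<And>n. n \<ge> n0 ==> {F \<in> C. homog (int n) F} = {F \<in> graded_generators.Q {0..t} p. homog (int n) F}"
    and s: "(\<Sum>j=1..t. b j) = (\<Sum>i=0..t. a i)"
  shows "hilbert_poly C = [:1 - g_C t a b, d_C t a b:]"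
proof -
  interpret graded_resolution "{0..t}" a p "{1..t}" b M by (rule r)
  let ?R = "[:1 - g_C t a b, d_C t a b:]"
  \<comment> \<open>Beyond all \<open>a i\<close> and \<open>b j\<close>, where every
    \<open>h0\<close> involved is a value of its cubic polynomial.\<close>
  define n1 where "n1 = n0 + (\<Sum>i=0..t. nat (a i)) + (\<Sum>j=1..t. nat (b j))"
  have "hilbert_fun C n = poly ?R (real n)" if n: "n \<ge> n1" for n
  proof -
    have "a i \<le> int n" if "i \<in> {0..t}" for i
      using n member_le_sum[of i "{0..t}" "\<lambda>i. nat (a i)"] that by (simp add: n1_def)
    moreover have "b j \<le> int n" if "j \<in> {1..t}" for j
      using n member_le_sum[of j "{1..t}" "\<lambda>j. nat (b j)"] that by (simp add: n1_def)
    ultimately have sums: "6 * (\<Sum>i\<in>{0..t}. real (h0 (int n - a i))) =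
        real (t + 1) * (real n ^ 3 + 6 * real n ^ 2 + 11 * real n + 6)
        - real_of_int (\<Sum>i=0..t. a i) * (3 * real n ^ 2 + 12 * real n + 11)
        + real_of_int (\<Sum>i=0..t. a i ^ 2) * (3 * real n + 6) - real_of_int (\<Sum>i=0..t. a i ^ 3)"
      "6 * (\<Sum>j\<in>{1..t}. real (h0 (int n - b j))) =
        real t * (real n ^ 3 + 6 * real n ^ 2 + 11 * real n + 6)
        - real_of_int (\<Sum>j=1..t. b j) * (3 * real n ^ 2 + 12 * real n + 11)
        + real_of_int (\<Sum>j=1..t. b j ^ 2) * (3 * real n + 6) - real_of_int (\<Sum>j=1..t. b j ^ 3)"
      using hilbert_sum[of "{0..t}" a n] hilbert_sum[of "{1..t}" b n] by simp_all
    have "real (fvs.dim {F \<in> C. homog (int n) F}) + (\<Sum>j\<in>{1..t}. real (h0 (int n - b j))) =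
        (\<Sum>i\<in>{0..t}. real (h0 (int n - a i)))"
      using arg_cong[OF dim_Q[of "int n"], of real] C[of n] n by (simp add: n1_def)
    moreover have "6 * real (fvs.dim {F. homog (int n) F}) = real n ^ 3 + 6 * real n ^ 2 + 11 * real n + 6"
      unfolding dim_homog using h0_real'[of "int n"] by (simp add: power2_eq_square power3_eq_cube algebra_simps)
    ultimately have "6 * hilbert_fun C n = 6 * poly ?R (real n)"
      using sums unfolding hilbert_fun_def s by (simp add: g_C_def d_C_def algebra_simps)
    then show ?thesis by simp
  qed
  then have R: "\<forall>\<^sub>F n in sequentially. hilbert_fun C n = poly ?R (real n)"
    unfolding eventually_sequentially by blast
  show ?thesis
    unfolding hilbert_poly_def
  proof (rule the_equality)
    fix P assume "\<forall>\<^sub>F n in sequentially. hilbert_fun C n = poly P (real n)"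
    with R have "\<forall>\<^sub>F n in sequentially. poly P (real n) = poly ?R (real n)"
      by eventually_elim simp
    then show "P = ?R" by (rule eventually_poly_unique)
  qed (rule R)
qed

section \<open>From a resolution of forms to an exact sequence of sheaves\<close>

lemma form_eq_on_open:
  fixes P R q :: form
  assumes "q \<noteq> 0" "\<And>u. nz u ==> peval q u \<noteq> 0 ==> peval P u = peval R u"
  shows "P = R"
proof (rule peval_eq_on_dense[of "q * xp 0 1"])
  fix v :: "4 => complex" assume "peval (q * xp 0 1) v \<noteq> 0"
  then have "peval q v \<noteq> 0" "v 0 \<noteq> 0" by simp_all
  then show "peval P v = peval R v" by (intro assms(2)) (auto simp: nz_def)
qed (use assms(1) in simp)

lemma point_cone: "openin P3 U ==> x \<in> U ==> \<exists>v. x = proj_pt v \<and> v \<in> \<Union>U"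
  using proj_space_ex[of x UNIV] openin_zariski_subset[of UNIV U] cone_P3[of U] by blast

context graded_resolution
begin

abbreviation "\<phi> \<equiv> mat_map K (\<lambda>j. - b j) I M"
abbreviation "\<psi> \<equiv> mat_map I (\<lambda>i. - a i) {0} (\<lambda>_. p)"

lemma \<psi>_in_ideal_sheaf:
  assumes U: "openin P3 U" and \<sigma>: "\<sigma> \<in> twist_sum I (\<lambda>i. - a i) U"
  shows "\<psi> U \<sigma> \<in> ideal_sheaf Q U"
  unfolding ideal_sheaf_def mem_Collect_eq
proof (intro conjI ballI)
  show "\<psi> U \<sigma> \<in> twist_sum {0} (\<lambda>_. 0) U"
    by (rule mat_map_in[OF U \<sigma>]) (simp add: p)
  fix x assume "x \<in> U"
  then obtain v where v: "x = proj_pt v" "v \<in> \<Union>U" using point_cone[OF U] by blast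
  obtain k q f where q: "homog k q" "peval q v \<noteq> 0" "\<And>i. i \<in> I ==> homog (k + - a i) (f i)"
    "\<And>u. nz u ==> peval q u \<noteq> 0 ==> u \<in> \<Union>U"
    "\<And>u i. nz u ==> peval q u \<noteq> 0 ==> i \<in> I ==> \<sigma> i u = peval (f i) u / peval q u"
    by (rule common_denominator[OF U finI twist_sum_comp[OF \<sigma>] v(2)]) (assumption, rule that)
  let ?V = "basic_open UNIV q" and ?F = "\<Sum>i\<in>I. p i * f i"
  have V: "openin P3 ?V" by (rule openin_basic[OF q(1)])
  have nzv: "nz v" by (rule cone_P3_nz[OF U v(2)])
  have c1: "x \<in> ?V" using nzv q(2) unfolding v(1) cone_P3[OF V, symmetric] cone_basic[OF q(1)] by blast
  have c2: "?V \<subseteq> U"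
  proof
    fix y assume "y \<in> ?V"
    then obtain u where u: "y = proj_pt u" "u \<in> \<Union>?V" using point_cone[OF V] by blast
    then show "y \<in> U" using q(4)[of u] unfolding cone_basic[OF q(1)] cone_P3[OF U] by blast
  qed
  have c3: "homog k ?F" by (intro homog_sum homog_mult'[OF p q(3)]) simp_all
  have c4: "peval q u \<noteq> 0 \<and> \<psi> U \<sigma> 0 u = peval ?F u / peval q u" if "u \<in> \<Union>?V" for u
  proof -
    have u: "nz u" "peval q u \<noteq> 0" using that unfolding cone_basic[OF q(1)] by blast+
    have "\<psi> U \<sigma> 0 u = (\<Sum>i\<in>I. peval (p i) u * (peval (f i) u / peval q u))"
      by (simp add: mat_map_apply[OF U \<sigma>] q(5)[OF u])
    then show ?thesis using u(2) by (simp add: sum_divide_distrib)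
  qed
  show "\<exists>V f g k. openin P3 V \<and> x \<in> V \<and> V \<subseteq> U \<and> f \<in> Q \<and> homog k f \<and> homog k g \<and>
      (\<forall>v\<in>\<Union>V. peval g v \<noteq> 0 \<and> \<psi> U \<sigma> 0 v = peval f v / peval g v)"
    by (rule exI[of _ ?V], rule exI[of _ ?F], rule exI[of _ q], rule exI[of _ k])
      (intro conjI ballI V c1 c2 Q_I c3 q(1) c4[THEN conjunct1] c4[THEN conjunct2])
qed

text \<open>Near a point all components have a common denominator of some degree \<open>k\<close>.
  Clearing it turns the claim into one about graded tuples of forms in degree \<open>k\<close>;
  \<open>sheaf_exact\<close> proceeds in the same way.\<close>

lemma sheaf_injective:
  assumes U: "openin P3 U" and \<tau>: "\<tau> \<in> twist_sum K (\<lambda>j. - b j) U" and 0: "\<phi> U \<tau> = 0"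
  shows "\<tau> = 0"
proof -
  have "\<tau> j v = 0" if j: "j \<in> K" and v: "v \<in> \<Union>U" for j v
  proof -
    obtain k q f where q: "homog k q" "peval q v \<noteq> 0" "\<And>j. j \<in> K ==> homog (k + - b j) (f j)"
      "\<And>u. nz u ==> peval q u \<noteq> 0 ==> u \<in> \<Union>U"
      "\<And>u i. nz u ==> peval q u \<noteq> 0 ==> i \<in> K ==> \<tau> i u = peval (f i) u / peval q u"
      by (rule common_denominator[OF U finK twist_sum_comp[OF \<tau>] v]) (assumption, rule that)
    have "f j = 0"
    proof (rule inj[of k])
      show "homog (k - b j) (f j)" if "j \<in> K" for j using q(3)[OF that] by simp
      fix i assume i: "i \<in> I"
      show "(\<Sum>j\<in>K. M i j * f j) = 0"
      proof (rule form_eq_on_open[of q])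
        show "q \<noteq> 0" using q(2) by auto
        fix u assume u: "nz u" "peval q u \<noteq> 0"
        have "0 = \<phi> U \<tau> i u" by (simp add: 0)
        also have "\<dots> = (\<Sum>j\<in>K. peval (M i j) u * (peval (f j) u / peval q u))"
          by (simp add: mat_map_apply[OF U \<tau>] i q(5)[OF u])
        also have "\<dots> = peval (\<Sum>j\<in>K. M i j * f j) u / peval q u" by (simp add: sum_divide_distrib)
        finally show "peval (\<Sum>j\<in>K. M i j * f j) u = peval 0 u" using u(2) by simp
      qed
    qed (rule j)
    then show ?thesis using q(2) q(5)[OF cone_P3_nz[OF U v] q(2) j] by simp
  qed
  then show ?thesis
    using twist_sum_outside[OF \<tau>] twist_sum_other[OF \<tau>] by (intro ext) (metis zero_fun_apply)
qed

lemma sheaf_complex: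
  assumes V: "openin P3 V" and \<tau>: "\<tau> \<in> twist_sum K (\<lambda>j. - b j) V"
  shows "(\<Sum>i\<in>I. peval (p i) v * \<phi> V \<tau> i v) = 0"
proof -
  have "(\<Sum>i\<in>I. peval (p i) v * \<phi> V \<tau> i v) = (\<Sum>i\<in>I. \<Sum>j\<in>K. peval (p i) v * peval (M i j) v * \<tau> j v)"
    by (simp add: mat_map_apply[OF V \<tau>] sum_distrib_left mult.assoc)
  also have "\<dots> = (\<Sum>j\<in>K. \<Sum>i\<in>I. peval (p i) v * peval (M i j) v * \<tau> j v)" by (rule sum.swap)
  also have "\<dots> = (\<Sum>j\<in>K. peval (\<Sum>i\<in>I. p i * M i j) v * \<tau> j v)" by (simp add: sum_distrib_right)
  also have "\<dots> = 0" by (rule sum.neutral) (simp add: cplx)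
  finally show ?thesis .
qed

lemma sheaf_exact:
  assumes U: "openin P3 U" and \<sigma>: "\<sigma> \<in> twist_sum I (\<lambda>i. - a i) U" and 0: "\<psi> U \<sigma> = 0" and x: "x \<in> U"
  shows "\<exists>V. openin P3 V \<and> x \<in> V \<and> V \<subseteq> U \<and> (\<exists>\<tau>\<in>twist_sum K (\<lambda>j. - b j) V. \<phi> V \<tau> = restr V \<sigma>)"
proof -
  obtain v where v: "x = proj_pt v" "v \<in> \<Union>U" using point_cone[OF U x] by blast
  obtain k q f where q: "homog k q" "peval q v \<noteq> 0" "\<And>i. i \<in> I ==> homog (k + - a i) (f i)"
    "\<And>u. nz u ==> peval q u \<noteq> 0 ==> u \<in> \<Union>U"
    "\<And>u i. nz u ==> peval q u \<noteq> 0 ==> i \<in> I ==> \<sigma> i u = peval (f i) u / peval q u"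
    by (rule common_denominator[OF U finI twist_sum_comp[OF \<sigma>] v(2)]) (assumption, rule that)
  have pf: "(\<Sum>i\<in>I. p i * f i) = 0"
  proof (rule form_eq_on_open[of q])
    show "q \<noteq> 0" using q(2) by auto
    fix u assume u: "nz u" "peval q u \<noteq> 0"
    have "0 = \<psi> U \<sigma> 0 u" by (simp add: 0)
    also have "\<dots> = (\<Sum>i\<in>I. peval (p i) u * (peval (f i) u / peval q u))"
      by (simp add: mat_map_apply[OF U \<sigma>] q(5)[OF u])
    also have "\<dots> = peval (\<Sum>i\<in>I. p i * f i) u / peval q u" by (simp add: sum_divide_distrib)
    finally show "peval (\<Sum>i\<in>I. p i * f i) u = peval 0 u" using u(2) by simp
  qed
  have fh: "homog (k - a i) (f i)" if "i \<in> I" for i using q(3)[OF that] by simp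
  obtain g where g: "\<And>j. j \<in> K ==> homog (k - b j) (g j)" "\<And>i. i \<in> I ==> f i = (\<Sum>j\<in>K. M i j * g j)"
    using exact[OF fh pf] by blast
  let ?V = "basic_open UNIV q"
  have V: "openin P3 ?V" by (rule openin_basic[OF q(1)])
  have nzv: "nz v" by (rule cone_P3_nz[OF U v(2)])
  have "x \<in> ?V" using nzv q(2) unfolding v(1) cone_P3[OF V, symmetric] cone_basic[OF q(1)] by blast
  moreover have "?V \<subseteq> U"
  proof
    fix y assume "y \<in> ?V"
    then obtain u where u: "y = proj_pt u" "u \<in> \<Union>?V" using point_cone[OF V] by blast
    then show "y \<in> U" using q(4)[of u] unfolding cone_basic[OF q(1)] cone_P3[OF U] by blast
  qed
  moreover define \<tau> where "\<tau> = (\<lambda>j u. if j \<in> K \<and> u \<in> \<Union>?V then peval (g j) u / peval q u else 0)"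
  have "\<tau> j \<in> twist (- b j) ?V" if j: "j \<in> K" for j
  proof (rule twistI[OF V])
    show "\<tau> j u = 0" if "u \<notin> \<Union>?V" for u using that by (simp add: \<tau>_def)
    show "\<exists>k q f. local_form (- b j) (\<Union>?V) (\<tau> j) u k q f" if u: "u \<in> \<Union>?V" for u
      using u q(1) g(1)[OF j] j
      by (intro exI[of _ k] exI[of _ q] exI[of _ "g j"]) (simp add: local_form_def \<tau>_def cone_basic[OF q(1)])
  qed
  then have \<tau>: "\<tau> \<in> twist_sum K (\<lambda>j. - b j) ?V" by (auto simp: twist_sum_def \<tau>_def)
  moreover have "\<phi> ?V \<tau> = restr ?V \<sigma>"
  proof (intro ext)
    fix i u
    show "\<phi> ?V \<tau> i u = restr ?V \<sigma> i u"
    proof (cases "i \<in> I \<and> u \<in> \<Union>?V")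
      case True
      then have u: "nz u" "peval q u \<noteq> 0" unfolding cone_basic[OF q(1)] by blast+
      have "\<phi> ?V \<tau> i u = (\<Sum>j\<in>K. peval (M i j) u * (peval (g j) u / peval q u))"
        unfolding mat_map_apply[OF V \<tau>] using True by (simp add: \<tau>_def)
      also have "\<dots> = peval (f i) u / peval q u" using True by (simp add: g(2) sum_divide_distrib)
      finally show ?thesis using True q(5)[OF u] by (simp add: restr_def)
    next
      case False
      then show ?thesis
        unfolding mat_map_apply[OF V \<tau>] using twist_sum_other[OF \<sigma>, of i] by (auto simp: \<tau>_def restr_def)
    qed
  qed
  ultimately show ?thesis using V by blast
qed

lemma sheaf_surjective:
  assumes U: "openin P3 U" and \<rho>: "\<rho> \<in> ideal_sheaf Q U" and x: "x \<in> U"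
  shows "\<exists>V. openin P3 V \<and> x \<in> V \<and> V \<subseteq> U \<and> (\<exists>\<sigma>\<in>twist_sum I (\<lambda>i. - a i) V. \<psi> V \<sigma> = restr V \<rho>)"
proof -
  have \<rho>t: "\<rho> \<in> twist_sum {0} (\<lambda>_. 0) U" using \<rho> unfolding ideal_sheaf_def by blast
  obtain V F g k where V: "openin P3 V" "x \<in> V" "V \<subseteq> U" "F \<in> Q" "homog k F" "homog k g"
    "\<forall>v\<in>\<Union>V. peval g v \<noteq> 0 \<and> \<rho> 0 v = peval F v / peval g v"
    using \<rho> x unfolding ideal_sheaf_def by blast
  obtain f where f: "\<forall>i\<in>I. homog (k - a i) (f i)" "F = (\<Sum>i\<in>I. p i * f i)"
    using Q_graded[OF V(4,5)] by blast
  define \<sigma> where "\<sigma> = (\<lambda>i u. if i \<in> I \<and> u \<in> \<Union>V then peval (f i) u / peval g u else 0)"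
  have "\<sigma> i \<in> twist (- a i) V" if i: "i \<in> I" for i
    unfolding twist_def mem_Collect_eq
  proof (intro conjI allI impI ballI)
    show "\<sigma> i v = 0" if "v \<notin> \<Union>V" for v using that by (simp add: \<sigma>_def)
    have "\<forall>v\<in>\<Union>V. peval g v \<noteq> 0 \<and> \<sigma> i v = peval (f i) v / peval g v" using V(7) i by (simp add: \<sigma>_def)
    then show "\<exists>W f g k. openin P3 W \<and> y \<in> W \<and> W \<subseteq> V \<and> homog (k + - a i) f \<and> homog k g \<and>
        (\<forall>v\<in>\<Union>W. peval g v \<noteq> 0 \<and> \<sigma> i v = peval f v / peval g v)" if "y \<in> V" for y
      using V(1,6) f(1) i that by (intro exI[of _ V] exI[of _ "f i"] exI[of _ g] exI[of _ k]) simp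
  qed
  then have \<sigma>: "\<sigma> \<in> twist_sum I (\<lambda>i. - a i) V" by (auto simp: twist_sum_def \<sigma>_def)
  moreover have "\<psi> V \<sigma> = restr V \<rho>"
  proof (intro ext)
    fix i u
    show "\<psi> V \<sigma> i u = restr V \<rho> i u"
    proof (cases "i = 0 \<and> u \<in> \<Union>V")
      case True
      then have "\<psi> V \<sigma> i u = (\<Sum>j\<in>I. peval (p j) u * (peval (f j) u / peval g u))"
        unfolding mat_map_apply[OF V(1) \<sigma>] by (simp add: \<sigma>_def)
      also have "\<dots> = peval F u / peval g u" by (simp add: f(2) sum_divide_distrib)
      also have "\<dots> = \<rho> 0 u" using V(7) True by force
      finally show ?thesis using True by (simp add: restr_def)
    next
      case False
      then show ?thesis
        unfolding mat_map_apply[OF V(1) \<sigma>] using twist_sum_other[OF \<rho>t, of i] by (auto simp: \<sigma>_def restr_def)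
    qed
  qed
  ultimately show ?thesis using V(1-3) by blast
qed

theorem short_exact_Q:
  "short_exact (twist_sum K (\<lambda>j. - b j)) (twist_sum I (\<lambda>i. - a i)) (ideal_sheaf Q) \<phi> \<psi>"
  unfolding short_exact_def
proof (intro conjI allI impI ballI)
  show "\<phi> \<in> sheaf_hom (twist_sum K (\<lambda>j. - b j)) (twist_sum I (\<lambda>i. - a i)) (topspace P3)"
    by (intro mat_map_sheaf_hom mat_map_in) (simp_all add: M)
  show "\<psi> \<in> sheaf_hom (twist_sum I (\<lambda>i. - a i)) (ideal_sheaf Q) (topspace P3)"
    by (intro mat_map_sheaf_hom \<psi>_in_ideal_sheaf)
  fix U assume U: "openin P3 U"
  show "\<tau> = 0" if "\<tau> \<in> twist_sum K (\<lambda>j. - b j) U" "\<phi> U \<tau> = 0" for \<tau>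
    by (rule sheaf_injective[OF U that])
  show "\<exists>V. openin P3 V \<and> x \<in> V \<and> V \<subseteq> U \<and> (\<exists>\<sigma>\<in>twist_sum I (\<lambda>i. - a i) V. \<psi> V \<sigma> = restr V \<rho>)"
    if "\<rho> \<in> ideal_sheaf Q U" "x \<in> U" for \<rho> x
    by (rule sheaf_surjective[OF U that])
  fix \<sigma> assume \<sigma>: "\<sigma> \<in> twist_sum I (\<lambda>i. - a i) U"
  show "\<psi> U \<sigma> = 0 \<longleftrightarrow> (\<forall>x\<in>U. \<exists>V. openin P3 V \<and> x \<in> V \<and> V \<subseteq> U \<and>
      (\<exists>\<tau>\<in>twist_sum K (\<lambda>j. - b j) V. \<phi> V \<tau> = restr V \<sigma>))"
  proof
    assume "\<psi> U \<sigma> = 0"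
    from sheaf_exact[OF U \<sigma> this]
    show "\<forall>x\<in>U. \<exists>V. openin P3 V \<and> x \<in> V \<and> V \<subseteq> U \<and>
      (\<exists>\<tau>\<in>twist_sum K (\<lambda>j. - b j) V. \<phi> V \<tau> = restr V \<sigma>)" by blast
  next
    assume loc: "\<forall>x\<in>U. \<exists>V. openin P3 V \<and> x \<in> V \<and> V \<subseteq> U \<and>
      (\<exists>\<tau>\<in>twist_sum K (\<lambda>j. - b j) V. \<phi> V \<tau> = restr V \<sigma>)"
    have "(\<Sum>i\<in>I. peval (p i) v * \<sigma> i v) = 0" for v
    proof (cases "v \<in> \<Union>U")
      case True
      then obtain V \<tau> where V: "openin P3 V" "proj_pt v \<in> V" "\<tau> \<in> twist_sum K (\<lambda>j. - b j) V"
        "\<phi> V \<tau> = restr V \<sigma>" using loc cone_P3[OF U, of v] by blast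
      have "\<phi> V \<tau> i v = \<sigma> i v" for i
        using V(2) unfolding V(4) restr_def cone_P3[OF V(1), symmetric] by simp
      then show ?thesis using sheaf_complex[OF V(1,3), of v] by simp
    next
      case False
      then show ?thesis using twist_sum_outside[OF \<sigma>] by simp
    qed
    then show "\<psi> U \<sigma> = 0" by (intro ext) (simp add: mat_map_apply[OF U \<sigma>])
  qed
qed

end

section \<open>A monomial determinantal curve\<close>

text \<open>The matrix \<open>M\<close> below is bidiagonal with powers of two variables as entries,
  up to sign; the monomials \<open>p k\<close> are its maximal minors, up to sign. The inequalities
  say that the entries have nonnegative degrees.\<close>

locale monomial_curve =
  fixes t :: nat and a b :: "nat => int"
  assumes t: "t > 0" and a0: "a 0 = (\<Sum>j=1..t. b j - a j)"
    and ab: "\<And>j. j \<in> {1..t} ==> a j \<le> b j" "\<And>j. j \<in> {1..t} ==> a (j - 1) \<le> b j"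
begin

definition ex where "ex j = nat (b j - a (j - 1))"
definition ey where "ey j = nat (b j - a j)"
definition p :: "nat => form" where "p k = xp 0 (\<Sum>j=1..k. ex j) * xp 1 (\<Sum>j=Suc k..t. ey j)"
definition M :: "nat => nat => form" where
  "M i j = (if j = Suc i then xp 0 (ex j) else 0) - (if j = i then xp 1 (ey j) else 0)"

lemma exy: "j \<in> {1..t} ==> int (ex j) = b j - a (j - 1)" "j \<in> {1..t} ==> int (ey j) = b j - a j"
  using ab[of j] by (auto simp: ex_def ey_def)

lemma sum_ey: "k < t ==> (\<Sum>j=Suc k..t. ey j) = ey (Suc k) + (\<Sum>j=Suc (Suc k)..t. ey j)"
  by (rule sum.atLeast_Suc_atMost) simp

lemma p_degree: "k \<le> t ==> int (\<Sum>j=1..k. ex j) + int (\<Sum>j=Suc k..t. ey j) = a k"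
proof (induction k)
  case 0
  have "int (\<Sum>j=1..t. ey j) = (\<Sum>j=1..t. b j - a j)"
    unfolding of_nat_sum by (rule sum.cong) (simp_all add: exy)
  then show ?case by (simp add: a0)
next
  case (Suc k)
  then show ?case using sum_ey[of k] exy[of "Suc k"] by simp
qed

lemma homog_p: "k \<le> t ==> homog (a k) (p k)"
  unfolding p_def using p_degree by (intro homog_mult'[OF homog_xp homog_xp]) simp

lemma p_neq_0: "p k \<noteq> 0"
  by (simp add: p_def)

lemma homog_M: "j \<in> {1..t} ==> homog (b j - a i) (M i j)"
  unfolding M_def using homog_xp[of "ex j" 0] homog_xp[of "ey j" 1] exy[of j]
  by (intro homog_diff) auto

lemma p_step: "k < t ==> p k * xp 0 (ex (Suc k)) = p (Suc k) * xp 1 (ey (Suc k))"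
  unfolding p_def by (simp add: sum_ey xp_add mult_ac)

lemma M_row:
  assumes "i \<le> t"
  shows "(\<Sum>j\<in>{1..t}. M i j * g j) =
    (if i < t then xp 0 (ex (Suc i)) * g (Suc i) else 0) - (if 0 < i then xp 1 (ey i) * g i else 0)"
proof -
  have "M i j * g j = (if j = Suc i then xp 0 (ex (Suc i)) * g (Suc i) else 0) - (if j = i then xp 1 (ey i) * g i else 0)" for j
    by (auto simp: M_def left_diff_distrib)
  then show ?thesis using assms by (auto simp: sum_subtractf)
qed

lemmas M_row' = M_row[unfolded One_nat_def]

lemma p_divisible: "Suc k \<le> i ==> \<exists>r. p i = xp 0 (\<Sum>j=1..k. ex j) * (xp 0 (ex (Suc k)) * r)"
proof -
  assume "Suc k \<le> i"
  then have "(\<Sum>j=1..i. ex j) = (\<Sum>j=1..k. ex j) + ex (Suc k) + (\<Sum>j=Suc (Suc k)..i. ex j)"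
    using sum.ub_add_nat[of 1 "Suc k" ex "i - Suc k"] by simp
  then show ?thesis
    by (intro exI[of _ "xp 0 (\<Sum>j=Suc (Suc k)..i. ex j) * xp 1 (\<Sum>j=Suc i..t. ey j)"]) (simp add: p_def xp_add mult_ac)
qed

text \<open>Elimination row by row. After \<open>k\<close> steps the relation involves only
  \<open>p k, ..., p t\<close>, and compared with \<open>p k\<close> all later ones carry the
  further factor \<open>xp 0 (ex (Suc k))\<close>. This factor is coprime to the power of variable
  \<open>1\<close> in \<open>p k\<close>, so it divides the coefficient of \<open>p k\<close> and
  yields the next entry of \<open>g\<close>. The last summand carries the contribution of column
  \<open>k\<close> to row \<open>k\<close>.\<close>

lemma exact_step:
  assumes 0: "(\<Sum>i=0..t. p i * f i) = 0" and k: "k \<le> t"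
  shows "\<exists>g. (\<forall>i<k. f i = (\<Sum>j\<in>{1..t}. M i j * g j)) \<and>
    (\<Sum>i=k..t. p i * f i) + (if 0 < k then p k * (xp 1 (ey k) * g k) else 0) = 0"
  using k
proof (induction k)
  case 0
  then show ?case using assms(1) by (intro exI[of _ "\<lambda>_. 0"]) simp
next
  case (Suc k)
  then have kt: "k < t" by simp
  obtain g where g: "\<And>i. i < k ==> f i = (\<Sum>j\<in>{1..t}. M i j * g j)"
    "(\<Sum>i=k..t. p i * f i) + (if 0 < k then p k * (xp 1 (ey k) * g k) else 0) = 0"
    using Suc by auto
  define u where "u = f k + (if 0 < k then xp 1 (ey k) * g k else 0)"
  have pu: "p k * u + (\<Sum>i=Suc k..t. p i * f i) = 0"
  proof -
    have "(\<Sum>i=k..t. p i * f i) = p k * f k + (\<Sum>i=Suc k..t. p i * f i)"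
      using kt by (intro sum.atLeast_Suc_atMost) simp
    then show ?thesis using g(2) unfolding u_def by (simp add: distrib_left add_ac split: if_splits)
  qed
  let ?A = "\<Sum>j=1..k. ex j"
  obtain r where r: "\<And>i. Suc k \<le> i ==> p i = xp 0 ?A * (xp 0 (ex (Suc k)) * r i)"
    using p_divisible by metis
  have "(\<Sum>i=Suc k..t. p i * f i) = xp 0 ?A * (xp 0 (ex (Suc k)) * (\<Sum>i=Suc k..t. r i * f i))"
    by (simp add: r sum_distrib_left mult_ac)
  then have "xp 0 ?A * (xp 1 (\<Sum>j=Suc k..t. ey j) * u + xp 0 (ex (Suc k)) * (\<Sum>i=Suc k..t. r i * f i)) = 0"
    using pu by (simp add: p_def distrib_left mult.assoc)
  then have "xp 1 (\<Sum>j=Suc k..t. ey j) * u + xp 0 (ex (Suc k)) * (\<Sum>i=Suc k..t. r i * f i) = 0" by simp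
  then have "xp 1 (\<Sum>j=Suc k..t. ey j) * u = xp 0 (ex (Suc k)) * (- (\<Sum>i=Suc k..t. r i * f i))"
    by (simp add: add_eq_0_iff2)
  then obtain w where w: "u = xp 0 (ex (Suc k)) * w" by (rule xp_dvd_cancel) simp
  let ?g = "g(Suc k := w)"
  have "f i = (\<Sum>j\<in>{1..t}. M i j * ?g j)" if "i < Suc k" for i
  proof (cases "i < k")
    case True
    then show ?thesis using g(1)[of i] kt by (simp add: M_row')
  next
    case False
    then have "i = k" using that by simp
    then show ?thesis using w kt unfolding u_def by (simp add: M_row' algebra_simps split: if_splits)
  qed
  moreover have "p (Suc k) * (xp 1 (ey (Suc k)) * w) = p k * u"
    unfolding w mult.assoc[symmetric] p_step[OF kt] ..
  then have "(\<Sum>i=Suc k..t. p i * f i) + p (Suc k) * (xp 1 (ey (Suc k)) * ?g (Suc k)) = 0"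
    using pu by (simp add: add.commute)
  ultimately show ?case by (intro exI[of _ ?g]) simp
qed

sublocale graded_resolution "{0..t}" a p "{1..t}" b M
proof unfold_locales
  show "homog (a i) (p i)" if "i \<in> {0..t}" for i using that by (intro homog_p) simp
  show "homog (b j - a i) (M i j)" if "j \<in> {1..t}" for i j by (rule homog_M[OF that])
  show "(\<Sum>i\<in>{0..t}. p i * M i j) = 0" if j: "j \<in> {1..t}" for j
  proof -
    obtain k where k: "j = Suc k" using j by (cases j) auto
    have "(\<Sum>i\<in>{0..t}. p i * M i j) =
        (\<Sum>i\<in>{0..t}. (if i = k then p k * xp 0 (ex j) else 0) - (if i = j then p j * xp 1 (ey j) else 0))"
      by (rule sum.cong) (auto simp: M_def k right_diff_distrib)
    also have "\<dots> = p k * xp 0 (ex j) - p j * xp 1 (ey j)" using j k by (simp add: sum_subtractf)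
    finally show ?thesis using p_step[of k] j k by simp
  qed
  fix n
  show "g j = 0" if row: "\<And>i. i \<in> {0..t} ==> (\<Sum>j\<in>{1..t}. M i j * g j) = 0" and j: "j \<in> {1..t}" for g j
  proof -
    have "k < t ==> g (Suc k) = 0" for k
    proof (induction k)
      case 0
      then show ?case using row[of 0] t by (simp add: M_row')
    next
      case (Suc k)
      then show ?case using row[of "Suc k"] by (simp add: M_row')
    qed
    moreover obtain k where "j = Suc k" "k < t" using j by (cases j) auto
    ultimately show ?thesis by simp
  qed
  fix f assume f: "\<And>i. i \<in> {0..t} ==> homog (n - a i) (f i)" and pf: "(\<Sum>i\<in>{0..t}. p i * f i) = 0"
  obtain g where g: "\<And>i. i < t ==> f i = (\<Sum>j\<in>{1..t}. M i j * g j)" "p t * f t + p t * (xp 1 (ey t) * g t) = 0"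
    using exact_step[OF pf order_refl] t by auto
  have "p t * (f t + xp 1 (ey t) * g t) = 0" using g(2) by (simp add: distrib_left)
  then have "f t + xp 1 (ey t) * g t = 0" using p_neq_0 by simp
  then have "f t = (\<Sum>j\<in>{1..t}. M t j * g j)" using t by (simp add: M_row' add_eq_0_iff2)
  then have fg: "f i = (\<Sum>j\<in>{1..t}. M i j * g j)" if "i \<in> {0..t}" for i
    using g(1)[of i] that by (cases "i = t") auto
  show "\<exists>g. (\<forall>j\<in>{1..t}. homog (n - b j) (g j)) \<and> (\<forall>i\<in>{0..t}. f i = (\<Sum>j\<in>{1..t}. M i j * g j))"
  proof (intro exI[of _ "\<lambda>j. hcomp (n - b j) (g j)"] conjI ballI homog_hcomp)
    fix i assume i: "i \<in> {0..t}"
    have "f i = hcomp (n - a i) (f i)" using f[OF i] by (simp add: hcomp_homog)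
    also have "\<dots> = (\<Sum>j\<in>{1..t}. hcomp (n - a i) (M i j * g j))" unfolding fg[OF i] hcomp_sum ..
    also have "\<dots> = (\<Sum>j\<in>{1..t}. M i j * hcomp (n - b j) (g j))"
      by (rule sum.cong) (simp_all add: hcomp_homog_mult[OF homog_M])
    finally show "f i = (\<Sum>j\<in>{1..t}. M i j * hcomp (n - b j) (g j))" .
  qed
qed simp_all

end

section \<open>From an exact sequence of sheaves to a resolution of forms\<close>

lemma cone_Int: "openin P3 U ==> openin P3 V ==> v \<in> \<Union>(U \<inter> V) \<longleftrightarrow> v \<in> \<Union>U \<and> v \<in> \<Union>V"
  using cone_P3[of U v] cone_P3[of V v] cone_P3[of "U \<inter> V" v] by blast

lemma cone_subset: "U \<subseteq> V ==> v \<in> \<Union>U ==> v \<in> \<Union>V"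
  by blast

lemma nz_chart: "nz v ==> \<exists>k. v \<in> \<Union>(chart k)"
  by (auto simp: nz_def cone_chart)

lemma twist_shift:
  assumes "openin P3 V" "V \<subseteq> chart k" "s \<in> twist m V"
  shows "(\<lambda>v. if v \<in> \<Union>V then v k powi n * s v else 0) \<in> twist (n + m) V"
proof -
  have "(\<lambda>v. if v \<in> \<Union>V then v k powi n * s v else 0) = (\<lambda>v. (if v \<in> \<Union>V then v k powi n else 0) * s v)"
    by auto
  then show ?thesis using twist_mult[OF assms(1) twist_powi[OF assms(1,2)] assms(3), of n] by simp
qed

lemma twist_shift_form:
  assumes "openin P3 V" "V \<subseteq> chart k" "homog m f"
  shows "(\<lambda>v. if v \<in> \<Union>V then v k powi n * peval f v else 0) \<in> twist (n + m) V"
proof -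
  have "(\<lambda>v. if v \<in> \<Union>V then v k powi n * peval f v else 0) =
      (\<lambda>v. if v \<in> \<Union>V then v k powi n * (if v \<in> \<Union>V then peval f v else 0) else 0)" by auto
  then show ?thesis using twist_shift[OF assms(1,2) twist_form[OF assms(1,3)], of n] by simp
qed

lemma twist_diff:
  assumes "openin P3 U" "s \<in> twist n U" "r \<in> twist n U"
  shows "(\<lambda>v. s v - r v) \<in> twist n U"
proof -
  have "(\<lambda>v. (if v \<in> \<Union>U then peval (mon 0 (-1)) v else 0) * r v) \<in> twist (0 + n) U"
    by (rule twist_mult[OF assms(1) twist_form[OF assms(1)] assms(3)]) (simp add: homog_mon)
  moreover have "(if v \<in> \<Union>U then peval (mon 0 (-1)) v else 0) * r v = - r v" for v
    using twist_zero_outside[OF assms(3), of v] by simp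
  ultimately have "(\<lambda>v. - r v) \<in> twist n U" by simp
  from twist_add[OF assms(1,2) this] show ?thesis by simp
qed

lemma homogeneous_ideal_is_ideal: "homogeneous_ideal C ==> is_ideal C"
  unfolding homogeneous_ideal_def is_ideal_def by blast

text \<open>The way back from sheaves to forms: the morphisms are already matrices, and
  \<open>C\<close> may differ from its saturation.\<close>

locale sheaf_resolution = graded_generators +
  fixes K :: "nat set" and b :: "nat => int" and M :: "nat => nat => form" and C :: "form set"
  assumes finK: "finite K"
    and M: "\<And>i j. i \<in> I ==> j \<in> K ==> homog (b j - a i) (M i j)"
    and C: "homogeneous_ideal C" and a: "\<And>i. i \<in> I ==> a i \<ge> 0"
    and se: "short_exact (twist_sum K (\<lambda>j. - b j)) (twist_sum I (\<lambda>i. - a i)) (ideal_sheaf C)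
      (mat_map K (\<lambda>j. - b j) I M) (mat_map I (\<lambda>i. - a i) {0} (\<lambda>_. p))"
begin

abbreviation "\<Phi> \<equiv> mat_map K (\<lambda>j. - b j) I M"
abbreviation "\<Psi> \<equiv> mat_map I (\<lambda>i. - a i) {0} (\<lambda>_. p)"

lemma se_parts:
  assumes U: "openin P3 U"
  shows "\<forall>\<sigma>\<in>twist_sum K (\<lambda>j. - b j) U. \<Phi> U \<sigma> = 0 --> \<sigma> = 0"
    and "\<forall>\<sigma>\<in>twist_sum I (\<lambda>i. - a i) U. \<Psi> U \<sigma> = 0 \<longleftrightarrow>
      (\<forall>x\<in>U. \<exists>V. openin P3 V \<and> x \<in> V \<and> V \<subseteq> U \<and>
        (\<exists>\<tau>\<in>twist_sum K (\<lambda>j. - b j) V. \<Phi> V \<tau> = restr V \<sigma>))"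
    and "\<forall>\<rho>\<in>ideal_sheaf C U. \<forall>x\<in>U. \<exists>V. openin P3 V \<and> x \<in> V \<and> V \<subseteq> U \<and>
      (\<exists>\<sigma>\<in>twist_sum I (\<lambda>i. - a i) V. \<Psi> V \<sigma> = restr V \<rho>)"
proof -
  note X = se[unfolded short_exact_def, THEN conjunct2, THEN conjunct2, THEN spec[of _ U], THEN mp, OF U]
  show "\<forall>\<sigma>\<in>twist_sum K (\<lambda>j. - b j) U. \<Phi> U \<sigma> = 0 --> \<sigma> = 0" by (rule X[THEN conjunct1])
  show "\<forall>\<sigma>\<in>twist_sum I (\<lambda>i. - a i) U. \<Psi> U \<sigma> = 0 \<longleftrightarrow>
      (\<forall>x\<in>U. \<exists>V. openin P3 V \<and> x \<in> V \<and> V \<subseteq> U \<and>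
        (\<exists>\<tau>\<in>twist_sum K (\<lambda>j. - b j) V. \<Phi> V \<tau> = restr V \<sigma>))"
    by (rule X[THEN conjunct2, THEN conjunct1])
  show "\<forall>\<rho>\<in>ideal_sheaf C U. \<forall>x\<in>U. \<exists>V. openin P3 V \<and> x \<in> V \<and> V \<subseteq> U \<and>
      (\<exists>\<sigma>\<in>twist_sum I (\<lambda>i. - a i) V. \<Psi> V \<sigma> = restr V \<rho>)"
    by (rule X[THEN conjunct2, THEN conjunct2])
qed

lemma section_injective:
  assumes V: "openin P3 V" and \<tau>: "\<And>j. j \<in> K ==> \<tau> j \<in> twist (- b j) V"
    and 0: "\<And>i v. i \<in> I ==> (\<Sum>j\<in>K. peval (M i j) v * \<tau> j v) = 0" and j: "j \<in> K"
  shows "\<tau> j v = 0"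
proof -
  let ?\<tau> = "\<lambda>j. if j \<in> K then \<tau> j else 0"
  have in_B: "?\<tau> \<in> twist_sum K (\<lambda>j. - b j) V" using \<tau> by (simp add: twist_sum_def)
  have "\<Phi> V ?\<tau> = 0" by (intro ext) (simp add: mat_map_apply[OF V in_B] 0)
  then have "?\<tau> = 0" by (rule se_parts(1)[OF V, THEN bspec, OF in_B, THEN mp])
  from fun_cong[OF fun_cong[OF this, of j], of v] show ?thesis using j by simp
qed

lemma section_exact:
  assumes U: "openin P3 U" and \<sigma>: "\<And>i. i \<in> I ==> \<sigma> i \<in> twist (- a i) U"
    and 0: "\<And>v. (\<Sum>i\<in>I. peval (p i) v * \<sigma> i v) = 0" and x: "x \<in> U"
  shows "\<exists>V \<tau>. openin P3 V \<and> x \<in> V \<and> V \<subseteq> U \<and> (\<forall>j\<in>K. \<tau> j \<in> twist (- b j) V) \<and>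
    (\<forall>i\<in>I. \<forall>v\<in>\<Union>V. (\<Sum>j\<in>K. peval (M i j) v * \<tau> j v) = \<sigma> i v)"
proof -
  let ?\<sigma> = "\<lambda>i. if i \<in> I then \<sigma> i else 0"
  have in_A: "?\<sigma> \<in> twist_sum I (\<lambda>i. - a i) U" using \<sigma> by (simp add: twist_sum_def)
  have "\<Psi> U ?\<sigma> = 0" by (intro ext) (simp add: mat_map_apply[OF U in_A] 0)
  then have "\<exists>V. openin P3 V \<and> x \<in> V \<and> V \<subseteq> U \<and> (\<exists>\<tau>\<in>twist_sum K (\<lambda>j. - b j) V. \<Phi> V \<tau> = restr V ?\<sigma>)"
    using se_parts(2)[OF U, THEN bspec, OF in_A] x by blast
  then obtain V \<tau> where V: "openin P3 V" "x \<in> V" "V \<subseteq> U" and \<tau>: "\<tau> \<in> twist_sum K (\<lambda>j. - b j) V"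
    and e: "\<Phi> V \<tau> = restr V ?\<sigma>" by blast
  have "(\<Sum>j\<in>K. peval (M i j) v * \<tau> j v) = \<sigma> i v" if "i \<in> I" "v \<in> \<Union>V" for i v
    using fun_cong[OF fun_cong[OF e, of i], of v] that by (simp add: mat_map_apply[OF V(1) \<tau>] restr_def)
  then have e': "\<forall>i\<in>I. \<forall>v\<in>\<Union>V. (\<Sum>j\<in>K. peval (M i j) v * \<tau> j v) = \<sigma> i v" by blast
  have t: "\<forall>j\<in>K. \<tau> j \<in> twist (- b j) V" using twist_sum_comp[OF \<tau>] by blast
  show ?thesis by (rule exI[of _ V], rule exI[of _ \<tau>]) (intro conjI V t e')
qed

text \<open>The composite is applied to a local generator on one chart, where it vanishes by
  exactness; this determines the forms.\<close>

lemma forms_complex: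
  assumes j: "j \<in> K"
  shows "(\<Sum>i\<in>I. p i * M i j) = 0"
proof (rule form_eq_on_open[of "xp 0 1"])
  fix u :: "4 => complex" assume u: "peval (xp 0 1) u \<noteq> 0"
  let ?U = "chart 0" and ?\<tau> = "unit_tuple (\<lambda>j. - b j) j 0 (chart 0)"
  have \<tau>: "?\<tau> \<in> twist_sum K (\<lambda>j. - b j) ?U" by (rule unit_tuple_in) (use j in simp_all)
  let ?\<sigma> = "\<Phi> ?U ?\<tau>"
  have \<sigma>: "?\<sigma> \<in> twist_sum I (\<lambda>i. - a i) ?U" by (rule mat_map_in) (use \<tau> M in simp_all)
  have "restr ?U ?\<sigma> = ?\<sigma>"
    using twist_sum_outside[OF \<sigma>] by (intro ext) (auto simp: restr_def)
  then have "\<forall>x\<in>?U. \<exists>V. openin P3 V \<and> x \<in> V \<and> V \<subseteq> ?U \<and> (\<exists>\<tau>\<in>twist_sum K (\<lambda>j. - b j) V. \<Phi> V \<tau> = restr V ?\<sigma>)"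
    using \<tau> by (intro ballI exI[of _ ?U]) auto
  then have "\<Psi> ?U ?\<sigma> = 0" by (rule se_parts(2)[OF openin_chart, THEN bspec, OF \<sigma>, THEN iffD2])
  then have "0 = \<Psi> ?U ?\<sigma> 0 u" by simp
  also have "\<dots> = (\<Sum>i\<in>I. peval (p i) u * (peval (M i j) u * u 0 powi (- b j)))"
    unfolding mat_map_apply[OF openin_chart \<sigma>] using mat_map_unit[OF finK j, where v = u and J' = I and n = "\<lambda>j. - b j" and M = M] u
    by (simp cong: sum.cong)
  also have "\<dots> = peval (\<Sum>i\<in>I. p i * M i j) u * u 0 powi (- b j)"
    by (simp add: sum_distrib_right mult.assoc)
  finally show "peval (\<Sum>i\<in>I. p i * M i j) u = peval 0 u" using u by simp
qed simp

text \<open>Multiplying by the power \<open>- n\<close> of the chart coordinate turns forms of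
  degree \<open>n - b j\<close> into local sections of \<open>O(- b j)\<close>, to which injectivity
  of the sheaf map applies.\<close>

lemma forms_injective:
  assumes g: "\<And>j. j \<in> K ==> homog (n - b j) (g j)" and 0: "\<And>i. i \<in> I ==> (\<Sum>j\<in>K. M i j * g j) = 0" and j: "j \<in> K"
  shows "g j = 0"
proof (rule form_eq_on_open[of "xp 0 1"])
  fix u :: "4 => complex" assume u: "peval (xp 0 1) u \<noteq> 0"
  let ?\<tau> = "\<lambda>j v. if v \<in> \<Union>(chart 0) then v 0 powi (- n) * peval (g j) v else 0"
  have "?\<tau> j u = 0"
  proof (rule section_injective[of "chart 0" ?\<tau>])
    show "?\<tau> j \<in> twist (- b j) (chart 0)" if "j \<in> K" for j
      using twist_shift_form[OF _ _ g[OF that], of "chart 0" 0 "- n"] by simp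
    fix i v assume i: "i \<in> I"
    have "(\<Sum>j\<in>K. peval (M i j) v * ?\<tau> j v) =
        (if v \<in> \<Union>(chart 0) then v 0 powi (- n) * peval (\<Sum>j\<in>K. M i j * g j) v else 0)"
      by (simp add: sum_distrib_left mult.left_commute)
    then show "(\<Sum>j\<in>K. peval (M i j) v * ?\<tau> j v) = 0" by (simp add: 0[OF i] del: peval_sum)
  qed (simp_all add: j)
  then show "peval (g j) u = peval 0 u" using u by (simp add: cone_chart)
qed simp

lemma lift_unique:
  assumes V: "openin P3 V" and r: "\<And>j. j \<in> K ==> r j \<in> twist (n - b j) V" "\<And>j. j \<in> K ==> r' j \<in> twist (n - b j) V"
    and e: "\<And>i v. i \<in> I ==> v \<in> \<Union>V ==> (\<Sum>j\<in>K. peval (M i j) v * r j v) = (\<Sum>j\<in>K. peval (M i j) v * r' j v)"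
    and u: "u \<in> \<Union>V" and j: "j \<in> K"
  shows "r j u = r' j u"
proof -
  obtain k where k: "u \<in> \<Union>(chart k)" using nz_chart[OF cone_P3_nz[OF V u]] by blast
  let ?W = "V \<inter> chart k"
  have W: "openin P3 ?W" "?W \<subseteq> V" "?W \<subseteq> chart k" using V by auto
  let ?d = "\<lambda>j v. if v \<in> \<Union>?W then r j v - r' j v else 0"
  let ?\<tau> = "\<lambda>j v. if v \<in> \<Union>?W then v k powi (- n) * ?d j v else 0"
  have "?\<tau> j u = 0"
  proof (rule section_injective[where V = ?W and \<tau> = ?\<tau>, OF W(1)])
    show "?\<tau> j \<in> twist (- b j) ?W" if "j \<in> K" for j
    proof -
      have "?d j \<in> twist (n - b j) ?W"
        by (rule twist_restrict[OF V W(1,2) twist_diff[OF V r(1)[OF that] r(2)[OF that]]])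
      from twist_shift[OF W(1,3) this, of "- n"] show ?thesis by simp
    qed
    fix i v assume i: "i \<in> I"
    show "(\<Sum>j\<in>K. peval (M i j) v * ?\<tau> j v) = 0"
    proof (cases "v \<in> \<Union>?W")
      case True
      have "(\<Sum>j\<in>K. peval (M i j) v * ?\<tau> j v) =
          v k powi (- n) * ((\<Sum>j\<in>K. peval (M i j) v * r j v) - (\<Sum>j\<in>K. peval (M i j) v * r' j v))"
        using True by (simp add: sum_distrib_left sum_subtractf right_diff_distrib mult.left_commute)
      also have "\<dots> = 0" using e[OF i cone_subset[OF W(2) True]] by simp
      finally show ?thesis .
    qed simp
  qed (rule j)
  moreover have "u \<in> \<Union>?W" using k u cone_Int[OF V] by simp
  moreover have "u k \<noteq> 0" using k by (simp add: cone_chart)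
  ultimately show ?thesis by simp
qed

text \<open>Left exactness of global sections. Local lifts exist by exactness, agree on overlaps by
  \<open>lift_unique\<close>, and glue to global sections of twists, which are forms.\<close>

lemma forms_exact:
  assumes f: "\<And>i. i \<in> I ==> homog (n - a i) (f i)" and pf: "(\<Sum>i\<in>I. p i * f i) = 0"
  shows "\<exists>g. (\<forall>j\<in>K. homog (n - b j) (g j)) \<and> (\<forall>i\<in>I. f i = (\<Sum>j\<in>K. M i j * g j))"
proof -
  define L where "L V r v \<longleftrightarrow> openin P3 V \<and> v \<in> \<Union>V \<and> (\<forall>j\<in>K. r j \<in> twist (n - b j) V) \<and>
    (\<forall>i\<in>I. \<forall>u\<in>\<Union>V. (\<Sum>j\<in>K. peval (M i j) u * r j u) = peval (f i) u)"
    for V and r :: "nat => (4 => complex) => complex" and v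
  have "\<exists>V r. L V r v" if v: "nz v" for v
  proof -
    obtain k where k: "v \<in> \<Union>(chart k)" using nz_chart[OF v] by blast
    let ?\<sigma> = "\<lambda>i v. if v \<in> \<Union>(chart k) then v k powi (- n) * peval (f i) v else 0"
    have "\<exists>V \<tau>. openin P3 V \<and> proj_pt v \<in> V \<and> V \<subseteq> chart k \<and> (\<forall>j\<in>K. \<tau> j \<in> twist (- b j) V) \<and>
      (\<forall>i\<in>I. \<forall>v\<in>\<Union>V. (\<Sum>j\<in>K. peval (M i j) v * \<tau> j v) = ?\<sigma> i v)"
    proof (rule section_exact[where \<sigma> = ?\<sigma>])
      show "?\<sigma> i \<in> twist (- a i) (chart k)" if "i \<in> I" for i
        using twist_shift_form[OF _ _ f[OF that], of "chart k" k "- n"] by simp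
      fix u
      have "(\<Sum>i\<in>I. peval (p i) u * ?\<sigma> i u) =
          (if u \<in> \<Union>(chart k) then u k powi (- n) * peval (\<Sum>i\<in>I. p i * f i) u else 0)"
        by (simp add: sum_distrib_left mult.left_commute)
      then show "(\<Sum>i\<in>I. peval (p i) u * ?\<sigma> i u) = 0" by (simp add: pf del: peval_sum)
    qed (use k cone_P3[OF openin_chart] in simp_all)
    then obtain V \<tau> where V: "openin P3 V" "proj_pt v \<in> V" "V \<subseteq> chart k" "\<And>j. j \<in> K ==> \<tau> j \<in> twist (- b j) V"
      "\<And>i v. i \<in> I ==> v \<in> \<Union>V ==> (\<Sum>j\<in>K. peval (M i j) v * \<tau> j v) = ?\<sigma> i v" by blast
    let ?r = "\<lambda>j v. if v \<in> \<Union>V then v k powi n * \<tau> j v else 0"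
    have "?r j \<in> twist (n - b j) V" if "j \<in> K" for j
      using twist_shift[OF V(1,3) V(4)[OF that], of n] by simp
    moreover have "(\<Sum>j\<in>K. peval (M i j) u * ?r j u) = peval (f i) u" if "i \<in> I" "u \<in> \<Union>V" for i u
    proof -
      have uk: "u \<in> \<Union>(chart k)" by (rule cone_subset[OF V(3) that(2)])
      then have "u k \<noteq> 0" by (simp add: cone_chart)
      have "(\<Sum>j\<in>K. peval (M i j) u * ?r j u) = u k powi n * (\<Sum>j\<in>K. peval (M i j) u * \<tau> j u)"
        using that(2) by (simp add: sum_distrib_left mult.left_commute)
      also have "\<dots> = peval (f i) u"
        unfolding V(5)[OF that] using uk \<open>u k \<noteq> 0\<close> by (simp add: power_int_minus)
      finally show ?thesis .
    qed
    ultimately have "L V ?r v" unfolding L_def using V(1,2) cone_P3[OF V(1)] by blast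
    then show ?thesis by blast
  qed
  then obtain W R where WR: "\<And>v. nz v ==> L (W v) (R v) v" by metis
  define s where "s j v = (if nz v then R v j v else 0)" for j v
  have sR: "s j u = R v j u" if v: "nz v" and u: "u \<in> \<Union>(W v)" and j: "j \<in> K" for v u j
  proof -
    have Wv: "openin P3 (W v)" using WR[OF v] unfolding L_def by blast
    have nu: "nz u" by (rule cone_P3_nz[OF Wv u])
    have Wu: "openin P3 (W u)" "u \<in> \<Union>(W u)" using WR[OF nu] unfolding L_def by blast+
    let ?V = "W u \<inter> W v"
    have V: "openin P3 ?V" using Wu(1) Wv by blast
    have uV: "u \<in> \<Union>?V" using cone_Int[OF Wu(1) Wv] Wu(2) u by blast
    have cu: "x \<in> \<Union>(W u)" and cv: "x \<in> \<Union>(W v)" if "x \<in> \<Union>?V" for x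
      using that cone_Int[OF Wu(1) Wv] by blast+
    let ?r = "\<lambda>w j x. if x \<in> \<Union>?V then R w j x else 0"
    have "?r u j u = ?r v j u"
    proof (rule lift_unique[where V = ?V and r = "?r u" and r' = "?r v" and n = n, OF V _ _ _ uV j])
      show "?r u j \<in> twist (n - b j) ?V" if "j \<in> K" for j
        using WR[OF nu] that unfolding L_def by (intro twist_restrict[OF Wu(1) V]) auto
      show "?r v j \<in> twist (n - b j) ?V" if "j \<in> K" for j
        using WR[OF v] that unfolding L_def by (intro twist_restrict[OF Wv V]) auto
      fix i x assume i: "i \<in> I" and x: "x \<in> \<Union>?V"
      have "(\<Sum>j\<in>K. peval (M i j) x * R u j x) = peval (f i) x"
        using WR[OF nu] i cu[OF x] unfolding L_def by blast
      moreover have "(\<Sum>j\<in>K. peval (M i j) x * R v j x) = peval (f i) x"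
        using WR[OF v] i cv[OF x] unfolding L_def by blast
      ultimately show "(\<Sum>j\<in>K. peval (M i j) x * ?r u j x) = (\<Sum>j\<in>K. peval (M i j) x * ?r v j x)"
        using x by simp
    qed
    then show ?thesis using uV nu by (simp add: s_def)
  qed
  have "s j \<in> twist (n - b j) whole" if j: "j \<in> K" for j
  proof (rule twist_glue[OF openin_whole])
    show "s j v = 0" if "v \<notin> \<Union>whole" for v using that by (simp add: s_def cone_whole)
    fix v assume "v \<in> \<Union>whole"
    then have v: "nz v" by (simp add: cone_whole)
    have "openin P3 (W v)" "v \<in> \<Union>(W v)" "R v j \<in> twist (n - b j) (W v)" using WR[OF v] j unfolding L_def by blast+
    moreover from this(1) have "W v \<subseteq> whole" by (rule openin_zariski_subset)
    ultimately show "\<exists>V r. openin P3 V \<and> v \<in> \<Union>V \<and> V \<subseteq> whole \<and> r \<in> twist (n - b j) V \<and> (\<forall>u\<in>\<Union>V. s j u = r u)"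
      using sR[OF v _ j] by blast
  qed
  then have "\<forall>j\<in>K. \<exists>g. homog (n - b j) g \<and> (\<forall>v. nz v --> s j v = peval g v)"
    using global_sections by blast
  then obtain g where g: "\<And>j. j \<in> K ==> homog (n - b j) (g j)" "\<And>j v. j \<in> K ==> nz v ==> s j v = peval (g j) v"
    by metis
  have "f i = (\<Sum>j\<in>K. M i j * g j)" if i: "i \<in> I" for i
  proof (rule peval_eq_nz)
    fix v :: "4 => complex" assume v: "nz v"
    have "v \<in> \<Union>(W v)" using WR[OF v] unfolding L_def by blast
    then have "(\<Sum>j\<in>K. peval (M i j) v * R v j v) = peval (f i) v" using WR[OF v] i unfolding L_def by blast
    moreover have "R v j v = peval (g j) v" if "j \<in> K" for j using g(2)[OF that v] v by (simp add: s_def)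
    ultimately show "peval (f i) v = peval (\<Sum>j\<in>K. M i j * g j) v" by simp
  qed
  then show ?thesis using g(1) by blast
qed

sublocale graded_resolution I a p K b M
  by unfold_locales (fact finK, rule M, assumption+, rule forms_complex, assumption,
    rule forms_injective, assumption+, rule forms_exact, assumption+)

text \<open>Locally \<open>p i\<close> gives a section of the ideal sheaf, so for every point some
  form that is nonzero there multiplies \<open>p i\<close> into \<open>C\<close>. The projective
  Nullstellensatz for the ideal of all such multipliers yields a power of each variable.\<close>

lemma generator_in_ideal:
  assumes i: "i \<in> I"
  shows "\<exists>N. xp k N * p i \<in> C"
proof -
  note ideal = homogeneous_ideal_is_ideal[OF C]
  have "\<exists>N. xp k N \<in> {q. q * p i \<in> C}"
  proof (rule projective_nullstellensatz)
    show "is_ideal {q. q * p i \<in> C}"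
      using is_idealD[OF ideal] by (auto simp: is_ideal_def distrib_right mult.assoc)
    fix v :: "4 => complex" assume v: "nz v"
    obtain k where k: "v \<in> \<Union>(chart k)" using nz_chart[OF v] by blast
    let ?\<sigma> = "unit_tuple (\<lambda>i. - a i) i k (chart k)"
    have \<sigma>: "?\<sigma> \<in> twist_sum I (\<lambda>i. - a i) (chart k)" by (rule unit_tuple_in) (use i in simp_all)
    have \<Psi>: "\<Psi> \<in> sheaf_hom (twist_sum I (\<lambda>i. - a i)) (ideal_sheaf C) (topspace P3)"
      using se unfolding short_exact_def by blast
    have "\<Psi> (chart k) ?\<sigma> \<in> ideal_sheaf C (chart k)" by (rule sheaf_homD(1)[OF \<Psi> openin_chart \<sigma>])
    moreover have "proj_pt v \<in> chart k" using k cone_P3[OF openin_chart] by blast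
    ultimately obtain V f g e where V: "openin P3 V" "proj_pt v \<in> V" "V \<subseteq> chart k" "f \<in> C" "homog e f" "homog e g"
      "\<forall>v\<in>\<Union>V. peval g v \<noteq> 0 \<and> \<Psi> (chart k) ?\<sigma> 0 v = peval f v / peval g v"
      unfolding ideal_sheaf_def by blast
    have vV: "v \<in> \<Union>V" using V(2) cone_P3[OF V(1)] by blast
    obtain m h where h: "homog m h" "peval h v \<noteq> 0" "\<And>u. nz u ==> peval h u \<noteq> 0 ==> u \<in> \<Union>V"
      using open_coneD[OF V(1) vV] by blast
    \<comment> \<open>The local generator has the value \<open>u k powi (- a i)\<close>; as
      \<open>a i\<close> is nonnegative, clearing it leaves a power of variable \<open>k\<close> on
      the other side.\<close>
    have "g * p i = xp k (nat (a i)) * f"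
    proof (rule form_eq_on_open[of h])
      show "h \<noteq> 0" using h(2) by auto
      fix u :: "4 => complex" assume "nz u" "peval h u \<noteq> 0"
      then have u: "u \<in> \<Union>V" by (rule h(3))
      then have uk: "u k \<noteq> 0" using cone_subset[OF V(3) u] by (simp add: cone_chart)
      have "\<Psi> (chart k) ?\<sigma> 0 u = (\<Sum>l\<in>I. if l = i then peval (p i) u * u k powi (- a i) else 0)"
        unfolding mat_map_apply[OF openin_chart \<sigma>]
        using uk by (auto simp: unit_tuple_def cone_chart intro!: sum.cong)
      also have "\<dots> = peval (p i) u * u k powi (- a i)" using finI i by simp
      finally have "peval (p i) u * u k powi (- a i) = peval f u / peval g u" using V(7) u by simp
      moreover have "u k powi (- a i) = 1 / u k ^ nat (a i)"
        using a[OF i] by (simp add: power_int_def inverse_eq_divide power_one_over)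
      moreover have "peval g u \<noteq> 0" using V(7) u by blast
      ultimately show "peval (g * p i) u = peval (xp k (nat (a i)) * f) u" using uk by (simp add: field_simps)
    qed
    moreover have "xp k (nat (a i)) * f \<in> C" using V(4) is_idealD(3)[OF ideal] by blast
    ultimately have "g * p i \<in> C" by simp
    moreover have "peval g v \<noteq> 0" using V(7) vV by blast
    ultimately show "\<exists>g n. g \<in> {q. q * p i \<in> C} \<and> homog n g \<and> peval g v \<noteq> 0"
      using V(6) by blast
  qed
  then show ?thesis by blast
qed

text \<open>By surjectivity \<open>F\<close> is locally a combination of the generators, so as in
  \<open>generator_in_ideal\<close> a power of each variable multiplies it into \<open>Q\<close>.
  Saturation of \<open>Q\<close> removes these powers.\<close>

lemma ideal_in_Q:
  assumes F: "F \<in> C" "homog (int n) F"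
  shows "F \<in> Q"
proof -
  have "\<exists>N. xp k N * F \<in> Q" for k
  proof -
    have "\<exists>N. xp k N \<in> {q. q * F \<in> Q}"
    proof (rule projective_nullstellensatz)
      show "is_ideal {q. q * F \<in> Q}"
        using is_idealD[OF is_ideal_Q] by (auto simp: is_ideal_def distrib_right mult.assoc)
      fix v :: "4 => complex" assume v: "nz v"
      obtain k where k: "v \<in> \<Union>(chart k)" using nz_chart[OF v] by blast
      let ?U = "chart k"
      define \<rho> :: tuple where "\<rho> = (\<lambda>i u. if i = 0 \<and> u \<in> \<Union>?U then u k powi (- int n) * peval F u else 0)"
      have "\<rho> 0 \<in> twist 0 ?U"
        using twist_shift_form[OF openin_chart order_refl F(2), of k "- int n"] by (simp add: \<rho>_def)
      then have "\<rho> \<in> twist_sum {0} (\<lambda>_. 0) ?U" by (auto simp: twist_sum_def \<rho>_def)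
      moreover have "\<forall>u\<in>\<Union>?U. peval (xp k n) u \<noteq> 0 \<and> \<rho> 0 u = peval F u / peval (xp k n) u"
        by (auto simp: \<rho>_def cone_chart power_int_minus field_simps)
      ultimately have "\<rho> \<in> ideal_sheaf C ?U"
        unfolding ideal_sheaf_def mem_Collect_eq using F homog_xp[of n k] openin_chart[of k]
        by (intro conjI ballI exI[of _ ?U] exI[of _ F] exI[of _ "xp k n"] exI[of _ "int n"]) auto
      moreover have "proj_pt v \<in> ?U" using k cone_P3[OF openin_chart] by blast
      ultimately have "\<exists>V. openin P3 V \<and> proj_pt v \<in> V \<and> V \<subseteq> ?U \<and> (\<exists>\<sigma>\<in>twist_sum I (\<lambda>i. - a i) V. \<Psi> V \<sigma> = restr V \<rho>)"
        by (intro se_parts(3)[OF openin_chart, THEN bspec, THEN bspec])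
      then obtain V \<sigma> where V: "openin P3 V" "proj_pt v \<in> V" "V \<subseteq> ?U" and \<sigma>: "\<sigma> \<in> twist_sum I (\<lambda>i. - a i) V"
        and e: "\<Psi> V \<sigma> = restr V \<rho>" by blast
      have vV: "v \<in> \<Union>V" using V(2) cone_P3[OF V(1)] by blast
      obtain m q f where q: "homog m q" "peval q v \<noteq> 0" "\<And>i. i \<in> I ==> homog (m + - a i) (f i)"
        "\<And>u. nz u ==> peval q u \<noteq> 0 ==> u \<in> \<Union>V"
        "\<And>u i. nz u ==> peval q u \<noteq> 0 ==> i \<in> I ==> \<sigma> i u = peval (f i) u / peval q u"
        by (rule common_denominator[OF V(1) finI twist_sum_comp[OF \<sigma>] vV]) (assumption, rule that)
      have "q * F = (\<Sum>i\<in>I. p i * (xp k n * f i))"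
      proof (rule form_eq_on_open[of q])
        show "q \<noteq> 0" using q(2) by auto
        fix u assume u: "nz u" "peval q u \<noteq> 0"
        have uV: "u \<in> \<Union>V" by (rule q(4)[OF u])
        then have uU: "u \<in> \<Union>?U" by (rule cone_subset[OF V(3)])
        then have uk: "u k \<noteq> 0" by (simp add: cone_chart)
        have "\<Psi> V \<sigma> 0 u = \<rho> 0 u" unfolding e restr_def using uV by simp
        then have "(\<Sum>i\<in>I. peval (p i) u * (peval (f i) u / peval q u)) = peval F u / u k ^ n"
          using uU by (simp add: mat_map_apply[OF V(1) \<sigma>] q(5)[OF u] \<rho>_def power_int_minus field_simps)
        then have "(\<Sum>i\<in>I. peval (p i) u * peval (f i) u) / peval q u = peval F u / u k ^ n"
          by (simp add: sum_divide_distrib)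
        then have "peval q u * peval F u = u k ^ n * (\<Sum>i\<in>I. peval (p i) u * peval (f i) u)"
          using uk u(2) by (simp add: field_simps)
        then show "peval (q * F) u = peval (\<Sum>i\<in>I. p i * (xp k n * f i)) u"
          by (simp add: sum_distrib_left mult.left_commute)
      qed
      then have "q * F \<in> Q" using Q_I by simp
      then show "\<exists>g n. g \<in> {q. q * F \<in> Q} \<and> homog n g \<and> peval g v \<noteq> 0" using q(1,2) by blast
    qed
    then show ?thesis by blast
  qed
  then obtain N where N: "\<And>k. xp k (N k) * F \<in> Q" by metis
  have "xp k (\<Sum>l\<in>UNIV. N l) * F \<in> Q" for k
  proof -
    have "(\<Sum>l\<in>UNIV. N l) = (\<Sum>l\<in>UNIV - {k}. N l) + N k"
      by (subst sum.remove[of UNIV k]) auto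
    then show ?thesis using is_idealD(3)[OF is_ideal_Q N[of k]] by (simp add: xp_add mult.assoc)
  qed
  then show ?thesis by (rule Q_saturated[OF F(2)])
qed

lemma Q_in_ideal: "\<exists>n0. \<forall>n\<ge>n0. \<forall>F\<in>Q. homog (int n) F --> F \<in> C"
proof -
  note ideal = is_idealD[OF homogeneous_ideal_is_ideal[OF C]]
  have "\<exists>N. \<forall>i\<in>I. \<forall>k. xp k (N i k) * p i \<in> C"
    using generator_in_ideal by metis
  then obtain N where N: "\<And>i k. i \<in> I ==> xp k (N i k) * p i \<in> C" by blast
  define B where "B = (\<Sum>i\<in>I. \<Sum>k\<in>UNIV. N i k)"
  have B: "N i k \<le> B" if "i \<in> I" for i k
  proof -
    have "N i k \<le> (\<Sum>k\<in>UNIV. N i k)" by (rule member_le_sum) simp_all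
    also have "\<dots> \<le> B" unfolding B_def using that finI by (intro member_le_sum) simp_all
    finally show ?thesis .
  qed
  have BC: "xp k B * p i \<in> C" if "i \<in> I" for i k
    using ideal(3)[OF N[OF that, of k], of "xp k (B - N i k)"] B[OF that, of k]
    by (simp flip: xp_add mult.assoc)
  show ?thesis
  proof (intro exI allI impI ballI)
    \<comment> \<open>In four variables a monomial of degree at least \<open>4 * B\<close> has some
      exponent at least \<open>B\<close>; the second summand absorbs the degrees of the
      generators.\<close>
    fix n F assume n: "4 * B + (\<Sum>i\<in>I. nat (a i)) \<le> n" and F: "F \<in> Q" "homog (int n) F"
    obtain f where f: "\<forall>i\<in>I. homog (int n - a i) (f i)" "F = (\<Sum>i\<in>I. p i * f i)"
      using Q_graded[OF F] by blast
    have "p i * f i \<in> C" if i: "i \<in> I" for i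
    proof -
      have "p i * mon m (coef (f i) m) \<in> C" if m: "m \<in> supp (f i)" for m
      proof -
        have "int (mono_deg m) = int n - a i" using f(1) i m by (auto simp: homog_def)
        moreover have "nat (a i) \<le> (\<Sum>i\<in>I. nat (a i))" using i finI by (intro member_le_sum) simp_all
        ultimately have "4 * B \<le> mono_deg m" using n by linarith
        then have "B \<le> expo m 0 \<or> B \<le> expo m 1 \<or> B \<le> expo m 2 \<or> B \<le> expo m 3"
          unfolding mono_deg_4 by linarith
        then have "\<exists>k. B \<le> expo m k" by blast
        then obtain k where k: "B \<le> expo m k" by blast
        have "mon m (coef (f i) m) = xp k B * mon (m - Poly_Mapping.single k B) (coef (f i) m)"
          using mon_le_decomp[OF k] by (simp add: xp_def mult_single)
        then show ?thesis
          using ideal(3)[OF BC[OF i, of k], of "mon (m - Poly_Mapping.single k B) (coef (f i) m)"]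
          by (simp only: mult_ac)
      qed
      then have "(\<Sum>m\<in>supp (f i). p i * mon m (coef (f i) m)) \<in> C"
        by (rule is_ideal_sum[OF homogeneous_ideal_is_ideal[OF C]])
      then show ?thesis using cpoly_decomp[of "f i"] by (simp flip: sum_distrib_left)
    qed
    then show "F \<in> C" unfolding f(2) by (rule is_ideal_sum[OF homogeneous_ideal_is_ideal[OF C]])
  qed
qed

lemma ideal_eventually_Q:
  "\<exists>n0. \<forall>n\<ge>n0. {F \<in> C. homog (int n) F} = {F \<in> Q. homog (int n) F}"
  using Q_in_ideal ideal_in_Q by blast

end

text \<open>By \<open>sheaf_hom_mat_map\<close> both morphisms are matrices of forms, which puts the
  sequence into the setting of \<open>sheaf_resolution\<close>.\<close>

lemma short_exact_resolution:
  assumes fin: "finite I" "finite K" and a: "\<And>i. i \<in> I ==> a i \<ge> 0" and C: "homogeneous_ideal C"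
    and se: "short_exact (twist_sum K (\<lambda>j. - b j)) (twist_sum I (\<lambda>i. - a i)) (ideal_sheaf C) \<Phi> \<Psi>"
  shows "\<exists>p M n0. graded_resolution I a p K b M \<and>
    (\<forall>n\<ge>n0. {F \<in> C. homog (int n) F} = {F \<in> graded_generators.Q I p. homog (int n) F})"
proof -
  have \<Phi>: "\<Phi> \<in> sheaf_hom (twist_sum K (\<lambda>j. - b j)) (twist_sum I (\<lambda>i. - a i)) (topspace P3)"
    and \<Psi>: "\<Psi> \<in> sheaf_hom (twist_sum I (\<lambda>i. - a i)) (ideal_sheaf C) (topspace P3)"
    using se unfolding short_exact_def by blast+
  have "\<exists>M. (\<forall>i\<in>I. \<forall>j\<in>K. homog (- a i - - b j) (M i j)) \<and> \<Phi> = mat_map K (\<lambda>j. - b j) I M"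
    by (rule sheaf_hom_mat_map[OF \<Phi> fin(2)]) simp
  then obtain M where M: "\<forall>i\<in>I. \<forall>j\<in>K. homog (- a i - - b j) (M i j)" "\<Phi> = mat_map K (\<lambda>j. - b j) I M" by blast
  have "\<exists>P. (\<forall>i\<in>{0}. \<forall>j\<in>I. homog (0 - - a j) (P i j)) \<and> \<Psi> = mat_map I (\<lambda>i. - a i) {0} P"
    by (rule sheaf_hom_mat_map[OF \<Psi> fin(1), where n' = "\<lambda>_. 0"]) (auto simp: ideal_sheaf_def)
  then obtain P where P: "\<forall>j\<in>I. homog (a j) (P 0 j)" "\<Psi> = mat_map I (\<lambda>i. - a i) {0} P" by auto
  have "mat_map I (\<lambda>i. - a i) {0} P = mat_map I (\<lambda>i. - a i) {0} (\<lambda>_. P 0)"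
    by (auto simp: mat_map_def fun_eq_iff)
  then interpret sheaf_resolution I a "P 0" K b M C
    using fin M(1) P(1) C a se unfolding M(2) P(2) by unfold_locales auto
  have r1: "graded_resolution I a (P 0) K b M" by unfold_locales
  obtain n0 where r2: "\<forall>n\<ge>n0. {F \<in> C. homog (int n) F} = {F \<in> Q. homog (int n) F}"
    by (rule exE[OF ideal_eventually_Q]) (rule that)
  show ?thesis
    by (rule exI[of _ "P 0"], rule exI[of _ M], rule exI[of _ n0], rule conjI[OF r1 r2])
qed

section \<open>The dimension formula\<close>

lemma sum_from_0: "(\<Sum>i=0..t. f i) = f 0 + (\<Sum>i=1..(t::nat). f i :: 'a :: comm_monoid_add)"
  using sum.atLeast_Suc_atMost[of 0 t f] by simp

lemma h0_sum_diff:
  fixes c :: "nat => int"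
  assumes "finite A" "\<And>i. i \<in> A ==> d \<le> c i"
  shows "6 * (\<Sum>i\<in>A. real (h0 (c i - d))) =
    real_of_int (\<Sum>i\<in>A. c i ^ 3) + real_of_int (\<Sum>i\<in>A. c i ^ 2) * (6 - 3 * real_of_int d)
    + real_of_int (\<Sum>i\<in>A. c i) * (3 * real_of_int d ^ 2 - 12 * real_of_int d + 11)
    - real (card A) * (real_of_int d ^ 3 - 6 * real_of_int d ^ 2 + 11 * real_of_int d - 6)"
  using assms
proof (induction A rule: finite_induct)
  case (insert x A)
  have "6 * real (h0 (c x - d)) = real_of_int (c x ^ 3) + real_of_int (c x ^ 2) * (6 - 3 * real_of_int d)
      + real_of_int (c x) * (3 * real_of_int d ^ 2 - 12 * real_of_int d + 11)
      - (real_of_int d ^ 3 - 6 * real_of_int d ^ 2 + 11 * real_of_int d - 6)"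
    using h0_real'[of "c x - d"] insert.prems[of x]
    by (simp add: power2_eq_square power3_eq_cube algebra_simps)
  then show ?case using insert by (simp add: algebra_simps)
qed simp

context
  fixes t :: nat and a b :: "nat => int" and d :: int
  assumes ap: "admissible_pair t a b" and d: "d = pair_degree t a b" and a1: "a 1 > d" and a0: "a 0 = d"
begin

lemma pair_bounds:
  shows "t \<ge> 2" "d > 0" "j \<in> {1..t} ==> d < a j" "i \<in> {1..t} ==> j \<in> {1..t} ==> a i < b j"
proof -
  show t: "t \<ge> 2" using ap by (simp add: admissible_pair_def)
  show ab: "i \<in> {1..t} ==> j \<in> {1..t} ==> a i < b j" for i j
    using ap unfolding admissible_pair_def by blast
  show "d > 0" unfolding d pair_degree_def by (rule sum_pos) (use t ab in auto)
  show "d < a j" if j: "j \<in> {1..t}" for j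
  proof -
    have "a 1 \<le> a j" using ap j t unfolding admissible_pair_def by (auto simp: mono_on_def)
    then show ?thesis using a1 by simp
  qed
qed

lemma sum_b_eq: "(\<Sum>j=1..t. b j) = (\<Sum>i=0..t. a i)"
  unfolding sum_from_0[of a] a0 by (simp add: d pair_degree_def sum_subtractf)

text \<open>A positive leading coefficient makes the Hilbert polynomial of the monomial ideal
  linear, as \<open>curve\<close> requires.\<close>

lemma d_C_pos: "d_C t a b > 0"
proof -
  \<comment> \<open>One factor of \<open>d ^ 2\<close> is written as the sum of all
    \<open>b j - a j\<close>, which makes every summand below a product of positive factors.\<close>
  have "(\<Sum>j=1..t. b j ^ 2) - (\<Sum>i=0..t. a i ^ 2) = (\<Sum>j=1..t. (b j ^ 2 - a j ^ 2)) - d * (\<Sum>j=1..t. b j - a j)"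
    unfolding sum_from_0 a0 sum_subtractf[of "\<lambda>j. b j ^ 2"] d[unfolded pair_degree_def, symmetric]
    by (simp add: power2_eq_square)
  also have "\<dots> = (\<Sum>j=1..t. (b j - a j) * (b j + a j - d))"
    unfolding sum_distrib_left sum_subtractf[symmetric]
    by (rule sum.cong) (simp_all add: power2_eq_square algebra_simps)
  also have "\<dots> > 0"
  proof (rule sum_pos)
    show "(b j - a j) * (b j + a j - d) > 0" if "j \<in> {1..t}" for j
      using pair_bounds(2) pair_bounds(3)[OF that] pair_bounds(4)[OF that that] by (intro mult_pos_pos) linarith+
  qed (use pair_bounds(1) in auto)
  finally have "real_of_int ((\<Sum>j=1..t. b j ^ 2) - (\<Sum>i=0..t. a i ^ 2)) > 0" by (simp only: of_int_0_less_iff)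
  then show ?thesis unfolding d_C_def by (intro mult_pos_pos) simp_all
qed

lemma monomial_curve: "monomial_curve t a b"
proof
  show "t > 0" using pair_bounds(1) by simp
  show "a 0 = (\<Sum>j=1..t. b j - a j)" by (simp add: a0 d pair_degree_def)
  fix j assume j: "j \<in> {1..t}"
  show "a j \<le> b j" using pair_bounds(4)[OF j j] by simp
  show "a (j - 1) \<le> b j"
  proof (cases "j = 1")
    case True
    then show ?thesis using a0 pair_bounds(3)[OF j] pair_bounds(4)[OF j j] by simp
  next
    case False
    then have "j - 1 \<in> {1..t}" using j by auto
    from pair_bounds(4)[OF this j] show ?thesis by simp
  qed
qed

lemma curve_exists:
  "\<exists>C \<phi> \<psi>. curve C \<and> short_exact (twist_sum {1..t} (\<lambda>j. - b j)) (twist_sum {0..t} (\<lambda>i. - a i)) (ideal_sheaf C) \<phi> \<psi>"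
proof -
  interpret monomial_curve t a b by (rule monomial_curve)
  have "hilbert_poly Q = [:1 - g_C t a b, d_C t a b:]"
    by (rule hilbert_poly_eq[OF graded_resolution_axioms _ sum_b_eq, of 0]) simp
  then have "curve Q" using d_C_pos homogeneous_ideal_Q by (simp add: curve_def)
  then show ?thesis using short_exact_Q by blast
qed

lemma curve_invariants:
  assumes C: "curve C"
    and se: "short_exact (twist_sum {1..t} (\<lambda>j. - b j)) (twist_sum {0..t} (\<lambda>i. - a i)) (ideal_sheaf C) \<phi> \<psi>"
  shows "curve_degree C = d_C t a b \<and> arith_genus C = g_C t a b"
proof -
  have a: "a i \<ge> 0" if "i \<in> {0..t}" for i
  proof (cases "i = 0")
    case True
    then show ?thesis using a0 pair_bounds(2) by simp
  next
    case False
    then have "i \<in> {1..t}" using that by simp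
    from pair_bounds(3)[OF this] show ?thesis using pair_bounds(2) by linarith
  qed
  have "\<exists>p M n0. graded_resolution {0..t} a p {1..t} b M \<and>
    (\<forall>n\<ge>n0. {F \<in> C. homog (int n) F} = {F \<in> graded_generators.Q {0..t} p. homog (int n) F})"
    by (rule short_exact_resolution[OF _ _ a _ se]) (use C in \<open>simp_all add: curve_def\<close>)
  then obtain p M n0 where r: "graded_resolution {0..t} a p {1..t} b M"
    and n0: "\<And>n. n \<ge> n0 ==> {F \<in> C. homog (int n) F} = {F \<in> graded_generators.Q {0..t} p. homog (int n) F}"
    by blast
  have "hilbert_poly C = [:1 - g_C t a b, d_C t a b:]" by (rule hilbert_poly_eq[OF r n0 sum_b_eq])
  then show ?thesis by (simp add: curve_degree_def arith_genus_def)
qed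

text \<open>Compared with the equation for \<open>l\<close>, only the summand of index
  \<open>0\<close> of \<open>A\<close> is new. It adds all \<open>h0 (b j - d)\<close> to the
  homomorphisms from \<open>B\<close> to \<open>A\<close>, and \<open>1\<close> together with all
  \<open>h0 (a j - d)\<close> to the endomorphisms of \<open>A\<close>. In the difference of these
  cubic polynomials the terms with \<open>t\<close> cancel.\<close>

lemma hom_dim_formula:
  assumes l: "(\<Sum>i=1..t. \<Sum>j=1..t. h0 (b j - a i)) + 1 =
    (\<Sum>i=1..t. \<Sum>j=1..t. h0 (a j - a i)) + (\<Sum>i=1..t. \<Sum>j=1..t. h0 (b j - b i)) + l"
    and AB: "A = twist_sum {0..t} (\<lambda>i. - a i)" "B = twist_sum {1..t} (\<lambda>j. - b j)"
  shows "real l = 2 + real (hom_dim B A) - real (hom_dim A A) - real (hom_dim B B)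
    - (real_of_int (d - 1) gchoose 3) - g_C t a b + (real_of_int d - 4) * d_C t a b"
proof -
  let ?N = "\<Sum>i=1..t. \<Sum>j=1..t. h0 (b j - a i)" and ?AA = "\<Sum>i=1..t. \<Sum>j=1..t. h0 (a j - a i)"
    and ?BB = "\<Sum>i=1..t. \<Sum>j=1..t. h0 (b j - b i)"
    and ?Hb = "\<Sum>j=1..t. h0 (b j - d)" and ?Ha = "\<Sum>j=1..t. h0 (a j - d)"
  have BA: "hom_dim B A = ?Hb + ?N"
    unfolding AB by (simp only: hom_dim_twist_sum finite_atLeastAtMost sum_from_0 a0 diff_minus_eq_add minus_add_distrib) simp
  have BB: "hom_dim B B = ?BB"
    unfolding AB by (simp add: hom_dim_twist_sum)
  \<comment> \<open>Morphisms from \<open>O(- d)\<close> to \<open>O(- a i)\<close> would be forms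
    of negative degree.\<close>
  have "h0 (d - a i) = 0" if "i \<in> {1..t}" for i using pair_bounds(3)[OF that] by (simp add: h0_eq)
  then have z: "(\<Sum>i=1..t. h0 (d - a i)) = 0" by simp
  have "hom_dim A A = (\<Sum>i=0..t. \<Sum>j=0..t. h0 (a j - a i))"
    unfolding AB by (simp add: hom_dim_twist_sum)
  also have "\<dots> = 1 + ?Ha + ?AA"
    unfolding sum_from_0 sum.distrib a0 z by (simp add: h0_eq)
  finally have AA: "hom_dim A A = 1 + ?Ha + ?AA" .
  define s1 s2 s3 where "s1 = real_of_int (\<Sum>j=1..t. a j)" and "s2 = real_of_int (\<Sum>j=1..t. a j ^ 2)"
    and "s3 = real_of_int (\<Sum>j=1..t. a j ^ 3)"
  define r1 r2 r3 where "r1 = real_of_int (\<Sum>j=1..t. b j)" and "r2 = real_of_int (\<Sum>j=1..t. b j ^ 2)"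
    and "r3 = real_of_int (\<Sum>j=1..t. b j ^ 3)"
  define D where "D = real_of_int d"
  have r1: "r1 = s1 + D"
    using arg_cong[OF sum_b_eq, of real_of_int] unfolding sum_from_0 a0 r1_def s1_def D_def by simp
  have dC: "d_C t a b = (r2 - (D ^ 2 + s2)) / 2"
    unfolding d_C_def sum_from_0 a0 r2_def s2_def D_def by simp
  have gC: "g_C t a b = 1 + (r3 - (D ^ 3 + s3)) / 6 - 2 * d_C t a b"
    unfolding g_C_def sum_from_0 a0 r3_def s3_def D_def by simp
  have b_ge: "d \<le> b j" if "j \<in> {1..t}" for j
    using pair_bounds(3)[OF that] pair_bounds(4)[OF that that] by linarith
  have a_ge: "d \<le> a j" if "j \<in> {1..t}" for j using pair_bounds(3)[OF that] by simp
  have Hb: "6 * real ?Hb = r3 + r2 * (6 - 3 * D) + r1 * (3 * D ^ 2 - 12 * D + 11)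
      - real t * (D ^ 3 - 6 * D ^ 2 + 11 * D - 6)"
    using h0_sum_diff[of "{1..t}" d b, OF _ b_ge] unfolding r1_def r2_def r3_def D_def by simp
  have Ha: "6 * real ?Ha = s3 + s2 * (6 - 3 * D) + s1 * (3 * D ^ 2 - 12 * D + 11)
      - real t * (D ^ 3 - 6 * D ^ 2 + 11 * D - 6)"
    using h0_sum_diff[of "{1..t}" d a, OF _ a_ge] unfolding s1_def s2_def s3_def D_def by simp
  have g3: "6 * (real_of_int (d - 1) gchoose 3) = D ^ 3 - 6 * D ^ 2 + 11 * D - 6"
  proof -
    have e: "6 * (x gchoose 3) = x * (x - 1) * (x - 2)" for x :: real by (simp add: gchoose_3)
    show ?thesis unfolding D_def e by (simp add: power2_eq_square power3_eq_cube algebra_simps)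
  qed
  have "6 * (real ?Hb - real ?Ha) = (r3 - s3) + (r2 - s2) * (6 - 3 * D) + D * (3 * D ^ 2 - 12 * D + 11)"
    using Hb Ha unfolding r1 by (simp add: algebra_simps)
  also have "\<dots> = 6 * ((real_of_int (d - 1) gchoose 3) + g_C t a b - (D - 4) * d_C t a b)"
    unfolding distrib_left right_diff_distrib g3 gC dC by (simp add: power2_eq_square power3_eq_cube field_simps)
  finally have X: "real ?Hb - real ?Ha = (real_of_int (d - 1) gchoose 3) + g_C t a b - (D - 4) * d_C t a b"
    by simp
  have "real ?N + 1 = real ?AA + real ?BB + real l"
    using arg_cong[OF l, of real] by (simp only: of_nat_add of_nat_1)
  moreover have "real (hom_dim B A) = real ?Hb + real ?N" "real (hom_dim A A) = 1 + real ?Ha + real ?AA"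
    "real (hom_dim B B) = real ?BB"
    unfolding BA AA BB by (simp_all only: of_nat_add of_nat_1)
  ultimately show ?thesis using X unfolding D_def by linarith
qed

end

theorem theorem1:
  fixes t :: nat and a b :: "nat \<Rightarrow> int" and d :: int and A B :: sheaf
  assumes "admissible_pair t a b"
    and "d = pair_degree t a b"
    and "a 1 > d"
    and "a 0 = d"
    and "A = twist_sum {0..t} (\<lambda>i. - a i)"
    and "B = twist_sum {1..t} (\<lambda>j. - b j)"
  shows "irreducible_closedin (linear_system d) (det_variety t a b) \<and>
    (\<exists>C \<phi> \<psi>. curve C \<and> short_exact B A (ideal_sheaf C) \<phi> \<psi>) \<and>
    (\<forall>C \<phi> \<psi>. curve C \<and> short_exact B A (ideal_sheaf C) \<phi> \<psi> \<longrightarrow>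
       curve_degree C = d_C t a b \<and> arith_genus C = g_C t a b) \<and>
    ereal_of_enat (krull_dim (subtopology (linear_system d) (det_variety t a b))) =
      ereal (2 + real (hom_dim B A) - real (hom_dim A A) - real (hom_dim B B)
        - (real_of_int (d - 1) gchoose 3) - g_C t a b + (real_of_int d - 4) * d_C t a b)"
proof (intro conjI allI impI)
  show "irreducible_closedin (linear_system d) (det_variety t a b)"
    unfolding assms(2) by (rule det_variety_dimension(1)[OF assms(1)])
  show "\<exists>C \<phi> \<psi>. curve C \<and> short_exact B A (ideal_sheaf C) \<phi> \<psi>"
    unfolding assms(5,6) by (rule curve_exists[OF assms(1-4)])
  show "curve_degree C = d_C t a b" "arith_genus C = g_C t a b"
    if "curve C \<and> short_exact B A (ideal_sheaf C) \<phi> \<psi>" for C \<phi> \<psi>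
    using curve_invariants[OF assms(1-4)] that unfolding assms(5,6) by blast+
  obtain l where l: "(\<Sum>i=1..t. \<Sum>j=1..t. h0 (b j - a i)) + 1 =
      (\<Sum>i=1..t. \<Sum>j=1..t. h0 (a j - a i)) + (\<Sum>i=1..t. \<Sum>j=1..t. h0 (b j - b i)) + l"
    "krull_dim (subtopology (linear_system d) (det_variety t a b)) = enat l"
    using det_variety_dimension(2)[OF assms(1)] unfolding assms(2) by blast
  show "ereal_of_enat (krull_dim (subtopology (linear_system d) (det_variety t a b))) =
      ereal (2 + real (hom_dim B A) - real (hom_dim A A) - real (hom_dim B B)
        - (real_of_int (d - 1) gchoose 3) - g_C t a b + (real_of_int d - 4) * d_C t a b)"
    unfolding l(2) hom_dim_formula[OF assms(1-4) l(1) assms(5,6), symmetric] by simp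
qed

end
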